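(* Let $\mathcal B_{\mathfrak h}$ be the free superboson PVA over a field $\mathbb F$ of characteristic $0$ associated to a finite-dimensional superspace $\mathfrak h$ with a supersymmetric nondegenerate bilinear form $(\cdot|\cdot)$. Then $$H^n_{\mathrm{PV}}(\mathcal B_{\mathfrak h},\mathcal B_{\mathfrak h})\simeq(S^n(\Pi\mathfrak h))^*\oplus(S^{n+1}(\Pi\mathfrak h))^*,\qquad n\ge0,$$ where $\Pi\mathfrak h$ is $\mathfrak h$ with reversed parity. Explicitly, let $\{u_1,\dots,u_N\}$ be a parity-homogeneous basis of $\mathfrak h$ and $\{u^1,\dots,u^N\}$ its dual basis, $(u_i|u^j)=\delta_{ij}$. Then an element $\alpha+\beta\in(S^n(\Pi\mathfrak h))^*\oplus(S^{n+1}(\Pi\mathfrak h))^*$ corresponds under this isomorphism to the class of the $n$-cocycle $Y\in C^n_{\mathrm{PV}}(\mathcal B_{\mathfrak h},\mathcal B_{\mathfrak h})$ uniquely defined by $$Y_{\lambda_1,\dots,\lambda_n}(u)=\alpha(u)+\sum_{j=1}^N\beta(u\otimes u^j)\,u_j+\langle\partial+\lambda_1+\dots+\lambda_n\rangle,\qquad u\in\mathfrak h^{\otimes n}.$$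
   Context: $\mathbb F$ is a field of characteristic $0$. All superspaces are over $\mathbb F$, with parity $p$; $\bar p=1-p$ is the opposite parity. Formulas with signs are for parity-homogeneous elements. PVA: a Poisson vertex superalgebra is a commutative (in the super sense) associative unital superalgebra $\mathcal V$ with an even derivation $\partial$ and a parity-preserving bilinear map $\mathcal V\otimes\mathcal V\to\mathcal V[\lambda]$, $a\otimes b\mapsto[a_\lambda b]$ ($\lambda$ even), with $[\partial a_\lambda b]=-\lambda[a_\lambda b]$, $[a_\lambda\partial b]=(\lambda+\partial)[a_\lambda b]$, $[a_\lambda b]=-(-1)^{p(a)p(b)}[b_{-\lambda-\partial}a]$ ($\partial$ acting from the left on coefficients), $[a_\lambda[b_\mu c]]-(-1)^{p(a)p(b)}[b_\mu[a_\lambda c]]=[[a_\lambda b]_{\lambda+\mu}c]$, and $[a_\lambda bc]=[a_\lambda b]c+(-1)^{p(b)p(c)}[a_\lambda c]b$. Variational PVA cohomology of $\mathcal V$ with coefficients in the adjoint module $M=\mathcal V$ (with $a_\lambda m=[a_\lambda m]$): $C^n_{\mathrm{PV}}(\mathcal V,M)$, $n\ge0$, is the superspace of linear maps $Y:\mathcal V^{\otimes n}\to M[\lambda_1,\dots,\lambda_n]/\langle\partial+\lambda_1+\cdots+\lambda_n\rangle$ ($\langle\Phi\rangle$ = image of $\Phi$), with parity $\bar p(Y)$ given by $\bar p(Y(a_1\otimes\cdots\otimes a_n))=\bar p(Y)+\sum\bar p(a_i)$, satisfying: sesquilinearity $Y_{\lambda_1,\dots,\lambda_n}(\cdots\otimes\partial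 a_i\otimes\cdots)=-\lambda_iY_{\lambda_1,\dots,\lambda_n}(\cdots\otimes a_i\otimes\cdots)$; symmetry: $Y$ is multiplied by $(-1)^{\bar p(a_i)\bar p(a_{i+1})}$ when $a_i,a_{i+1}$ and $\lambda_i,\lambda_{i+1}$ are simultaneously interchanged; Leibniz rules $Y(\cdots\otimes b_ic_i\otimes\cdots)=(-1)^{p(b_i)s_i}(e^{\partial\partial_{\lambda_i}}b_i)Y(\cdots\otimes c_i\otimes\cdots)+(-1)^{p(c_i)(p(b_i)+s_i)}(e^{\partial\partial_{\lambda_i}}c_i)Y(\cdots\otimes b_i\otimes\cdots)$, where $s_i=\bar p(Y)+\bar p(a_1)+\dots+\bar p(a_{i-1})$ and $(e^{\partial\partial_\lambda}a)P(\lambda)=\sum_{k\ge0}\frac1{k!}(\partial^ka)\frac{d^kP}{d\lambda^k}$. In particular $C^0_{\mathrm{PV}}=M/\partial M$. The differential $d:C^n_{\mathrm{PV}}\to C^{n+1}_{\mathrm{PV}}$, $d^2=0$, is $$(dY)_{\lambda_0,\dots,\lambda_n}(a_0\otimes\cdots\otimes a_n)=\sum_{i=0}^n(-1)^{\gamma_i}{a_i}_{\lambda_i}Y_{\lambda_0,\overset{i}{\check\dots},\lambda_n}(a_0\otimes\overset{i}{\check\cdots}\otimes a_n)+\sum_{i<j}(-1)^{\gamma_{ij}}Y_{\lambda_i+\lambda_j,\lambda_0,\overset{i}{\check\dots}\overset{j}{\check\dots},\lambda_n}([{a_i}_{\lambda_i}a_j]\otimes a_0\otimes\overset{i}{\check\cdots}\overset{j}{\check\cdots}\otimes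 a_n),$$ with $\check{}$ meaning omission, $\gamma_i=\bar p(a_i)(\bar p(Y)+\bar p(a_0)+\dots+\bar p(a_{i-1})+1)+1$, $\gamma_{ij}=\bar p(Y)+\bar p(a_i)(\bar p(a_0)+\dots+\bar p(a_{i-1})+1)+\bar p(a_j)(\bar p(a_0)+\overset{i}{\check\dots}+\bar p(a_{j-1}))$. $H^n_{\mathrm{PV}}(\mathcal V,M)=\ker(d|_{C^n_{\mathrm{PV}}})/d(C^{n-1}_{\mathrm{PV}})$. A cochain is determined by its values on generators of $\mathcal V$ as a differential algebra. Free superboson PVA: the form on $\mathfrak h$ satisfies $(a|b)=(-1)^{p(a)p(b)}(b|a)$ and $(a|b)=0$ if $p(a)\ne p(b)$. $\mathcal B_{\mathfrak h}=S(\mathbb F[\partial]\otimes\mathfrak h)$ (symmetric superalgebra), with $\partial$ extended as an even derivation and with the unique PVA $\lambda$-bracket such that $[a_\lambda b]=\lambda(a|b)1$ for $a,b\in\mathfrak h$. $S^n(\Pi\mathfrak h)$ is the $n$-th supersymmetric power; elements of its dual are viewed as linear functions on $(\Pi\mathfrak h)^{\otimes n}$, identified as a vector space with $\mathfrak h^{\otimes n}$.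
   Formalization: The dual basis is normalised by (u^j|u_i)=δ_ij instead of (u_i|u^j)=δ_ij; the two differ by a sign on odd elements, and with the stated order the explicit Y need not be a cocycle when the superspace has both even and odd parts. *)

theory Defs
  imports
    "HOL-Library.Poly_Mapping"
    "HOL-Library.Z2"
    "HOL-Library.FuncSet"
    "HOL-Computational_Algebra.Polynomial"
begin

section \<open>Linear spaces with a carrier\<close>

text \<open>Function spaces, quotients and cohomology are treated as linear spaces with an explicit
  carrier; elements of a quotient are honest cosets.\<close>

record ('f, 'a) lin_space =
  lcarr :: "'a set"
  lzero :: 'a
  ladd :: "'a \<Rightarrow> 'a \<Rightarrow> 'a"
  lsmul :: "'f \<Rightarrow> 'a \<Rightarrow> 'a"

definition lsum :: "('f, 'a) lin_space \<Rightarrow> 'a list \<Rightarrow> 'a" where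
  "lsum W xs = foldr (ladd W) xs (lzero W)"

definition lcoset :: "('f, 'a) lin_space \<Rightarrow> 'a set \<Rightarrow> 'a \<Rightarrow> 'a set" where
  "lcoset W U x = {ladd W x u | u. u \<in> U}"

definition lquot :: "('f, 'a) lin_space \<Rightarrow> 'a set \<Rightarrow> ('f, 'a set) lin_space" where
  "lquot W U = \<lparr>
     lcarr = lcoset W U ` lcarr W,
     lzero = U,
     ladd = (\<lambda>A B. {ladd W x y | x y. x \<in> A \<and> y \<in> B}),
     lsmul = (\<lambda>c A. {ladd W (lsmul W c x) u | x u. x \<in> A \<and> u \<in> U}) \<rparr>"

definition ldsum :: "('f, 'a) lin_space \<Rightarrow> ('f, 'b) lin_space \<Rightarrow> ('f, 'a \<times> 'b) lin_space" where
  "ldsum W W' = \<lparr>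
     lcarr = lcarr W \<times> lcarr W',
     lzero = (lzero W, lzero W'),
     ladd = (\<lambda>(x, x') (y, y'). (ladd W x y, ladd W' x' y')),
     lsmul = (\<lambda>c (x, x'). (lsmul W c x, lsmul W' c x')) \<rparr>"

definition lin_iso :: "('f, 'a) lin_space \<Rightarrow> ('f, 'b) lin_space \<Rightarrow> ('a \<Rightarrow> 'b) \<Rightarrow> bool" where
  "lin_iso W W' \<Psi> \<longleftrightarrow>
     bij_betw \<Psi> (lcarr W) (lcarr W') \<and>
     (\<forall>x\<in>lcarr W. \<forall>y\<in>lcarr W. \<Psi> (ladd W x y) = ladd W' (\<Psi> x) (\<Psi> y)) \<and>
     (\<forall>c. \<forall>x\<in>lcarr W. \<Psi> (lsmul W c x) = lsmul W' c (\<Psi> x))"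

definition lists_of_length :: "nat \<Rightarrow> 'a list set" where
  "lists_of_length n = {xs. length xs = n}"

definition fun_space :: "nat \<Rightarrow> ('f, 'b) lin_space \<Rightarrow> ('a list \<Rightarrow> 'b) set \<Rightarrow> ('f, 'a list \<Rightarrow> 'b) lin_space"
where
  "fun_space n W S = \<lparr>
     lcarr = S,
     lzero = (\<lambda>as\<in>lists_of_length n. lzero W),
     ladd = (\<lambda>Y Z. \<lambda>as\<in>lists_of_length n. ladd W (Y as) (Z as)),
     lsmul = (\<lambda>c Y. \<lambda>as\<in>lists_of_length n. lsmul W c (Y as)) \<rparr>"

text \<open>Linear maps from the $n$-th tensor power of a vector space to \<open>W\<close>, as $n$-linear maps:
  functions on lists of length \<open>n\<close>, \<open>undefined\<close> elsewhere.\<close>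

definition multilinear ::
  "('f \<Rightarrow> 'a::ab_group_add \<Rightarrow> 'a) \<Rightarrow> nat \<Rightarrow> ('f, 'b) lin_space \<Rightarrow> ('a list \<Rightarrow> 'b) set"
where
  "multilinear sc n W = {Y \<in> lists_of_length n \<rightarrow>\<^sub>E lcarr W.
     \<forall>as\<in>lists_of_length n. \<forall>i<n.
       (\<forall>a b. Y (as[i := a + b]) = ladd W (Y (as[i := a])) (Y (as[i := b]))) \<and>
       (\<forall>c a. Y (as[i := sc c a]) = lsmul W c (Y (as[i := a])))}"


section \<open>Superspaces\<close>

text \<open>Parities live in the two-element field, so the opposite parity of \<open>p\<close> is \<open>1 + p\<close>.\<close>

definition sg :: "bit \<Rightarrow> 'a::ring_1" where
  "sg p = (if p = 0 then 1 else - 1)"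

record ('f, 'v) superspace =
  scl :: "'f \<Rightarrow> 'v \<Rightarrow> 'v"
  par :: "bit \<Rightarrow> 'v set"

locale super_space =
  fixes S :: "('f::field, 'v::ab_group_add, 'm) superspace_scheme"
  assumes vs: "vector_space (scl S)"
    and par_subspace: "module.subspace (scl S) (par S p)"
    and par_decomp: "\<exists>y\<in>par S 0. \<exists>z\<in>par S 1. x = y + z"
    and par_disjoint: "par S 0 \<inter> par S 1 = {0}"

definition pcomp :: "('f, 'v::ab_group_add, 'm) superspace_scheme \<Rightarrow> bit \<Rightarrow> 'v \<Rightarrow> 'v" where
  "pcomp S p a = (THE b. b \<in> par S p \<and> a - b \<in> par S (1 + p))"

definition homs :: "('f, 'v, 'm) superspace_scheme \<Rightarrow> bit list \<Rightarrow> 'v list \<Rightarrow> bool" where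
  "homs S ps as \<longleftrightarrow> list_all2 (\<lambda>p a. a \<in> par S p) ps as"

definition lswap :: "nat \<Rightarrow> 'a list \<Rightarrow> 'a list" where
  "lswap i as = as[i := as ! Suc i, Suc i := as ! i]"

definition base_field :: "('f::field, 'f) lin_space" where
  "base_field = \<lparr>lcarr = UNIV, lzero = 0, ladd = (+), lsmul = (*)\<rparr>"

text \<open>$(S^n(\Pi\mathfrak h))^*$: linear functions on the $n$-th tensor power that are
  supersymmetric for the reversed parity.\<close>

definition Sdual :: "('f::field, 'h::ab_group_add) superspace \<Rightarrow> nat \<Rightarrow> ('f, 'h list \<Rightarrow> 'f) lin_space" where
  "Sdual H n = fun_space n base_field {\<alpha> \<in> multilinear (scl H) n base_field.
     \<forall>as ps i. length as = n \<and> homs H ps as \<and> Suc i < n \<longrightarrow>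
       \<alpha> (lswap i as) = sg ((1 + ps ! i) * (1 + ps ! Suc i)) * \<alpha> as}"

locale supersymmetric_form = super_space H
  for H :: "('f::field, 'h::ab_group_add) superspace" +
  fixes form :: "'h \<Rightarrow> 'h \<Rightarrow> 'f"
  assumes fin_dim: "\<exists>B. finite B \<and> module.span (scl H) B = UNIV"
    and form_add_left: "form (a + a') b = form a b + form a' b"
    and form_add_right: "form a (b + b') = form a b + form a b'"
    and form_scale_left: "form (scl H c a) b = c * form a b"
    and form_scale_right: "form a (scl H c b) = c * form a b"
    and form_sym: "a \<in> par H p \<Longrightarrow> b \<in> par H q \<Longrightarrow> form a b = sg (p * q) * form b a"
    and form_even: "a \<in> par H p \<Longrightarrow> b \<in> par H q \<Longrightarrow> p \<noteq> q \<Longrightarrow> form a b = 0"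
    and form_nondeg: "(\<And>b. form a b = 0) \<Longrightarrow> a = 0"

definition homogeneous_basis :: "('f::field, 'h::ab_group_add) superspace \<Rightarrow> 'h list \<Rightarrow> bool" where
  "homogeneous_basis H us \<longleftrightarrow>
     distinct us \<and> \<not> module.dependent (scl H) (set us) \<and> module.span (scl H) (set us) = UNIV \<and>
     set us \<subseteq> par H 0 \<union> par H 1"

text \<open>The order of the arguments matters on odd elements. With $(u^j|u_i)=\delta_{ij}$ one has
  $a = \sum_j (a|u_j)u^j$, hence $\sum_j \beta(u\otimes u^j)[a_\lambda u_j] = \lambda\beta(u\otimes a)$
  with no sign. The normalisation $(u_i|u^j)=\delta_{ij}$ would give $(-1)^{p(a)}\lambda\beta(u\otimes a)$,
  and then $\sum_j \beta(u\otimes u^j)u_j$ is not a cocycle if \<open>\<beta>\<close> pairs even with odd elements.\<close>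

definition dual_basis :: "('h \<Rightarrow> 'h \<Rightarrow> 'f::field) \<Rightarrow> 'h list \<Rightarrow> 'h list \<Rightarrow> bool" where
  "dual_basis form us us' \<longleftrightarrow> length us' = length us \<and>
     (\<forall>i<length us. \<forall>j<length us. form (us' ! j) (us ! i) = (if i = j then 1 else 0))"


section \<open>Polynomials in the formal variables\<close>

text \<open>$\mathcal V[\lambda_0,\lambda_1,\dots]$; the ring structure is that of a monoid algebra over
  the (noncommutative) ring \<open>'v\<close>, so the variables are central and even. Variables are indexed from
  \<open>0\<close>: an \<open>n\<close>-cochain uses \<open>X 0, ..., X (n - 1)\<close>.\<close>

type_synonym 'v pol = "(nat \<Rightarrow>\<^sub>0 nat) \<Rightarrow>\<^sub>0 'v"

abbreviation X :: "nat \<Rightarrow> 'v::ring_1 pol" where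
  "X i \<equiv> Poly_Mapping.single (Poly_Mapping.single i 1) 1"

abbreviation cst :: "'v::ring_1 \<Rightarrow> 'v pol" where
  "cst a \<equiv> Poly_Mapping.single 0 a"

definition pols :: "nat \<Rightarrow> 'v::ring_1 pol set" where
  "pols n = {P. \<forall>m\<in>Poly_Mapping.keys P. Poly_Mapping.keys m \<subseteq> {..<n}}"

text \<open>Substitution of \<open>\<Lambda> ! k\<close> for the \<open>k\<close>-th variable, for all \<open>k < length \<Lambda>\<close>; the substituted
  polynomials will only involve integer coefficients.\<close>

definition subst :: "'v::ring_1 pol list \<Rightarrow> 'v pol \<Rightarrow> 'v pol" where
  "subst \<Lambda> P = (\<Sum>m\<in>Poly_Mapping.keys P.
     cst (Poly_Mapping.lookup P m) *
     prod_list (map (\<lambda>k. (\<Lambda> ! k) ^ Poly_Mapping.lookup m k) [0..<length \<Lambda>]))"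

definition pdiff :: "nat \<Rightarrow> 'v::ring_1 pol \<Rightarrow> 'v pol" where
  "pdiff i P = (\<Sum>m\<in>Poly_Mapping.keys P.
     Poly_Mapping.single (m - Poly_Mapping.single i 1)
       (of_nat (Poly_Mapping.lookup m i) * Poly_Mapping.lookup P m))"


section \<open>Poisson vertex superalgebras\<close>

text \<open>Product and unit are those of the type \<open>'v\<close>; \<open>lbr a b\<close> is the polynomial $[a_\lambda b]$.\<close>

record (overloaded) ('f, 'v) pva = "('f, 'v) superspace" +
  der :: "'v \<Rightarrow> 'v"
  lbr :: "'v \<Rightarrow> 'v \<Rightarrow> 'v poly"

definition dpol :: "('f, 'v::ring_1) pva \<Rightarrow> 'v pol \<Rightarrow> 'v pol" where
  "dpol V P = Poly_Mapping.map (der V) P"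

definition spol :: "('f, 'v::ring_1) pva \<Rightarrow> 'f \<Rightarrow> 'v pol \<Rightarrow> 'v pol" where
  "spol V c P = Poly_Mapping.map (scl V c) P"

text \<open>$[a_\Lambda b]$, $[a_\Lambda P]$ and $[P_\Lambda b]$ for a polynomial \<open>\<Lambda>\<close> and with the bracket
  extended coefficientwise to a polynomial \<open>P\<close>.\<close>

definition brk :: "('f, 'v::ring_1) pva \<Rightarrow> 'v \<Rightarrow> 'v pol \<Rightarrow> 'v \<Rightarrow> 'v pol" where
  "brk V a \<Lambda> b = (\<Sum>k\<le>degree (lbr V a b). cst (coeff (lbr V a b) k) * \<Lambda> ^ k)"

definition brkr :: "('f, 'v::ring_1) pva \<Rightarrow> 'v \<Rightarrow> 'v pol \<Rightarrow> 'v pol \<Rightarrow> 'v pol" where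
  "brkr V a \<Lambda> P = (\<Sum>m\<in>Poly_Mapping.keys P.
     brk V a \<Lambda> (Poly_Mapping.lookup P m) * Poly_Mapping.single m 1)"

definition brkl :: "('f, 'v::ring_1) pva \<Rightarrow> 'v pol \<Rightarrow> 'v pol \<Rightarrow> 'v \<Rightarrow> 'v pol" where
  "brkl V P \<Lambda> b = (\<Sum>m\<in>Poly_Mapping.keys P.
     brk V (Poly_Mapping.lookup P m) \<Lambda> b * Poly_Mapping.single m 1)"

locale super_comm_algebra = super_space V
  for V :: "('f::field, 'v::ring_1, 'm) superspace_scheme" +
  assumes scale_mult_left: "scl V c a * b = scl V c (a * b)"
    and scale_mult_right: "a * scl V c b = scl V c (a * b)"
    and one_even: "1 \<in> par V 0"
    and mult_par: "a \<in> par V p \<Longrightarrow> b \<in> par V q \<Longrightarrow> a * b \<in> par V (p + q)"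
    and mult_comm: "a \<in> par V p \<Longrightarrow> b \<in> par V q \<Longrightarrow> a * b = sg (p * q) * (b * a)"

locale poisson_vertex_superalgebra = super_comm_algebra V
  for V :: "('f::field_char_0, 'v::ring_1) pva" +
  assumes der_linear: "Vector_Spaces.linear (scl V) (scl V) (der V)"
    and der_even: "a \<in> par V p \<Longrightarrow> der V a \<in> par V p"
    and der_mult: "der V (a * b) = der V a * b + a * der V b"
    and lbr_add_left: "lbr V (a + a') b = lbr V a b + lbr V a' b"
    and lbr_add_right: "lbr V a (b + b') = lbr V a b + lbr V a b'"
    and lbr_scale_left: "lbr V (scl V r a) b = map_poly (scl V r) (lbr V a b)"
    and lbr_scale_right: "lbr V a (scl V r b) = map_poly (scl V r) (lbr V a b)"
    and lbr_par: "a \<in> par V p \<Longrightarrow> b \<in> par V q \<Longrightarrow> coeff (lbr V a b) k \<in> par V (p + q)"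
    and sesqui_left: "brk V (der V a) (X 0) b = - (X 0 * brk V a (X 0) b)"
    and sesqui_right:
      "brk V a (X 0) (der V b) = X 0 * brk V a (X 0) b + dpol V (brk V a (X 0) b)"
    and skew: "a \<in> par V p \<Longrightarrow> b \<in> par V q \<Longrightarrow>
      brk V a (X 0) b = - (sg (p * q) *
        (\<Sum>k\<le>degree (lbr V b a).
          ((\<lambda>P. - (X 0 * P) - dpol V P) ^^ k) (cst (coeff (lbr V b a) k))))"
    and jacobi: "a \<in> par V p \<Longrightarrow> b \<in> par V q \<Longrightarrow>
      brkr V a (X 0) (brk V b (X 1) c) - sg (p * q) * brkr V b (X 1) (brk V a (X 0) c)
        = brkl V (brk V a (X 0) b) (X 0 + X 1) c"
    and leibniz: "b \<in> par V p \<Longrightarrow> c \<in> par V q \<Longrightarrow>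
      brk V a (X 0) (b * c) = brk V a (X 0) b * cst c + sg (p * q) * (brk V a (X 0) c * cst b)"


section \<open>The variational complex with coefficients in the adjoint module\<close>

definition pol_space :: "('f, 'v::ring_1) pva \<Rightarrow> nat \<Rightarrow> ('f, 'v pol) lin_space" where
  "pol_space V n = \<lparr>lcarr = pols n, lzero = 0, ladd = (+), lsmul = spol V\<rparr>"

definition tot_der_image :: "('f, 'v::ring_1) pva \<Rightarrow> nat \<Rightarrow> 'v pol set" where
  "tot_der_image V n = (\<lambda>P. dpol V P + (\<Sum>i<n. X i) * P) ` pols n"

text \<open>The target $\mathcal V[\lambda_0,\dots,\lambda_{n-1}]/\langle\partial+\lambda_0+\dots+\lambda_{n-1}\rangle$,
  and the class of a polynomial in it.\<close>

definition tgt :: "('f, 'v::ring_1) pva \<Rightarrow> nat \<Rightarrow> ('f, 'v pol set) lin_space" where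
  "tgt V n = lquot (pol_space V n) (tot_der_image V n)"

definition cls :: "('f, 'v::ring_1) pva \<Rightarrow> nat \<Rightarrow> 'v pol \<Rightarrow> 'v pol set" where
  "cls V n = lcoset (pol_space V n) (tot_der_image V n)"

definition tgt_par :: "('f, 'v::ring_1) pva \<Rightarrow> nat \<Rightarrow> bit \<Rightarrow> 'v pol set set" where
  "tgt_par V n p = cls V n ` {P \<in> pols n. \<forall>m. Poly_Mapping.lookup P m \<in> par V p}"

text \<open>The map to \<open>tgt V n\<close> induced by a map \<open>f\<close> of polynomials that is compatible with the
  quotients.\<close>

definition qmap :: "('f, 'v::ring_1) pva \<Rightarrow> nat \<Rightarrow> ('v pol \<Rightarrow> 'v pol) \<Rightarrow> 'v pol set \<Rightarrow> 'v pol set" where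
  "qmap V n f A = (\<Union>P\<in>A. cls V n (f P))"

text \<open>Left multiplication by $e^{\partial\partial_{\lambda_i}} b$.\<close>

definition exp_mult :: "('f::field_char_0, 'v::ring_1) pva \<Rightarrow> nat \<Rightarrow> 'v \<Rightarrow> 'v pol \<Rightarrow> 'v pol" where
  "exp_mult V i b P = (\<Sum>k | (pdiff i ^^ k) P \<noteq> 0.
     spol V (1 / fact k) (cst ((der V ^^ k) b) * (pdiff i ^^ k) P))"

text \<open>Homogeneous cochains of parity \<open>q\<close> (the parity called $\bar p(Y)$).\<close>

definition hcochains :: "('f::field_char_0, 'v::ring_1) pva \<Rightarrow> nat \<Rightarrow> bit \<Rightarrow> ('v list \<Rightarrow> 'v pol set) set"
where
  "hcochains V n q = {Y \<in> multilinear (scl V) n (tgt V n).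
     (\<comment> \<open>parity\<close>
      \<forall>as ps. length as = n \<and> homs V ps as \<longrightarrow>
        Y as \<in> tgt_par V n (1 + (q + (\<Sum>p\<leftarrow>ps. 1 + p)))) \<and>
     (\<comment> \<open>sesquilinearity\<close>
      \<forall>as i a. length as = n \<and> i < n \<longrightarrow>
        Y (as[i := der V a]) = qmap V n (\<lambda>P. - (X i * P)) (Y (as[i := a]))) \<and>
     (\<comment> \<open>symmetry\<close>
      \<forall>as ps i. length as = n \<and> homs V ps as \<and> Suc i < n \<longrightarrow>
        qmap V n (subst (lswap i (map X [0..<n]))) (Y (lswap i as))
          = lsmul (tgt V n) (sg ((1 + ps ! i) * (1 + ps ! Suc i))) (Y as)) \<and>
     (\<comment> \<open>Leibniz rules\<close>
      \<forall>as ps i b c pb pc.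
        length as = n \<and> homs V ps as \<and> i < n \<and> b \<in> par V pb \<and> c \<in> par V pc \<longrightarrow>
        (let s = q + (\<Sum>p\<leftarrow>take i ps. 1 + p) in
          Y (as[i := b * c]) = ladd (tgt V n)
            (lsmul (tgt V n) (sg (pb * s)) (qmap V n (exp_mult V i b) (Y (as[i := c]))))
            (lsmul (tgt V n) (sg (pc * (pb + s))) (qmap V n (exp_mult V i c) (Y (as[i := b]))))))}"

text \<open>A general cochain is a sum of an even and an odd one.\<close>

definition C_PV :: "('f::field_char_0, 'v::ring_1) pva \<Rightarrow> nat \<Rightarrow> ('f, 'v list \<Rightarrow> 'v pol set) lin_space"
where
  "C_PV V n = (let W = fun_space n (tgt V n) {} in
     fun_space n (tgt V n) {ladd W Y0 Y1 | Y0 Y1. Y0 \<in> hcochains V n 0 \<and> Y1 \<in> hcochains V n 1})"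

definition cochain_comp ::
  "('f::field_char_0, 'v::ring_1) pva \<Rightarrow> nat \<Rightarrow> bit \<Rightarrow> ('v list \<Rightarrow> 'v pol set) \<Rightarrow> 'v list \<Rightarrow> 'v pol set"
where
  "cochain_comp V n q Y = (THE Z. Z \<in> hcochains V n q \<and>
     (\<exists>Z'\<in>hcochains V n (1 + q). Y = ladd (C_PV V n) Z Z'))"

text \<open>The indices \<open>0, ..., n\<close> without those in \<open>I\<close>, and the corresponding sublist.\<close>

definition omit :: "nat \<Rightarrow> nat set \<Rightarrow> nat list" where
  "omit n I = filter (\<lambda>k. k \<notin> I) [0..<Suc n]"

definition omit_args :: "nat \<Rightarrow> nat set \<Rightarrow> 'a list \<Rightarrow> 'a list" where
  "omit_args n I as = map ((!) as) (omit n I)"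

definition gamma1 :: "bit \<Rightarrow> bit list \<Rightarrow> nat \<Rightarrow> bit" where
  "gamma1 q ps i = (1 + ps ! i) * (q + (\<Sum>k<i. 1 + ps ! k) + 1) + 1"

definition gamma2 :: "bit \<Rightarrow> bit list \<Rightarrow> nat \<Rightarrow> nat \<Rightarrow> bit" where
  "gamma2 q ps i j = q + (1 + ps ! i) * ((\<Sum>k<i. 1 + ps ! k) + 1)
     + (1 + ps ! j) * (\<Sum>k\<in>{..<j} - {i}. 1 + ps ! k)"

text \<open>The formula for $dY$, for \<open>Y\<close> of parity \<open>q\<close> and arguments \<open>as\<close> of parities \<open>ps\<close>. In the second
  sum $[{a_i}_{\lambda_i}a_j] = \sum_k c_k \lambda_i^k$, and the powers of $\lambda_i$ are taken out
  of \<open>Y\<close>.\<close>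

definition d_hom ::
  "('f::field_char_0, 'v::ring_1) pva \<Rightarrow> nat \<Rightarrow> bit \<Rightarrow> ('v list \<Rightarrow> 'v pol set) \<Rightarrow> bit list \<Rightarrow> 'v list \<Rightarrow> 'v pol set"
where
  "d_hom V n q Y ps as = (let T = tgt V (Suc n) in ladd T
     (lsum T
       [lsmul T (sg (gamma1 q ps i))
          (qmap V (Suc n) (\<lambda>P. brkr V (as ! i) (X i) (subst (map X (omit n {i})) P))
            (Y (omit_args n {i} as))).
        i \<leftarrow> [0..<Suc n]])
     (lsum T
       [lsmul T (sg (gamma2 q ps i j))
          (qmap V (Suc n) (\<lambda>P. X i ^ k * subst ((X i + X j) # map X (omit n {i, j})) P)
            (Y (coeff (lbr V (as ! i) (as ! j)) k # omit_args n {i, j} as))).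
        j \<leftarrow> [0..<Suc n], i \<leftarrow> [0..<j], k \<leftarrow> [0..<Suc (degree (lbr V (as ! i) (as ! j)))]]))"

text \<open>Extension to arbitrary arguments by multilinearity, and to arbitrary cochains by additivity.\<close>

definition d_ext ::
  "('f::field_char_0, 'v::ring_1) pva \<Rightarrow> nat \<Rightarrow> bit \<Rightarrow> ('v list \<Rightarrow> 'v pol set) \<Rightarrow> 'v list \<Rightarrow> 'v pol set"
where
  "d_ext V n q Y = (\<lambda>as\<in>lists_of_length (Suc n). lsum (tgt V (Suc n))
     [d_hom V n q Y ps (map2 (pcomp V) ps as). ps \<leftarrow> List.n_lists (Suc n) [0, 1]])"

definition d_PV ::
  "('f::field_char_0, 'v::ring_1) pva \<Rightarrow> nat \<Rightarrow> ('v list \<Rightarrow> 'v pol set) \<Rightarrow> 'v list \<Rightarrow> 'v pol set"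
where
  "d_PV V n Y = ladd (C_PV V (Suc n))
     (d_ext V n 0 (cochain_comp V n 0 Y)) (d_ext V n 1 (cochain_comp V n 1 Y))"

definition Z_PV :: "('f::field_char_0, 'v::ring_1) pva \<Rightarrow> nat \<Rightarrow> ('f, 'v list \<Rightarrow> 'v pol set) lin_space"
where
  "Z_PV V n = fun_space n (tgt V n) {Y \<in> lcarr (C_PV V n). d_PV V n Y = lzero (C_PV V (Suc n))}"

definition B_PV :: "('f::field_char_0, 'v::ring_1) pva \<Rightarrow> nat \<Rightarrow> ('v list \<Rightarrow> 'v pol set) set" where
  "B_PV V n = (case n of 0 \<Rightarrow> {lzero (C_PV V 0)} | Suc m \<Rightarrow> d_PV V m ` lcarr (C_PV V m))"

definition H_PV :: "('f::field_char_0, 'v::ring_1) pva \<Rightarrow> nat \<Rightarrow> ('f, ('v list \<Rightarrow> 'v pol set) set) lin_space"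
where
  "H_PV V n = lquot (Z_PV V n) (B_PV V n)"

definition H_class ::
  "('f::field_char_0, 'v::ring_1) pva \<Rightarrow> nat \<Rightarrow> ('v list \<Rightarrow> 'v pol set) \<Rightarrow> ('v list \<Rightarrow> 'v pol set) set"
where
  "H_class V n Y = lcoset (Z_PV V n) (B_PV V n) Y"


section \<open>Symmetric superalgebras and free superbosons\<close>

text \<open>\<open>'w list \<Rightarrow>\<^sub>0 'f\<close> is the space underlying the free algebra on the set \<open>'w\<close>. The first two families
  of relations cut out the tensor algebra of the vector space, the third one its symmetric
  superalgebra.\<close>

definition sym_relations :: "('f::field, 'w::ab_group_add) superspace \<Rightarrow> ('w list \<Rightarrow>\<^sub>0 'f) set" where
  "sym_relations W =
     {Poly_Mapping.single (x @ [a + b] @ y) 1 - Poly_Mapping.single (x @ [a] @ y) 1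
        - Poly_Mapping.single (x @ [b] @ y) 1 | x y a b. True} \<union>
     {Poly_Mapping.single (x @ [scl W c a] @ y) 1 - Poly_Mapping.single (x @ [a] @ y) c
        | x y a c. True} \<union>
     {Poly_Mapping.single (x @ [a, b] @ y) 1 - Poly_Mapping.single (x @ [b, a] @ y) (sg (p * q))
        | x y a b p q. a \<in> par W p \<and> b \<in> par W q}"

definition eval_words ::
  "('f::field, 'v::ring_1, 'm) superspace_scheme \<Rightarrow> ('w \<Rightarrow> 'v) \<Rightarrow> ('w list \<Rightarrow>\<^sub>0 'f) \<Rightarrow> 'v"
where
  "eval_words V j t =
     (\<Sum>w\<in>Poly_Mapping.keys t. scl V (Poly_Mapping.lookup t w) (prod_list (map j w)))"

text \<open>\<open>V\<close> with \<open>j : W \<rightarrow> V\<close> is the symmetric superalgebra of \<open>W\<close>: the parity is the induced one, and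
  evaluation of words identifies \<open>V\<close> with the quotient by the two-sided ideal generated by the
  relations (as the words \<open>x\<close>, \<open>y\<close> are arbitrary, this ideal is the linear span).\<close>

definition symmetric_superalgebra ::
  "('f::field, 'w::ab_group_add) superspace \<Rightarrow> ('f, 'v::ring_1, 'm) superspace_scheme \<Rightarrow> ('w \<Rightarrow> 'v) \<Rightarrow> bool"
where
  "symmetric_superalgebra W V j \<longleftrightarrow>
     super_comm_algebra V \<and> (\<forall>p. j ` par W p \<subseteq> par V p) \<and>
     surj (eval_words V j) \<and>
     {t. eval_words V j t = 0}
       = module.span (\<lambda>c. Poly_Mapping.map ((*) c)) (sym_relations W)"

text \<open>$\mathbb F[\partial]\otimes\mathfrak h$, as polynomials in $\partial$ with coefficients in
  $\mathfrak h$.\<close>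

definition der_module :: "('f::field, 'h::ab_group_add) superspace \<Rightarrow> ('f, 'h poly) superspace" where
  "der_module H = \<lparr>scl = (\<lambda>c. map_poly (scl H c)), par = (\<lambda>p. {P. \<forall>k. coeff P k \<in> par H p})\<rparr>"

definition der_module_map :: "('f, 'v::ring_1) pva \<Rightarrow> ('h::zero \<Rightarrow> 'v) \<Rightarrow> 'h poly \<Rightarrow> 'v" where
  "der_module_map V \<iota> P = (\<Sum>k\<le>degree P. (der V ^^ k) (\<iota> (coeff P k)))"

locale free_superboson =
  supersymmetric_form H form + poisson_vertex_superalgebra V
  for H :: "('f::field_char_0, 'h::ab_group_add) superspace"
    and form :: "'h \<Rightarrow> 'h \<Rightarrow> 'f"
    and V :: "('f, 'v::ring_1) pva"
    and \<iota> :: "'h \<Rightarrow> 'v" +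
  assumes sym_alg: "symmetric_superalgebra (der_module H) V (der_module_map V \<iota>)"
    and lbr_gens: "lbr V (\<iota> a) (\<iota> b) = monom (scl V (form a b) 1) 1"

end

theory Submission
  imports Defs
begin

text \<open>Before passing to the quotient by \<open>\<partial> + \<Sum>\<lambda>\<^sub>i\<close>, a cochain with honest polynomial values is determined by its
  values on generators. As the bracket of two generators is a constant multiple of \<open>\<lambda>\<close>, the differential
  is there the contraction with the operators \<open>[a\<^sub>\<lambda> \<cdot>]\<close>. Inserting a dual basis in a fresh slot and
  dividing by the fresh variable gives a homotopy whose anticommutator with the differential is an
  Euler operator, namely the degree in the generators plus the number of variables that occur; hence
  this basic complex has only the constants \<open>(S\<^sup>n(\<Pi>h))\<^sup>*\<close> as cohomology. For \<open>n > 0\<close> the operator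
  \<open>\<partial> + \<Sum>\<lambda>\<^sub>i\<close> is injective, and every cochain with values in the quotient lifts to a basic one, by means
  of the section \<open>\<lambda>\<^sub>k \<mapsto> \<lambda>\<^sub>k - (\<partial> + \<Sum>\<lambda>\<^sub>i) / n\<close>. In the long exact sequence of
  \<open>\<partial> + \<Sum>\<lambda>\<^sub>i\<close> this operator acts by zero on cohomology, because it maps a constant cochain \<open>\<beta>\<close> to minus the
  differential of \<open>\<Sum>\<^sub>j \<beta>(\<cdot> \<otimes> u\<^sup>j) u\<^sub>j\<close>. So the cohomology in degree \<open>n\<close> consists of the constants
  of degree \<open>n\<close> and of the classes of these cochains for the constants of degree \<open>n + 1\<close>.\<close>

section \<open>Polynomials over a noncommutative ring\<close>

text \<open>Two levels are kept apart. Leibniz rules and the comparison with the given differential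
  need cochains on the whole algebra; on generators no Leibniz rule is left, and the differential is
  a Koszul-type sum of supercommuting operators. The master formula extends from the second level to
  the first.

  The Euler operator owes its second summand to the commutator of the homotopy with a bracket: the
  factor \<lambda> in [a_\<lambda> u] = \<lambda>(a|u) undoes the division by the fresh variable and
  leaves a polynomial minus its value at zero. Without this summand, all polynomials in the
  variables with scalar coefficients would lie in the kernel. The eigenvalues are natural numbers,
  so in characteristic 0 the operator can be inverted off its kernel.

  In degree 0 the operator that is divided out is \<partial> alone and kills scalars. Injectivity is
  therefore used only in positive degrees. Scalars are separated from the image by setting all
  variables to zero, where coboundaries vanish and the operator becomes \<partial>: a nonzero scalar
  is not a total derivative.\<close>

declare add_bit_eq_xor [simp del] mult_bit_eq_and [simp del] One_nat_def [simp del] Poly_Mapping.single_one [simp del]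

abbreviation lk where "lk \<equiv> Poly_Mapping.lookup"
abbreviation sgl where "sgl \<equiv> Poly_Mapping.single"
abbreviation ky where "ky \<equiv> Poly_Mapping.keys"

text \<open>The general rule leaves the simpset because it also fires on exponents, where it would
  rewrite the inner part of \<open>X 0\<close>; this instance puts it back for coefficients only.
  The rules for \<open>bit\<close> are removed in order to compute with parities in a ring.\<close>

lemma cst_1 [simp]: "Poly_Mapping.single (0 :: nat \<Rightarrow>\<^sub>0 nat) 1 = (1 :: 'v::ring_1 pol)"
  by (rule Poly_Mapping.single_one)

lemma sg_01 [simp]: "sg 0 = 1" "sg 1 = - 1"
  by (simp_all add: sg_def)

lemma sg_add: "sg (p + q) = sg p * sg q"
  by (cases p; cases q) simp_all

lemma sg_sg [simp]: "sg p * sg p = 1" "sg p * (sg p * x) = x"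
  by (cases p; simp)+

lemma sg_comm: "x * sg p = sg p * x" "x * (sg p * y) = sg p * (x * y)"
  by (cases p; simp)+

lemma bit_self [simp]: "p + p = (0::bit)" "p + (p + q) = (q::bit)" "p * p = (p::bit)"
  by (cases p; cases q; simp)+

lemma additiveI: "(\<And>x y. f (x + y) = f x + f y) \<Longrightarrow> additive f"
  by (simp add: additive_def)

lemma pm_sum: "P = (\<Sum>m\<in>ky P. sgl m (lk P m))"
  by (rule poly_mapping_eqI) (simp add: lookup_sum lookup_single when_def in_keys_iff)

text \<open>Most operations on polynomials below are sums over monomials; this gives their
  additivity once and for all.\<close>

lemma ky_sum_additive:
  assumes "\<And>m. additive (f m)"
  shows "additive (\<lambda>P. \<Sum>m\<in>ky P. f m (lk P m))"
proof (rule additiveI)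
  fix P Q :: "'a \<Rightarrow>\<^sub>0 'b"
  show "(\<Sum>m\<in>ky (P + Q). f m (lk (P + Q) m)) = (\<Sum>m\<in>ky P. f m (lk P m)) + (\<Sum>m\<in>ky Q. f m (lk Q m))"
    by (rule setsum_keys_plus_distrib)
      (auto simp: additive.zero[OF assms] additive.add[OF assms])
qed

lemma mono_one_comm: "sgl m 1 * P = P * sgl (m :: nat \<Rightarrow>\<^sub>0 nat) (1::'v::ring_1)"
proof -
  have "sgl m 1 * (\<Sum>k\<in>ky P. sgl k (lk P k)) = (\<Sum>k\<in>ky P. sgl k (lk P k)) * sgl m (1::'v)"
    by (simp add: sum_distrib_left sum_distrib_right mult_single add.commute)
  then show ?thesis using pm_sum[of P] by simp
qed

lemma X_mono: "X k * sgl m v = sgl (sgl k 1 + m) v"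
  by (simp add: mult_single)

text \<open>Arguments will carry arbitrary labels as their variables, so the initial segments of
  \<open>pols\<close> are replaced by arbitrary sets of variables.\<close>

definition pon :: "nat set \<Rightarrow> 'v::ring_1 pol set" where
  "pon A = {P. \<forall>m\<in>ky P. ky m \<subseteq> A}"

lemma pols_pon: "pols n = pon {..<n}"
  by (simp add: pols_def pon_def)

lemma pon_mono: "P \<in> pon A \<Longrightarrow> A \<subseteq> B \<Longrightarrow> P \<in> pon B"
  by (auto simp: pon_def)

lemma pon_UNIV [simp]: "P \<in> pon UNIV"
  by (simp add: pon_def)

lemma pon_0 [simp]: "0 \<in> pon A" and pon_cst [simp]: "cst v \<in> pon A"
  by (auto simp: pon_def)

lemma pon_1 [simp]: "1 \<in> pon A"
  using pon_cst[of 1 A] by simp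

lemma ky_nat_add: "ky (a + b :: nat \<Rightarrow>\<^sub>0 nat) = ky a \<union> ky b"
  by (auto simp: in_keys_iff lookup_add)

lemma pon_X [simp]: "X i \<in> pon A \<longleftrightarrow> i \<in> A"
  by (auto simp: pon_def)

lemma pon_mono1: "sgl m v \<in> pon A \<longleftrightarrow> v = 0 \<or> ky m \<subseteq> A"
  by (auto simp: pon_def)

lemma pon_add [simp]: "P \<in> pon A \<Longrightarrow> Q \<in> pon A \<Longrightarrow> P + Q \<in> pon A"
  using keys_add[of P Q] by (fastforce simp: pon_def)

lemma pon_uminus [simp]: "P \<in> pon A \<Longrightarrow> - P \<in> pon A"
  by (auto simp: pon_def in_keys_iff)

lemma pon_diff [simp]: "P \<in> pon A \<Longrightarrow> Q \<in> pon A \<Longrightarrow> P - Q \<in> pon A"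
  using pon_add[of P A "- Q"] by simp

lemma pon_mult [simp]: "P \<in> pon A \<Longrightarrow> Q \<in> pon A \<Longrightarrow> P * Q \<in> pon A"
  using keys_mult[of P Q] by (fastforce simp: pon_def ky_nat_add)

lemma pon_sum [simp]: "(\<And>i. i \<in> I \<Longrightarrow> f i \<in> pon A) \<Longrightarrow> sum f I \<in> pon A"
  by (induction I rule: infinite_finite_induct) auto

lemma pon_power [simp]: "P \<in> pon A \<Longrightarrow> P ^ k \<in> pon A"
  by (induction k) auto

lemma pon_sg [simp]: "sg p \<in> pon A"
  by (cases p) auto

lemma mono_induct_on:
  assumes "ky m \<subseteq> A" and c: "Q (cst v)"
    and x: "\<And>k P. k \<in> A \<Longrightarrow> P \<in> pon A \<Longrightarrow> Q P \<Longrightarrow> Q (X k * P)"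
  shows "Q (sgl m v)"
  using assms(1)
proof (induction "sum (lk m) (ky m)" arbitrary: m)
  case 0
  then have "lk m k = 0" for k by (metis finite_keys in_keys_iff sum_eq_0_iff)
  then have "m = 0" by (intro poly_mapping_eqI) simp
  then show ?case by (simp add: c)
next
  case (Suc s)
  then have "ky m \<noteq> {}" by (metis Suc_neq_Zero sum.empty)
  then obtain k where k: "k \<in> ky m" by blast
  \<comment> \<open>Truncated subtraction, but exact here because \<open>k\<close> occurs in
    \<open>m\<close>.\<close>
  define m' where "m' = m - sgl k 1"
  have lk: "lk m k > 0" using k by (simp add: in_keys_iff)
  have m: "m = sgl k 1 + m'" by (rule poly_mapping_eqI)
      (use lk in \<open>auto simp: m'_def lookup_add lookup_minus lookup_single when_def\<close>)
  have sub: "ky m' \<subseteq> ky m" using m ky_nat_add[of "sgl k 1" m'] by auto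
  have "sum (lk m) (ky m) = sum (lk (sgl k 1)) (ky m) + sum (lk m') (ky m)"
    by (subst m) (simp add: lookup_add sum.distrib)
  also have "sum (lk (sgl k (1::nat))) (ky m) = 1" using k by (simp add: lookup_single when_def)
  also have "sum (lk m') (ky m) = sum (lk m') (ky m')"
    by (rule sum.mono_neutral_right) (use sub in \<open>auto simp: in_keys_iff\<close>)
  finally have "s = sum (lk m') (ky m')" using Suc.hyps(2) by simp
  then have "Q (sgl m' v)" by (rule Suc.hyps(1)) (use sub Suc.prems in auto)
  then have "Q (X k * sgl m' v)" by (rule x[rotated 2]) (use sub Suc.prems k in \<open>auto simp: pon_mono1\<close>)
  then show ?case by (simp add: X_mono m)
qed

text \<open>The common source of the induction rules: constants, multiplication by a variable, sums.
  With \<open>S = UNIV\<close> it is the plain rule, with \<open>S\<close> a parity component the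
  rule for homogeneous polynomials.\<close>

lemma pol_induct_S [consumes 3, case_names cst X add]:
  assumes P: "P \<in> pon A" "\<And>m. lk P m \<in> S" and z: "0 \<in> S" and c: "\<And>v. v \<in> S \<Longrightarrow> Q (cst v)"
    and x: "\<And>k P. k \<in> A \<Longrightarrow> P \<in> pon A \<Longrightarrow> Q P \<Longrightarrow> Q (X k * P)"
    and a: "\<And>P P'. P \<in> pon A \<Longrightarrow> P' \<in> pon A \<Longrightarrow> Q P \<Longrightarrow> Q P' \<Longrightarrow> Q (P + P')"
  shows "Q P"
proof -
  have "T \<subseteq> ky P \<Longrightarrow> (\<Sum>m\<in>T. sgl m (lk P m)) \<in> pon A \<and> Q (\<Sum>m\<in>T. sgl m (lk P m))" if "finite T" for T using that
  proof (induction T)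
    case empty
    then show ?case using c[OF z] by simp
  next
    case (insert m T)
    have "ky m \<subseteq> A" using insert.prems P by (auto simp: pon_def)
    then have "Q (sgl m (lk P m))" "sgl m (lk P m) \<in> pon A"
      using mono_induct_on[of m A Q] c P x by (auto simp: pon_mono1)
    then show ?case using insert a by auto
  qed
  from this[of "ky P"] show ?thesis using pm_sum[of P] by simp
qed

lemma pol_induct_on [consumes 1, case_names cst X add]:
  assumes P: "P \<in> pon A" and c: "\<And>v. Q (cst v)"
    and x: "\<And>k P. k \<in> A \<Longrightarrow> P \<in> pon A \<Longrightarrow> Q P \<Longrightarrow> Q (X k * P)"
    and a: "\<And>P P'. P \<in> pon A \<Longrightarrow> P' \<in> pon A \<Longrightarrow> Q P \<Longrightarrow> Q P' \<Longrightarrow> Q (P + P')"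
  shows "Q P"
  by (rule pol_induct_S[OF P, of UNIV]) (simp, simp, rule c, rule x, assumption+, rule a, assumption+)

lemmas pol_induct [case_names cst X add] = pol_induct_on[OF pon_UNIV, simplified]

text \<open>The subring generated by the variables. It is central although the coefficient ring need
  not be commutative, and substitution is multiplicative only for central values; every polynomial
  that is ever substituted lies in it.\<close>

inductive_set IP :: "'v::ring_1 pol set" where
  IP_0 [simp]: "0 \<in> IP"
| IP_1 [simp]: "1 \<in> IP"
| IP_X [simp]: "X i \<in> IP"
| IP_add [simp]: "P \<in> IP \<Longrightarrow> Q \<in> IP \<Longrightarrow> P + Q \<in> IP"
| IP_uminus [simp]: "P \<in> IP \<Longrightarrow> - P \<in> IP"
| IP_mult [simp]: "P \<in> IP \<Longrightarrow> Q \<in> IP \<Longrightarrow> P * Q \<in> IP"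

lemma IP_power [simp]: "P \<in> IP \<Longrightarrow> P ^ k \<in> IP"
  by (induction k) auto

lemma IP_sum [simp]: "(\<And>i. i \<in> I \<Longrightarrow> f i \<in> IP) \<Longrightarrow> sum f I \<in> IP"
  by (induction I rule: infinite_finite_induct) auto

lemma IP_sg [simp]: "sg p \<in> IP"
  by (cases p) auto

lemma IP_comm: "\<Lambda> \<in> IP \<Longrightarrow> \<Lambda> * P = P * \<Lambda>"
proof (induction arbitrary: P rule: IP.induct)
  case (IP_X i)
  then show ?case by (rule mono_one_comm)
next
  case (IP_mult P' Q)
  then show ?case by (metis mult.assoc)
qed (simp_all add: algebra_simps)

lemma IP_left_comm: "\<Lambda> \<in> IP \<Longrightarrow> P * (\<Lambda> * Q) = \<Lambda> * (P * Q)"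
  by (metis IP_comm mult.assoc)

lemma IP_semilinear:
  assumes "additive F" "\<And>i P. F (X i * P) = X i * F P" "\<Lambda> \<in> IP"
  shows "F (\<Lambda> * P) = \<Lambda> * F P"
  using assms(3) by (induction arbitrary: P rule: IP.induct)
    (simp_all add: assms(2) additive.zero[OF assms(1)] additive.add[OF assms(1)]
      additive.minus[OF assms(1)] algebra_simps)

text \<open>The extension of a map on coefficients that is linear over all variables. It serves for
  the bracket with a polynomial as well as for inserting the coefficients of a bracket into a slot
  of a cochain.\<close>

definition lft :: "('a::ab_group_add \<Rightarrow> 'v::ring_1 pol) \<Rightarrow> ((nat \<Rightarrow>\<^sub>0 nat) \<Rightarrow>\<^sub>0 'a) \<Rightarrow> 'v pol" where
  "lft G P = (\<Sum>m\<in>ky P. G (lk P m) * sgl m 1)"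

lemma lft_additive:
  assumes "additive G"
  shows "additive (lft G)"
  unfolding lft_def by (rule ky_sum_additive, rule additiveI) (simp add: additive.add[OF assms] algebra_simps)

lemma lft_mono: "additive G \<Longrightarrow> lft G (sgl m v) = G v * sgl m 1"
  by (simp add: lft_def additive.zero)

lemma lft_cst: "additive G \<Longrightarrow> lft G (cst v) = G v"
  by (simp add: lft_mono)

lemma lft_X:
  fixes P :: "'v::ring_1 pol"
  assumes "additive G"
  shows "lft G (X k * P) = X k * lft G P"
proof -
  note l = lft_additive[OF assms]
  have "lft G (X k * (\<Sum>m\<in>ky P. sgl m (lk P m))) = X k * lft G (\<Sum>m\<in>ky P. sgl m (lk P m))"
    by (simp add: sum_distrib_left X_mono additive.sum[OF l] lft_mono[OF assms]
        IP_left_comm[OF IP_X, symmetric])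
  then show ?thesis using pm_sum[of P] by simp
qed

lemma lft_IP: "additive G \<Longrightarrow> \<Lambda> \<in> IP \<Longrightarrow> lft G (\<Lambda> * P) = \<Lambda> * lft G P"
  by (rule IP_semilinear) (auto simp: lft_additive lft_X)

lemma lft_add_fun: "additive G \<Longrightarrow> additive G' \<Longrightarrow> lft (\<lambda>v. G v + G' v) P = lft G P + lft G' P"
  by (simp add: lft_def algebra_simps sum.distrib)

lemma lft_mult_left: "a * lft G P = lft (\<lambda>v. a * G v) P"
  by (simp add: lft_def sum_distrib_left mult.assoc)

lemma lft_pon:
  assumes "P \<in> pon A" "\<And>m. G (lk P m) \<in> pon A"
  shows "lft G P \<in> pon A"
  unfolding lft_def using assms by (intro pon_sum pon_mult) (auto simp: pon_def)

section \<open>Substitution of polynomials for the variables\<close>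

definition mon_ev :: "(nat \<Rightarrow> 'v::ring_1 pol) \<Rightarrow> (nat \<Rightarrow>\<^sub>0 nat) \<Rightarrow> 'v pol" where
  "mon_ev \<sigma> m = prod_list (map (\<lambda>k. \<sigma> k ^ lk m k) [0..<Suc (Max (insert 0 (ky m)))])"

text \<open>A value for every variable, unlike the list in \<open>subst\<close>, so that
  substitutions compose without conditions on lengths. The finite range in \<open>mon_ev\<close> is
  immaterial by \<open>mon_ev_eq\<close>.\<close>

definition sb :: "(nat \<Rightarrow> 'v::ring_1 pol) \<Rightarrow> 'v pol \<Rightarrow> 'v pol" where
  "sb \<sigma> P = (\<Sum>m\<in>ky P. cst (lk P m) * mon_ev \<sigma> m)"

lemma prod_list_neutral: "(\<And>x. x \<in> set xs \<Longrightarrow> x = 1) \<Longrightarrow> prod_list xs = (1::'a::monoid_mult)"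
  by (induction xs) auto

lemma prod_list_upt_ext:
  assumes "ky m \<subseteq> {..<M}" "M \<le> N"
  shows "prod_list (map (\<lambda>k. \<sigma> k ^ lk m k) [0..<N]) = prod_list (map (\<lambda>k. \<sigma> k ^ lk m k) [0..<M])"
proof -
  have N: "N = M + (N - M)" using assms(2) by simp
  have "lk m k = 0" if "M \<le> k" for k using assms(1) that by (metis in_keys_iff lessThan_iff not_less subsetD)
  then have "prod_list (map (\<lambda>k. \<sigma> k ^ lk m k) [M..<M + (N - M)]) = 1" by (intro prod_list_neutral) auto
  then show ?thesis by (subst N, subst upt_add_eq_append) auto
qed

lemma mon_ev_eq:
  assumes "ky m \<subseteq> {..<N}"
  shows "mon_ev \<sigma> m = prod_list (map (\<lambda>k. \<sigma> k ^ lk m k) [0..<N])"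
proof -
  define M where "M = Suc (Max (insert 0 (ky m)))"
  have "ky m \<subseteq> {..<M}" by (auto simp: M_def less_Suc_eq_le)
  then have "prod_list (map (\<lambda>k. \<sigma> k ^ lk m k) [0..<M]) = prod_list (map (\<lambda>k. \<sigma> k ^ lk m k) [0..<max M N])"
    by (rule prod_list_upt_ext[symmetric]) simp
  moreover have "prod_list (map (\<lambda>k. \<sigma> k ^ lk m k) [0..<N]) = prod_list (map (\<lambda>k. \<sigma> k ^ lk m k) [0..<max M N])"
    by (rule prod_list_upt_ext[symmetric]) (use assms in auto)
  ultimately show ?thesis by (simp add: mon_ev_def M_def)
qed

lemma mon_ev_X:
  assumes "\<And>k. \<sigma> k \<in> IP"
  shows "mon_ev \<sigma> (sgl i 1 + m) = \<sigma> i * mon_ev \<sigma> m"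
proof -
  define N where "N = Suc (max i (Max (insert 0 (ky m))))"
  have "ky m \<subseteq> {..<N}" by (auto simp: N_def less_Suc_eq_le le_max_iff_disj)
  then have m: "ky m \<subseteq> {..<N}" "ky (sgl i 1 + m) \<subseteq> {..<N}" by (auto simp: ky_nat_add) (simp add: N_def)
  have spl: "[0..<N] = [0..<i] @ i # [Suc i..<N]"
    using upt_add_eq_append[of 0 i "N - i"] upt_conv_Cons[of i N] by (simp add: N_def del: upt_Suc)
  have "mon_ev \<sigma> (sgl i 1 + m) = prod_list (map (\<lambda>k. \<sigma> k ^ lk m k) [0..<i])
    * (\<sigma> i * (\<sigma> i ^ lk m i * prod_list (map (\<lambda>k. \<sigma> k ^ lk m k) [Suc i..<N])))"
  proof -
    have "map (\<lambda>k. \<sigma> k ^ lk (sgl i 1 + m) k) [0..<i] = map (\<lambda>k. \<sigma> k ^ lk m k) [0..<i]"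
      "map (\<lambda>k. \<sigma> k ^ lk (sgl i 1 + m) k) [Suc i..<N] = map (\<lambda>k. \<sigma> k ^ lk m k) [Suc i..<N]"
      by (auto simp: lookup_add lookup_single)
    moreover have "\<sigma> i ^ lk (sgl i 1 + m) i = \<sigma> i * \<sigma> i ^ lk m i" by (simp add: lookup_add power_add)
    ultimately show ?thesis
      by (simp only: mon_ev_eq[OF m(2)] spl map_append list.map prod_list.append prod_list.Cons mult.assoc)
  qed
  also have "\<dots> = \<sigma> i * mon_ev \<sigma> m" by (simp add: mon_ev_eq[OF m(1)] spl IP_left_comm[OF assms(1)])
  finally show ?thesis .
qed

lemma mon_ev_0 [simp]: "mon_ev \<sigma> 0 = 1"
  by (simp add: mon_ev_def)

lemma sb_additive: "additive (sb \<sigma>)"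
  unfolding sb_def by (rule ky_sum_additive, rule additiveI) (simp add: single_add algebra_simps)

lemmas sb_add [simp] = additive.add[OF sb_additive]
lemmas sb_0 [simp] = additive.zero[OF sb_additive]
lemmas sb_uminus [simp] = additive.minus[OF sb_additive]
lemmas sb_diff [simp] = additive.diff[OF sb_additive]
lemmas sb_sum = additive.sum[OF sb_additive]

lemma sb_mono: "sb \<sigma> (sgl m v) = cst v * mon_ev \<sigma> m"
  by (simp add: sb_def)

lemma sb_cst [simp]: "sb \<sigma> (cst v) = cst v"
  by (simp add: sb_mono)

lemma sb_1 [simp]: "sb \<sigma> 1 = 1"
  using sb_cst[of \<sigma> 1] by simp

lemma sb_mult_X:
  assumes "\<And>k. \<sigma> k \<in> IP"
  shows "sb \<sigma> (X i * P) = \<sigma> i * sb \<sigma> P"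
proof -
  have "sb \<sigma> (X i * (\<Sum>m\<in>ky P. sgl m (lk P m))) = \<sigma> i * sb \<sigma> (\<Sum>m\<in>ky P. sgl m (lk P m))"
    by (simp add: sum_distrib_left X_mono sb_sum sb_mono mon_ev_X[OF assms] IP_left_comm[OF assms])
  then show ?thesis using pm_sum[of P] by simp
qed

lemma sb_X [simp]: "(\<And>k. \<sigma> k \<in> IP) \<Longrightarrow> sb \<sigma> (X i) = \<sigma> i"
  using sb_mult_X[of \<sigma> i 1] by simp

text \<open>Values must move past coefficients to be collected, which is why they have to be
  central.\<close>

lemma sb_mult:
  assumes "\<And>k. \<sigma> k \<in> IP"
  shows "sb \<sigma> (P * Q) = sb \<sigma> P * sb \<sigma> Q"
proof (induction P rule: pol_induct)
  case (cst v)
  show ?case by (induction Q rule: pol_induct)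
     (simp_all add: sb_mult_X[OF assms] mult_single algebra_simps IP_left_comm[of "X _"]
      IP_left_comm[OF assms])
next
  case (X k P)
  then show ?case by (simp add: sb_mult_X[OF assms] mult.assoc)
qed (simp add: algebra_simps)

lemma sb_power: "(\<And>k. \<sigma> k \<in> IP) \<Longrightarrow> sb \<sigma> (P ^ n) = sb \<sigma> P ^ n"
  by (induction n) (simp_all add: sb_mult)

lemma sb_sg [simp]: "sb \<sigma> (sg p) = sg p"
  by (cases p) auto

lemma sb_sg_mult [simp]: "sb \<sigma> (sg p * P) = sg p * sb \<sigma> P"
  by (cases p) auto

lemma sb_IP [simp]: "(\<And>k. \<sigma> k \<in> IP) \<Longrightarrow> \<Lambda> \<in> IP \<Longrightarrow> sb \<sigma> \<Lambda> \<in> IP"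
  by (rotate_tac, induction rule: IP.induct) (auto simp: sb_mult)

lemma sb_cong:
  assumes "P \<in> pon A" "\<And>k. \<sigma> k \<in> IP" "\<And>k. \<tau> k \<in> IP" "\<And>k. k \<in> A \<Longrightarrow> \<sigma> k = \<tau> k"
  shows "sb \<sigma> P = sb \<tau> P"
  using assms(1) by (induction rule: pol_induct_on) (simp_all add: sb_mult_X assms)

lemma sb_sb:
  assumes "\<And>k. \<sigma> k \<in> IP" "\<And>k. \<tau> k \<in> IP"
  shows "sb \<sigma> (sb \<tau> P) = sb (\<lambda>k. sb \<sigma> (\<tau> k)) P"
  by (induction P rule: pol_induct) (simp_all add: sb_mult_X sb_mult assms)

lemma sb_ident [simp]: "sb X P = P"
  by (induction P rule: pol_induct) (simp_all add: sb_mult_X)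

lemma sb_pon:
  assumes "P \<in> pon A" "\<And>k. \<sigma> k \<in> IP" "\<And>k. k \<in> A \<Longrightarrow> \<sigma> k \<in> pon B"
  shows "sb \<sigma> P \<in> pon B"
  using assms(1) by (induction rule: pol_induct_on) (simp_all add: sb_mult_X assms)

text \<open>\<open>subst\<close> drops the powers of variables beyond its list, which amounts to
  substituting 1 for them.\<close>

lemma subst_sb: "subst \<Lambda> P = sb (\<lambda>k. if k < length \<Lambda> then \<Lambda> ! k else 1) P"
proof -
  have "prod_list (map (\<lambda>k. \<Lambda> ! k ^ lk m k) [0..<length \<Lambda>])
    = mon_ev (\<lambda>k. if k < length \<Lambda> then \<Lambda> ! k else 1) m" for m
  proof -
    define N where "N = max (length \<Lambda>) (Suc (Max (insert 0 (ky m))))"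
    have m: "ky m \<subseteq> {..<N}" by (auto simp: N_def less_max_iff_disj less_Suc_eq_le)
    have N: "N = length \<Lambda> + (N - length \<Lambda>)" by (simp add: N_def)
    have 1: "prod_list (map (\<lambda>k. (if k < length \<Lambda> then \<Lambda> ! k else 1) ^ lk m k) [length \<Lambda>..<length \<Lambda> + (N - length \<Lambda>)]) = 1"
      by (rule prod_list_neutral) auto
    have 2: "map (\<lambda>k. (if k < length \<Lambda> then \<Lambda> ! k else 1) ^ lk m k) [0..<length \<Lambda>]
      = map (\<lambda>k. \<Lambda> ! k ^ lk m k) [0..<length \<Lambda>]" by auto
    show ?thesis by (subst mon_ev_eq[OF m], subst N, subst upt_add_eq_append)
        (simp, simp only: map_append prod_list.append 1 2 mult_1_right)
  qed
  then show ?thesis by (simp add: subst_def sb_def)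
qed

definition ren :: "(nat \<Rightarrow> nat) \<Rightarrow> 'v::ring_1 pol \<Rightarrow> 'v pol" where
  "ren \<rho> = sb (\<lambda>k. X (\<rho> k))"

lemma ren_simps [simp]:
  "ren \<rho> (P + Q) = ren \<rho> P + ren \<rho> Q" "ren \<rho> (P - Q) = ren \<rho> P - ren \<rho> Q" "ren \<rho> 0 = 0"
  "ren \<rho> (- P) = - ren \<rho> P" "ren \<rho> (cst v) = cst v" "ren \<rho> (P * Q) = ren \<rho> P * ren \<rho> Q"
  "ren \<rho> (X k) = X (\<rho> k)" "ren \<rho> (sg p) = sg p" "ren \<rho> 1 = 1" "ren \<rho> (sum f I) = (\<Sum>i\<in>I. ren \<rho> (f i))"
  "ren \<rho> (P ^ n) = ren \<rho> P ^ n" by (simp_all add: ren_def sb_mult sb_sum sb_power)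

lemma ren_pon: "P \<in> pon A \<Longrightarrow> ren \<rho> P \<in> pon (\<rho> ` A)"
  unfolding ren_def by (rule sb_pon) auto

lemma ren_cong: "P \<in> pon A \<Longrightarrow> (\<And>k. k \<in> A \<Longrightarrow> \<rho> k = \<rho>' k) \<Longrightarrow> ren \<rho> P = ren \<rho>' P"
  unfolding ren_def by (rule sb_cong) auto

lemma ren_ren: "ren \<rho> (ren \<rho>' P) = ren (\<rho> \<circ> \<rho>') P"
  by (simp add: ren_def sb_sb comp_def)

lemma ren_ident: "P \<in> pon A \<Longrightarrow> (\<And>k. k \<in> A \<Longrightarrow> \<rho> k = k) \<Longrightarrow> ren \<rho> P = P"
  using ren_cong[of P A \<rho> "\<lambda>k. k"] sb_ident[of P] by (simp add: ren_def del: sb_ident)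

section \<open>Substitution of commuting operators for the variables\<close>

definition opm :: "(nat \<Rightarrow> 'v::ring_1 pol \<Rightarrow> 'v pol) \<Rightarrow> (nat \<Rightarrow>\<^sub>0 nat) \<Rightarrow> 'v pol \<Rightarrow> 'v pol" where
  "opm U m = foldr (\<lambda>k f. (U k ^^ lk m k) \<circ> f) [0..<Suc (Max (insert 0 (ky m)))] id"

text \<open>Each monomial of operators is applied to its coefficient, regarded as a constant
  polynomial. This gives meaning to substituting -\<lambda> - \<partial> in skewsymmetry, and later
  to the section of the quotient map.\<close>

definition ops :: "(nat \<Rightarrow> 'v::ring_1 pol \<Rightarrow> 'v pol) \<Rightarrow> 'v pol \<Rightarrow> 'v pol" where
  "ops U P = (\<Sum>m\<in>ky P. opm U m (cst (lk P m)))"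

lemma funpow_additive: "additive (f :: 'a \<Rightarrow> 'a::ab_group_add) \<Longrightarrow> additive (f ^^ n)"
  by (induction n) (auto simp: additive_def)

lemma foldr_comp_append:
  "foldr (\<lambda>k f. g k \<circ> f) (xs @ ys) id = foldr (\<lambda>k f. g k \<circ> f) xs id \<circ> foldr (\<lambda>k f. g k \<circ> f) ys id"
  by (induction xs) (auto simp: comp_assoc)

lemma opm_eq:
  assumes "ky m \<subseteq> {..<N}"
  shows "opm U m = foldr (\<lambda>k f. (U k ^^ lk m k) \<circ> f) [0..<N] id"
proof -
  have *: "foldr (\<lambda>k f. (U k ^^ lk m k) \<circ> f) [0..<N] id = foldr (\<lambda>k f. (U k ^^ lk m k) \<circ> f) [0..<M] id"
    if "ky m \<subseteq> {..<M}" "M \<le> N" for M N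
  proof -
    have N: "N = M + (N - M)" using that by simp
    have z: "lk m k = 0" if "M \<le> k" for k
      using \<open>ky m \<subseteq> {..<M}\<close> that by (metis in_keys_iff lessThan_iff not_less subsetD)
    have "foldr (\<lambda>k f. (U k ^^ lk m k) \<circ> f) xs id = id" if "\<forall>k\<in>set xs. M \<le> k" for xs
      using that by (induction xs) (auto simp: z)
    then have "foldr (\<lambda>k f. (U k ^^ lk m k) \<circ> f) [M..<M + (N - M)] id = id" by simp
    then show ?thesis by (subst N, subst upt_add_eq_append) (simp_all only: foldr_comp_append, simp)
  qed
  define M where "M = Suc (Max (insert 0 (ky m)))"
  have "ky m \<subseteq> {..<M}" by (auto simp: M_def less_Suc_eq_le)
  then show ?thesis using *[of M "max M N"] *[OF assms, of "max M N"] by (simp add: opm_def M_def)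
qed

lemma opm_X:
  assumes comm: "\<And>i j P. U i (U j P) = U j (U i P)"
  shows "opm U (sgl i 1 + m) P = U i (opm U m P)"
proof -
  define N where "N = Suc (max i (Max (insert 0 (ky m))))"
  have "ky m \<subseteq> {..<N}" by (auto simp: N_def less_Suc_eq_le le_max_iff_disj)
  then have m: "ky m \<subseteq> {..<N}" "ky (sgl i 1 + m) \<subseteq> {..<N}" by (auto simp: ky_nat_add) (simp add: N_def)
  have spl: "[0..<N] = [0..<i] @ i # [Suc i..<N]"
    using upt_add_eq_append[of 0 i "N - i"] upt_conv_Cons[of i N] by (simp add: N_def del: upt_Suc)
  have c1: "(U j ^^ n) (U i P) = U i ((U j ^^ n) P)" for j n P by (induction n) (simp_all add: comm[of j i])
  have c2: "foldr (\<lambda>k f. (U k ^^ e k) \<circ> f) xs id (U i P) = U i (foldr (\<lambda>k f. (U k ^^ e k) \<circ> f) xs id P)" for xs e P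
    by (induction xs) (simp_all add: c1)
  have cong: "foldr (\<lambda>k f. (U k ^^ lk (sgl i 1 + m) k) \<circ> f) xs id = foldr (\<lambda>k f. (U k ^^ lk m k) \<circ> f) xs id"
    if "i \<notin> set xs" for xs using that by (induction xs) (auto simp: lookup_add lookup_single)
  have Ui: "(U i ^^ lk (sgl i 1 + m) i) P = U i ((U i ^^ lk m i) P)" for P by (simp add: lookup_add One_nat_def)
  show ?thesis
    by (simp add: opm_eq[OF m(1)] opm_eq[OF m(2)] spl foldr_comp_append cong Ui c2 del: upt_Suc foldr_append)
qed

lemma ops_additive:
  assumes "\<And>i. additive (U i)"
  shows "additive (ops U)"
proof -
  have "additive (opm U m)" for m unfolding opm_def
  proof -
    have "additive (foldr (\<lambda>k f. (U k ^^ lk m k) \<circ> f) xs id)" for xs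
      by (induction xs) (use funpow_additive[OF assms] in \<open>auto simp: additive_def\<close>)
    then show "additive (foldr (\<lambda>k f. (U k ^^ lk m k) \<circ> f) [0..<Suc (Max (insert 0 (ky m)))] id)" by (simp del: upt_Suc)
  qed
  then show ?thesis unfolding ops_def by (intro ky_sum_additive) (simp add: additive_def single_add)
qed

lemma ops_cst: "(\<And>i. additive (U i)) \<Longrightarrow> ops U (cst v) = cst v"
  by (cases "v = 0") (simp_all add: ops_def opm_def)

lemma ops_X:
  assumes add: "\<And>i. additive (U i)" and comm: "\<And>i j P. U i (U j P) = U j (U i P)"
  shows "ops U (X i * P) = U i (ops U P)"
proof -
  have s: "ops U (sgl m v) = opm U m (cst v)" if "additive (opm U m)" for m v
    using that by (simp add: ops_def additive.zero)
  have a: "additive (opm U m)" for m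
  proof -
    have "additive (foldr (\<lambda>k f. (U k ^^ lk m k) \<circ> f) xs id)" for xs
      by (induction xs) (use funpow_additive[OF add] in \<open>auto simp: additive_def\<close>)
    then show "additive (opm U m)" by (simp add: opm_def del: upt_Suc)
  qed
  note l = ops_additive[of U, OF add]
  have "ops U (X i * (\<Sum>m\<in>ky P. sgl m (lk P m))) = U i (ops U (\<Sum>m\<in>ky P. sgl m (lk P m)))"
    by (simp add: sum_distrib_left X_mono additive.sum[OF l] s[OF a] opm_X[of U, OF comm]
        additive.sum[OF add])
  then show ?thesis using pm_sum[of P] by simp
qed

lemma lk_lft_cst: "additive f \<Longrightarrow> lk (lft (\<lambda>v. cst (f v)) P) m = f (lk P m)"
  by (auto simp: lft_def lookup_sum lookup_single mult_single when_def additive.zero in_keys_iff)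

lemma map_lft: "additive f \<Longrightarrow> Poly_Mapping.map f P = lft (\<lambda>v. cst (f v)) P"
  by (rule poly_mapping_eqI) (simp add: lk_lft_cst map.rep_eq additive.zero when_def)

lemma cst_additive: "additive f \<Longrightarrow> additive (\<lambda>v. cst (f v))"
  by (simp add: additive_def single_add)

lemma map_pol:
  assumes "additive f"
  shows "Poly_Mapping.map f (P + Q) = Poly_Mapping.map f P + Poly_Mapping.map f Q"
    "Poly_Mapping.map f (cst v) = cst (f v)"
    "Poly_Mapping.map f (X k * P) = X k * Poly_Mapping.map f P"
    "\<Lambda> \<in> IP \<Longrightarrow> Poly_Mapping.map f (\<Lambda> * P) = \<Lambda> * Poly_Mapping.map f P"
    "lk (Poly_Mapping.map f P) m = f (lk P m)"
  using cst_additive[OF assms]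
  by (simp_all add: map_lft[OF assms] additive.add[OF lft_additive] lft_cst lft_X lft_IP lk_lft_cst[OF assms])

section \<open>Derivatives with respect to the variables\<close>

lemma pdiff_additive: "additive (pdiff i)"
  unfolding pdiff_def by (rule ky_sum_additive, rule additiveI) (simp add: distrib_left single_add)

lemma pdiff_mono: "pdiff i (sgl m v) = sgl (m - sgl i 1) (of_nat (lk m i) * v)"
  by (simp add: pdiff_def)

lemma pdiff_cst: "pdiff i (cst v) = 0"
  by (simp add: pdiff_mono)

lemma pdiff_X: "pdiff i (X k * P) = X k * pdiff i P + (if k = i then P else 0)"
proof -
  have *: "pdiff i (X k * sgl m v) = X k * pdiff i (sgl m v) + (if k = i then sgl m v else 0)" for m v
  proof (cases "k = i")
    case True
    have "sgl i 1 + m - sgl i 1 = m" by simp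
    moreover have "sgl i 1 + (m - sgl i 1) = m" if "lk m i \<noteq> 0"
      by (rule poly_mapping_eqI) (use that in \<open>auto simp: lookup_add lookup_minus lookup_single when_def\<close>)
    ultimately show ?thesis by (cases "lk m i = 0")
       (simp_all add: True X_mono pdiff_mono lookup_add distrib_right single_add add.commute)
  next
    case False
    have "sgl k 1 + m - sgl i 1 = sgl k 1 + (m - sgl i 1)" if "lk m i \<noteq> 0"
      by (rule poly_mapping_eqI) (use that False in \<open>auto simp: lookup_add lookup_minus lookup_single when_def\<close>)
    then show ?thesis using False by (cases "lk m i = 0") (simp_all add: X_mono pdiff_mono lookup_add lookup_single)
  qed
  then have "pdiff i (X k * (\<Sum>m\<in>ky P. sgl m (lk P m))) = X k * pdiff i (\<Sum>m\<in>ky P. sgl m (lk P m))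
    + (if k = i then (\<Sum>m\<in>ky P. sgl m (lk P m)) else 0)"
    by (simp only: sum_distrib_left additive.sum[OF pdiff_additive] * sum.distrib) simp
  then show ?thesis using pm_sum[of P] by simp
qed

lemma pdiffs_X_other: "k \<noteq> i \<Longrightarrow> (pdiff i ^^ n) (X k * P) = X k * (pdiff i ^^ n) P"
  by (induction n) (simp_all add: pdiff_X)

lemma pdiffs_X_same: "(pdiff i ^^ Suc n) (X i * P) = X i * (pdiff i ^^ Suc n) P + of_nat (Suc n) * (pdiff i ^^ n) P"
proof (induction n)
  case 0
  then show ?case by (simp add: pdiff_X)
next
  case (Suc n)
  have "of_nat k * Q = (\<Sum>j<k. Q)" for k and Q :: "'a pol" by simp
  have on: "pdiff i (of_nat k * Q) = of_nat k * pdiff i Q" for k and Q :: "'a pol"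
    by (induction k) (simp_all add: additive.add[OF pdiff_additive] additive.zero[OF pdiff_additive] algebra_simps)
  show ?case by (subst funpow.simps, simp only: comp_apply Suc)
      (simp add: additive.add[OF pdiff_additive] pdiff_X on algebra_simps)
qed

text \<open>Makes the exponential series in \<open>exp_mult\<close> finite, so that it can be
  truncated at any sufficiently large order.\<close>

lemma pdiff_nilpotent: "\<exists>N. \<forall>k\<ge>N. (pdiff i ^^ k) P = 0"
proof (induction P rule: pol_induct)
  case (cst v)
  have "(pdiff i ^^ k) (cst v) = 0" if k: "k \<ge> 1" for k
  proof -
    obtain k' where "k = Suc k'" using k by (cases k) auto
    then show ?thesis
      by (simp add: funpow_Suc_right pdiff_cst additive.zero[OF funpow_additive[OF pdiff_additive]] del: funpow.simps)
  qed
  then show ?case by blast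
next
  case (X k P)
  then obtain N where N: "\<forall>k\<ge>N. (pdiff i ^^ k) P = 0" by blast
  have "(pdiff i ^^ j) (X k * P) = 0" if j: "j \<ge> Suc N" for j
  proof -
    obtain j' where "j = Suc j'" "j' \<ge> N" using j by (cases j) auto
    then show ?thesis using N by (cases "k = i") (simp_all add: pdiffs_X_same pdiffs_X_other del: funpow.simps)
  qed
  then show ?case by blast
next
  case (add P P')
  then obtain N N' where "\<forall>k\<ge>N. (pdiff i ^^ k) P = 0" "\<forall>k\<ge>N'. (pdiff i ^^ k) P' = 0" by blast
  then have "\<forall>k\<ge>max N N'. (pdiff i ^^ k) (P + P') = 0"
    by (simp add: additive.add[OF funpow_additive[OF pdiff_additive]])
  then show ?case by blast
qed

section \<open>Superspaces and their parity components\<close>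

context super_space
begin

lemma scl_simps:
  "scl S c (a + b) = scl S c a + scl S c b" "scl S (c + d) a = scl S c a + scl S d a"
  "scl S c (scl S d a) = scl S (c * d) a" "scl S 1 a = a" "scl S 0 a = 0" "scl S c 0 = 0"
  "scl S c (- a) = - scl S c a" "scl S (- c) a = - scl S c a"
  "scl S c (a - b) = scl S c a - scl S c b"
proof -
  interpret VS: vector_space "scl S" by (rule vs)
  show "scl S c (a + b) = scl S c a + scl S c b" "scl S (c + d) a = scl S c a + scl S d a"
  "scl S c (scl S d a) = scl S (c * d) a" "scl S 1 a = a" "scl S 0 a = 0" "scl S c 0 = 0"
  "scl S c (- a) = - scl S c a" "scl S (- c) a = - scl S c a"
  "scl S c (a - b) = scl S c a - scl S c b"
    by (simp_all add: VS.scale_right_distrib VS.scale_left_distrib VS.scale_right_diff_distrib)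
qed

lemma scl_eq_0: "scl S c a = 0 \<longleftrightarrow> c = 0 \<or> a = 0"
proof -
  interpret VS: vector_space "scl S" by (rule vs)
  show ?thesis by simp
qed

lemma scl_additive: "additive (scl S c)"
  by (simp add: additive_def scl_simps)

lemma par_closed [simp]:
  "0 \<in> par S p" "a \<in> par S p \<Longrightarrow> b \<in> par S p \<Longrightarrow> a + b \<in> par S p"
  "a \<in> par S p \<Longrightarrow> scl S c a \<in> par S p" "a \<in> par S p \<Longrightarrow> - a \<in> par S p"
  "a \<in> par S p \<Longrightarrow> b \<in> par S p \<Longrightarrow> a - b \<in> par S p"
proof -
  interpret VS: vector_space "scl S" by (rule vs)
  note s = par_subspace[of p]
  show "0 \<in> par S p" "a \<in> par S p \<Longrightarrow> b \<in> par S p \<Longrightarrow> a + b \<in> par S p"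
  "a \<in> par S p \<Longrightarrow> scl S c a \<in> par S p" "a \<in> par S p \<Longrightarrow> - a \<in> par S p"
  "a \<in> par S p \<Longrightarrow> b \<in> par S p \<Longrightarrow> a - b \<in> par S p"
    using VS.subspace_0[OF s] VS.subspace_add[OF s] VS.subspace_scale[OF s] VS.subspace_neg[OF s]
      VS.subspace_diff[OF s] by auto
qed

lemma par_sum: "(\<And>i. i \<in> I \<Longrightarrow> f i \<in> par S p) \<Longrightarrow> sum f I \<in> par S p"
  by (induction I rule: infinite_finite_induct) auto

lemma par_01: "a \<in> par S p \<Longrightarrow> a \<in> par S (1 + p) \<Longrightarrow> a = 0"
  using par_disjoint by (cases p) auto

lemma pcomp_unique:
  assumes "b \<in> par S p" "a - b \<in> par S (1 + p)"
  shows "pcomp S p a = b"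
  unfolding pcomp_def
proof (rule the_equality)
  fix b' assume b': "b' \<in> par S p \<and> a - b' \<in> par S (1 + p)"
  then have "b' - b \<in> par S p" using assms by simp
  moreover have "(a - b) - (a - b') \<in> par S (1 + p)" using b' assms par_closed(5) by blast
  ultimately show "b' = b" using par_01[of "b' - b" p] by simp
qed (use assms in auto)

lemma pcomp_par: "pcomp S p a \<in> par S p" "a - pcomp S p a \<in> par S (1 + p)"
proof -
  obtain y z where "y \<in> par S 0" "z \<in> par S 1" "a = y + z" using par_decomp by metis
  then have "\<exists>b. b \<in> par S p \<and> a - b \<in> par S (1 + p)" by (cases p) (auto intro: exI[of _ y] exI[of _ z])
  then obtain b where "b \<in> par S p" "a - b \<in> par S (1 + p)" by blast
  then show "pcomp S p a \<in> par S p" "a - pcomp S p a \<in> par S (1 + p)" using pcomp_unique by auto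
qed

lemma pcomp_sum: "pcomp S 0 a + pcomp S 1 a = a"
  using pcomp_unique[of "a - pcomp S 0 a" 1 a] pcomp_par(1)[of 0 a] pcomp_par(2)[of a 0] by simp

lemma pcomp_add: "pcomp S p (a + b) = pcomp S p a + pcomp S p b"
proof (rule pcomp_unique)
  have "(a - pcomp S p a) + (b - pcomp S p b) \<in> par S (1 + p)" by (intro par_closed pcomp_par)
  then show "a + b - (pcomp S p a + pcomp S p b) \<in> par S (1 + p)" by (simp add: algebra_simps)
qed (simp add: pcomp_par)

lemma pcomp_scl: "pcomp S p (scl S c a) = scl S c (pcomp S p a)"
proof (rule pcomp_unique)
  show "scl S c a - scl S c (pcomp S p a) \<in> par S (1 + p)"
    using par_closed(3)[OF pcomp_par(2)] by (simp add: scl_simps)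
qed (simp add: pcomp_par)

lemma pcomp_hom: "a \<in> par S p \<Longrightarrow> pcomp S q a = (if q = p then a else 0)"
  by (cases "q = p") (cases p; cases q; auto intro!: pcomp_unique)+

lemma par_induct:
  assumes "additive f" "additive g" "\<And>p a. a \<in> par S p \<Longrightarrow> f a = g a"
  shows "f a = g a"
proof -
  have "f (pcomp S 0 a + pcomp S 1 a) = g (pcomp S 0 a + pcomp S 1 a)"
    by (simp only: additive.add[OF assms(1)] additive.add[OF assms(2)] assms(3)[OF pcomp_par(1)])
  then show ?thesis by (simp add: pcomp_sum)
qed

end

section \<open>Polynomial calculus in a Poisson vertex superalgebra\<close>

lemma sum_coeff_le:
  assumes "\<And>k. g k 0 = 0" "degree p \<le> N"
  shows "(\<Sum>k\<le>degree p. g k (coeff p k)) = (\<Sum>k\<le>N. g k (coeff p k))"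
  by (rule sum.mono_neutral_left) (use assms in \<open>auto simp: not_le coeff_eq_0\<close>)

lemma sum_coeff_additive:
  assumes "\<And>k. additive (g k)"
  shows "additive (\<lambda>p. \<Sum>k\<le>degree p. g k (coeff p k))"
proof (rule additiveI)
  fix p q :: "'a poly"
  define N where "N = max (degree p) (degree q)"
  have "degree (p + q) \<le> N" "degree p \<le> N" "degree q \<le> N" by (auto simp: N_def degree_add_le_max)
  then show "(\<Sum>k\<le>degree (p + q). g k (coeff (p + q) k)) =
    (\<Sum>k\<le>degree p. g k (coeff p k)) + (\<Sum>k\<le>degree q. g k (coeff q k))"
    by (simp only: sum_coeff_le[of g, OF additive.zero[OF assms], where N = N])
      (simp add: additive.add[OF assms] sum.distrib)
qed

definition rpar :: "('f, 'v::ring_1, 'm) superspace_scheme \<Rightarrow> bit \<Rightarrow> 'v pol set" where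
  "rpar V p = {P. \<forall>m. lk P m \<in> par V p}"

lemma sg_lookup: "lk (sg p * P) m = sg p * lk P (m::nat \<Rightarrow>\<^sub>0 nat)" for P :: "'v::ring_1 pol"
  by (cases p) simp_all

context super_comm_algebra
begin

lemma rpar_closed [simp]:
  "0 \<in> rpar V p" "P \<in> rpar V p \<Longrightarrow> Q \<in> rpar V p \<Longrightarrow> P + Q \<in> rpar V p"
  "P \<in> rpar V p \<Longrightarrow> - P \<in> rpar V p" "P \<in> rpar V p \<Longrightarrow> Q \<in> rpar V p \<Longrightarrow> P - Q \<in> rpar V p"
  "v \<in> par V p \<Longrightarrow> cst v \<in> rpar V p" by (auto simp: rpar_def lookup_add lookup_minus lookup_single when_def)

lemma rpar_sum [simp]: "(\<And>i. i \<in> I \<Longrightarrow> f i \<in> rpar V p) \<Longrightarrow> sum f I \<in> rpar V p"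
  by (induction I rule: infinite_finite_induct) auto

lemma rpar_X [simp]: "P \<in> rpar V p \<Longrightarrow> X i * P \<in> rpar V p"
proof -
  assume P: "P \<in> rpar V p"
  have "X i * (\<Sum>m\<in>ky P. sgl m (lk P m)) \<in> rpar V p" unfolding sum_distrib_left X_mono
    by (rule rpar_sum) (use P in \<open>auto simp: rpar_def lookup_single when_def\<close>)
  then show ?thesis using pm_sum[of P] by simp
qed

lemma rpar_IP [simp]: "\<Lambda> \<in> IP \<Longrightarrow> P \<in> rpar V p \<Longrightarrow> \<Lambda> * P \<in> rpar V p"
  by (induction arbitrary: P rule: IP.induct) (auto simp: algebra_simps)

lemma rpar_induct_on [consumes 2, case_names cst X add]:
  assumes "P \<in> pon A" "P \<in> rpar V p" and c: "\<And>v. v \<in> par V p \<Longrightarrow> Q (cst v)"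
    and x: "\<And>k P. k \<in> A \<Longrightarrow> P \<in> pon A \<Longrightarrow> Q P \<Longrightarrow> Q (X k * P)"
    and a: "\<And>P P'. P \<in> pon A \<Longrightarrow> P' \<in> pon A \<Longrightarrow> Q P \<Longrightarrow> Q P' \<Longrightarrow> Q (P + P')"
  shows "Q P"
  by (rule pol_induct_S[OF assms(1), of "par V p"])
    (use assms(2) in \<open>simp add: rpar_def\<close>, simp, rule c, assumption, rule x, assumption+, rule a, assumption+)

lemma rpar_induct [consumes 1, case_names cst X add]:
  assumes "P \<in> rpar V p" and c: "\<And>v. v \<in> par V p \<Longrightarrow> Q (cst v)"
    and x: "\<And>k P. Q P \<Longrightarrow> Q (X k * P)"
    and a: "\<And>P P'. Q P \<Longrightarrow> Q P' \<Longrightarrow> Q (P + P')"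
  shows "Q P"
  by (rule rpar_induct_on[OF pon_UNIV assms(1)]) (auto intro: c x a)

text \<open>The variables are even and central, so in the two nested inductions only the constants
  contribute a sign.\<close>

lemma rpar_comm:
  assumes "P \<in> rpar V p" "Q \<in> rpar V q"
  shows "P * Q = sg (p * q) * (Q * P)"
proof -
  have "sg r * cst v = cst (sg r * v)" for r v by (cases r) (simp_all add: single_uminus)
  from assms(1) show ?thesis
  proof (induction rule: rpar_induct)
    case (cst v)
    from assms(2) show ?case
    proof (induction rule: rpar_induct)
      case (cst w)
      show ?case using mult_comm[OF \<open>v \<in> par V p\<close> cst] by (cases p; cases q; simp add: mult_single single_uminus)
    qed (cases p; cases q; simp add: mult.assoc IP_left_comm[OF IP_X] distrib_left distrib_right)+
  qed (cases p; cases q; simp add: mult.assoc IP_left_comm[OF IP_X] distrib_left distrib_right)+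
qed

lemma rpar_01: "P \<in> rpar V p \<Longrightarrow> P \<in> rpar V (1 + p) \<Longrightarrow> P = 0"
  by (rule poly_mapping_eqI) (auto simp: rpar_def intro: par_01)

end

definition Nop :: "('f, 'v::ring_1) pva \<Rightarrow> nat \<Rightarrow> 'v pol \<Rightarrow> 'v pol" where
  "Nop V i P = - (X i * P) - dpol V P"

text \<open>\<open>SK V i P\<close> is P with -\<lambda>_i - \<partial> in place of \<lambda>_i, the
  derivative acting on the coefficients; the other variables stay.\<close>

definition SK :: "('f, 'v::ring_1) pva \<Rightarrow> nat \<Rightarrow> 'v pol \<Rightarrow> 'v pol" where
  "SK V i = ops (\<lambda>k. if k = i then Nop V i else (*) (X k))"

context poisson_vertex_superalgebra
begin

abbreviation "em \<equiv> exp_mult V"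
abbreviation act :: "'v \<Rightarrow> nat \<Rightarrow> 'v pol \<Rightarrow> 'v pol" where "act a i \<equiv> brkr V a (X i)"

lemma der_simps: "der V (a + b) = der V a + der V b" "der V (scl V c a) = scl V c (der V a)"
  "der V 0 = 0" "der V (- a) = - der V a" "der V (a - b) = der V a - der V b"
proof -
  interpret D: Vector_Spaces.linear "scl V" "scl V" "der V" by (rule der_linear)
  show "der V (a + b) = der V a + der V b" "der V (scl V c a) = scl V c (der V a)"
    "der V 0 = 0" "der V (- a) = - der V a" "der V (a - b) = der V a - der V b"
    by (simp_all add: D.add D.scale D.neg D.diff)
qed

lemma der_additive: "additive (der V)"
  by (simp add: additive_def der_simps)

lemma der_1: "der V 1 = 0"
  using der_mult[of 1 1] by simp

lemmas dpol_simps = map_pol[OF der_additive, folded dpol_def]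
lemmas spol_simps = map_pol[OF scl_additive, folded spol_def]

lemma dpol_additive: "additive (dpol V)"
  by (simp add: additive_def dpol_simps)
lemma spol_additive: "additive (spol V c)"
  by (simp add: additive_def spol_simps)

lemmas spol_add = additive.add[OF spol_additive] and spol_0 = additive.zero[OF spol_additive]
  and spol_diff = additive.diff[OF spol_additive] and spol_minus = additive.minus[OF spol_additive]
  and spol_sum = additive.sum[OF spol_additive]

lemmas dpol_add [simp] = additive.add[OF dpol_additive]
  and dpol_0 [simp] = additive.zero[OF dpol_additive]
  and dpol_uminus [simp] = additive.minus[OF dpol_additive]
  and dpol_diff [simp] = additive.diff[OF dpol_additive]
  and dpol_sum = additive.sum[OF dpol_additive]

lemma spol_sg [simp]: "spol V c (sg p * P) = sg p * spol V c P"
  by (cases p) (auto simp: spol_minus)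

lemma spol_sg_eq: "spol V (sg p) P = sg p * P"
  by (rule poly_mapping_eqI, cases p; simp add: spol_simps scl_simps)

lemma spol_lin:
  "spol V (c + d) P = spol V c P + spol V d P" "spol V c (spol V d P) = spol V (c * d) P"
  "spol V 1 P = P" "spol V 0 P = 0" by (rule poly_mapping_eqI; simp add: spol_simps scl_simps lookup_add)+

lemma spol_scl1: "spol V c P = cst (scl V c 1) * P"
  by (induction P rule: pol_induct)
   (simp_all add: spol_simps mult_single scale_mult_left IP_left_comm[OF IP_X] distrib_left)

lemma scl1_even: "scl V c 1 \<in> par V 0"
  by (simp add: one_even)

lemma spol_mult: "spol V c (P * Q) = spol V c P * Q" "P * spol V c Q = spol V c (P * Q)"
proof -
  have "v * scl V c 1 = scl V c 1 * v" for v by (simp add: scale_mult_left scale_mult_right)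
  then have "P * cst (scl V c 1) = cst (scl V c 1) * P"
    by (induction P rule: pol_induct) (simp_all add: mult_single mult.assoc IP_left_comm[OF IP_X] distrib_left distrib_right)
  then show "spol V c (P * Q) = spol V c P * Q" "P * spol V c Q = spol V c (P * Q)" by (metis spol_scl1 mult.assoc)+
qed

lemma dpol_pon: "P \<in> pon A \<Longrightarrow> dpol V P \<in> pon A"
  by (auto simp: pon_def in_keys_iff dpol_simps der_simps)

lemma spol_pon: "P \<in> pon A \<Longrightarrow> spol V c P \<in> pon A"
  by (auto simp: pon_def in_keys_iff spol_simps scl_simps)

lemma dpol_rpar: "P \<in> rpar V p \<Longrightarrow> dpol V P \<in> rpar V p"
  by (auto simp: rpar_def dpol_simps der_even)

lemma spol_rpar: "P \<in> rpar V p \<Longrightarrow> spol V c P \<in> rpar V p"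
  by (auto simp: rpar_def spol_simps)

lemma dpol_spol: "dpol V (spol V c P) = spol V c (dpol V P)"
  by (rule poly_mapping_eqI) (simp add: spol_simps dpol_simps der_simps)

lemma ders_additive: "additive (der V ^^ k)"
  by (rule funpow_additive[OF der_additive])

text \<open>The free cutoff allows a common one for polynomials that are annihilated by different
  powers of the derivative.\<close>

lemma em_eq:
  assumes "\<And>k. k \<ge> N \<Longrightarrow> (pdiff i ^^ k) P = 0"
  shows "em i b P = (\<Sum>k<N. spol V (1 / fact k) (cst ((der V ^^ k) b) * (pdiff i ^^ k) P))"
  unfolding exp_mult_def
proof (rule sum.mono_neutral_left)
  show "{k. (pdiff i ^^ k) P \<noteq> 0} \<subseteq> {..<N}" by (metis (mono_tags, lifting) assms lessThan_iff mem_Collect_eq not_le subsetI)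
qed (simp_all add: spol_0)

lemma em_additive: "additive (em i b)"
proof (rule additiveI)
  fix P Q :: "'v pol"
  obtain N where N1: "\<forall>k\<ge>N. (pdiff i ^^ k) P = 0" using pdiff_nilpotent[of i P] ..
  obtain N' where N2: "\<forall>k\<ge>N'. (pdiff i ^^ k) Q = 0" using pdiff_nilpotent[of i Q] ..
  note N = N1 N2
  define M where "M = max N N'"
  have M: "k \<ge> M \<Longrightarrow> (pdiff i ^^ k) P = 0" "k \<ge> M \<Longrightarrow> (pdiff i ^^ k) Q = 0"
    "k \<ge> M \<Longrightarrow> (pdiff i ^^ k) (P + Q) = 0" for k
    using N by (auto simp: M_def additive.add[OF funpow_additive[OF pdiff_additive]])
  show "em i b (P + Q) = em i b P + em i b Q"
    by (simp add: em_eq[OF M(1)] em_eq[OF M(2)] em_eq[OF M(3)] sum.distrib distrib_left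
        additive.add[OF funpow_additive[OF pdiff_additive]] spol_add)
qed

lemmas em_add [simp] = additive.add[OF em_additive]
  and em_0 [simp] = additive.zero[OF em_additive]
  and em_uminus [simp] = additive.minus[OF em_additive]
  and em_diff [simp] = additive.diff[OF em_additive]
  and em_sum = additive.sum[OF em_additive]

lemma em_sg [simp]: "em i b (sg p * P) = sg p * em i b P"
  by (cases p) auto

lemma em_additive_left: "additive (\<lambda>b. em i b P)"
  by (rule additiveI) (simp add: exp_mult_def additive.add[OF ders_additive] single_add distrib_right
      spol_add sum.distrib)

lemmas em_add_left = additive.add[OF em_additive_left]
  and em_0_left [simp] = additive.zero[OF em_additive_left]

lemma em_cst [simp]: "em i b (cst v) = cst (b * v)"
proof -
  have "(pdiff i ^^ k) (cst v) = 0" if k: "k \<ge> 1" for k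
  proof -
    obtain k' where "k = Suc k'" using k by (cases k) auto
    then show ?thesis
      by (simp add: funpow_Suc_right pdiff_cst additive.zero[OF funpow_additive[OF pdiff_additive]] del: funpow.simps)
  qed
  from em_eq[OF this, where b = b] show ?thesis by (simp add: mult_single spol_simps scl_simps lessThan_Suc One_nat_def)
qed

lemma em_X_other: "k \<noteq> i \<Longrightarrow> em i b (X k * P) = X k * em i b P"
proof -
  assume k: "k \<noteq> i"
  obtain N where "\<forall>k\<ge>N. (pdiff i ^^ k) P = 0" using pdiff_nilpotent[of i P] ..
  then have N: "k \<ge> N \<Longrightarrow> (pdiff i ^^ k) P = 0" for k by blast
  have N': "j \<ge> N \<Longrightarrow> (pdiff i ^^ j) (X k * P) = 0" for j by (simp add: pdiffs_X_other[OF k] N)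
  show ?thesis
    by (simp add: em_eq[OF N] em_eq[OF N'] sum_distrib_left pdiffs_X_other[OF k] IP_left_comm[OF IP_X] spol_simps)
qed

lemma of_nat_spol: "of_nat n * P = spol V (of_nat n) P"
  by (induction n) (simp_all add: spol_lin distrib_right)

text \<open>The commutator of the exponential with its own variable. Together with
  \<open>em_cst\<close> and \<open>em_X_other\<close> it determines \<open>em\<close>, and later
  properties are proved by induction from these rules instead of the series.\<close>

lemma em_X_same: "em i b (X i * P) = X i * em i b P + em i (der V b) P"
proof -
  obtain N0 where "\<forall>k\<ge>N0. (pdiff i ^^ k) P = 0" using pdiff_nilpotent[of i P] ..
  then have N0: "k \<ge> N0 \<Longrightarrow> (pdiff i ^^ k) P = 0" for k by blast
  define N where "N = Suc N0"
  have N: "k \<ge> N \<Longrightarrow> (pdiff i ^^ k) P = 0" for k using N0 by (simp add: N_def)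
  have N': "k \<ge> N \<Longrightarrow> (pdiff i ^^ k) (X i * P) = 0" for k
  proof -
    assume k: "k \<ge> N"
    then obtain k' where "k = Suc k'" by (cases k) (auto simp: N_def)
    then show ?thesis using k by (simp only: pdiffs_X_same) (simp add: N0 N_def additive.zero[OF pdiff_additive])
  qed
  have t: "spol V (1 / fact (Suc k)) (cst ((der V ^^ Suc k) b) * (pdiff i ^^ Suc k) (X i * P))
    = X i * spol V (1 / fact (Suc k)) (cst ((der V ^^ Suc k) b) * (pdiff i ^^ Suc k) P)
      + spol V (1 / fact k) (cst ((der V ^^ k) (der V b)) * (pdiff i ^^ k) P)" for k
  proof -
    \<comment> \<open>The factor from differentiating the k+1 times repeated variable lowers the
      factorial by one, so the extra terms form the same series for \<open>der V b\<close>.\<close>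
    have e: "(1 / fact (Suc k)) * of_nat (Suc k) = (1 / fact k :: 'f)" by (simp add: field_simps del: of_nat_Suc)
    have "spol V (1 / fact (Suc k)) (cst ((der V ^^ Suc k) b) * (of_nat (Suc k) * (pdiff i ^^ k) P))
      = spol V (1 / fact k) (cst ((der V ^^ k) (der V b)) * (pdiff i ^^ k) P)"
      by (simp only: of_nat_spol spol_mult(2) spol_lin(2) e funpow_Suc_right comp_apply)
    then show ?thesis by (simp only: pdiffs_X_same distrib_left spol_add
          IP_left_comm[OF IP_X] spol_simps)
  qed
  have "em i b (X i * P) = spol V 1 (cst b * (X i * P))
    + (\<Sum>k<N0. spol V (1 / fact (Suc k)) (cst ((der V ^^ Suc k) b) * (pdiff i ^^ Suc k) (X i * P)))"
    by (simp only: em_eq[OF N'] N_def sum.lessThan_Suc_shift) simp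
  also have "\<dots> = X i * (spol V 1 (cst b * P) + (\<Sum>k<N0. spol V (1 / fact (Suc k)) (cst ((der V ^^ Suc k) b) * (pdiff i ^^ Suc k) P)))
     + (\<Sum>k<N0. spol V (1 / fact k) (cst ((der V ^^ k) (der V b)) * (pdiff i ^^ k) P))"
    by (simp only: t sum.distrib sum_distrib_left distrib_left IP_left_comm[OF IP_X] spol_simps add.assoc)
  also have "spol V 1 (cst b * P) + (\<Sum>k<N0. spol V (1 / fact (Suc k)) (cst ((der V ^^ Suc k) b) * (pdiff i ^^ Suc k) P))
     = em i b P" by (simp only: em_eq[OF N] N_def sum.lessThan_Suc_shift) simp
  also have "(\<Sum>k<N0. spol V (1 / fact k) (cst ((der V ^^ k) (der V b)) * (pdiff i ^^ k) P)) = em i (der V b) P"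
    by (simp only: em_eq[OF N0])
  finally show ?thesis .
qed

end

text \<open>In the differential the bracket of the arguments labelled \<open>j\<close> and
  \<open>i\<close> occupies the slot of \<open>i\<close>, whose variable then becomes the sum of
  both.\<close>

definition shift :: "nat \<Rightarrow> nat \<Rightarrow> 'v::ring_1 pol \<Rightarrow> 'v pol" where
  "shift j i = sb (X(i := X j + X i))"

lemma shift_simps [simp]:
  "shift j i (P + Q) = shift j i P + shift j i Q" "shift j i (cst v) = cst v"
  "shift j i (X k * P) = (if k = i then (X j + X i) * shift j i P else X k * shift j i P)"
  "shift j i (- P) = - shift j i P" "shift j i (P - Q) = shift j i P - shift j i Q" "shift j i 0 = 0"
  "shift j i (sg p * P) = sg p * shift j i P" by (simp_all add: shift_def sb_mult_X)

lemma shift_pon: "P \<in> pon A \<Longrightarrow> shift j i P \<in> pon (insert j A)"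
  unfolding shift_def by (rule sb_pon) (auto intro: pon_mono)

lemma lft_mult_right: "lft (\<lambda>q. cst (q * v)) Q = Q * cst v"
proof -
  have a: "additive (\<lambda>q. cst (q * v))" by (simp add: additive_def distrib_right single_add)
  show ?thesis by (induction Q rule: pol_induct)
      (simp_all add: lft_cst[OF a] lft_X[OF a] additive.add[OF lft_additive[OF a]] mult_single mult.assoc distrib_right)
qed

section \<open>Exponential multiplication and the action by brackets\<close>

context poisson_vertex_superalgebra
begin

text \<open>The exponential of a derivation is multiplicative; in the induction this is just the
  product rule for \<open>der V\<close>.\<close>

lemma em_mult: "em i b (em i c P) = em i (b * c) P"
proof (induction P arbitrary: b c rule: pol_induct)
  case (X k P)
  then show ?case by (cases "k = i") (simp_all add: em_X_same em_X_other der_mult em_add_left algebra_simps)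
qed (simp_all add: mult.assoc)

lemma em_comm:
  assumes "i \<noteq> j" "b \<in> par V p" "c \<in> par V q"
  shows "em i b (em j c P) = sg (p * q) * em j c (em i b P)"
  using assms(2,3)
proof (induction P arbitrary: b c rule: pol_induct)
  case (cst v)
  then show ?case using mult_comm[of b p c q]
    by (cases p; cases q; simp add: mult.assoc[symmetric] single_uminus[symmetric])
next
  case (X k P)
  then show ?case using assms(1)
    by (cases "k = i"; cases "k = j"; simp add: em_X_same em_X_other der_even distrib_left sg_comm(2)[of "X _"])
qed (simp_all add: distrib_left)

lemma em_dpol: "dpol V (em i b P) = em i (der V b) P + em i b (dpol V P)"
proof (induction P arbitrary: b rule: pol_induct)
  case (X k P)
  then show ?case by (cases "k = i") (simp_all add: em_X_same em_X_other dpol_simps algebra_simps)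
qed (simp_all add: dpol_simps der_mult single_add)

lemma em_spol: "em i b (spol V c P) = spol V c (em i b P)"
proof (induction P arbitrary: b rule: pol_induct)
  case (X k P)
  then show ?case by (cases "k = i") (simp_all add: em_X_same em_X_other spol_simps)
qed (simp_all add: spol_simps scale_mult_right)

lemma em_scl: "em i (scl V c b) P = spol V c (em i b P)"
proof (induction P arbitrary: b rule: pol_induct)
  case (X k P)
  then show ?case by (cases "k = i") (simp_all add: em_X_same em_X_other spol_simps der_simps)
qed (simp_all add: spol_simps scale_mult_left)

lemma em_1 [simp]: "em i 1 P = P"
proof (induction P rule: pol_induct)
  case (X k P)
  then show ?case by (cases "k = i") (simp_all add: em_X_same em_X_other der_1)
qed simp_all

lemma em_pon: "P \<in> pon A \<Longrightarrow> em i b P \<in> pon A"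
proof (induction P arbitrary: b rule: pol_induct_on)
  case (X k P)
  then show ?case by (cases "k = i") (simp_all add: em_X_same em_X_other)
qed simp_all

lemma em_rpar:
  assumes "P \<in> rpar V q" "b \<in> par V p"
  shows "em i b P \<in> rpar V (p + q)"
  using assms
proof (induction P arbitrary: b rule: rpar_induct)
  case (X k P)
  then show ?case by (cases "k = i") (simp_all add: em_X_same em_X_other der_even)
qed (simp_all add: mult_par)

lemma em_const: "P \<in> pon A \<Longrightarrow> i \<notin> A \<Longrightarrow> em i b P = cst b * P"
proof (induction P rule: pol_induct_on)
  case (X k P)
  then have "k \<noteq> i" by auto
  then show ?case using X by (simp add: em_X_other IP_left_comm[OF IP_X])
qed (simp_all add: mult_single distrib_left)

text \<open>A substitution commutes with the exponential as soon as its values behave like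
  variables: they commute with \<open>em j\<close>, except for the value of \<open>i\<close>, whose
  commutator is again the exponential of the derivative. Both renaming and \<open>shift\<close> are
  of this kind.\<close>

lemma em_sb:
  assumes P: "P \<in> pon A" and \<sigma>: "\<And>k. \<sigma> k \<in> IP"
    and o: "\<And>k b Q. k \<in> A \<Longrightarrow> k \<noteq> i \<Longrightarrow> em j b (\<sigma> k * Q) = \<sigma> k * em j b Q"
    and s: "\<And>b Q. em j b (\<sigma> i * Q) = \<sigma> i * em j b Q + em j (der V b) Q"
  shows "sb \<sigma> (em i b P) = em j b (sb \<sigma> P)"
  using P
proof (induction P arbitrary: b rule: pol_induct_on)
  case (X k P)
  then show ?case by (cases "k = i") (simp_all add: em_X_same em_X_other sb_mult_X \<sigma> o s)
qed simp_all

lemma em_ren: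
  assumes "P \<in> pon A" "inj_on \<rho> A" "i \<in> A"
  shows "ren \<rho> (em i b P) = em (\<rho> i) b (ren \<rho> P)"
  unfolding ren_def by (rule em_sb[OF assms(1)])
    (use assms(2,3) in \<open>auto simp: em_X_same inj_on_eq_iff intro!: em_X_other\<close>)

lemma em_shift: "i \<noteq> j \<Longrightarrow> shift j k (em i b P) = em i b (shift j k P)"
  unfolding shift_def by (rule em_sb[OF pon_UNIV]) (auto simp: em_X_same em_X_other distrib_right)

lemma lft_em: "lft (\<lambda>v. em i b (G v)) P = em i b (lft G P)" if "additive G" "P \<in> pon A" "i \<notin> A"
  using that(2)
proof (induction P rule: pol_induct_on)
  case (cst v)
  then show ?case by (simp add: lft_cst that(1) additive_def additive.add[OF that(1)])
next
  case (X k P)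
  have "additive (\<lambda>v. em i b (G v))" by (simp add: additive_def additive.add[OF that(1)])
  moreover have "k \<noteq> i" using X that by auto
  ultimately show ?case using X by (simp add: lft_X that(1) em_X_other)
next
  case (add P P')
  have "additive (\<lambda>v. em i b (G v))" by (simp add: additive_def additive.add[OF that(1)])
  then show ?case using add by (simp add: additive.add[OF lft_additive] that(1))
qed

lemma lft_dpol: "additive G \<Longrightarrow> lft (\<lambda>v. G (der V v)) P = lft G (dpol V P)"
proof (induction P rule: pol_induct)
  case (cst v)
  have "additive (\<lambda>v. G (der V v))" using cst by (simp add: additive_def der_simps)
  then show ?case using cst by (simp add: lft_cst dpol_simps)
next
  case (X k P)
  have "additive (\<lambda>v. G (der V v))" using X(2) by (simp add: additive_def der_simps)
  then show ?case using X by (simp add: lft_X dpol_simps)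
next
  case (add P P')
  have "additive (\<lambda>v. G (der V v))" using add(3) by (simp add: additive_def der_simps)
  then show ?case using add by (simp add: additive.add[OF lft_additive])
qed

lemma sb_dpol: "(\<And>k. \<sigma> k \<in> IP) \<Longrightarrow> sb \<sigma> (dpol V P) = dpol V (sb \<sigma> P)"
  by (induction P rule: pol_induct) (simp_all add: dpol_simps sb_mult_X)

lemma sb_spol: "(\<And>k. \<sigma> k \<in> IP) \<Longrightarrow> sb \<sigma> (spol V c P) = spol V c (sb \<sigma> P)"
  by (induction P rule: pol_induct) (simp_all add: spol_simps sb_mult_X)

lemma sb_rpar: "P \<in> rpar V p \<Longrightarrow> (\<And>k. \<sigma> k \<in> IP) \<Longrightarrow> sb \<sigma> P \<in> rpar V p"
  by (induction P rule: rpar_induct) (simp_all add: sb_mult_X)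

lemma ren_dpol: "ren \<rho> (dpol V P) = dpol V (ren \<rho> P)"
  unfolding ren_def by (rule sb_dpol) simp

lemma ren_spol: "ren \<rho> (spol V c P) = spol V c (ren \<rho> P)"
  unfolding ren_def by (rule sb_spol) simp

lemma ren_rpar: "P \<in> rpar V p \<Longrightarrow> ren \<rho> P \<in> rpar V p"
  unfolding ren_def by (rule sb_rpar) auto

lemma shift_spol: "shift j i (spol V c P) = spol V c (shift j i P)"
  unfolding shift_def by (rule sb_spol) simp

lemma shift_rpar: "P \<in> rpar V p \<Longrightarrow> shift j i P \<in> rpar V p"
  unfolding shift_def by (rule sb_rpar) auto

definition pev :: "'v pol \<Rightarrow> 'v poly \<Rightarrow> 'v pol" where
  "pev \<Lambda> p = (\<Sum>k\<le>degree p. cst (coeff p k) * \<Lambda> ^ k)"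

lemma pev_additive: "additive (pev \<Lambda>)"
  unfolding pev_def by (rule sum_coeff_additive) (simp add: additive_def single_add distrib_right)

lemma brk_pev: "brk V a \<Lambda> b = pev \<Lambda> (lbr V a b)"
  by (simp add: brk_def pev_def)

lemma brk_additive: "additive (brk V a \<Lambda>)" "additive (\<lambda>a. brk V a \<Lambda> b)"
  by (simp_all add: additive_def brk_pev lbr_add_left lbr_add_right additive.add[OF pev_additive])

lemma pev_scl: "pev \<Lambda> (map_poly (scl V r) p) = spol V r (pev \<Lambda> p)"
proof -
  have c: "coeff (map_poly (scl V r) p) k = scl V r (coeff p k)" for k by (simp add: coeff_map_poly scl_simps)
  have "degree (map_poly (scl V r) p) \<le> degree p" by (rule degree_le) (simp add: c coeff_eq_0 scl_simps)
  then have "pev \<Lambda> (map_poly (scl V r) p) = (\<Sum>k\<le>degree p. cst (coeff (map_poly (scl V r) p) k) * \<Lambda> ^ k)"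
    unfolding pev_def by (intro sum_coeff_le[of "\<lambda>k v. cst v * \<Lambda> ^ k"]) auto
  then show ?thesis by (simp add: c pev_def spol_sum spol_mult(1) spol_simps)
qed

lemma brk_scl: "brk V (scl V r a) \<Lambda> b = spol V r (brk V a \<Lambda> b)"
  "brk V a \<Lambda> (scl V r b) = spol V r (brk V a \<Lambda> b)" by (simp_all add: brk_pev lbr_scale_left lbr_scale_right pev_scl)

lemma brk_rpar:
  assumes "a \<in> par V p" "b \<in> par V q" "\<Lambda> \<in> IP"
  shows "brk V a \<Lambda> b \<in> rpar V (p + q)"
  unfolding brk_def by (rule rpar_sum) (use assms lbr_par in \<open>simp flip: IP_comm[OF IP_power[OF assms(3)]]\<close>)

lemma brk_pon: "\<Lambda> \<in> pon A \<Longrightarrow> brk V a \<Lambda> b \<in> pon A"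
  unfolding brk_def by (intro pon_sum pon_mult pon_power) auto

lemma sb_brk: "(\<And>k. \<sigma> k \<in> IP) \<Longrightarrow> sb \<sigma> (brk V a \<Lambda> b) = brk V a (sb \<sigma> \<Lambda>) b"
  by (simp add: brk_def sb_sum sb_mult sb_power)

lemma ren_brk: "ren \<rho> (brk V a (X i) b) = brk V a (X (\<rho> i)) b"
  by (simp add: ren_def sb_brk)

lemma brk_der_left: "brk V (der V a) (X i) b = - (X i * brk V a (X i) b)"
  using arg_cong[OF sesqui_left[of a b], of "ren (\<lambda>_. i)"] by (simp add: ren_brk)

lemma brk_der_right: "brk V a (X i) (der V b) = X i * brk V a (X i) b + dpol V (brk V a (X i) b)"
  using arg_cong[OF sesqui_right[of a b], of "ren (\<lambda>_. i)"] by (simp add: ren_brk ren_dpol)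

lemma brk_leib_hom:
  assumes "b \<in> par V p" "c \<in> par V q"
  shows "brk V a (X i) (b * c) = brk V a (X i) b * cst c + sg (p * q) * (brk V a (X i) c * cst b)"
  using arg_cong[OF leibniz[OF assms, of a], of "ren (\<lambda>_. i)"] by (simp add: ren_brk)

text \<open>The axiom has \<open>b\<close> and \<open>c\<close> as right factors. Moving
  \<open>b\<close> in front of the bracket of \<open>a\<close> and \<open>c\<close> costs a sign in
  which the parity of \<open>c\<close> cancels; this is why only the parities of \<open>a\<close>
  and \<open>b\<close> enter.\<close>

lemma brk_leib:
  assumes "a \<in> par V p" "b \<in> par V q"
  shows "brk V a (X i) (b * c) = brk V a (X i) b * cst c + sg (p * q) * (cst b * brk V a (X i) c)"
proof (rule par_induct[of "\<lambda>c. brk V a (X i) (b * c)" _ c])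
  fix r c assume c: "c \<in> par V r"
  have "brk V a (X i) c * cst b = sg ((p + r) * q) * (cst b * brk V a (X i) c)"
    by (rule rpar_comm) (use assms c in \<open>auto intro: brk_rpar\<close>)
  then show "brk V a (X i) (b * c) = brk V a (X i) b * cst c + sg (p * q) * (cst b * brk V a (X i) c)"
    using brk_leib_hom[OF assms(2) c, of a i] by (cases p; cases q; cases r; simp)
qed (simp_all add: additive_def distrib_left additive.add[OF brk_additive(1)] single_add)

lemma act_lft: "act a i P = lft (brk V a (X i)) P"
  by (simp add: brkr_def lft_def)

lemma act_additive: "additive (act a i)"
  by (subst act_lft[abs_def]) (rule lft_additive[OF brk_additive(1)])

lemmas act_add [simp] = additive.add[OF act_additive]
  and act_0 [simp] = additive.zero[OF act_additive]
  and act_uminus [simp] = additive.minus[OF act_additive]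
  and act_diff [simp] = additive.diff[OF act_additive]
  and act_sum = additive.sum[OF act_additive]

lemma act_cst [simp]: "act a i (cst v) = brk V a (X i) v"
  by (simp add: act_lft lft_cst brk_additive)

lemma act_IP: "\<Lambda> \<in> IP \<Longrightarrow> act a i (\<Lambda> * P) = \<Lambda> * act a i P"
  by (simp add: act_lft lft_IP brk_additive)

lemmas act_X [simp] = act_IP[OF IP_X] and act_sg [simp] = act_IP[OF IP_sg]

lemma act_add_left: "act (a + b) i P = act a i P + act b i P"
proof -
  have "brk V (a + b) (X i) = (\<lambda>v. brk V a (X i) v + brk V b (X i) v)"
    by (rule ext) (simp add: additive.add[OF brk_additive(2)])
  then show ?thesis by (simp add: act_lft lft_add_fun brk_additive(1))
qed

lemma act_spol: "act a i (spol V c P) = spol V c (act a i P)"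
  by (induction P rule: pol_induct) (simp_all add: spol_simps brk_scl)

lemma act_scl: "act (scl V c a) i P = spol V c (act a i P)"
  by (induction P rule: pol_induct) (simp_all add: spol_simps brk_scl)

lemma act_der: "act (der V a) i P = - (X i * act a i P)"
  by (induction P rule: pol_induct) (simp_all add: brk_der_left algebra_simps IP_left_comm[OF IP_X, of "X _"])

lemma act_dpol: "act a i (dpol V P) = X i * act a i P + dpol V (act a i P)"
  by (induction P rule: pol_induct) (simp_all add: brk_der_right dpol_simps algebra_simps IP_left_comm[OF IP_X, of "X _"])

lemma act_pon: "P \<in> pon A \<Longrightarrow> i \<in> A \<Longrightarrow> act a i P \<in> pon A"
  unfolding act_lft by (intro lft_pon brk_pon) auto

lemma act_rpar:
  assumes "P \<in> rpar V q" "a \<in> par V p"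
  shows "act a i P \<in> rpar V (p + q)"
  using assms(1) by (induction rule: rpar_induct) (auto intro: brk_rpar[OF assms(2)])

lemma sb_act: "(\<And>k. \<sigma> k \<in> IP) \<Longrightarrow> sb \<sigma> (act a i P) = lft (brk V a (\<sigma> i)) (sb \<sigma> P)"
  by (induction P rule: pol_induct)
    (simp_all add: sb_brk sb_mult_X lft_cst lft_IP brk_additive additive.add[OF lft_additive[OF brk_additive(1)]])

lemma ren_act: "ren \<rho> (act a i P) = act a (\<rho> i) (ren \<rho> P)"
  using sb_act[of "\<lambda>k. X (\<rho> k)" a i P] by (simp add: ren_def act_lft)

text \<open>Since [a_\<lambda> \<partial>b] = (\<lambda> + \<partial>)[a_\<lambda> b], taking the
  bracket with \<open>b\<close> replaces \<partial> in the exponent by \<partial> + \<lambda>_j, and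
  the additional exponential is the shift of \<lambda>_i by \<lambda>_j. These shifted terms are
  what the bracket terms of the differential cancel in \<open>dd_leib\<close>.\<close>

lemma act_em:
  assumes ij: "i \<noteq> j" and a: "a \<in> par V p" and b: "b \<in> par V q"
  shows "act a j (em i b P) = lft (\<lambda>w. em i w (shift j i P)) (brk V a (X j) b)
    + sg (p * q) * em i b (act a j P)" using b
proof (induction P arbitrary: b rule: pol_induct)
  case (cst v)
  have "brk V a (X j) v \<in> pon {j}" by (rule brk_pon) simp
  then have "em i b (brk V a (X j) v) = cst b * brk V a (X j) v" by (rule em_const) (use ij in simp)
  then show ?case by (simp add: brk_leib[OF a cst] lft_mult_right)
next
  case (X k P)
  note l = em_additive_left[of i "shift j i P"]
  show ?case
  proof (cases "k = i")
    case True
    have G: "lft (\<lambda>w. em i w ((X j + X i) * shift j i P)) Q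
      = X j * lft (\<lambda>w. em i w (shift j i P)) Q + X i * lft (\<lambda>w. em i w (shift j i P)) Q
        + lft (\<lambda>w. em i w (shift j i P)) (dpol V Q)" for Q
    proof -
      have "(\<lambda>w. em i w ((X j + X i) * shift j i P)) = (\<lambda>w. (X j * em i w (shift j i P) + X i * em i w (shift j i P)) + em i (der V w) (shift j i P))"
        using ij by (simp add: distrib_right em_X_same em_X_other fun_eq_iff add.assoc)
      then show ?thesis
        by (simp add: lft_add_fun additive_def em_add_left der_simps distrib_left lft_dpol[OF l, symmetric] lft_mult_left)
    qed
    have "der V b \<in> par V q" using X by (simp add: der_even)
    then show ?thesis using X
      by (simp add: True em_X_same G brk_der_right additive.add[OF lft_additive[OF l]] lft_X[OF l]
          distrib_left sg_comm(2)[of "X _"] del: shift_simps(1))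
  next
    case False
    have "(\<lambda>w. em i w (X k * shift j i P)) = (\<lambda>w. X k * em i w (shift j i P))" using False by (simp add: em_X_other)
    then show ?thesis using X False
      by (simp add: em_X_other lft_mult_left[symmetric] distrib_left sg_comm(2)[of "X _"])
  qed
next
  case (add P P')
  have "lft (\<lambda>w. em i w (shift j i P) + em i w (shift j i P')) (brk V a (X j) b)
    = lft (\<lambda>w. em i w (shift j i P)) (brk V a (X j) b) + lft (\<lambda>w. em i w (shift j i P')) (brk V a (X j) b)"
    by (simp add: lft_add_fun em_additive_left)
  then show ?case using add by (simp add: distrib_left)
qed

lemma Nop_additive: "additive (Nop V i)"
  by (simp add: additive_def Nop_def algebra_simps)

lemma SK_simps [simp]:
  "SK V i (P + Q) = SK V i P + SK V i Q" "SK V i (cst v) = cst v"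
  "SK V i (X k * P) = (if k = i then Nop V i (SK V i P) else X k * SK V i P)"
proof -
  have a: "additive ((if k = i then Nop V i else (*) (X k)) :: 'v pol \<Rightarrow> _)" for k
    using Nop_additive by (simp add: additive_def distrib_left)
  have c: "(if k = i then Nop V i else (*) (X k)) ((if l = i then Nop V i else (*) (X l)) P)
    = (if l = i then Nop V i else (*) (X l)) ((if k = i then Nop V i else (*) (X k)) P)" for k l and P :: "'v pol"
    by (auto simp: Nop_def dpol_simps right_diff_distrib IP_left_comm[OF IP_X, of "X _"])
  show "SK V i (P + Q) = SK V i P + SK V i Q" "SK V i (cst v) = cst v"
  "SK V i (X k * P) = (if k = i then Nop V i (SK V i P) else X k * SK V i P)" unfolding SK_def
    using additive.add[OF ops_additive[OF a]] ops_cst[OF a] ops_X[OF a c, of _ k P] by auto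
qed

lemma SK_additive: "additive (SK V i)"
  by (simp add: additive_def)

lemma SK_power: "SK V i (cst v * X i ^ k) = (Nop V i ^^ k) (cst v)"
proof (induction k)
  case (Suc k)
  have "cst v * X i ^ Suc k = X i * (cst v * X i ^ k)" by (simp add: IP_left_comm[OF IP_X])
  then show ?case using Suc by simp
qed simp

lemma SK_brk: "SK V i (brk V a (X i) b) = (\<Sum>k\<le>degree (lbr V a b). (Nop V i ^^ k) (cst (coeff (lbr V a b) k)))"
  by (simp add: brk_def additive.sum[OF SK_additive] SK_power)

lemma ren_Nops: "ren (\<lambda>_. i) ((Nop V 0 ^^ k) (cst v)) = (Nop V i ^^ k) (cst v)"
  by (induction k) (simp_all add: Nop_def ren_dpol)

lemma brk_skew:
  assumes "a \<in> par V p" "b \<in> par V q"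
  shows "brk V a (X i) b = - (sg (p * q) * SK V i (brk V b (X i) a))"
proof -
  have "brk V a (X 0) b = - (sg (p * q) * SK V 0 (brk V b (X 0) a))"
    using skew[OF assms] by (simp add: SK_brk Nop_def[abs_def])
  from arg_cong[OF this, of "ren (\<lambda>_. i)"] show ?thesis by (simp add: ren_brk SK_brk ren_Nops)
qed

text \<open>\<open>em i c\<close> commutes with -\<lambda>_i - \<partial>: its commutators with
  \<lambda>_i and with \<partial> are both given by \<open>em i (der V c)\<close>, with opposite
  signs.\<close>

lemma SK_mult: "SK V i (cst c * Q) = em i c (SK V i Q)"
proof (induction Q rule: pol_induct)
  case (X k P)
  show ?case
  proof (cases "k = i")
    case True
    have "cst c * (X i * P) = X i * (cst c * P)" by (simp add: IP_left_comm[OF IP_X])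
    then show ?thesis using X by (simp add: True Nop_def em_dpol em_X_same algebra_simps)
  next
    case False
    have "cst c * (X k * P) = X k * (cst c * P)" by (simp add: IP_left_comm[OF IP_X])
    then show ?thesis using X False by (simp add: em_X_other)
  qed
qed (simp_all add: distrib_left mult_single)

lemma SK_sg: "SK V i (sg p * P) = sg p * SK V i P"
  by (cases p) (simp_all add: additive.minus[OF SK_additive])

text \<open>Skewsymmetry, applied before and after, reduces this to the Leibniz rule in the second
  argument; the exponentials enter through \<open>SK_mult\<close>.\<close>

lemma brk_mult_left:
  assumes b: "b \<in> par V p" and c: "c \<in> par V q"
  shows "brk V (b * c) (X i) a = em i b (brk V c (X i) a) + sg (p * q) * em i c (brk V b (X i) a)"
proof (rule par_induct[of "brk V (b * c) (X i)" _ a])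
  fix r a assume a: "a \<in> par V r"
  have "brk V a (X i) b * cst c = sg ((r + p) * q) * (cst c * brk V a (X i) b)"
    by (rule rpar_comm) (use a b c in \<open>auto intro: brk_rpar\<close>)
  then have "brk V a (X i) (b * c) = sg ((r + p) * q) * (cst c * brk V a (X i) b) + sg (r * p) * (cst b * brk V a (X i) c)"
    using brk_leib[OF a b] by simp
  then have "brk V (b * c) (X i) a = - (sg ((p + q) * r) * (sg ((r + p) * q) * em i c (SK V i (brk V a (X i) b))
     + sg (r * p) * em i b (SK V i (brk V a (X i) c))))"
    using brk_skew[OF mult_par[OF b c] a] by (simp add: SK_sg SK_mult)
  then show "brk V (b * c) (X i) a = em i b (brk V c (X i) a) + sg (p * q) * em i c (brk V b (X i) a)"
    unfolding brk_skew[OF b a] brk_skew[OF c a] by (cases p; cases q; cases r; simp)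
qed (simp_all add: additive_def additive.add[OF brk_additive(1)] distrib_left)

lemma act_mult_left:
  assumes "P \<in> pon A" "i \<notin> A" "b \<in> par V p" "c \<in> par V q"
  shows "act (b * c) i P = em i b (act c i P) + sg (p * q) * em i c (act b i P)"
  using assms(1)
proof (induction P rule: pol_induct_on)
  case (X k P)
  then have "k \<noteq> i" using assms(2) by auto
  then show ?case using X by (simp add: em_X_other distrib_left sg_comm(2)[of "X _"])
qed (simp_all add: brk_mult_left[OF assms(3,4)] distrib_left)

text \<open>For a sesquilinear \<open>G\<close> whose slot carries the sum of two variables,
  \<partial> acts as -(\<lambda>_x + \<lambda>_z), so -\<lambda>_x - \<partial> is simply
  \<lambda>_z.\<close>

lemma lft_SK_brk:
  fixes G :: "'v \<Rightarrow> 'v pol"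
  assumes G: "additive G" and d: "\<And>v. G (der V v) = - ((X x + X z) * G v)"
  shows "lft G (SK V x (brk V b (X x) a)) = lft G (brk V b (X z) a)"
proof -
  have dp: "lft G (dpol V P) = - ((X x + X z) * lft G P)" for P by (simp add: lft_dpol[OF G, symmetric] d)
      (simp add: lft_def sum_negf sum_distrib_left mult.assoc)
  have N: "lft G (Nop V x P) = X z * lft G P" for P
    by (simp add: Nop_def additive.diff[OF lft_additive[OF G]] additive.minus[OF lft_additive[OF G]]
       lft_X[OF G] dp distrib_right)
  have "lft G ((Nop V x ^^ k) (cst v)) = X z ^ k * G v" for k v
    by (induction k) (simp_all add: N lft_cst[OF G] mult.assoc)
  moreover have "lft G (cst v * X z ^ k) = X z ^ k * G v" for v k
    by (simp add: IP_comm[OF IP_power[OF IP_X], symmetric] lft_IP[OF G IP_power[OF IP_X]] lft_cst[OF G])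
  ultimately show ?thesis
    by (simp add: SK_brk additive.sum[OF lft_additive[OF G]]) (simp add: brk_def additive.sum[OF lft_additive[OF G]])
qed

end

section \<open>Basic cochains\<close>

text \<open>An argument is a triple of a label, a parity and a value, and the argument with label \<open>i\<close> carries
  the variable \<open>X i\<close>. So arguments keep their variables when others are omitted, and exchanging two
  arguments together with their variables is a permutation of the list.\<close>

type_synonym 'a item = "nat \<times> bit \<times> 'a"

abbreviation lb :: "'a item list \<Rightarrow> nat set" where "lb l \<equiv> fst ` set l"
abbreviation pt :: "'a item \<Rightarrow> bit" where "pt x \<equiv> fst (snd x)"
abbreviation ag :: "'a item \<Rightarrow> 'a" where "ag x \<equiv> snd (snd x)"

abbreviation sgx :: "'a item \<Rightarrow> 'a item \<Rightarrow> 'b::ring_1" where "sgx x z \<equiv> sg ((1 + pt x) * (1 + pt z))"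

text \<open>Distinct labels mean that no variable belongs to two arguments. The family
  \<open>A\<close> is \<open>par V\<close> for arguments in the algebra and \<open>par H\<close> for
  generators.\<close>

definition gd :: "(bit \<Rightarrow> 'a set) \<Rightarrow> 'a item list \<Rightarrow> bool" where
  "gd A l \<longleftrightarrow> distinct (map fst l) \<and> (\<forall>x\<in>set l. ag x \<in> A (pt x))"

definition pbs :: "'a item list \<Rightarrow> bit" where
  "pbs l = (\<Sum>x\<leftarrow>l. 1 + pt x)"

definition rl :: "(nat \<Rightarrow> nat) \<Rightarrow> 'a item list \<Rightarrow> 'a item list" where
  "rl \<rho> l = map (\<lambda>x. (\<rho> (fst x), snd x)) l"

lemma pbs_simps [simp]: "pbs [] = 0" "pbs (x # l) = 1 + pt x + pbs l" "pbs (l @ l') = pbs l + pbs l'"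
  by (simp_all add: pbs_def)

lemma rl_simps [simp]: "rl \<rho> [] = []" "rl \<rho> (x # l) = (\<rho> (fst x), snd x) # rl \<rho> l"
  "rl \<rho> (l @ l') = rl \<rho> l @ rl \<rho> l'" "length (rl \<rho> l) = length l" "pbs (rl \<rho> l) = pbs l"
  by (simp_all add: rl_def pbs_def comp_def)

lemma rl_set: "lb (rl \<rho> l) = \<rho> ` lb l"
  by (simp add: rl_def image_image)

lemma rl_cong: "(\<And>k. k \<in> lb l \<Longrightarrow> \<rho> k = \<rho>' k) \<Longrightarrow> rl \<rho> l = rl \<rho>' l"
  by (auto simp: rl_def)

lemma rl_ident: "(\<And>k. k \<in> lb l \<Longrightarrow> \<rho> k = k) \<Longrightarrow> rl \<rho> l = l"
  unfolding rl_def by (rule map_idI) auto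

lemma gd_simps [simp]: "gd A []" "gd A (x # l) \<longleftrightarrow> ag x \<in> A (pt x) \<and> fst x \<notin> lb l \<and> gd A l"
  "gd A (l @ l') \<longleftrightarrow> gd A l \<and> gd A l' \<and> lb l \<inter> lb l' = {}" by (auto simp: gd_def)

lemma gd_rl: "gd A l \<Longrightarrow> inj_on \<rho> (lb l) \<Longrightarrow> gd A (rl \<rho> l)"
  by (induction l) (auto simp: rl_set inj_on_def)

text \<open>The values of \<open>lco\<close> and \<open>bco\<close> off the good lists are irrelevant. Linearity, sesquilinearity and the
  Leibniz rule are imposed in the first slot only; symmetry gives them in all the others.\<close>

definition lco :: "('f, 'v::ring_1) pva \<Rightarrow> (bit \<Rightarrow> 'a::ab_group_add set) \<Rightarrow> ('f \<Rightarrow> 'a \<Rightarrow> 'a) \<Rightarrow> nat \<Rightarrow> bit \<Rightarrow>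
    ('a item list \<Rightarrow> 'v pol) \<Rightarrow> bool" where
  "lco V A s n q y \<longleftrightarrow>
    (\<forall>l. gd A l \<and> length l = n \<longrightarrow> y l \<in> pon (lb l) \<and> y l \<in> rpar V (1 + q + pbs l) \<and>
      (\<forall>\<rho>. inj_on \<rho> (lb l) \<longrightarrow> y (rl \<rho> l) = ren \<rho> (y l))) \<and>
    (\<forall>l1 x z l2. gd A (l1 @ x # z # l2) \<and> length (l1 @ x # z # l2) = n \<longrightarrow>
      y (l1 @ x # z # l2) = sgx x z * y (l1 @ z # x # l2)) \<and>
    (\<forall>i p a b c l. gd A ((i, p, a) # l) \<and> gd A ((i, p, b) # l) \<and> Suc (length l) = n \<longrightarrow>
      y ((i, p, s c a + b) # l) = spol V c (y ((i, p, a) # l)) + y ((i, p, b) # l))"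

definition bco :: "('f::field_char_0, 'v::ring_1) pva \<Rightarrow> nat \<Rightarrow> bit \<Rightarrow> ('v item list \<Rightarrow> 'v pol) \<Rightarrow> bool" where
  "bco V n q y \<longleftrightarrow> lco V (par V) (scl V) n q y \<and>
    (\<forall>i p a l. gd (par V) ((i, p, a) # l) \<and> Suc (length l) = n \<longrightarrow>
      y ((i, p, der V a) # l) = - (X i * y ((i, p, a) # l))) \<and>
    (\<forall>i p b p' c l. gd (par V) ((i, p, b) # l) \<and> gd (par V) ((i, p', c) # l) \<and> Suc (length l) = n \<longrightarrow>
      y ((i, p + p', b * c) # l) = sg (p * q) * exp_mult V i b (y ((i, p', c) # l))
        + sg (p' * (p + q)) * exp_mult V i c (y ((i, p, b) # l)))"

lemma lco_pon: "lco V A s n q y \<Longrightarrow> gd A l \<Longrightarrow> length l = n \<Longrightarrow> y l \<in> pon (lb l)"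
  by (simp add: lco_def)

lemma lco_rpar: "lco V A s n q y \<Longrightarrow> gd A l \<Longrightarrow> length l = n \<Longrightarrow> y l \<in> rpar V (1 + q + pbs l)"
  by (simp add: lco_def)

lemma lco_rl: "lco V A s n q y \<Longrightarrow> gd A l \<Longrightarrow> length l = n \<Longrightarrow> inj_on \<rho> (lb l) \<Longrightarrow> y (rl \<rho> l) = ren \<rho> (y l)"
  by (simp add: lco_def)

lemma lco_swap: "lco V A s n q y \<Longrightarrow> gd A (l1 @ x # z # l2) \<Longrightarrow> length (l1 @ x # z # l2) = n \<Longrightarrow>
    y (l1 @ x # z # l2) = sgx x z * y (l1 @ z # x # l2)" unfolding lco_def by blast

lemma lco_lin_front: "lco V A s n q y \<Longrightarrow> gd A ((i, p, a) # l) \<Longrightarrow> gd A ((i, p, b) # l) \<Longrightarrow> Suc (length l) = n \<Longrightarrow>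
    y ((i, p, s c a + b) # l) = spol V c (y ((i, p, a) # l)) + y ((i, p, b) # l)" unfolding lco_def by blast

lemma bco_der_front: "bco V n q y \<Longrightarrow> gd (par V) ((i, p, a) # l) \<Longrightarrow> Suc (length l) = n \<Longrightarrow>
    y ((i, p, der V a) # l) = - (X i * y ((i, p, a) # l))" unfolding bco_def by blast

lemma bco_leib_front: "bco V n q y \<Longrightarrow> gd (par V) ((i, p, b) # l) \<Longrightarrow> gd (par V) ((i, p', c) # l) \<Longrightarrow>
    Suc (length l) = n \<Longrightarrow>
    y ((i, p + p', b * c) # l) = sg (p * q) * exp_mult V i b (y ((i, p', c) # l))
      + sg (p' * (p + q)) * exp_mult V i c (y ((i, p, b) # l))" unfolding bco_def by blast

text \<open>The Koszul sign, in reversed parity, of carrying \<open>x\<close> past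
  \<open>l1\<close>, one transposition at a time.\<close>

lemma lco_front:
  assumes y: "lco V A s n q y"
  shows "gd A (l1 @ x # l2) \<Longrightarrow> length (l1 @ x # l2) = n \<Longrightarrow>
    y (l1 @ x # l2) = sg ((1 + pt x) * pbs l1) * y (x # l1 @ l2)"
proof (induction l1 arbitrary: l2 rule: rev_induct)
  case (snoc z l1)
  have "y (l1 @ z # x # l2) = sgx z x * y (l1 @ x # z # l2)"
    by (rule lco_swap[OF y]) (use snoc.prems in auto)
  also have "y (l1 @ x # z # l2) = sg ((1 + pt x) * pbs l1) * y (x # l1 @ z # l2)"
    by (rule snoc.IH) (use snoc.prems in auto)
  finally show ?case by (cases "pt z"; cases "pt x"; cases "pbs l1"; simp)
qed simp

text \<open>Cochains are often known only up to values on bad lists, such as those produced by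
  choice; the closure hypothesis keeps linear combinations among the good lists.\<close>

lemma lco_cong:
  assumes y: "lco V A s n q y" and e: "\<And>l. gd A l \<Longrightarrow> length l = n \<Longrightarrow> y l = y' l"
    and s: "\<And>p a b c. a \<in> A p \<Longrightarrow> b \<in> A p \<Longrightarrow> s c a + b \<in> A p"
  shows "lco V A s n q y'"
  unfolding lco_def
proof (intro conjI allI impI)
  fix l assume l: "gd A l \<and> length l = n"
  then show "y' l \<in> pon (lb l)" "y' l \<in> rpar V (1 + q + pbs l)" using lco_pon[OF y] lco_rpar[OF y] e by auto
  fix \<rho> :: "nat \<Rightarrow> nat" assume "inj_on \<rho> (lb l)"
  then show "y' (rl \<rho> l) = ren \<rho> (y' l)" using lco_rl[OF y] e gd_rl l by (metis rl_simps(4))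
next
  fix l1 x z l2 assume g: "gd A (l1 @ x # z # l2) \<and> length (l1 @ x # z # l2) = n"
  then have "gd A (l1 @ z # x # l2)" "length (l1 @ z # x # l2) = n" by auto
  then show "y' (l1 @ x # z # l2) = sgx x z * y' (l1 @ z # x # l2)"
    using lco_swap[OF y, of l1 x z l2] e g by metis
next
  fix i p a b c l assume g: "gd A ((i, p, a) # l) \<and> gd A ((i, p, b) # l) \<and> Suc (length l) = n"
  then have "gd A ((i, p, s c a + b) # l)" using s by auto
  then show "y' ((i, p, s c a + b) # l) = spol V c (y' ((i, p, a) # l)) + y' ((i, p, b) # l)"
    using lco_lin_front[OF y, of i p a l b c] e g by auto
qed

lemma lft_sg: "lft (\<lambda>v. sg p * G v) P = sg p * lft G P"
  by (simp add: lft_mult_left)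

section \<open>The differential on basic cochains and its symmetry\<close>

context poisson_vertex_superalgebra
begin

lemma lco_lin:
  assumes y: "lco V A s n q y" and g: "gd A (l1 @ (i, p, a) # l2)" "gd A (l1 @ (i, p, b) # l2)"
    "gd A (l1 @ (i, p, s c a + b) # l2)"
    and n: "length (l1 @ (i, p, a) # l2) = n"
  shows "y (l1 @ (i, p, s c a + b) # l2) = spol V c (y (l1 @ (i, p, a) # l2)) + y (l1 @ (i, p, b) # l2)"
proof -
  have "y ((i, p, s c a + b) # l1 @ l2) = spol V c (y ((i, p, a) # l1 @ l2)) + y ((i, p, b) # l1 @ l2)"
    by (rule lco_lin_front[OF y]) (use g n in auto)
  then show ?thesis using lco_front[OF y g(1)] lco_front[OF y g(2)] lco_front[OF y g(3)] n by (simp add: distrib_left)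
qed

abbreviation "gdv \<equiv> gd (par V)"

lemma bco_lco: "bco V n q y \<Longrightarrow> lco V (par V) (scl V) n q y"
  by (simp add: bco_def)

lemma bco_lin:
  assumes y: "bco V n q y" and g: "gdv (l1 @ (i, p, a) # l2)" "gdv (l1 @ (i, p, b) # l2)"
    and n: "length (l1 @ (i, p, a) # l2) = n"
  shows "y (l1 @ (i, p, scl V c a + b) # l2) = spol V c (y (l1 @ (i, p, a) # l2)) + y (l1 @ (i, p, b) # l2)"
  by (rule lco_lin[OF bco_lco[OF y]]) (use g n in auto)

lemma bco_der:
  assumes y: "bco V n q y" and g: "gdv (l1 @ (i, p, a) # l2)" and n: "length (l1 @ (i, p, a) # l2) = n"
  shows "y (l1 @ (i, p, der V a) # l2) = - (X i * y (l1 @ (i, p, a) # l2))"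
proof -
  have g': "gdv (l1 @ (i, p, der V a) # l2)" using g by (simp add: der_even)
  have "y ((i, p, der V a) # l1 @ l2) = - (X i * y ((i, p, a) # l1 @ l2))"
    by (rule bco_der_front[OF y]) (use g n in auto)
  then show ?thesis using lco_front[OF bco_lco[OF y] g] lco_front[OF bco_lco[OF y] g'] n
    by (simp add: sg_comm(2)[of "X _"])
qed

lemma bco_leib:
  assumes y: "bco V n q y" and g: "gdv (l1 @ (i, p, b) # l2)" "gdv (l1 @ (i, p', c) # l2)"
    and n: "length (l1 @ (i, p, b) # l2) = n"
  shows "y (l1 @ (i, p + p', b * c) # l2) = sg (p * (q + pbs l1)) * em i b (y (l1 @ (i, p', c) # l2))
        + sg (p' * (p + q + pbs l1)) * em i c (y (l1 @ (i, p, b) # l2))"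
proof -
  have g': "gdv (l1 @ (i, p + p', b * c) # l2)" using g by (simp add: mult_par)
  have "y ((i, p + p', b * c) # l1 @ l2) = sg (p * q) * em i b (y ((i, p', c) # l1 @ l2))
        + sg (p' * (p + q)) * em i c (y ((i, p, b) # l1 @ l2))" by (rule bco_leib_front[OF y]) (use g n in auto)
  then show ?thesis
    using lco_front[OF bco_lco[OF y] g(1)] lco_front[OF bco_lco[OF y] g(2)] lco_front[OF bco_lco[OF y] g'] n
    by (simp, cases p; cases p'; cases q; cases "pbs l1"; simp add: algebra_simps)
qed

lemma pcomp_der: "pcomp V p (der V a) = der V (pcomp V p a)"
proof (rule pcomp_unique)
  show "der V a - der V (pcomp V p a) \<in> par V (1 + p)" using der_even[OF pcomp_par(2)] by (simp add: der_simps)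
qed (simp add: der_even pcomp_par)

lemma pcomp_par_id: "a \<in> par V p \<Longrightarrow> pcomp V p a = a"
  by (simp add: pcomp_hom)

text \<open>The projection makes the slot additive in arbitrary coefficients, as \<open>lft\<close>
  requires. It is the identity on the brackets of homogeneous arguments, whose coefficients have
  parity \<open>pt x + pt z\<close>.\<close>

definition br :: "('v item list \<Rightarrow> 'v pol) \<Rightarrow> 'v item \<Rightarrow> 'v item \<Rightarrow> 'v item list \<Rightarrow> 'v item list \<Rightarrow> 'v pol" where
  "br y x z pre l = lft (\<lambda>c. shift (fst x) (fst z) (y (pre @ (fst z, pt x + pt z, pcomp V (pt x + pt z) c) # l)))
     (brk V (ag x) (X (fst x)) (ag z))"

text \<open>\<open>dd y q [] l\<close> is the differential by recursion on the list of the first of the two indices, \<open>pre\<close> being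
  the arguments already passed. The argument \<open>[x\<^sub>\<lambda> z]\<close> stays in the slot of \<open>z\<close> instead of
  moving to the front, which simplifies the signs.\<close>

fun BB :: "('v item list \<Rightarrow> 'v pol) \<Rightarrow> 'v item \<Rightarrow> 'v item list \<Rightarrow> 'v item list \<Rightarrow> 'v pol" where
  "BB y x pre [] = 0"
| "BB y x pre (z # l) = br y x z pre l + sg (pt x * (1 + pt z)) * BB y x (pre @ [z]) l"

fun dd :: "('v item list \<Rightarrow> 'v pol) \<Rightarrow> bit \<Rightarrow> 'v item list \<Rightarrow> 'v item list \<Rightarrow> 'v pol" where
  "dd y q pre [] = 0"
| "dd y q pre (x # l) = sg ((1 + pt x) * (q + pbs pre + 1) + 1) * act (ag x) (fst x) (y (pre @ l))
     + sg (q + pbs pre + 1 + pt x) * BB y x pre l + dd y q (pre @ [x]) l"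

lemma additive_slot:
  assumes y: "bco V n q y" and g: "gdv (pre @ l)" "i \<notin> lb pre" "i \<notin> lb l"
    and n: "Suc (length (pre @ l)) = n"
  shows "additive (\<lambda>c. y (pre @ (i, r, pcomp V r c) # l))"
proof (rule additiveI)
  fix a b
  show "y (pre @ (i, r, pcomp V r (a + b)) # l) = y (pre @ (i, r, pcomp V r a) # l) + y (pre @ (i, r, pcomp V r b) # l)"
    using bco_lin[OF y, of pre i r "pcomp V r a" l "pcomp V r b" 1] g n
    by (auto simp: scl_simps spol_lin pcomp_add pcomp_par)
qed

lemma additive_shift: "additive G \<Longrightarrow> additive (\<lambda>c. shift j i (G c))"
  by (simp add: additive_def)

lemma brk_item_pon: "brk V a (X k) b \<in> pon {k}"
  by (rule brk_pon) simp

context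
  fixes n q y
  assumes y: "bco V n q y"
begin

lemma br_additive:
  assumes "gdv (pre @ z # l)" "length (pre @ z # l) = n"
  shows "additive (\<lambda>c. shift j (fst z) (y (pre @ (fst z, r, pcomp V r c) # l)))"
  by (rule additive_shift, rule additive_slot[OF y]) (use assms in auto)

lemma br_cong:
  assumes "\<And>c. c \<in> par V (pt x + pt z) \<Longrightarrow> y (pre @ (fst z, pt x + pt z, c) # l) = sg e * y (pre' @ (fst z, pt x + pt z, c) # l')"
  shows "br y x z pre l = sg e * br y x z pre' l'"
  unfolding br_def by (simp add: assms pcomp_par lft_sg)

lemma BB_swap_pre:
  assumes "gdv (x # pre1 @ u # v # pre2 @ l)" "length (pre1 @ u # v # pre2 @ l) = n"
  shows "BB y x (pre1 @ u # v # pre2) l = sgx u v * BB y x (pre1 @ v # u # pre2) l"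
  using assms
proof (induction l arbitrary: pre2)
  case (Cons z l)
  have "br y x z (pre1 @ u # v # pre2) l = sgx u v * br y x z (pre1 @ v # u # pre2) l"
    by (rule br_cong) (use Cons.prems in \<open>simp, intro lco_swap[OF bco_lco[OF y]], auto\<close>)
  moreover have "BB y x (pre1 @ u # v # pre2 @ [z]) l = sgx u v * BB y x (pre1 @ v # u # pre2 @ [z]) l"
    by (rule Cons.IH) (use Cons.prems in auto)
  ultimately show ?case by (simp add: distrib_left sg_comm(2)[of "sg _"])
qed simp

text \<open>When \<open>u\<close> and \<open>v\<close> come next, their two brackets with
  \<open>x\<close> trade places; further on the exchange happens in the remaining arguments, or in
  \<open>pre\<close> by \<open>BB_swap_pre\<close>.\<close>

lemma BB_swap_post:
  assumes "gdv (x # pre @ l1 @ u # v # l2)" "length (pre @ l1 @ u # v # l2) = n"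
  shows "BB y x pre (l1 @ u # v # l2) = sgx u v * BB y x pre (l1 @ v # u # l2)"
  using assms
proof (induction l1 arbitrary: pre)
  case Nil
  \<comment> \<open>The brackets are matched crosswise: that with \<open>u\<close> standing before
    \<open>v\<close> with that standing after it. The slot now has the parity of the bracket, which
    accounts for the extra \<open>pt x\<close> in the sign.\<close>
  have 1: "br y x u pre (v # l2) = sg ((1 + pt x + pt u) * (1 + pt v)) * br y x u (pre @ [v]) l2"
    by (rule br_cong) (use Nil in \<open>simp, subst lco_swap[OF bco_lco[OF y]], auto simp: add.assoc\<close>)
  have 2: "br y x v (pre @ [u]) l2 = sg ((1 + pt u) * (1 + pt x + pt v)) * br y x v pre (u # l2)"
    by (rule br_cong) (use Nil in \<open>simp, subst lco_swap[OF bco_lco[OF y]], auto simp: add.assoc\<close>)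
  have 3: "BB y x (pre @ u # v # []) l2 = sgx u v * BB y x (pre @ v # u # []) l2"
    by (rule BB_swap_pre) (use Nil in auto)
  show ?case using 1 2 3 by (simp, cases "pt x"; cases "pt u"; cases "pt v"; simp add: algebra_simps)
next
  case (Cons z l1)
  have "br y x z pre (l1 @ u # v # l2) = sgx u v * br y x z pre (l1 @ v # u # l2)"
  proof (rule br_cong)
    fix c assume c: "c \<in> par V (pt x + pt z)"
    have "y ((pre @ (fst z, pt x + pt z, c) # l1) @ u # v # l2) = sgx u v * y ((pre @ (fst z, pt x + pt z, c) # l1) @ v # u # l2)"
      by (rule lco_swap[OF bco_lco[OF y]]) (use Cons.prems c in auto)
    then show "y (pre @ (fst z, pt x + pt z, c) # l1 @ u # v # l2) = sgx u v * y (pre @ (fst z, pt x + pt z, c) # l1 @ v # u # l2)"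
      by simp
  qed
  moreover have "BB y x (pre @ [z]) (l1 @ u # v # l2) = sgx u v * BB y x (pre @ [z]) (l1 @ v # u # l2)"
    by (rule Cons.IH) (use Cons.prems in auto)
  ultimately show ?case by (simp add: distrib_left sg_comm(2)[of "sg _"])
qed

text \<open>Skewsymmetry produces -\<lambda>_x - \<partial>, and by sesquilinearity of the cochain
  in the slot with variable \<lambda>_x + \<lambda>_z this equals \<lambda>_z.\<close>

lemma br_skew:
  assumes g: "gdv (pre @ x # z # l)" and n: "Suc (length (pre @ l)) = n"
  shows "br y x z pre l = - (sg (pt x * pt z) * br y z x pre l)"
proof -
  define r where "r = pt x + pt z"
  define G where "G c = shift (fst x) (fst z) (y (pre @ (fst z, r, pcomp V r c) # l))" for c
  have G: "additive G" unfolding G_def by (rule br_additive) (use g n in auto)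
  have Gd: "G (der V c) = - ((X (fst x) + X (fst z)) * G c)" for c unfolding G_def pcomp_der
    by (subst bco_der[OF y]) (use g n pcomp_par in \<open>auto simp: gd_def\<close>)
  \<comment> \<open>One side keeps the slot under the label of \<open>z\<close>, the other under
    that of \<open>x\<close>. A renaming relates them, and after the shifts both slots carry the
    same sum of variables.\<close>
  have G': "shift (fst z) (fst x) (y (pre @ (fst x, r, pcomp V r c) # l)) = G c" for c
  proof -
    define L where "L = pre @ (fst z, r, pcomp V r c) # l"
    have L: "gdv L" "length L = n" "fst x \<notin> lb L" using g n pcomp_par by (auto simp: L_def gd_def)
    define \<rho> where "\<rho> = (id :: nat \<Rightarrow> nat)(fst z := fst x)"
    have "inj_on \<rho> (lb L)" using L(3) unfolding \<rho>_def by (intro inj_on_fun_updI) auto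
    then have "y (rl \<rho> L) = ren \<rho> (y L)" by (rule lco_rl[OF bco_lco[OF y] L(1,2)])
    moreover have "k \<in> lb pre \<union> lb l \<Longrightarrow> \<rho> k = k" for k using g by (cases "k = fst z") (simp_all add: \<rho>_def)
    then have "rl \<rho> pre = pre" "rl \<rho> l = l" by (auto intro!: rl_ident)
    ultimately have "y (pre @ (fst x, r, pcomp V r c) # l) = ren \<rho> (y L)" by (simp add: L_def \<rho>_def)
    moreover have "shift (fst z) (fst x) (ren \<rho> (y L)) = shift (fst x) (fst z) (y L)"
    proof -
      have e: "sb (X(fst x := X (fst z) + X (fst x))) (X (\<rho> k)) = (X(fst z := X (fst x) + X (fst z))) k"
        if "k \<in> lb L" for k
      proof -
        have "k \<noteq> fst x" using L(3) that by metis
        then show ?thesis by (simp add: \<rho>_def add.commute)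
      qed
      show ?thesis unfolding shift_def ren_def
        apply (subst sb_sb)
          apply simp
         apply simp
        apply (rule sb_cong[OF lco_pon[OF bco_lco[OF y] L(1,2)]])
          apply simp
         apply simp
        apply (erule e)
        done
    qed
    ultimately show ?thesis by (simp add: G_def L_def)
  qed
  have 1: "br y x z pre l = lft G (brk V (ag x) (X (fst x)) (ag z))" by (simp add: br_def G_def[abs_def] r_def)
  have 2: "br y z x pre l = lft G (brk V (ag z) (X (fst z)) (ag x))"
    unfolding br_def add.commute[of "pt z"] r_def[symmetric] by (simp add: G')
  have "ag x \<in> par V (pt x)" "ag z \<in> par V (pt z)" using g by auto
  then have "brk V (ag x) (X (fst x)) (ag z) = - (sg (pt x * pt z) * SK V (fst x) (brk V (ag z) (X (fst x)) (ag x)))"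
    by (rule brk_skew)
  then show ?thesis
    by (simp add: 1 2 lft_SK_brk[OF G Gd, symmetric] additive.minus[OF lft_additive[OF G]] lft_IP[OF G IP_sg])
qed

lemma dd_swap_pre:
  assumes "gdv (pre1 @ u # v # pre2 @ l)" "length (pre1 @ u # v # pre2 @ l) = Suc n"
  shows "dd y q' (pre1 @ u # v # pre2) l = sgx u v * dd y q' (pre1 @ v # u # pre2) l"
  using assms
proof (induction l arbitrary: pre2)
  case (Cons z l)
  have 1: "y (pre1 @ u # v # pre2 @ l) = sgx u v * y (pre1 @ v # u # pre2 @ l)"
    by (rule lco_swap[OF bco_lco[OF y]]) (use Cons.prems in auto)
  have 2: "BB y z (pre1 @ u # v # pre2) l = sgx u v * BB y z (pre1 @ v # u # pre2) l"
    by (rule BB_swap_pre) (use Cons.prems in auto)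
  have 3: "dd y q' (pre1 @ u # v # pre2 @ [z]) l = sgx u v * dd y q' (pre1 @ v # u # pre2 @ [z]) l"
    by (rule Cons.IH) (use Cons.prems in auto)
  show ?case using 1 2 3 by (simp add: distrib_left sg_comm(2)[of "sg _"] add_ac)
qed simp

lemma dd_swap:
  assumes "gdv (pre @ l1 @ u # v # l2)" "length (pre @ l1 @ u # v # l2) = Suc n"
  shows "dd y q' pre (l1 @ u # v # l2) = sgx u v * dd y q' pre (l1 @ v # u # l2)"
  using assms
proof (induction l1 arbitrary: pre)
  case Nil
  \<comment> \<open>The only place where the two exchanged arguments meet in one bracket, and hence
    the only use of skewsymmetry.\<close>
  have 1: "br y u v pre l2 = - (sg (pt u * pt v) * br y v u pre l2)" by (rule br_skew) (use Nil in auto)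
  have 2: "dd y q' (pre @ u # v # []) l2 = sgx u v * dd y q' (pre @ v # u # []) l2"
    by (rule dd_swap_pre) (use Nil in auto)
  show ?case using 2 by (simp add: 1, cases "pt u"; cases "pt v"; cases "q' + pbs pre"; simp add: algebra_simps)
next
  case (Cons z l1)
  have 1: "y ((pre @ l1) @ u # v # l2) = sgx u v * y ((pre @ l1) @ v # u # l2)"
    by (rule lco_swap[OF bco_lco[OF y]]) (use Cons.prems in auto)
  have 2: "BB y z pre (l1 @ u # v # l2) = sgx u v * BB y z pre (l1 @ v # u # l2)"
    by (rule BB_swap_post) (use Cons.prems in auto)
  have 3: "dd y q' (pre @ [z]) (l1 @ u # v # l2) = sgx u v * dd y q' (pre @ [z]) (l1 @ v # u # l2)"
    by (rule Cons.IH) (use Cons.prems in auto)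
  show ?case using 1 2 3 by (simp add: distrib_left sg_comm(2)[of "sg _"] add_ac)
qed

end

end

section \<open>Linearity, sesquilinearity and Leibniz rule of the differential\<close>

context poisson_vertex_superalgebra
begin

lemma lft_spol: "lft (\<lambda>c. spol V r (G c)) P = spol V r (lft G P)"
  by (simp add: lft_def spol_sum spol_mult(1))

lemma lft_brk_rpar:
  assumes Q: "Q \<in> rpar V p" and G: "additive G" "\<And>c. c \<in> par V p \<Longrightarrow> G c \<in> rpar V r"
  shows "lft G Q \<in> rpar V r"
  using Q by (induction rule: rpar_induct)
    (auto simp: lft_cst[OF G(1)] lft_X[OF G(1)] additive.add[OF lft_additive[OF G(1)]] G(2))

context
  fixes n q y
  assumes y: "bco V n q y"
begin

lemma BB_lin_pre:
  assumes "gdv (x # pre1 @ (i, p, a) # pre2 @ l)" "gdv (x # pre1 @ (i, p, b) # pre2 @ l)"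
    "length (pre1 @ (i, p, a) # pre2 @ l) = n"
  shows "BB y x (pre1 @ (i, p, scl V c a + b) # pre2) l
    = spol V c (BB y x (pre1 @ (i, p, a) # pre2) l) + BB y x (pre1 @ (i, p, b) # pre2) l" using assms
proof (induction l arbitrary: pre2)
  case (Cons z l)
  define L where "L w = pre2 @ (fst z, pt x + pt z, pcomp V (pt x + pt z) w) # l" for w
  have "y (pre1 @ (i, p, scl V c a + b) # L w) = spol V c (y (pre1 @ (i, p, a) # L w)) + y (pre1 @ (i, p, b) # L w)" for w
    by (rule bco_lin[OF y]) (use Cons.prems in \<open>auto simp: L_def pcomp_par\<close>)
  moreover have "additive (\<lambda>w. shift (fst x) (fst z) (y (pre1 @ (i, p, a) # L w)))"
    "additive (\<lambda>w. shift (fst x) (fst z) (y (pre1 @ (i, p, b) # L w)))"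
    using br_additive[OF y, of "pre1 @ (i, p, a) # pre2" z l] br_additive[OF y, of "pre1 @ (i, p, b) # pre2" z l] Cons.prems
    by (auto simp: L_def)
  ultimately have "br y x z (pre1 @ (i, p, scl V c a + b) # pre2) l
    = spol V c (br y x z (pre1 @ (i, p, a) # pre2) l) + br y x z (pre1 @ (i, p, b) # pre2) l"
    by (simp add: br_def L_def[symmetric] shift_spol lft_spol[symmetric] lft_add_fun additive_def
        spol_add)
  moreover have "BB y x (pre1 @ (i, p, scl V c a + b) # pre2 @ [z]) l
    = spol V c (BB y x (pre1 @ (i, p, a) # pre2 @ [z]) l) + BB y x (pre1 @ (i, p, b) # pre2 @ [z]) l"
    by (rule Cons.IH) (use Cons.prems in auto)
  ultimately show ?case by (simp add: spol_add distrib_left)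
qed (simp add: spol_0)

lemma dd_lin_pre:
  assumes "gdv (pre1 @ (i, p, a) # pre2 @ l)" "gdv (pre1 @ (i, p, b) # pre2 @ l)"
    "length (pre1 @ (i, p, a) # pre2 @ l) = Suc n"
  shows "dd y q' (pre1 @ (i, p, scl V c a + b) # pre2) l
    = spol V c (dd y q' (pre1 @ (i, p, a) # pre2) l) + dd y q' (pre1 @ (i, p, b) # pre2) l" using assms
proof (induction l arbitrary: pre2)
  case (Cons z l)
  have 1: "y (pre1 @ (i, p, scl V c a + b) # pre2 @ l) = spol V c (y (pre1 @ (i, p, a) # pre2 @ l)) + y (pre1 @ (i, p, b) # pre2 @ l)"
    by (rule bco_lin[OF y]) (use Cons.prems in auto)
  have 2: "BB y z (pre1 @ (i, p, scl V c a + b) # pre2) l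
    = spol V c (BB y z (pre1 @ (i, p, a) # pre2) l) + BB y z (pre1 @ (i, p, b) # pre2) l"
    by (rule BB_lin_pre) (use Cons.prems in auto)
  have 3: "dd y q' (pre1 @ (i, p, scl V c a + b) # pre2 @ [z]) l
    = spol V c (dd y q' (pre1 @ (i, p, a) # pre2 @ [z]) l) + dd y q' (pre1 @ (i, p, b) # pre2 @ [z]) l"
    by (rule Cons.IH) (use Cons.prems in auto)
  show ?case using 1 2 3 by (simp add: spol_add distrib_left act_spol algebra_simps)
qed (simp add: spol_0)

lemma BB_lin:
  assumes "gdv ((i, p, a) # pre @ l)" "length (pre @ l) = n"
  shows "BB y (i, p, scl V c a + b) pre l = spol V c (BB y (i, p, a) pre l) + BB y (i, p, b) pre l"
  using assms
proof (induction l arbitrary: pre)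
  case (Cons z l)
  have "additive (\<lambda>w. shift i (fst z) (y (pre @ (fst z, p + pt z, pcomp V (p + pt z) w) # l)))"
    by (rule br_additive[OF y]) (use Cons.prems in auto)
  then have "br y (i, p, scl V c a + b) z pre l = spol V c (br y (i, p, a) z pre l) + br y (i, p, b) z pre l"
  proof -
    assume G: "additive (\<lambda>w. shift i (fst z) (y (pre @ (fst z, p + pt z, pcomp V (p + pt z) w) # l)))" (is "additive ?G")
    have s: "?G (scl V c w) = spol V c (?G w)" for w
    proof -
      have "y (pre @ (fst z, p + pt z, scl V c (pcomp V (p + pt z) w) + 0) # l) =
        spol V c (y (pre @ (fst z, p + pt z, pcomp V (p + pt z) w) # l)) + y (pre @ (fst z, p + pt z, 0) # l)"
        by (rule bco_lin[OF y]) (use Cons.prems in \<open>auto simp: pcomp_par\<close>)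
      moreover have "y (pre @ (fst z, p + pt z, scl V 0 0 + 0) # l) =
        spol V 0 (y (pre @ (fst z, p + pt z, 0) # l)) + y (pre @ (fst z, p + pt z, 0) # l)"
        by (rule bco_lin[OF y]) (use Cons.prems in \<open>auto simp: pcomp_par\<close>)
      moreover have "y (pre @ (fst z, p + pt z, scl V 1 0 + 0) # l) =
        spol V 1 (y (pre @ (fst z, p + pt z, 0) # l)) + y (pre @ (fst z, p + pt z, 0) # l)"
        by (rule bco_lin[OF y]) (use Cons.prems in \<open>auto simp: pcomp_par\<close>)
      ultimately show ?thesis by (simp add: pcomp_scl scl_simps spol_lin shift_spol)
    qed
    have "lft ?G (spol V c P) = spol V c (lft ?G P)" for P by (induction P rule: pol_induct)
        (simp_all add: spol_simps lft_cst[OF G] lft_X[OF G] additive.add[OF lft_additive[OF G]] s)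
    then show ?thesis
      by (simp add: br_def additive.add[OF lft_additive[OF G]] brk_scl(1) additive.add[OF brk_additive(2)])
  qed
  moreover have "BB y (i, p, scl V c a + b) (pre @ [z]) l = spol V c (BB y (i, p, a) (pre @ [z]) l) + BB y (i, p, b) (pre @ [z]) l"
    by (rule Cons.IH) (use Cons.prems in auto)
  ultimately show ?case by (simp add: spol_add distrib_left)
qed (simp add: spol_0)

lemma dd_lin:
  assumes "gdv ((i, p, a) # pre @ l)" "gdv ((i, p, b) # pre @ l)" "length (pre @ l) = n"
  shows "dd y q' pre ((i, p, scl V c a + b) # l) = spol V c (dd y q' pre ((i, p, a) # l)) + dd y q' pre ((i, p, b) # l)"
proof -
  have 1: "dd y q' (pre @ (i, p, scl V c a + b) # []) l
    = spol V c (dd y q' (pre @ (i, p, a) # []) l) + dd y q' (pre @ (i, p, b) # []) l"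
    by (rule dd_lin_pre) (use assms in auto)
  have 2: "BB y (i, p, scl V c a + b) pre l = spol V c (BB y (i, p, a) pre l) + BB y (i, p, b) pre l"
    by (rule BB_lin) (use assms in auto)
  show ?thesis using 1 2 by (simp add: act_add_left act_scl spol_add distrib_left add_ac)
qed

lemma BB_der_pre:
  assumes "gdv (x # pre1 @ (i, p, a) # pre2 @ l)" "length (pre1 @ (i, p, a) # pre2 @ l) = n"
  shows "BB y x (pre1 @ (i, p, der V a) # pre2) l = - (X i * BB y x (pre1 @ (i, p, a) # pre2) l)"
  using assms
proof (induction l arbitrary: pre2)
  case (Cons z l)
  define L where "L w = pre2 @ (fst z, pt x + pt z, pcomp V (pt x + pt z) w) # l" for w
  have "y (pre1 @ (i, p, der V a) # L w) = - (X i * y (pre1 @ (i, p, a) # L w))" for w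
    by (rule bco_der[OF y]) (use Cons.prems in \<open>auto simp: L_def pcomp_par\<close>)
  moreover have "i \<noteq> fst z" using Cons.prems by auto
  moreover have "lft (\<lambda>w. - (X i * G w)) P = - (X i * lft G P)" for G :: "'v \<Rightarrow> 'v pol" and P
    by (simp add: lft_def sum_negf sum_distrib_left mult.assoc)
  ultimately have "br y x z (pre1 @ (i, p, der V a) # pre2) l = - (X i * br y x z (pre1 @ (i, p, a) # pre2) l)"
    by (simp add: br_def L_def[symmetric])
  moreover have "BB y x (pre1 @ (i, p, der V a) # pre2 @ [z]) l = - (X i * BB y x (pre1 @ (i, p, a) # pre2 @ [z]) l)"
    by (rule Cons.IH) (use Cons.prems in auto)
  ultimately show ?case by (simp add: distrib_left sg_comm(2)[of "X _"])
qed simp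

lemma dd_der_pre:
  assumes "gdv (pre1 @ (i, p, a) # pre2 @ l)" "length (pre1 @ (i, p, a) # pre2 @ l) = Suc n"
  shows "dd y q' (pre1 @ (i, p, der V a) # pre2) l = - (X i * dd y q' (pre1 @ (i, p, a) # pre2) l)"
  using assms
proof (induction l arbitrary: pre2)
  case (Cons z l)
  have 1: "y (pre1 @ (i, p, der V a) # pre2 @ l) = - (X i * y (pre1 @ (i, p, a) # pre2 @ l))"
    by (rule bco_der[OF y]) (use Cons.prems in auto)
  have 2: "BB y z (pre1 @ (i, p, der V a) # pre2) l = - (X i * BB y z (pre1 @ (i, p, a) # pre2) l)"
    by (rule BB_der_pre) (use Cons.prems in auto)
  have 3: "dd y q' (pre1 @ (i, p, der V a) # pre2 @ [z]) l = - (X i * dd y q' (pre1 @ (i, p, a) # pre2 @ [z]) l)"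
    by (rule Cons.IH) (use Cons.prems in auto)
  show ?case using 1 2 3 by (simp add: distrib_left sg_comm(2)[of "X _"])
qed simp

lemma BB_der:
  assumes "gdv ((i, p, a) # pre @ l)" "length (pre @ l) = n"
  shows "BB y (i, p, der V a) pre l = - (X i * BB y (i, p, a) pre l)"
  using assms
proof (induction l arbitrary: pre)
  case (Cons z l)
  have G: "additive (\<lambda>w. shift i (fst z) (y (pre @ (fst z, p + pt z, pcomp V (p + pt z) w) # l)))"
    by (rule br_additive[OF y]) (use Cons.prems in auto)
  have "br y (i, p, der V a) z pre l = - (X i * br y (i, p, a) z pre l)"
    by (simp add: br_def brk_der_left additive.minus[OF lft_additive[OF G]] lft_X[OF G])
  moreover have "BB y (i, p, der V a) (pre @ [z]) l = - (X i * BB y (i, p, a) (pre @ [z]) l)"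
    by (rule Cons.IH) (use Cons.prems in auto)
  ultimately show ?case by (simp add: distrib_left sg_comm(2)[of "X _"])
qed simp

lemma dd_der:
  assumes "gdv ((i, p, a) # pre @ l)" "length (pre @ l) = n"
  shows "dd y q' pre ((i, p, der V a) # l) = - (X i * dd y q' pre ((i, p, a) # l))"
proof -
  have 1: "dd y q' (pre @ (i, p, der V a) # []) l = - (X i * dd y q' (pre @ (i, p, a) # []) l)"
    by (rule dd_der_pre) (use assms in auto)
  have 2: "BB y (i, p, der V a) pre l = - (X i * BB y (i, p, a) pre l)" by (rule BB_der) (use assms in auto)
  show ?thesis using 1 2 by (simp add: act_der distrib_left sg_comm(2)[of "X _"])
qed

text \<open>The product stands among the arguments already passed, so no bracket touches it, and
  \<open>em i\<close> commutes with the shifts and with inserting coefficients because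
  \<open>i\<close> is not the label of \<open>x\<close>.\<close>

lemma BB_leib_pre:
  assumes "gdv (x # pre1 @ (i, p, b) # pre2 @ l)" "gdv (x # pre1 @ (i, p', c) # pre2 @ l)"
    "length (pre1 @ (i, p, b) # pre2 @ l) = n"
  shows "BB y x (pre1 @ (i, p + p', b * c) # pre2) l
    = sg (p * (q + pbs pre1)) * em i b (BB y x (pre1 @ (i, p', c) # pre2) l)
      + sg (p' * (p + q + pbs pre1)) * em i c (BB y x (pre1 @ (i, p, b) # pre2) l)" using assms
proof (induction l arbitrary: pre2)
  case (Cons z l)
  define L where "L w = pre2 @ (fst z, pt x + pt z, pcomp V (pt x + pt z) w) # l" for w
  define sh :: "'v pol \<Rightarrow> 'v pol" where "sh = shift (fst x) (fst z)"
  have xi: "i \<noteq> fst x" using Cons.prems by auto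
  then have emsh: "sh (em i w P) = em i w (sh P)" for w P by (simp add: sh_def em_shift)
  have yL: "y (pre1 @ (i, p + p', b * c) # L w) = sg (p * (q + pbs pre1)) * em i b (y (pre1 @ (i, p', c) # L w))
      + sg (p' * (p + q + pbs pre1)) * em i c (y (pre1 @ (i, p, b) # L w))" for w
    by (rule bco_leib[OF y]) (use Cons.prems in \<open>auto simp: L_def pcomp_par\<close>)
  have G1: "additive (\<lambda>w. sh (y (pre1 @ (i, p', c) # L w)))"
    and G2: "additive (\<lambda>w. sh (y (pre1 @ (i, p, b) # L w)))"
    using br_additive[OF y, of "pre1 @ (i, p', c) # pre2" z l] br_additive[OF y, of "pre1 @ (i, p, b) # pre2" z l] Cons.prems
    by (auto simp: L_def sh_def)
  have E1: "lft (\<lambda>w. em i b (sh (y (pre1 @ (i, p', c) # L w)))) (brk V (ag x) (X (fst x)) (ag z)) =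
      em i b (lft (\<lambda>w. sh (y (pre1 @ (i, p', c) # L w))) (brk V (ag x) (X (fst x)) (ag z)))"
    by (rule lft_em[OF G1 brk_item_pon]) (use xi in simp)
  have E2: "lft (\<lambda>w. em i c (sh (y (pre1 @ (i, p, b) # L w)))) (brk V (ag x) (X (fst x)) (ag z)) =
      em i c (lft (\<lambda>w. sh (y (pre1 @ (i, p, b) # L w))) (brk V (ag x) (X (fst x)) (ag z)))"
    by (rule lft_em[OF G2 brk_item_pon]) (use xi in simp)
  have "br y x z (pre1 @ (i, p + p', b * c) # pre2) l
    = lft (\<lambda>w. sg (p * (q + pbs pre1)) * em i b (sh (y (pre1 @ (i, p', c) # L w)))
      + sg (p' * (p + q + pbs pre1)) * em i c (sh (y (pre1 @ (i, p, b) # L w)))) (brk V (ag x) (X (fst x)) (ag z))"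
    using emsh by (simp add: br_def L_def[symmetric] yL sh_def)
  also have "\<dots> = sg (p * (q + pbs pre1)) * em i b (br y x z (pre1 @ (i, p', c) # pre2) l)
      + sg (p' * (p + q + pbs pre1)) * em i c (br y x z (pre1 @ (i, p, b) # pre2) l)" by (subst lft_add_fun)
      (use G1 G2 in \<open>simp_all add: additive_def distrib_left lft_sg E1 E2 br_def L_def[symmetric] sh_def[symmetric]\<close>)
  finally have "br y x z (pre1 @ (i, p + p', b * c) # pre2) l = \<dots>" .
  moreover have "BB y x (pre1 @ (i, p + p', b * c) # pre2 @ [z]) l
    = sg (p * (q + pbs pre1)) * em i b (BB y x (pre1 @ (i, p', c) # pre2 @ [z]) l)
      + sg (p' * (p + q + pbs pre1)) * em i c (BB y x (pre1 @ (i, p, b) # pre2 @ [z]) l)"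
    by (rule Cons.IH) (use Cons.prems in auto)
  ultimately show ?case by (cases "pt x"; cases "pt z"; simp add: algebra_simps)
qed simp

text \<open>The bracket with a product splits by the Leibniz rule of the bracket, and the cochain
  splits each product once more by its own. Of the four resulting terms two are as desired; the two
  with \<open>em i u\<close> for the coefficients \<open>u\<close> of a bracket are to be cancelled
  by those of \<open>act_em\<close>.\<close>

lemma br_leib:
  assumes g: "gdv (w # pre @ (i, p, b) # l)" "gdv (w # pre @ (i, p', c) # l)"
    and n: "length (pre @ (i, p, b) # l) = n"
  shows "br y w (i, p + p', b * c) pre l
    = sg ((pt w + p) * (q + pbs pre)) * lft (\<lambda>u. em i u (shift (fst w) i (y (pre @ (i, p', c) # l)))) (brk V (ag w) (X (fst w)) b)
    + sg (p' * (pt w + p + q + pbs pre)) * em i c (br y w (i, p, b) pre l)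
    + sg (p * (pt w + q + pbs pre)) * em i b (br y w (i, p', c) pre l)
    + sg (pt w * p + (pt w + p') * (p + q + pbs pre)) * lft (\<lambda>u. em i u (shift (fst w) i (y (pre @ (i, p, b) # l)))) (brk V (ag w) (X (fst w)) c)"
proof -
  define s where "s = q + pbs pre"
  define G where "G r u = shift (fst w) i (y (pre @ (i, r, pcomp V r u) # l))" for r u
  have G: "additive (G r)" for r unfolding G_def using br_additive[OF y, of pre "(i, p, b)" l] g n by auto
  have wi: "i \<noteq> fst w" using g by auto
  have bp: "b \<in> par V p" and cp: "c \<in> par V p'" and wp: "ag w \<in> par V (pt w)" using g by auto
  have Gm: "G (r1 + r2) (u * v) = sg (r1 * s) * em i u (G r2 v) + sg (r2 * (r1 + s)) * em i v (G r1 u)"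
    if "u \<in> par V r1" "v \<in> par V r2" for u v r1 r2
  proof -
    have "y (pre @ (i, r1 + r2, u * v) # l) = sg (r1 * (q + pbs pre)) * em i u (y (pre @ (i, r2, v) # l))
        + sg (r2 * (r1 + q + pbs pre)) * em i v (y (pre @ (i, r1, u) # l))"
      by (rule bco_leib[OF y]) (use g n that in auto)
    then show ?thesis using that wi by (simp add: G_def pcomp_par_id mult_par em_shift s_def add.assoc)
  qed
  have em_add: "additive (\<lambda>u. em i u P)" for P by (rule em_additive_left)
  \<comment> \<open>\<open>Q\<close> involves only the variable of \<open>w\<close>, which commutes
    with \<open>em i\<close>; so the claim reduces to constants, that is, to
    \<open>Gm\<close>.\<close>
  have Q1: "lft (G (r1 + p')) (Q * cst c) = sg (r1 * s) * lft (\<lambda>u. em i u (G p' c)) Q + sg (p' * (r1 + s)) * em i c (lft (G r1) Q)"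
    if "Q \<in> rpar V r1" "Q \<in> pon {fst w}" for Q r1 using that(2,1)
  proof (induction rule: rpar_induct_on)
    case (cst v)
    then show ?case by (simp add: mult_single lft_cst[OF G] lft_cst[OF em_add] Gm[OF _ cp])
  next
    case (X k P)
    then have "k \<noteq> i" using wi by auto
    then show ?case using X
      by (simp add: lft_X[OF G] lft_X[OF em_add] mult.assoc em_X_other distrib_left sg_comm(2)[of "X _"])
  next
    case (add P P')
    then show ?case
      by (simp add: distrib_right distrib_left additive.add[OF lft_additive[OF G]] additive.add[OF lft_additive[OF em_add]] add_ac)
  qed
  have Q2: "lft (G (p + r2)) (cst b * Q) = sg (p * s) * em i b (lft (G r2) Q) + sg (r2 * (p + s)) * lft (\<lambda>u. em i u (G p b)) Q"
    if "Q \<in> rpar V r2" "Q \<in> pon {fst w}" for Q r2 using that(2,1)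
  proof (induction rule: rpar_induct_on)
    case (cst v)
    then show ?case by (simp add: mult_single lft_cst[OF G] lft_cst[OF em_add] Gm[OF bp])
  next
    case (X k P)
    then have "k \<noteq> i" using wi by auto
    moreover have "cst b * (X k * P) = X k * (cst b * P)" by (rule IP_left_comm[OF IP_X])
    ultimately show ?case using X
      by (simp add: lft_X[OF G] lft_X[OF em_add] em_X_other distrib_left sg_comm(2)[of "X _"])
  next
    case (add P P')
    then show ?case
      by (simp add: distrib_right distrib_left additive.add[OF lft_additive[OF G]] additive.add[OF lft_additive[OF em_add]] add_ac)
  qed
  define B where "B = brk V (ag w) (X (fst w)) b"
  define C where "C = brk V (ag w) (X (fst w)) c"
  have B: "B \<in> rpar V (pt w + p)" "B \<in> pon {fst w}" and C: "C \<in> rpar V (pt w + p')" "C \<in> pon {fst w}"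
    by (auto simp: B_def C_def intro: brk_rpar wp bp cp brk_pon)
  have r: "pt w + (p + p') = (pt w + p) + p'" "pt w + (p + p') = p + (pt w + p')" by (simp_all add: add_ac)
  have "br y w (i, p + p', b * c) pre l = lft (G (pt w + (p + p'))) (B * cst c) + sg (pt w * p) * lft (G (pt w + (p + p'))) (cst b * C)"
    by (simp add: br_def G_def[symmetric] brk_leib[OF wp bp] B_def C_def additive.add[OF lft_additive[OF G]] lft_IP[OF G IP_sg])
  also have "lft (G (pt w + (p + p'))) (B * cst c) = sg ((pt w + p) * s) * lft (\<lambda>u. em i u (G p' c)) B + sg (p' * (pt w + p + s)) * em i c (lft (G (pt w + p)) B)"
    by (subst r(1)) (rule Q1[OF B])
  also have "lft (G (pt w + (p + p'))) (cst b * C) = sg (p * s) * em i b (lft (G (pt w + p')) C) + sg ((pt w + p') * (p + s)) * lft (\<lambda>u. em i u (G p b)) C"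
    by (subst r(2)) (rule Q2[OF C])
  also have "lft (G (pt w + p)) B = br y w (i, p, b) pre l" by (simp add: br_def G_def[abs_def] B_def)
  also have "lft (G (pt w + p')) C = br y w (i, p', c) pre l" by (simp add: br_def G_def[abs_def] C_def)
  also have "G p' c = shift (fst w) i (y (pre @ (i, p', c) # l))" by (simp add: G_def pcomp_par_id cp)
  also have "G p b = shift (fst w) i (y (pre @ (i, p, b) # l))" by (simp add: G_def pcomp_par_id bp)
  finally show ?thesis unfolding B_def[symmetric] C_def[symmetric] s_def[symmetric] add.assoc
    by (cases "pt w"; cases p; cases p'; cases s; simp add: algebra_simps)
qed

text \<open>The product is moved past the next argument \<open>w\<close> by symmetry. Then only
  brackets of the form [w, bc] occur, never [bc, w], and the action of the product itself is met
  only when no argument is left, in \<open>act_mult_left\<close>.\<close>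

lemma dd_leib:
  assumes "gdv (pre @ (i, p, b) # l)" "gdv (pre @ (i, p', c) # l)" "length (pre @ (i, p, b) # l) = Suc n"
  shows "dd y q pre ((i, p + p', b * c) # l)
    = sg (p * (q + 1 + pbs pre)) * em i b (dd y q pre ((i, p', c) # l))
      + sg (p' * (p + (q + 1) + pbs pre)) * em i c (dd y q pre ((i, p, b) # l))" using assms
proof (induction l arbitrary: pre)
  case Nil
  define s where "s = q + pbs pre"
  have "y pre \<in> pon (lb pre)" by (rule lco_pon[OF bco_lco[OF y]]) (use Nil in auto)
  then have "act (b * c) i (y pre) = em i b (act c i (y pre)) + sg (p * p') * em i c (act b i (y pre))"
    by (rule act_mult_left) (use Nil in auto)
  then show ?case by (cases p; cases p'; cases q; cases "pbs pre"; simp)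
next
  case (Cons w l)
  define s where "s = q + pbs pre"
  define z where "z = (i, p + p', b * c)"
  have gz: "gdv (pre @ z # w # l)" "gdv (pre @ w # z # l)" using Cons.prems by (auto simp: z_def mult_par)
  have wi: "i \<noteq> fst w" using Cons.prems by auto
  have bp: "b \<in> par V p" and cp: "c \<in> par V p'" and wp: "ag w \<in> par V (pt w)" using Cons.prems by auto
  have sw: "dd y q pre (z # w # l) = sgx z w * dd y q pre (w # z # l)"
    "dd y q pre ((i, p, b) # w # l) = sg ((1 + p) * (1 + pt w)) * dd y q pre (w # (i, p, b) # l)"
    "dd y q pre ((i, p', c) # w # l) = sg ((1 + p') * (1 + pt w)) * dd y q pre (w # (i, p', c) # l)"
    using dd_swap[OF y, of pre "[]" z w l q] dd_swap[OF y, of pre "[]" "(i,p,b)" w l q] dd_swap[OF y, of pre "[]" "(i,p',c)" w l q]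
      gz Cons.prems by (auto simp: z_def)
  have IH: "dd y q (pre @ [w]) (z # l)
    = sg (p * (q + 1 + pbs (pre @ [w]))) * em i b (dd y q (pre @ [w]) ((i, p', c) # l))
      + sg (p' * (p + (q + 1) + pbs (pre @ [w]))) * em i c (dd y q (pre @ [w]) ((i, p, b) # l))"
    unfolding z_def by (rule Cons.IH) (use Cons.prems in auto)
  have yl: "y (pre @ z # l) = sg (p * (q + pbs pre)) * em i b (y (pre @ (i, p', c) # l))
        + sg (p' * (p + q + pbs pre)) * em i c (y (pre @ (i, p, b) # l))"
    unfolding z_def by (rule bco_leib[OF y]) (use Cons.prems in auto)
  have a1: "act (ag w) (fst w) (em i b P) = lft (\<lambda>u. em i u (shift (fst w) i P)) (brk V (ag w) (X (fst w)) b)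
    + sg (pt w * p) * em i b (act (ag w) (fst w) P)" for P by (rule act_em[OF wi wp bp])
  have a2: "act (ag w) (fst w) (em i c P) = lft (\<lambda>u. em i u (shift (fst w) i P)) (brk V (ag w) (X (fst w)) c)
    + sg (pt w * p') * em i c (act (ag w) (fst w) P)" for P by (rule act_em[OF wi wp cp])
  have brl: "br y w z pre l
    = sg ((pt w + p) * (q + pbs pre)) * lft (\<lambda>u. em i u (shift (fst w) i (y (pre @ (i, p', c) # l)))) (brk V (ag w) (X (fst w)) b)
    + sg (p' * (pt w + p + q + pbs pre)) * em i c (br y w (i, p, b) pre l)
    + sg (p * (pt w + q + pbs pre)) * em i b (br y w (i, p', c) pre l)
    + sg (pt w * p + (pt w + p') * (p + q + pbs pre)) * lft (\<lambda>u. em i u (shift (fst w) i (y (pre @ (i, p, b) # l)))) (brk V (ag w) (X (fst w)) c)"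
    unfolding z_def by (rule br_leib) (use Cons.prems in auto)
  have BBl: "BB y w (pre @ [z]) l = sg (p * (q + pbs pre)) * em i b (BB y w (pre @ [(i, p', c)]) l)
      + sg (p' * (p + q + pbs pre)) * em i c (BB y w (pre @ [(i, p, b)]) l)"
    unfolding z_def by (rule BB_leib_pre) (use Cons.prems in auto)
  define Eb Ec where "Eb = lft (\<lambda>u. em i u (shift (fst w) i (y (pre @ (i, p', c) # l)))) (brk V (ag w) (X (fst w)) b)"
    and "Ec = lft (\<lambda>u. em i u (shift (fst w) i (y (pre @ (i, p, b) # l)))) (brk V (ag w) (X (fst w)) c)"
  define Db where "Db = dd y q (pre @ [w]) ((i, p, b) # l)"
  define Dc where "Dc = dd y q (pre @ [w]) ((i, p', c) # l)"
  have ptz: "pt z = p + p'" by (simp add: z_def)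
  have main: "dd y q pre (w # z # l)
    = sg (p * (q + pbs pre + pt w)) * em i b (dd y q pre (w # (i, p', c) # l))
      + sg (p' * (p + q + pbs pre + pt w)) * em i c (dd y q pre (w # (i, p, b) # l))"
    \<comment> \<open>\<open>Eb\<close> and \<open>Ec\<close> each occur twice, from the action of
      \<open>w\<close> and from the bracket with \<open>w\<close>, and cancel.\<close>
    by (simp only: dd.simps(2)[of y q pre w] BB.simps yl brl BBl IH act_add act_sg a1 a2 ptz
        Eb_def[symmetric] Ec_def[symmetric] Db_def[symmetric] Dc_def[symmetric]
        fst_conv snd_conv em_add em_sg pbs_simps)
      (cases "pt w"; cases p; cases p'; cases q; cases "pbs pre"; simp add: algebra_simps)
  show ?case unfolding z_def[symmetric] sw main ptz em_sg
    by (cases "pt w"; cases p; cases p'; cases q; cases "pbs pre"; simp)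
qed

end

end

lemma ren_lft:
  fixes G :: "'v::ring_1 \<Rightarrow> 'v pol"
  assumes G: "additive G"
  shows "ren \<rho> (lft G Q) = lft (\<lambda>c. ren \<rho> (G c)) (ren \<rho> Q)"
proof -
  have G': "additive (\<lambda>c. ren \<rho> (G c))" using G by (simp add: additive_def)
  show ?thesis by (induction Q rule: pol_induct)
      (simp_all add: lft_cst[OF G] lft_cst[OF G'] lft_X[OF G] lft_X[OF G'] additive.add[OF lft_additive[OF G]]
        additive.add[OF lft_additive[OF G']])
qed

lemma ren_shift:
  assumes "P \<in> pon A" "inj_on \<rho> (insert i A)"
  shows "ren \<rho> (shift j i P) = shift (\<rho> j) (\<rho> i) (ren \<rho> P)"
proof -
  have e: "ren \<rho> ((X(i := X j + X i)) k) = sb (X(\<rho> i := X (\<rho> j) + X (\<rho> i))) (X (\<rho> k))" if "k \<in> A" for k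
    using that assms(2) by (cases "k = i") (auto simp: inj_on_def)
  have "ren \<rho> (shift j i P) = sb (\<lambda>k. ren \<rho> ((X(i := X j + X i)) k)) P"
    unfolding shift_def ren_def by (subst sb_sb) auto
  also have "\<dots> = sb (\<lambda>k. sb (X(\<rho> i := X (\<rho> j) + X (\<rho> i))) (X (\<rho> k))) P"
    by (rule sb_cong[OF assms(1) _ _ e]) (simp_all add: ren_def)
  also have "\<dots> = shift (\<rho> j) (\<rho> i) (ren \<rho> P)" unfolding shift_def ren_def by (subst sb_sb) auto
  finally show ?thesis .
qed

section \<open>Parity, variables and renaming: the differential preserves basic cochains\<close>

context poisson_vertex_superalgebra
begin

context
  fixes n q y
  assumes y: "bco V n q y"
begin

lemma BB_rpar:
  assumes "gdv (x # pre @ l)" "length (pre @ l) = n"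
  shows "BB y x pre l \<in> rpar V (1 + q + pt x + pbs pre + pbs l)"
  using assms
proof (induction l arbitrary: pre)
  case (Cons z l)
  have G: "additive (\<lambda>w. shift (fst x) (fst z) (y (pre @ (fst z, pt x + pt z, pcomp V (pt x + pt z) w) # l)))"
    by (rule br_additive[OF y]) (use Cons.prems in auto)
  have "br y x z pre l \<in> rpar V (1 + q + pbs (pre @ (fst z, pt x + pt z, 0) # l))" unfolding br_def
  proof (rule lft_brk_rpar[OF _ G, of _ "pt x + pt z"])
    show "brk V (ag x) (X (fst x)) (ag z) \<in> rpar V (pt x + pt z)" by (rule brk_rpar) (use Cons.prems in auto)
    fix c assume c: "c \<in> par V (pt x + pt z)"
    then have "y (pre @ (fst z, pt x + pt z, c) # l) \<in> rpar V (1 + q + pbs (pre @ (fst z, pt x + pt z, c) # l))"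
      by (intro lco_rpar[OF bco_lco[OF y]]) (use Cons.prems in auto)
    then show "shift (fst x) (fst z) (y (pre @ (fst z, pt x + pt z, pcomp V (pt x + pt z) c) # l))
      \<in> rpar V (1 + q + pbs (pre @ (fst z, pt x + pt z, 0) # l))" using c by (simp add: pcomp_par_id shift_rpar)
  qed
  moreover have "BB y x (pre @ [z]) l \<in> rpar V (1 + q + pt x + pbs (pre @ [z]) + pbs l)"
    by (rule Cons.IH) (use Cons.prems in auto)
  ultimately show ?case by (cases "pt x"; cases "pt z"; simp add: add_ac)
qed simp

lemma dd_rpar:
  assumes "gdv (pre @ l)" "length (pre @ l) = Suc n"
  shows "dd y q' pre l \<in> rpar V (q + pbs pre + pbs l)"
  using assms
proof (induction l arbitrary: pre)
  case (Cons z l)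
  have "BB y z pre l \<in> rpar V (1 + q + pt z + pbs pre + pbs l)" by (rule BB_rpar) (use Cons.prems in auto)
  moreover have "y (pre @ l) \<in> rpar V (1 + q + pbs (pre @ l))"
    by (rule lco_rpar[OF bco_lco[OF y]]) (use Cons.prems in auto)
  then have "act (ag z) (fst z) (y (pre @ l)) \<in> rpar V (pt z + (1 + q + pbs (pre @ l)))"
    by (rule act_rpar) (use Cons.prems in auto)
  moreover have "dd y q' (pre @ [z]) l \<in> rpar V (q + pbs (pre @ [z]) + pbs l)"
    by (rule Cons.IH) (use Cons.prems in auto)
  moreover have "pt z + (1 + q + pbs (pre @ l)) = q + (1 + pt z) + pbs pre + pbs l" by (simp add: add_ac)
  ultimately show ?case by (cases "pt z"; simp add: add_ac)
qed simp

lemma BB_pon: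
  assumes "gdv (x # pre @ l)" "length (pre @ l) = n"
  shows "BB y x pre l \<in> pon (insert (fst x) (lb (pre @ l)))"
  using assms
proof (induction l arbitrary: pre)
  case (Cons z l)
  have "br y x z pre l \<in> pon (insert (fst x) (lb (pre @ z # l)))" unfolding br_def
  proof (rule lft_pon)
    show "brk V (ag x) (X (fst x)) (ag z) \<in> pon (insert (fst x) (lb (pre @ z # l)))" by (rule brk_pon) simp
    fix m
    define w where "w = pcomp V (pt x + pt z) (lk (brk V (ag x) (X (fst x)) (ag z)) m)"
    have "y (pre @ (fst z, pt x + pt z, w) # l) \<in> pon (lb (pre @ (fst z, pt x + pt z, w) # l))"
      by (rule lco_pon[OF bco_lco[OF y]]) (use Cons.prems pcomp_par in \<open>auto simp: w_def\<close>)
    from shift_pon[OF this, of "fst x" "fst z"]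
    show "shift (fst x) (fst z) (y (pre @ (fst z, pt x + pt z, pcomp V (pt x + pt z) (lk (brk V (ag x) (X (fst x)) (ag z)) m)) # l))
      \<in> pon (insert (fst x) (lb (pre @ z # l)))" by (simp add: w_def)
  qed
  moreover have "BB y x (pre @ [z]) l \<in> pon (insert (fst x) (lb ((pre @ [z]) @ l)))"
    by (rule Cons.IH) (use Cons.prems in auto)
  ultimately show ?case by simp
qed simp

lemma dd_pon:
  assumes "gdv (pre @ l)" "length (pre @ l) = Suc n"
  shows "dd y q' pre l \<in> pon (lb (pre @ l))"
  using assms
proof (induction l arbitrary: pre)
  case (Cons z l)
  have "BB y z pre l \<in> pon (insert (fst z) (lb (pre @ l)))" by (rule BB_pon) (use Cons.prems in auto)
  moreover have "y (pre @ l) \<in> pon (lb (pre @ l))" by (rule lco_pon[OF bco_lco[OF y]]) (use Cons.prems in auto)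
  then have "y (pre @ l) \<in> pon (insert (fst z) (lb (pre @ l)))" by (rule pon_mono) auto
  then have "act (ag z) (fst z) (y (pre @ l)) \<in> pon (insert (fst z) (lb (pre @ l)))" by (rule act_pon) simp
  moreover have "dd y q' (pre @ [z]) l \<in> pon (lb ((pre @ [z]) @ l))" by (rule Cons.IH) (use Cons.prems in auto)
  ultimately show ?case by simp
qed simp

lemma BB_rl:
  assumes "gdv (x # pre @ l)" "length (pre @ l) = n" "inj_on \<rho> (lb (x # pre @ l))"
  shows "BB y (\<rho> (fst x), snd x) (rl \<rho> pre) (rl \<rho> l) = ren \<rho> (BB y x pre l)"
  using assms
proof (induction l arbitrary: pre)
  case (Cons z l)
  have G: "additive (\<lambda>w. shift (fst x) (fst z) (y (pre @ (fst z, pt x + pt z, pcomp V (pt x + pt z) w) # l)))"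
    by (rule br_additive[OF y]) (use Cons.prems in auto)
  have "ren \<rho> (shift (fst x) (fst z) (y (pre @ (fst z, pt x + pt z, pcomp V (pt x + pt z) w) # l)))
    = shift (\<rho> (fst x)) (\<rho> (fst z)) (y (rl \<rho> pre @ (\<rho> (fst z), pt x + pt z, pcomp V (pt x + pt z) w) # rl \<rho> l))" for w
  proof -
    define L where "L = pre @ (fst z, pt x + pt z, pcomp V (pt x + pt z) w) # l"
    have L: "gdv L" "length L = n" using Cons.prems by (auto simp: L_def pcomp_par)
    have i: "inj_on \<rho> (lb L)" "inj_on \<rho> (insert (fst z) (lb L))" using Cons.prems(3) by (auto simp: L_def inj_on_def)
    show ?thesis using ren_shift[OF lco_pon[OF bco_lco[OF y] L] i(2), of "fst x"] lco_rl[OF bco_lco[OF y] L i(1)]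
      by (simp add: L_def)
  qed
  then have "br y (\<rho> (fst x), snd x) (\<rho> (fst z), snd z) (rl \<rho> pre) (rl \<rho> l) = ren \<rho> (br y x z pre l)"
    by (simp add: br_def ren_lft[OF G] ren_brk)
  moreover have "BB y (\<rho> (fst x), snd x) (rl \<rho> (pre @ [z])) (rl \<rho> l) = ren \<rho> (BB y x (pre @ [z]) l)"
    by (rule Cons.IH) (use Cons.prems in auto)
  ultimately show ?case by simp
qed simp

lemma dd_rl:
  assumes "gdv (pre @ l)" "length (pre @ l) = Suc n" "inj_on \<rho> (lb (pre @ l))"
  shows "dd y q' (rl \<rho> pre) (rl \<rho> l) = ren \<rho> (dd y q' pre l)"
  using assms
proof (induction l arbitrary: pre)
  case (Cons z l)
  have 1: "BB y (\<rho> (fst z), snd z) (rl \<rho> pre) (rl \<rho> l) = ren \<rho> (BB y z pre l)"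
    by (rule BB_rl) (use Cons.prems in auto)
  have 2: "y (rl \<rho> (pre @ l)) = ren \<rho> (y (pre @ l))"
    by (rule lco_rl[OF bco_lco[OF y]]) (use Cons.prems in \<open>auto simp: inj_on_def\<close>)
  have 3: "dd y q' (rl \<rho> (pre @ [z])) (rl \<rho> l) = ren \<rho> (dd y q' (pre @ [z]) l)"
    by (rule Cons.IH) (use Cons.prems in auto)
  show ?case using 1 2 3 by (simp add: ren_act)
qed simp

text \<open>The recursion moves arguments into \<open>pre\<close>, so everything was shown for
  arbitrary \<open>pre\<close>; it is empty here.\<close>

theorem dd_bco: "bco V (Suc n) (q + 1) (dd y q [])"
  unfolding bco_def lco_def
proof (intro conjI allI impI)
  fix l assume l: "gdv l \<and> length l = Suc n"
  show "dd y q [] l \<in> pon (lb l)" using dd_pon[of "[]" l q] l by simp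
  show "dd y q [] l \<in> rpar V (1 + (q + 1) + pbs l)" using dd_rpar[of "[]" l q] l by (simp add: add_ac)
  fix \<rho> :: "nat \<Rightarrow> nat" assume "inj_on \<rho> (lb l)"
  then show "dd y q [] (rl \<rho> l) = ren \<rho> (dd y q [] l)" using dd_rl[of "[]" l \<rho> q] l by simp
next
  fix l1 x z l2 assume "gdv (l1 @ x # z # l2) \<and> length (l1 @ x # z # l2) = Suc n"
  then show "dd y q [] (l1 @ x # z # l2) = sgx x z * dd y q [] (l1 @ z # x # l2)"
    using dd_swap[OF y, of "[]" l1 x z l2 q] by simp
next
  fix i p a b c l assume "gdv ((i, p, a) # l) \<and> gdv ((i, p, b) # l) \<and> Suc (length l) = Suc n"
  then show "dd y q [] ((i, p, scl V c a + b) # l) = spol V c (dd y q [] ((i, p, a) # l)) + dd y q [] ((i, p, b) # l)"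
    by (intro dd_lin[OF y]) auto
next
  fix i p a l assume "gdv ((i, p, a) # l) \<and> Suc (length l) = Suc n"
  then show "dd y q [] ((i, p, der V a) # l) = - (X i * dd y q [] ((i, p, a) # l))" by (intro dd_der[OF y]) auto
next
  fix i p b p' c l assume "gdv ((i, p, b) # l) \<and> gdv ((i, p', c) # l) \<and> Suc (length l) = Suc n"
  then show "dd y q [] ((i, p + p', b * c) # l) = sg (p * (q + 1)) * em i b (dd y q [] ((i, p', c) # l))
    + sg (p' * (p + (q + 1))) * em i c (dd y q [] ((i, p, b) # l))" using dd_leib[OF y, of "[]" i p b l p' c] by simp
qed

end

end

section \<open>The free superboson\<close>

lemma super_space_der_module: "super_space H \<Longrightarrow> a \<in> par H p \<Longrightarrow> [:a:] \<in> par (der_module H) p"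
  by (auto simp: der_module_def coeff_pCons super_space.par_closed split: nat.split)

text \<open>Fixing the bases as parameters serves both halves of the final statement; for the half
  that mentions no basis, one is chosen at the end.\<close>

locale boson = free_superboson H form V \<iota>
  for H :: "('f::field_char_0, 'h::ab_group_add) superspace"
    and form :: "'h \<Rightarrow> 'h \<Rightarrow> 'f" and V :: "('f, 'v::ring_1) pva" and \<iota> :: "'h \<Rightarrow> 'v" +
  fixes us us' :: "'h list"
  assumes hb: "homogeneous_basis H us" and db: "dual_basis form us us'"
begin

lemma HS: "super_space H" and VS: "super_space V"
  by unfold_locales

lemmas Hscl = super_space.scl_simps[OF HS] and Vscl = super_space.scl_simps[OF VS]
  and Hpar = super_space.par_closed[OF HS] and Vpar = super_space.par_closed[OF VS]

abbreviation "jm \<equiv> der_module_map V \<iota>"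

lemma eval_words_additive: "additive (eval_words V jm)"
  unfolding eval_words_def by (rule ky_sum_additive) (simp add: additive_def Vscl)

lemma eval_words_single: "eval_words V jm (sgl w c) = scl V c (prod_list (map jm w))"
  by (simp add: eval_words_def Vscl)

lemma eval_words_relation:
  assumes "t \<in> sym_relations (der_module H)"
  shows "eval_words V jm t = 0"
proof -
  have vs: "module (\<lambda>c. Poly_Mapping.map ((*) c) :: ('h poly list \<Rightarrow>\<^sub>0 'f) \<Rightarrow> _)" by unfold_locales
      (auto intro!: poly_mapping_eqI simp: map.rep_eq lookup_add when_def algebra_simps simp flip: distrib_left)
  have "t \<in> module.span (\<lambda>c. Poly_Mapping.map ((*) c)) (sym_relations (der_module H))"
    using module.span_base[OF vs assms] .
  then show ?thesis using sym_alg by (auto simp: symmetric_superalgebra_def)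
qed

text \<open>Linearity of \<open>jm\<close>, and thereby of \<iota>, is contained in the relations of
  the tensor algebra for words of length one, which evaluation sends to zero.\<close>

lemma jm_add: "jm (P + Q) = jm P + jm Q"
proof -
  have "sgl ([] @ [P + Q] @ []) 1 - sgl ([] @ [P] @ []) 1 - sgl ([] @ [Q] @ []) 1 \<in> sym_relations (der_module H)"
    unfolding sym_relations_def by blast
  from eval_words_relation[OF this] show ?thesis
    by (simp add: additive.diff[OF eval_words_additive] additive.add[OF eval_words_additive] eval_words_single Vscl algebra_simps)
qed

lemma jm_scl: "jm (scl (der_module H) c P) = scl V c (jm P)"
proof -
  have "sgl ([] @ [scl (der_module H) c P] @ []) 1 - sgl ([] @ [P] @ []) c \<in> sym_relations (der_module H)"
    unfolding sym_relations_def by blast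
  from eval_words_relation[OF this] show ?thesis
    by (simp add: additive.diff[OF eval_words_additive] eval_words_single Vscl)
qed

lemma jm_const: "jm [:a:] = \<iota> a"
  by (simp add: der_module_map_def)

lemma \<iota>_add: "\<iota> (a + b) = \<iota> a + \<iota> b"
  using jm_add[of "[:a:]" "[:b:]"] by (simp add: jm_const)

lemma \<iota>_scl: "\<iota> (scl H c a) = scl V c (\<iota> a)"
proof -
  have "map_poly (scl H c) [:a:] = [:scl H c a:]"
    by (rule poly_eqI) (simp add: coeff_map_poly Hscl coeff_pCons split: nat.split)
  then show ?thesis using jm_scl[of c "[:a:]"] by (simp add: jm_const der_module_def)
qed

lemma \<iota>_additive: "additive \<iota>"
  by (simp add: additive_def \<iota>_add)

lemma \<iota>_par: "a \<in> par H p \<Longrightarrow> \<iota> a \<in> par V p"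
  using sym_alg super_space_der_module[OF HS, of a p] jm_const[of a]
  unfolding symmetric_superalgebra_def by (metis image_eqI subsetD)

lemma ders_par: "a \<in> par V p \<Longrightarrow> (der V ^^ k) a \<in> par V p"
  by (induction k) (auto simp: der_even)

text \<open>Surjectivity of word evaluation: the algebra is spanned by products of derivatives of
  generators, and the generators split into homogeneous ones.\<close>

lemma V_induct [case_names one scl add gen]:
  assumes one: "Q 1" and scl: "\<And>c v. Q v \<Longrightarrow> Q (scl V c v)"
    and add: "\<And>v w. Q v \<Longrightarrow> Q w \<Longrightarrow> Q (v + w)"
    and gen: "\<And>p a k v. a \<in> par H p \<Longrightarrow> Q v \<Longrightarrow> Q ((der V ^^ k) (\<iota> a) * v)"
  shows "Q v"
proof -
  have Q0: "Q 0" using scl[OF one, of 0] by (simp add: Vscl)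
  have Qsum: "Q (sum f I)" if "\<And>i. i \<in> I \<Longrightarrow> Q (f i)" for f and I :: "'i set"
    using that by (induction I rule: infinite_finite_induct) (auto intro: Q0 add)
  have word: "Q (prod_list (map jm w))" for w
  proof (induction w)
    case (Cons P w)
    have "Q ((der V ^^ k) (\<iota> a) * prod_list (map jm w))" for k a
    proof -
      have "\<iota> a = \<iota> (pcomp H 0 a) + \<iota> (pcomp H 1 a)" by (simp add: \<iota>_add[symmetric] super_space.pcomp_sum[OF HS])
      then show ?thesis
        using add[OF gen[OF super_space.pcomp_par(1)[OF HS] Cons] gen[OF super_space.pcomp_par(1)[OF HS] Cons]]
        by (simp add: additive.add[OF ders_additive] distrib_right)
    qed
    then show ?case by (simp add: der_module_map_def[of V \<iota> P] sum_distrib_right Qsum)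
  qed (simp add: one)
  obtain t where "v = eval_words V jm t" using sym_alg unfolding symmetric_superalgebra_def by (metis surjD)
  then show ?thesis unfolding eval_words_def by (simp add: Qsum scl word)
qed

lemma pcomp_mult:
  assumes "g \<in> par V r"
  shows "pcomp V p (g * v) = g * pcomp V (r + p) v"
proof (rule pcomp_unique)
  show "g * pcomp V (r + p) v \<in> par V p"
    using mult_par[OF assms super_space.pcomp_par(1)[OF VS, of "r + p" v]] by simp
  have "v - pcomp V (r + p) v \<in> par V (1 + (r + p))" by (rule super_space.pcomp_par(2)[OF VS])
  from mult_par[OF assms this] show "g * v - g * pcomp V (r + p) v \<in> par V (1 + p)"
    by (simp add: right_diff_distrib add.left_commute[of r])
qed

lemma V_induct_hom [consumes 1, case_names zero one scl add gen]:
  assumes "v \<in> par V p" and zero: "\<And>p. Q p 0" and one: "Q 0 1"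
    and scl: "\<And>p c v. v \<in> par V p \<Longrightarrow> Q p v \<Longrightarrow> Q p (scl V c v)"
    and add: "\<And>p v w. v \<in> par V p \<Longrightarrow> w \<in> par V p \<Longrightarrow> Q p v \<Longrightarrow> Q p w \<Longrightarrow> Q p (v + w)"
    and gen: "\<And>r p a k v. a \<in> par H r \<Longrightarrow> v \<in> par V p \<Longrightarrow> Q p v \<Longrightarrow> Q (r + p) ((der V ^^ k) (\<iota> a) * v)"
  shows "Q p v"
proof -
  have pp: "pcomp V p v \<in> par V p" for p v by (rule super_space.pcomp_par(1)[OF VS])
  \<comment> \<open>All homogeneous components are treated at once, because multiplication by an
    element of parity \<open>r\<close> permutes them.\<close>
  have "\<forall>p. Q p (pcomp V p v)"
  proof (induction v rule: V_induct)
    case one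
    then show ?case using assms(3) zero by (simp add: super_space.pcomp_hom[OF VS one_even])
  next
    case (scl c v)
    then show ?case using assms(4) pp by (simp add: super_space.pcomp_scl[OF VS])
  next
    case (add v w)
    then show ?case using assms(5) pp by (simp add: super_space.pcomp_add[OF VS])
  next
    case (gen r a k v)
    show ?case
    proof
      fix p
      have "Q (r + (r + p)) ((der V ^^ k) (\<iota> a) * pcomp V (r + p) v)" by (rule assms(6)) (use gen pp in auto)
      then show "Q p (pcomp V p ((der V ^^ k) (\<iota> a) * v))" by (simp add: pcomp_mult[OF ders_par[OF \<iota>_par[OF gen(1)]]])
    qed
  qed
  then have "Q p (pcomp V p v)" ..
  then show ?thesis using assms(1) by (simp add: super_space.pcomp_hom[OF VS])
qed

definition pu :: "nat \<Rightarrow> bit" where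
  "pu j = (SOME p. us ! j \<in> par H p)"

abbreviation "N \<equiv> length us"

lemma us_par: "j < N \<Longrightarrow> us ! j \<in> par H (pu j)"
proof -
  assume "j < N"
  then have "us ! j \<in> par H 0 \<union> par H 1" using hb nth_mem unfolding homogeneous_basis_def by blast
  then show ?thesis unfolding pu_def by (auto intro: someI)
qed

lemma form_dual: "i < N \<Longrightarrow> j < N \<Longrightarrow> form (us' ! j) (us ! i) = (if i = j then 1 else 0)"
  using db by (simp add: dual_basis_def)

lemma form_zero: "form 0 b = 0" "form a 0 = 0"
  using form_scale_left[of 0 0 b] form_scale_right[of a 0 0] by (simp_all add: Hscl)

lemma form_additive: "additive (form a)" "additive (\<lambda>a. form a b)"
  by (simp_all add: additive_def form_add_left form_add_right)

lemma us_expand: "a = (\<Sum>j<N. scl H (form (us' ! j) a) (us ! j))"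
proof -
  interpret Hv: vector_space "scl H" by (rule super_space.vs[OF HS])
  have "a \<in> Hv.span (set us)" using hb by (simp add: homogeneous_basis_def)
  then show ?thesis
  proof (induction rule: Hv.span_induct_alt)
    case base
    then show ?case by (simp add: form_zero Hscl)
  next
    case (step c x y)
    then obtain i where i: "i < N" "x = us ! i" by (metis in_set_conv_nth)
    have "(\<Sum>j<N. scl H (form (us' ! j) x) (us ! j)) = (\<Sum>j<N. if j = i then us ! j else 0)"
      by (rule sum.cong) (use i in \<open>auto simp: form_dual Hscl\<close>)
    also have "\<dots> = x" using i by simp
    finally have x: "(\<Sum>j<N. scl H (form (us' ! j) x) (us ! j)) = x" .
    have "scl H c x + y = scl H c (\<Sum>j<N. scl H (form (us' ! j) x) (us ! j)) + (\<Sum>j<N. scl H (form (us' ! j) y) (us ! j))"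
      using step x by simp
    also have "\<dots> = (\<Sum>j<N. scl H (form (us' ! j) (scl H c x + y)) (us ! j))"
      by (simp add: Hv.scale_sum_right form_add_right form_scale_right Hscl sum.distrib)
    finally show ?case .
  qed
qed

text \<open>Both sides pair equally with every \<open>us ! i\<close>, hence with everything, and the
  form is nondegenerate in its first argument.\<close>

lemma us'_expand: "a = (\<Sum>j<N. scl H (form a (us ! j)) (us' ! j))"
proof -
  define x where "x = (\<Sum>j<N. scl H (form a (us ! j)) (us' ! j))"
  have "form (a - x) b = 0" for b
  proof -
    have "form x (us ! i) = form a (us ! i)" if "i < N" for i
    proof -
      have "form x (us ! i) = (\<Sum>j<N. form a (us ! j) * form (us' ! j) (us ! i))"
        by (simp add: x_def additive.sum[OF form_additive(2)] form_scale_left)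
      also have "\<dots> = (\<Sum>j<N. if j = i then form a (us ! j) else 0)"
        by (rule sum.cong) (use that in \<open>auto simp: form_dual\<close>)
      finally show ?thesis using that by simp
    qed
    then have "form (a - x) (us ! i) = 0" if "i < N" for i
      using that by (simp add: additive.diff[OF form_additive(2)])
    then show ?thesis by (subst us_expand[of b]) (simp add: additive.sum[OF form_additive(1)] form_scale_right)
  qed
  then have "a - x = 0" by (rule form_nondeg)
  then show ?thesis by (simp add: x_def)
qed

text \<open>The component of wrong parity pairs to zero with all basis vectors: with those of equal
  parity by duality, with the others because the form is even.\<close>

lemma us'_par: "j < N \<Longrightarrow> us' ! j \<in> par H (pu j)"
proof -
  assume j: "j < N"
  define x where "x = pcomp H (1 + pu j) (us' ! j)"
  have xp: "x \<in> par H (1 + pu j)" "us' ! j - x \<in> par H (pu j)"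
    using super_space.pcomp_par[OF HS, where p = "1 + pu j" and a = "us' ! j"] by (simp_all add: x_def)
  have "form x (us ! i) = 0" if i: "i < N" for i
  proof (cases "pu i = pu j")
    case True
    then show ?thesis using form_even[OF xp(1) us_par[OF i]] by (cases "pu j") auto
  next
    case False
    then have "form (us' ! j - x) (us ! i) = 0" "i \<noteq> j" using form_even[OF xp(2) us_par[OF i]] by auto
    then show ?thesis using form_dual[OF i j] by (simp add: additive.diff[OF form_additive(2)])
  qed
  then have "form x b = 0" for b
    by (subst us_expand[of b]) (simp add: additive.sum[OF form_additive(1)] form_scale_right)
  then have "x = 0" by (rule form_nondeg)
  then show ?thesis using xp by simp
qed

lemma form_us: "a \<in> par H p \<Longrightarrow> j < N \<Longrightarrow> pu j \<noteq> p \<Longrightarrow> form (us' ! j) a = 0"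
  "a \<in> par H p \<Longrightarrow> j < N \<Longrightarrow> pu j \<noteq> p \<Longrightarrow> form a (us ! j) = 0" using form_even us_par us'_par by metis+

section \<open>Brackets with a generator, and the master formula\<close>

lemma lk_X_power: "cst c * X i ^ k = sgl (sgl i k) c"
proof (induction k)
  case (Suc k)
  have "sgl i (1::nat) + sgl i k = sgl i (Suc k)" by (simp add: single_add[symmetric] One_nat_def)
  moreover have "cst c * X i ^ Suc k = X i * (cst c * X i ^ k)" by (simp add: IP_left_comm[OF IP_X])
  ultimately show ?case using Suc by (simp add: X_mono)
qed simp

lemma lk_pev: "lk (pev (X i) p) (sgl i k) = coeff p k"
proof -
  have inj: "sgl i (k::nat) = sgl i k' \<longleftrightarrow> k = k'" for k k' by (metis lookup_single_eq)
  show ?thesis by (simp add: pev_def lk_X_power lookup_sum lookup_single inj when_def coeff_eq_0 not_le)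
qed

lemma lk_cst_mult: "lk (cst c * P) m = c * lk P m" "lk (P * cst c) m = lk P m * c"
proof -
  have "lk (cst c * (\<Sum>k\<in>ky P. sgl k (lk P k))) m = c * lk P m"
    by (simp add: sum_distrib_left mult_single lookup_sum lookup_single when_def in_keys_iff)
  moreover have "lk ((\<Sum>k\<in>ky P. sgl k (lk P k)) * cst c) m = lk P m * c"
    by (simp add: sum_distrib_right mult_single lookup_sum lookup_single when_def in_keys_iff)
  ultimately show "lk (cst c * P) m = c * lk P m" "lk (P * cst c) m = lk P m * c" using pm_sum[of P] by simp_all
qed

lemma lk_X_mult: "lk (X i * P) (sgl i (Suc k)) = lk P (sgl i k)" "lk (X i * P) 0 = 0"
proof -
  have e: "sgl i 1 + m = sgl i (Suc k) \<longleftrightarrow> m = sgl i k" for m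
  proof -
    have "sgl i (Suc k) = sgl i 1 + sgl i k" by (simp add: single_add[symmetric] One_nat_def)
    then show ?thesis by (metis add_left_cancel)
  qed
  have z: "sgl i (1::nat) + m \<noteq> 0" for m by (metis add_is_0 lookup_add lookup_single_eq lookup_zero zero_neq_one)
  have "lk (X i * (\<Sum>m\<in>ky P. sgl m (lk P m))) (sgl i (Suc k)) = lk P (sgl i k)"
    by (simp add: sum_distrib_left X_mono lookup_sum lookup_single e when_def in_keys_iff)
  moreover have "lk (X i * (\<Sum>m\<in>ky P. sgl m (lk P m))) 0 = 0"
    by (simp add: sum_distrib_left X_mono lookup_sum lookup_single z when_def)
  ultimately show "lk (X i * P) (sgl i (Suc k)) = lk P (sgl i k)" "lk (X i * P) 0 = 0" using pm_sum[of P] by simp_all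
qed

text \<open>\<open>cf (us' ! j) v (Suc m)\<close> is the left partial derivative of \<open>v\<close>
  with respect to the m-th derivative of u_j. Correspondingly, \<open>cf_mult\<close> says that it
  is a superderivation, and \<open>cf_der\<close> is its commutator with \<partial>.\<close>

definition cf :: "'h \<Rightarrow> 'v \<Rightarrow> nat \<Rightarrow> 'v" where
  "cf a v k = coeff (lbr V (\<iota> a) v) k"

lemma cf_brk: "cf a v k = lk (brk V (\<iota> a) (X i) v) (sgl i k)"
  by (simp add: cf_def brk_pev lk_pev)

lemma cf_add: "cf a (v + w) k = cf a v k + cf a w k"
  by (simp add: cf_def lbr_add_right)

lemma cf_add_left: "cf (a + b) v k = cf a v k + cf b v k"
  by (simp add: cf_def lbr_add_left \<iota>_add)

lemma cf_additive: "additive (\<lambda>v. cf a v k)"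
  by (simp add: additive_def cf_add)

lemma cf_scl: "cf a (scl V c v) k = scl V c (cf a v k)"
  by (simp add: cf_def lbr_scale_right coeff_map_poly Vscl)

lemma cf_mult:
  assumes "a \<in> par H p" "v \<in> par V q"
  shows "cf a (v * w) k = cf a v k * w + sg (p * q) * (v * cf a w k)"
  unfolding cf_brk[of _ _ _ 0] brk_leib[OF \<iota>_par[OF assms(1)] assms(2)]
  by (simp add: lookup_add lk_cst_mult sg_lookup)

lemma cf_der: "cf a (der V v) (Suc k) = cf a v k + der V (cf a v (Suc k))"
  "cf a (der V v) 0 = der V (cf a v 0)"
proof -
  show "cf a (der V v) (Suc k) = cf a v k + der V (cf a v (Suc k))"
    unfolding cf_brk[of _ _ _ 0] brk_der_right by (simp add: lookup_add lk_X_mult dpol_simps)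
  show "cf a (der V v) 0 = der V (cf a v 0)"
    unfolding cf_brk[of _ _ _ 0] brk_der_right by (simp add: lookup_add lk_X_mult dpol_simps)
qed

lemma cf_gen: "cf a (\<iota> b) k = (if k = 1 then scl V (form a b) 1 else 0)"
  by (simp add: cf_def lbr_gens coeff_monom)

lemma cf_1: "cf a 1 k = 0"
proof (rule super_space.par_induct[OF HS, of "\<lambda>a. cf a 1 k" "\<lambda>a. 0" a])
  fix p a assume "a \<in> par H p"
  from cf_mult[OF this one_even, of 1 k] show "cf a 1 k = 0" by simp
qed (simp_all add: additive_def cf_add_left)

lemma cf_par: "a \<in> par H p \<Longrightarrow> v \<in> par V q \<Longrightarrow> cf a v k \<in> par V (p + q)"
  unfolding cf_def by (intro lbr_par \<iota>_par)

text \<open>Brackets with a generator are divisible by \<lambda>: this holds on derivatives of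
  generators and is inherited by products. Division by the fresh variable in the homotopy rests on
  it.\<close>

lemma cf_zero: "cf a v 0 = 0"
proof (rule super_space.par_induct[OF HS, of "\<lambda>a. cf a v 0" "\<lambda>a. 0" a])
  fix p a assume a: "a \<in> par H p"
  have g: "cf a ((der V ^^ k) (\<iota> b)) 0 = 0" for k b by (induction k) (simp_all add: cf_gen cf_der der_simps)
  show "cf a v 0 = 0"
  proof (induction v rule: V_induct)
    case (gen p b k v)
    then show ?case using cf_mult[OF a ders_par[OF \<iota>_par[OF gen(1)]], of k v 0] by (simp add: g)
  qed (simp_all add: cf_1 cf_scl cf_add Vscl)
qed (simp_all add: additive_def cf_add_left)

lemma cf_bound: "k > degree (lbr V (\<iota> a) v) \<Longrightarrow> cf a v k = 0"
  by (simp add: cf_def coeff_eq_0)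

lemma brk_cf:
  assumes "degree (lbr V (\<iota> a) v) \<le> M"
  shows "brk V (\<iota> a) (X i) v = X i * (\<Sum>m<M. cst (cf a v (Suc m)) * X i ^ m)"
proof -
  have "brk V (\<iota> a) (X i) v = (\<Sum>k\<le>M. cst (coeff (lbr V (\<iota> a) v) k) * X i ^ k)"
    unfolding brk_def by (rule sum_coeff_le[of "\<lambda>k v. cst v * X i ^ k"]) (use assms in auto)
  also have "\<dots> = (\<Sum>k<Suc M. cst (cf a v k) * X i ^ k)" by (simp add: cf_def lessThan_Suc_atMost)
  also have "\<dots> = X i * (\<Sum>m<M. cst (cf a v (Suc m)) * X i ^ m)"
    by (simp add: sum.lessThan_Suc_shift cf_zero sum_distrib_left IP_left_comm[OF IP_X] del: sum.lessThan_Suc)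
  finally show ?thesis .
qed

text \<open>\<open>Mop i j f\<close> is the operator \<open>\<Sum>m. (\<partial>f/\<partial>u_j^(m)) (- \<lambda>_i - \<partial>)^m\<close> of the master formula: it extends a
  cochain from generators to all of the algebra in the argument with variable \<open>i\<close>.\<close>

definition Mop :: "nat \<Rightarrow> nat \<Rightarrow> 'v \<Rightarrow> 'v pol \<Rightarrow> 'v pol" where
  "Mop i j f P = (\<Sum>m<degree (lbr V (\<iota> (us' ! j)) f). em i (cf (us' ! j) f (Suc m)) ((- X i) ^ m * P))"

lemma Mop_eq:
  assumes "degree (lbr V (\<iota> (us' ! j)) f) \<le> M"
  shows "Mop i j f P = (\<Sum>m<M. em i (cf (us' ! j) f (Suc m)) ((- X i) ^ m * P))"
  unfolding Mop_def by (rule sum.mono_neutral_left) (use assms in \<open>auto simp: cf_bound not_less\<close>)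

lemma Mop_lin: "Mop i j (scl V c f + g) P = spol V c (Mop i j f P) + Mop i j g P"
proof -
  define M where "M = Max (degree ` lbr V (\<iota> (us' ! j)) ` {f, g, scl V c f + g})"
  have M: "degree (lbr V (\<iota> (us' ! j)) f) \<le> M" "degree (lbr V (\<iota> (us' ! j)) g) \<le> M"
    "degree (lbr V (\<iota> (us' ! j)) (scl V c f + g)) \<le> M" by (auto simp: M_def)
  show ?thesis by (simp add: Mop_eq[OF M(1)] Mop_eq[OF M(2)] Mop_eq[OF M(3)] cf_add cf_scl em_add_left em_scl
        sum.distrib spol_sum)
qed

lemma Mop_additive: "additive (Mop i j f)"
  by (simp add: additive_def Mop_def distrib_left sum.distrib)

lemmas Mop_0 [simp] = additive.zero[OF Mop_additive]
  and Mop_add = additive.add[OF Mop_additive]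
  and Mop_sum = additive.sum[OF Mop_additive]
  and Mop_minus = additive.minus[OF Mop_additive]

lemma Mop_sg: "Mop i j f (sg p * P) = sg p * Mop i j f P"
  by (cases p) (simp_all add: Mop_minus)

lemma Mop_spol: "Mop i j f (spol V c P) = spol V c (Mop i j f P)"
  by (simp add: Mop_def spol_mult(2) em_spol spol_sum)

text \<open>The partial derivatives of \<partial>f are those of f with index lowered, plus their
  derivatives. The first part raises the power of -\<lambda>_i, and the commutator that arises when
  this power leaves \<open>em i\<close> cancels the second.\<close>

lemma Mop_der: "Mop i j (der V f) P = - (X i * Mop i j f P)"
proof -
  define M where "M = max (degree (lbr V (\<iota> (us' ! j)) f)) (degree (lbr V (\<iota> (us' ! j)) (der V f)))"
  define D where "D m = cf (us' ! j) f (Suc m)" for m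
  have M: "degree (lbr V (\<iota> (us' ! j)) f) \<le> M" "degree (lbr V (\<iota> (us' ! j)) (der V f)) \<le> Suc M" by (auto simp: M_def)
  \<comment> \<open>With the top coefficient zero, the sums up to \<open>M\<close> and up to
    \<open>Suc M\<close> agree after the index shift.\<close>
  have DM: "D M = 0" using M(1) by (simp add: D_def cf_bound)
  have D0: "cf (us' ! j) (der V f) (Suc m) = (case m of 0 \<Rightarrow> 0 | Suc m' \<Rightarrow> D m') + der V (D m)" for m
    by (cases m) (simp_all add: D_def cf_der cf_zero)
  have "Mop i j (der V f) P = (\<Sum>m<Suc M. em i (case m of 0 \<Rightarrow> 0 | Suc m' \<Rightarrow> D m') ((- X i) ^ m * P))
    + (\<Sum>m<Suc M. em i (der V (D m)) ((- X i) ^ m * P))" by (simp only: Mop_eq[OF M(2)] D0 em_add_left sum.distrib)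
  also have "(\<Sum>m<Suc M. em i (case m of 0 \<Rightarrow> 0 | Suc m' \<Rightarrow> D m') ((- X i) ^ m * P))
    = (\<Sum>m<M. em i (D m) ((- X i) ^ Suc m * P))" by (simp add: sum.lessThan_Suc_shift del: sum.lessThan_Suc power_Suc)
  also have "\<dots> = (\<Sum>m<M. - (X i * em i (D m) ((- X i) ^ m * P))) - (\<Sum>m<M. em i (der V (D m)) ((- X i) ^ m * P))"
    by (simp add: mult.assoc em_X_same sum_subtractf sum.distrib sum_negf)
  also have "(\<Sum>m<Suc M. em i (der V (D m)) ((- X i) ^ m * P)) = (\<Sum>m<M. em i (der V (D m)) ((- X i) ^ m * P))"
    by (simp add: DM der_simps)
  finally show ?thesis by (simp add: Mop_eq[OF M(1)] D_def sum_distrib_left sum_negf)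
qed

lemma Mop_gen: "Mop i j (\<iota> a) P = spol V (form (us' ! j) a) P"
proof -
  have "degree (lbr V (\<iota> (us' ! j)) (\<iota> a)) \<le> 1" by (simp add: lbr_gens degree_monom_le)
  then have "Mop i j (\<iota> a) P = (\<Sum>m<1. em i (cf (us' ! j) (\<iota> a) (Suc m)) ((- X i) ^ m * P))" by (rule Mop_eq)
  then show ?thesis by (simp add: cf_gen em_scl One_nat_def)
qed

lemma Mop_leib:
  assumes j: "j < N" and f: "f \<in> par V p" and g: "g \<in> par V q"
  shows "Mop i j (f * g) P = sg (pu j * p) * em i f (Mop i j g P) + sg ((pu j + p) * q) * em i g (Mop i j f P)"
proof -
  define M where "M = Max (degree ` lbr V (\<iota> (us' ! j)) ` {f, g, f * g})"
  have M: "degree (lbr V (\<iota> (us' ! j)) f) \<le> M" "degree (lbr V (\<iota> (us' ! j)) g) \<le> M"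
    "degree (lbr V (\<iota> (us' ! j)) (f * g)) \<le> M" by (auto simp: M_def)
  have "em i (cf (us' ! j) (f * g) k) R = sg (pu j * p) * em i f (em i (cf (us' ! j) g k) R)
    + sg ((pu j + p) * q) * em i g (em i (cf (us' ! j) f k) R)" for k R
  proof -
    have "cf (us' ! j) f k * g = sg ((pu j + p) * q) * (g * cf (us' ! j) f k)"
      by (rule mult_comm[OF cf_par[OF us'_par[OF j] f] g])
    moreover have "em i (sg r * v) R = sg r * em i v R" for r v
      by (cases r) (simp_all add: additive.minus[OF em_additive_left])
    ultimately show ?thesis by (simp add: cf_mult[OF us'_par[OF j] f] em_add_left em_mult add.commute)
  qed
  then show ?thesis
    by (simp only: Mop_eq[OF M(1)] Mop_eq[OF M(2)] Mop_eq[OF M(3)] sum.distrib em_sum sum_distrib_left)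
qed

lemma Mop_pon: "P \<in> pon A \<Longrightarrow> i \<in> A \<Longrightarrow> Mop i j f P \<in> pon A"
  unfolding Mop_def by (intro pon_sum em_pon pon_mult pon_power pon_uminus) auto

lemma Mop_rpar:
  assumes j: "j < N" and f: "f \<in> par V p" and P: "P \<in> rpar V r"
  shows "Mop i j f P \<in> rpar V (pu j + p + r)"
  unfolding Mop_def by (intro rpar_sum em_rpar cf_par us'_par j f rpar_IP IP_power IP_uminus IP_X P)

lemma Mop_ren:
  assumes "P \<in> pon A" "inj_on \<rho> (insert i A)"
  shows "ren \<rho> (Mop i j f P) = Mop (\<rho> i) j f (ren \<rho> P)"
proof -
  have "(- X i) ^ m * P \<in> pon (insert i A)" for m
    using assms(1) by (intro pon_mult pon_power pon_uminus) (auto intro: pon_mono)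
  then have "ren \<rho> (em i b ((- X i) ^ m * P)) = em (\<rho> i) b (ren \<rho> ((- X i) ^ m * P))" for m b
    by (rule em_ren[OF _ assms(2)]) simp
  then show ?thesis by (simp add: Mop_def)
qed

lemma em_IP_other: "k \<noteq> i \<Longrightarrow> em i b ((- X k) ^ m * P) = (- X k) ^ m * em i b P"
  by (induction m) (simp_all add: mult.assoc em_X_other)

lemma Mop_comm:
  assumes ii: "i \<noteq> i'" and j: "j < N" "j' < N" and f: "f \<in> par V p" and g: "g \<in> par V q"
  shows "Mop i j f (Mop i' j' g P) = sg ((pu j + p) * (pu j' + q)) * Mop i' j' g (Mop i j f P)"
proof -
  have "em i (cf (us' ! j) f k) ((- X i) ^ m * em i' (cf (us' ! j') g k') ((- X i') ^ m' * P))
    = sg ((pu j + p) * (pu j' + q)) * em i' (cf (us' ! j') g k') ((- X i') ^ m' * em i (cf (us' ! j) f k) ((- X i) ^ m * P))"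
    for k m k' m'
  proof -
    have "em i (cf (us' ! j) f k) ((- X i) ^ m * em i' (cf (us' ! j') g k') ((- X i') ^ m' * P))
      = em i (cf (us' ! j) f k) (em i' (cf (us' ! j') g k') ((- X i) ^ m * ((- X i') ^ m' * P)))"
      using ii by (simp add: em_IP_other)
    also have "\<dots> = sg ((pu j + p) * (pu j' + q)) * em i' (cf (us' ! j') g k') (em i (cf (us' ! j) f k) ((- X i) ^ m * ((- X i') ^ m' * P)))"
      by (rule em_comm[OF ii cf_par[OF us'_par f] cf_par[OF us'_par g]]) (use j in auto)
    also have "(- X i) ^ m * ((- X i') ^ m' * P) = (- X i') ^ m' * ((- X i) ^ m * P)" by (rule IP_left_comm) simp
    also have "em i (cf (us' ! j) f k) ((- X i') ^ m' * ((- X i) ^ m * P)) = (- X i') ^ m' * em i (cf (us' ! j) f k) ((- X i) ^ m * P)"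
      using ii by (simp add: em_IP_other)
    finally show ?thesis .
  qed
  then show ?thesis by (simp add: Mop_def em_sum sum_distrib_left) (rule sum.swap)
qed

end

section \<open>Extension from generators to the algebra and restriction back\<close>

context boson
begin

abbreviation "gdh \<equiv> gd (par H)"
abbreviation "lch \<equiv> lco V (par H) (scl H)"

text \<open>Arguments are replaced by basis vectors from left to right, and \<open>pre\<close>
  collects the vectors. The operator in the slot of \<open>x\<close> has parity
  \<open>pt x + pu j\<close>; the sign carries it past the cochain and \<open>pre\<close>, and the
  last summand \<open>pu j\<close> makes up for the partial derivative being taken from the
  left.\<close>

fun Ext :: "('h item list \<Rightarrow> 'v pol) \<Rightarrow> bit \<Rightarrow> 'h item list \<Rightarrow> 'v item list \<Rightarrow> 'v pol" where
  "Ext w q pre [] = w pre"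
| "Ext w q pre (x # l) = (\<Sum>j<N. sg ((pt x + pu j) * (q + pbs pre + pu j))
     * Mop (fst x) j (ag x) (Ext w q (pre @ [(fst x, pu j, us ! j)]) l))"

definition im :: "'h item list \<Rightarrow> 'v item list" where
  "im l = map (\<lambda>x. (fst x, pt x, \<iota> (ag x))) l"

lemma im_simps [simp]: "im [] = []" "im (x # l) = (fst x, pt x, \<iota> (ag x)) # im l"
  "im (l @ l') = im l @ im l'" "length (im l) = length l" "pbs (im l) = pbs l"
  by (simp_all add: im_def pbs_def comp_def)

lemma im_set [simp]: "lb (im l) = lb l"
  by (simp add: im_def image_image)

lemma im_gd: "gdh l \<Longrightarrow> gdv (im l)"
  by (induction l) (auto simp: \<iota>_par)

lemma im_rl: "im (rl \<rho> l) = rl \<rho> (im l)"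
  by (simp add: im_def rl_def)

text \<open>The restriction of \<open>dd\<close> to generators: brackets of generators are constants, which cochains kill.\<close>

fun dc :: "('h item list \<Rightarrow> 'v pol) \<Rightarrow> bit \<Rightarrow> 'h item list \<Rightarrow> 'v pol" where
  "dc w Q [] = 0"
| "dc w Q (x # l) = sg ((1 + pt x) * (Q + 1) + 1) * act (\<iota> (ag x)) (fst x) (w l)
     + dc (\<lambda>l. w (x # l)) (Q + (1 + pt x)) l"

lemma dc_cong:
  assumes "gdh l" "\<And>l'. Suc (length l') = length l \<Longrightarrow> gdh l' \<Longrightarrow> set l' \<subseteq> set l \<Longrightarrow> w l' = w' l'"
  shows "dc w Q l = dc w' Q l"
  using assms
proof (induction l arbitrary: w w' Q)
  case (Cons x l)
  have "w l = w' l" by (rule Cons.prems(2)) (use Cons.prems(1) in auto)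
  moreover have "dc (\<lambda>l. w (x # l)) (Q + (1 + pt x)) l = dc (\<lambda>l. w' (x # l)) (Q + (1 + pt x)) l"
  proof (rule Cons.IH)
    fix l' assume l': "Suc (length l') = length l" "gdh l'" "set l' \<subseteq> set l"
    have "lb l' \<subseteq> lb l" using l'(3) by (rule image_mono)
    then show "w (x # l') = w' (x # l')" using Cons.prems(1) l' by (intro Cons.prems(2)) auto
  qed (use Cons.prems in auto)
  ultimately show ?case by simp
qed simp

lemma lco_zero:
  assumes w: "lch n q w" and g: "gdh (l1 @ (i, p, 0) # l2)" "length (l1 @ (i, p, 0) # l2) = n"
  shows "w (l1 @ (i, p, 0) # l2) = 0"
  using lco_lin[OF w, of l1 i p 0 l2 0 1] g by (simp add: Hscl spol_lin)

lemma lco_sum: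
  assumes w: "lch n q w" and g: "gdh (l1 @ (i, p, 0) # l2)" "length (l1 @ (i, p, 0) # l2) = n"
    and b: "\<And>j. j \<in> J \<Longrightarrow> b j \<in> par H p"
  shows "w (l1 @ (i, p, \<Sum>j\<in>J. scl H (c j) (b j)) # l2) = (\<Sum>j\<in>J. spol V (c j) (w (l1 @ (i, p, b j) # l2)))"
  using b
proof (induction J rule: infinite_finite_induct)
  case (insert j J)
  have s: "(\<Sum>j\<in>J. scl H (c j) (b j)) \<in> par H p"
    by (rule super_space.par_sum[OF HS]) (use insert in \<open>auto intro: Hpar\<close>)
  have "w (l1 @ (i, p, scl H (c j) (b j) + (\<Sum>j\<in>J. scl H (c j) (b j))) # l2)
    = spol V (c j) (w (l1 @ (i, p, b j) # l2)) + w (l1 @ (i, p, \<Sum>j\<in>J. scl H (c j) (b j)) # l2)"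
    by (rule lco_lin[OF w]) (use g s insert.prems in \<open>auto intro: Hpar\<close>)
  then show ?case using insert by simp
qed (use lco_zero[OF w] g in auto)

lemma lco_expand:
  assumes w: "lch n q w" and g: "gdh (l1 @ (i, p, a) # l2)" "length (l1 @ (i, p, a) # l2) = n"
  shows "w (l1 @ (i, p, a) # l2) = (\<Sum>j | j < N \<and> pu j = p. spol V (form (us' ! j) a) (w (l1 @ (i, p, us ! j) # l2)))"
    "w (l1 @ (i, p, a) # l2) = (\<Sum>j | j < N \<and> pu j = p. spol V (form a (us ! j)) (w (l1 @ (i, p, us' ! j) # l2)))"
proof -
  have a: "a \<in> par H p" and g': "gdh (l1 @ (i, p, 0) # l2)" "length (l1 @ (i, p, 0) # l2) = n" using g by auto
  have 1: "a = (\<Sum>j | j < N \<and> pu j = p. scl H (form (us' ! j) a) (us ! j))"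
    by (subst us_expand, rule sum.mono_neutral_right) (auto simp: form_us[OF a] Hscl)
  have 2: "a = (\<Sum>j | j < N \<and> pu j = p. scl H (form a (us ! j)) (us' ! j))"
    by (subst us'_expand, rule sum.mono_neutral_right) (auto simp: form_us[OF a] Hscl)
  show "w (l1 @ (i, p, a) # l2) = (\<Sum>j | j < N \<and> pu j = p. spol V (form (us' ! j) a) (w (l1 @ (i, p, us ! j) # l2)))"
    by (subst 1, rule lco_sum[OF w g']) (use us_par in auto)
  show "w (l1 @ (i, p, a) # l2) = (\<Sum>j | j < N \<and> pu j = p. spol V (form a (us ! j)) (w (l1 @ (i, p, us' ! j) # l2)))"
    by (subst 2, rule lco_sum[OF w g']) (use us'_par in auto)
qed

context
  fixes n q w
  assumes w: "lch n q w"
begin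

abbreviation "okl pre l \<equiv> gdh pre \<and> gdv l \<and> lb pre \<inter> lb l = {} \<and> length pre + length l = n"

lemma ok_step: "okl pre (x # l) \<Longrightarrow> j < N \<Longrightarrow> okl (pre @ [(fst x, pu j, us ! j)]) l"
  using us_par by auto

lemma Ext_swap_pre:
  "okl (pre1 @ u # v # pre2) l \<Longrightarrow>
   Ext w q (pre1 @ u # v # pre2) l = sgx u v * Ext w q (pre1 @ v # u # pre2) l"
proof (induction l arbitrary: pre2)
  case Nil
  then show ?case using lco_swap[OF w, of pre1 u v pre2] by simp
next
  case (Cons x l)
  have "Ext w q (pre1 @ u # v # (pre2 @ [(fst x, pu j, us ! j)])) l
    = sgx u v * Ext w q (pre1 @ v # u # (pre2 @ [(fst x, pu j, us ! j)])) l" if "j < N" for j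
    by (rule Cons.IH) (use ok_step[OF Cons.prems that] in simp)
  then show ?case
    by (simp add: Mop_sg sum_distrib_left add.left_commute[of "pt u"] sg_comm(2)[of "sg ((pt x + _) * _)"])
qed

text \<open>Operators in different slots supercommute, and on the basis vectors the symmetry of
  \<open>w\<close> applies; it remains to exchange the two sums over the basis.\<close>

lemma Ext_swap:
  "okl pre (l1 @ x # z # l2) \<Longrightarrow>
   Ext w q pre (l1 @ x # z # l2) = sgx x z * Ext w q pre (l1 @ z # x # l2)"
proof (induction l1 arbitrary: pre)
  case Nil
  define E where "E j j' = Ext w q (pre @ [(fst z, pu j', us ! j'), (fst x, pu j, us ! j)]) l2" for j j'
  have E: "Ext w q (pre @ [(fst x, pu j, us ! j), (fst z, pu j', us ! j')]) l2 = sg ((1 + pu j) * (1 + pu j')) * E j j'"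
    if "j < N" "j' < N" for j j'
    unfolding E_def using Ext_swap_pre[of pre "(fst x, pu j, us ! j)" "(fst z, pu j', us ! j')" "[]" l2] Nil that us_par
    by auto
  have t: "sg ((pt x + pu j) * (q + pbs pre + pu j)) * (sg ((pt z + pu j') * (q + (pbs pre + (1 + pu j)) + pu j'))
      * (sg ((1 + pu j) * (1 + pu j')) * Mop (fst x) j (ag x) (Mop (fst z) j' (ag z) (E j j'))))
    = sgx x z * (sg ((pt z + pu j') * (q + pbs pre + pu j')) *
       (sg ((pt x + pu j) * (q + (pbs pre + (1 + pu j')) + pu j)) * Mop (fst z) j' (ag z) (Mop (fst x) j (ag x) (E j j'))))"
    if "j < N" "j' < N" for j j'
  proof -
    have "Mop (fst x) j (ag x) (Mop (fst z) j' (ag z) (E j j')) = sg ((pu j + pt x) * (pu j' + pt z)) * Mop (fst z) j' (ag z) (Mop (fst x) j (ag x) (E j j'))"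
      by (rule Mop_comm) (use Nil that in auto)
    then show ?thesis by (cases "pt x"; cases "pt z"; cases "pu j"; cases "pu j'"; cases "q"; cases "pbs pre"; simp)
  qed
  have "Ext w q pre (x # z # l2) = (\<Sum>j<N. \<Sum>j'<N. sg ((pt x + pu j) * (q + pbs pre + pu j)) * (sg ((pt z + pu j') * (q + (pbs pre + (1 + pu j)) + pu j'))
      * (sg ((1 + pu j) * (1 + pu j')) * Mop (fst x) j (ag x) (Mop (fst z) j' (ag z) (E j j')))))"
    by (simp add: Mop_sum sum_distrib_left Mop_sg E)
  also have "\<dots> = (\<Sum>j<N. \<Sum>j'<N. sgx x z * (sg ((pt z + pu j') * (q + pbs pre + pu j')) *
       (sg ((pt x + pu j) * (q + (pbs pre + (1 + pu j')) + pu j)) * Mop (fst z) j' (ag z) (Mop (fst x) j (ag x) (E j j')))))"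
    by (intro sum.cong refl t) auto
  also have "\<dots> = (\<Sum>j'<N. \<Sum>j<N. sgx x z * (sg ((pt z + pu j') * (q + pbs pre + pu j')) *
       (sg ((pt x + pu j) * (q + (pbs pre + (1 + pu j')) + pu j)) * Mop (fst z) j' (ag z) (Mop (fst x) j (ag x) (E j j')))))"
    by (rule sum.swap)
  also have "\<dots> = sgx x z * Ext w q pre (z # x # l2)"
    by (simp add: Mop_sum sum_distrib_left Mop_sg E_def)
  finally show ?case by simp
next
  case (Cons u l1)
  have "Ext w q (pre @ [(fst u, pu j, us ! j)]) (l1 @ x # z # l2)
    = sgx x z * Ext w q (pre @ [(fst u, pu j, us ! j)]) (l1 @ z # x # l2)" if "j < N" for j
    by (rule Cons.IH) (use ok_step[of pre u "l1 @ x # z # l2", OF _ that] Cons.prems in simp)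
  then show ?case by (simp add: Mop_sg sum_distrib_left)
      (intro sum.cong refl, cases "pt x"; cases "pt z"; simp)
qed

lemma Ext_pon: "okl pre l \<Longrightarrow> Ext w q pre l \<in> pon (lb pre \<union> lb l)"
proof (induction l arbitrary: pre)
  case Nil
  then show ?case using lco_pon[OF w, of pre] by simp
next
  case (Cons x l)
  have "Ext w q (pre @ [(fst x, pu j, us ! j)]) l \<in> pon (lb pre \<union> lb (x # l))" if "j < N" for j
    using Cons.IH[OF ok_step[OF Cons.prems that]] by simp
  then show ?case by (auto intro!: pon_sum pon_mult Mop_pon)
qed

lemma Ext_rpar: "okl pre l \<Longrightarrow> Ext w q pre l \<in> rpar V (1 + q + pbs pre + pbs l)"
proof (induction l arbitrary: pre)
  case Nil
  then show ?case using lco_rpar[OF w, of pre] by (simp add: add_ac)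
next
  case (Cons x l)
  have "Mop (fst x) j (ag x) (Ext w q (pre @ [(fst x, pu j, us ! j)]) l) \<in> rpar V (1 + q + pbs pre + pbs (x # l))" if "j < N" for j
  proof -
    have "Mop (fst x) j (ag x) (Ext w q (pre @ [(fst x, pu j, us ! j)]) l)
      \<in> rpar V (pu j + pt x + (1 + q + pbs (pre @ [(fst x, pu j, us ! j)]) + pbs l))"
      by (rule Mop_rpar[OF that _ Cons.IH[OF ok_step[OF Cons.prems that]]]) (use Cons.prems in simp)
    moreover have "pu j + pt x + (1 + q + pbs (pre @ [(fst x, pu j, us ! j)]) + pbs l) = 1 + q + pbs pre + pbs (x # l)"
      by (cases "pu j"; simp add: add_ac)
    ultimately show ?thesis by (simp only:)
  qed
  then show ?case by (auto intro!: rpar_sum rpar_IP)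
qed

lemma Ext_rl: "okl pre l \<Longrightarrow> inj_on \<rho> (lb pre \<union> lb l) \<Longrightarrow> Ext w q (rl \<rho> pre) (rl \<rho> l) = ren \<rho> (Ext w q pre l)"
proof (induction l arbitrary: pre)
  case Nil
  then show ?case using lco_rl[OF w, of pre \<rho>] by simp
next
  case (Cons x l)
  have "Mop (\<rho> (fst x)) j (ag x) (Ext w q (rl \<rho> (pre @ [(fst x, pu j, us ! j)])) (rl \<rho> l))
    = ren \<rho> (Mop (fst x) j (ag x) (Ext w q (pre @ [(fst x, pu j, us ! j)]) l))" if "j < N" for j
  proof -
    have "Ext w q (rl \<rho> (pre @ [(fst x, pu j, us ! j)])) (rl \<rho> l) = ren \<rho> (Ext w q (pre @ [(fst x, pu j, us ! j)]) l)"
      by (rule Cons.IH[OF ok_step[OF Cons.prems(1) that]]) (use Cons.prems in simp)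
    moreover have "ren \<rho> (Mop (fst x) j (ag x) (Ext w q (pre @ [(fst x, pu j, us ! j)]) l))
      = Mop (\<rho> (fst x)) j (ag x) (ren \<rho> (Ext w q (pre @ [(fst x, pu j, us ! j)]) l))"
      by (rule Mop_ren[OF Ext_pon[OF ok_step[OF Cons.prems(1) that]]]) (use Cons.prems in \<open>simp add: insert_absorb\<close>)
    ultimately show ?thesis by simp
  qed
  then show ?case by simp
qed

lemma Ext_bco: "bco V n q (Ext w q [])"
  unfolding bco_def lco_def
proof (intro conjI allI impI)
  fix l assume l: "gdv l \<and> length l = n"
  show "Ext w q [] l \<in> pon (lb l)" using Ext_pon[of "[]" l] l by simp
  show "Ext w q [] l \<in> rpar V (1 + q + pbs l)" using Ext_rpar[of "[]" l] l by simp
  fix \<rho> :: "nat \<Rightarrow> nat" assume "inj_on \<rho> (lb l)"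
  then show "Ext w q [] (rl \<rho> l) = ren \<rho> (Ext w q [] l)" using Ext_rl[of "[]" l \<rho>] l by simp
next
  fix l1 x z l2 assume "gdv (l1 @ x # z # l2) \<and> length (l1 @ x # z # l2) = n"
  then show "Ext w q [] (l1 @ x # z # l2) = sgx x z * Ext w q [] (l1 @ z # x # l2)"
    using Ext_swap[of "[]" l1 x z l2] by simp
next
  fix i p a b c l
  show "Ext w q [] ((i, p, scl V c a + b) # l) = spol V c (Ext w q [] ((i, p, a) # l)) + Ext w q [] ((i, p, b) # l)"
    by (simp add: Mop_lin distrib_left sum.distrib spol_sum)
next
  fix i p a l
  show "Ext w q [] ((i, p, der V a) # l) = - (X i * Ext w q [] ((i, p, a) # l))"
    by (simp add: Mop_der sum_negf sum_distrib_left sg_comm(2)[of "X _"])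
next
  fix i p b p' c l assume g: "gdv ((i, p, b) # l) \<and> gdv ((i, p', c) # l) \<and> Suc (length l) = n"
  define E where "E j = Ext w q [(i, pu j, us ! j)] l" for j
  have t: "sg ((p + p' + pu j) * (q + pu j)) * Mop i j (b * c) (E j)
    = sg (p * q) * em i b (sg ((p' + pu j) * (q + pu j)) * Mop i j c (E j))
      + sg (p' * (p + q)) * em i c (sg ((p + pu j) * (q + pu j)) * Mop i j b (E j))" if "j < N" for j
  proof -
    have "Mop i j (b * c) (E j) = sg (pu j * p) * em i b (Mop i j c (E j)) + sg ((pu j + p) * p') * em i c (Mop i j b (E j))"
      by (rule Mop_leib[OF that]) (use g in auto)
    then show ?thesis by (cases p; cases p'; cases "pu j"; cases q; simp)
  qed
  have "(\<Sum>j<N. sg ((p + p' + pu j) * (q + pu j)) * Mop i j (b * c) (E j))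
    = (\<Sum>j<N. sg (p * q) * em i b (sg ((p' + pu j) * (q + pu j)) * Mop i j c (E j))
      + sg (p' * (p + q)) * em i c (sg ((p + pu j) * (q + pu j)) * Mop i j b (E j)))" by (intro sum.cong refl t) auto
  then show "Ext w q [] ((i, p + p', b * c) # l) = sg (p * q) * em i b (Ext w q [] ((i, p', c) # l))
    + sg (p' * (p + q)) * em i c (Ext w q [] ((i, p, b) # l))"
    by (simp add: E_def sum.distrib em_sum sum_distrib_left)
qed

text \<open>At a generator \<open>Mop\<close> is multiplication by its coefficient in the basis, so
  the sum over the basis reassembles the argument.\<close>

lemma Ext_gens: "gdh (pre @ l) \<Longrightarrow> length (pre @ l) = n \<Longrightarrow> Ext w q pre (im l) = w (pre @ l)"
proof (induction l arbitrary: pre)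
  case (Cons x l)
  obtain i p a where x: "x = (i, p, a)" by (cases x)
  have a: "a \<in> par H p" using Cons.prems x by simp
  have "Ext w q pre (im (x # l)) = (\<Sum>j<N. sg ((p + pu j) * (q + pbs pre + pu j)) * spol V (form (us' ! j) a) (Ext w q (pre @ [(i, pu j, us ! j)]) (im l)))"
    by (simp add: x Mop_gen)
  also have "\<dots> = (\<Sum>j | j < N \<and> pu j = p. spol V (form (us' ! j) a) (w (pre @ (i, p, us ! j) # l)))"
  proof (rule sum.mono_neutral_cong_right)
    show "\<forall>j\<in>{..<N} - {j. j < N \<and> pu j = p}. sg ((p + pu j) * (q + pbs pre + pu j)) * spol V (form (us' ! j) a) (Ext w q (pre @ [(i, pu j, us ! j)]) (im l)) = 0"
      by (auto simp: form_us[OF a] spol_lin)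
    fix j assume j: "j \<in> {j. j < N \<and> pu j = p}"
    have "Ext w q (pre @ [(i, pu j, us ! j)]) (im l) = w ((pre @ [(i, pu j, us ! j)]) @ l)"
      by (rule Cons.IH) (use Cons.prems x j us_par in auto)
    then show "sg ((p + pu j) * (q + pbs pre + pu j)) * spol V (form (us' ! j) a) (Ext w q (pre @ [(i, pu j, us ! j)]) (im l))
      = spol V (form (us' ! j) a) (w (pre @ (i, p, us ! j) # l))" using j by simp
  qed auto
  also have "\<dots> = w (pre @ x # l)" unfolding x by (rule lco_expand(1)[OF w, symmetric]) (use Cons.prems x in auto)
  finally show ?case .
qed simp

end

lemma lco_im:
  assumes y: "bco V n q y"
  shows "lch n q (\<lambda>l. y (im l))"
  unfolding lco_def
proof (intro conjI allI impI)
  note L = bco_lco[OF y]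
  fix l assume l: "gdh l \<and> length l = n"
  show "y (im l) \<in> pon (lb l)" using lco_pon[OF L, of "im l"] l im_gd[of l] by simp
  show "y (im l) \<in> rpar V (1 + q + pbs l)" using lco_rpar[OF L, of "im l"] l im_gd[of l] by simp
  fix \<rho> :: "nat \<Rightarrow> nat" assume "inj_on \<rho> (lb l)"
  then show "y (im (rl \<rho> l)) = ren \<rho> (y (im l))" using lco_rl[OF L, of "im l" \<rho>] l im_gd[of l] by (simp add: im_rl)
next
  note L = bco_lco[OF y]
  fix l1 x z l2 assume g: "gdh (l1 @ x # z # l2) \<and> length (l1 @ x # z # l2) = n"
  then have "gdv (im (l1 @ x # z # l2))" using im_gd by blast
  then show "y (im (l1 @ x # z # l2)) = sgx x z * y (im (l1 @ z # x # l2))"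
    using lco_swap[OF L, of "im l1" "(fst x, pt x, \<iota> (ag x))" "(fst z, pt z, \<iota> (ag z))" "im l2"] g by simp
next
  fix i p a b c l assume g: "gdh ((i, p, a) # l) \<and> gdh ((i, p, b) # l) \<and> Suc (length l) = n"
  then have "gdv (im ((i, p, a) # l))" "gdv (im ((i, p, b) # l))" using im_gd by blast+
  then show "y (im ((i, p, scl H c a + b) # l)) = spol V c (y (im ((i, p, a) # l))) + y (im ((i, p, b) # l))"
    using lco_lin_front[OF bco_lco[OF y], of i p "\<iota> a" "im l" "\<iota> b" c] g by (simp add: \<iota>_add \<iota>_scl)
qed

text \<open>The Leibniz rule for 1 times 1 gives y(1) = 2 y(1).\<close>

lemma bco_one:
  assumes y: "bco V n q y" and g: "gdv (l1 @ (i, 0, 1) # l2)" "length (l1 @ (i, 0, 1) # l2) = n"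
  shows "y (l1 @ (i, 0, scl V c 1) # l2) = 0"
proof -
  have "y (l1 @ (i, 0, 1) # l2) = 0" using bco_leib[OF y g(1) g(1) g(2)] by simp
  moreover have "y (l1 @ (i, 0, 0) # l2) = 0" using bco_lin[OF y, of l1 i 0 0 l2 0 1] g by (simp add: Vscl spol_lin)
  ultimately show ?thesis using bco_lin[OF y, of l1 i 0 1 l2 0 c] g by (simp add: spol_0)
qed

lemma brk_gens: "brk V (\<iota> a) (X i) (\<iota> b) = X i * cst (scl V (form a b) 1)"
  by (simp add: brk_pev lbr_gens pev_def IP_comm[OF IP_X])
    (cases "form a b = 0"; simp add: Vscl scl_eq_0 degree_monom_eq; simp add: One_nat_def)

lemma br_gens:
  assumes y: "bco V n q y" and g: "gdv pre" "gdv (im (x # z # l))" "gdh (x # z # l)"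
    "lb pre \<inter> lb (x # z # l) = {}" and n: "Suc (length pre + length l) = n"
  shows "br y (fst x, pt x, \<iota> (ag x)) (fst z, pt z, \<iota> (ag z)) pre (im l) = 0"
proof (cases "pt x = pt z")
  case True
  have G: "additive (\<lambda>c. shift (fst x) (fst z) (y (pre @ (fst z, pt x + pt z, pcomp V (pt x + pt z) c) # im l)))"
    using br_additive[OF y, of pre "(fst z, pt z, \<iota> (ag z))" "im l" "fst x" "pt x + pt z"] g n by auto
  have "y (pre @ (fst z, pt x + pt z, pcomp V (pt x + pt z) (scl V c 1)) # im l) = 0" for c
    using bco_one[OF y, of pre "fst z" "im l" c] g n by (simp add: True pcomp_par_id[OF scl1_even] one_even)
  then show ?thesis by (simp add: br_def brk_gens lft_X[OF G] lft_cst[OF G])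
next
  \<comment> \<open>An odd slot could not hold a scalar, but for different parities the form is zero
    anyway.\<close>
  case False
  then have "form (ag x) (ag z) = 0" using form_even[of "ag x" "pt x" "ag z" "pt z"] g by auto
  then show ?thesis by (simp add: br_def brk_gens Vscl lft_def)
qed

lemma dd_gens:
  assumes y: "bco V n q y"
  shows "gdv pre \<Longrightarrow> gdh l \<Longrightarrow> lb pre \<inter> lb l = {} \<Longrightarrow> length pre + length l = Suc n
    \<Longrightarrow> dd y q pre (im l) = dc (\<lambda>l. y (pre @ im l)) (q + pbs pre) l"
proof (induction l arbitrary: pre)
  case (Cons x l)
  have BB0: "BB y (fst x, pt x, \<iota> (ag x)) pre' (im l') = 0"
    if "gdv pre'" "gdh (x # l')" "lb pre' \<inter> lb (x # l') = {}" "length pre' + length l' = n" for pre' l' using that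
  proof (induction l' arbitrary: pre')
    case (Cons z l')
    have "br y (fst x, pt x, \<iota> (ag x)) (fst z, pt z, \<iota> (ag z)) pre' (im l') = 0"
      by (rule br_gens[OF y]) (use Cons.prems im_gd[of "x # z # l'"] in auto)
    moreover have "BB y (fst x, pt x, \<iota> (ag x)) (pre' @ [(fst z, pt z, \<iota> (ag z))]) (im l') = 0"
      by (rule Cons.IH) (use Cons.prems \<iota>_par in auto)
    ultimately show ?case by simp
  qed simp
  have 1: "BB y (fst x, pt x, \<iota> (ag x)) pre (im l) = 0" by (rule BB0) (use Cons.prems in auto)
  have 2: "dd y q (pre @ [(fst x, pt x, \<iota> (ag x))]) (im l) = dc (\<lambda>l. y ((pre @ [(fst x, pt x, \<iota> (ag x))]) @ im l)) (q + pbs (pre @ [(fst x, pt x, \<iota> (ag x))])) l"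
    by (rule Cons.IH) (use Cons.prems \<iota>_par in auto)
  show ?case using 1 2 by (simp add: add_ac)
qed simp

text \<open>No separate verification on generators: extend to the algebra, apply \<open>dd\<close>,
  which preserves basic cochains, and restrict.\<close>

theorem dc_lco:
  assumes w: "lch n q w"
  shows "lch (Suc n) (q + 1) (dc w q)"
proof -
  define y where "y = Ext w q []"
  have y: "bco V n q y" unfolding y_def by (rule Ext_bco[OF w])
  have l: "lch (Suc n) (q + 1) (\<lambda>l. dd y q [] (im l))" by (rule lco_im[OF dd_bco[OF y]])
  have e: "dd y q [] (im l) = dc w q l" if "gdh l" "length l = Suc n" for l
  proof -
    have "dd y q [] (im l) = dc (\<lambda>l. y (im l)) q l" using dd_gens[OF y, of "[]" l] that by simp
    also have "\<dots> = dc w q l" by (rule dc_cong) (use that Ext_gens[OF w, of "[]"] in \<open>auto simp: y_def\<close>)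
    finally show ?thesis .
  qed
  show ?thesis by (rule lco_cong[OF l e]) (auto intro: Hpar)
qed

end

section \<open>Division by a variable, and the operator that defines the quotient\<close>

definition ev0 :: "nat \<Rightarrow> 'v::ring_1 pol \<Rightarrow> 'v pol" where
  "ev0 k = sb (X(k := 0))"

text \<open>The divided difference (P - P at \<open>X k\<close> = 0) / \<open>X k\<close>; see
  \<open>ev0_dq\<close>.\<close>

definition dq :: "nat \<Rightarrow> 'v::ring_1 pol \<Rightarrow> 'v pol" where
  "dq k P = (\<Sum>m\<in>ky P. if lk m k = 0 then 0 else sgl (m - sgl k 1) (lk P m))"

lemma ev0_simps [simp]:
  "ev0 k (P + Q) = ev0 k P + ev0 k Q" "ev0 k (cst v) = cst v" "ev0 k 0 = 0" "ev0 k (- P) = - ev0 k P"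
  "ev0 k (P - Q) = ev0 k P - ev0 k Q" "ev0 k (X j * P) = (if j = k then 0 else X j * ev0 k P)"
  "ev0 k (sg p * P) = sg p * ev0 k P" "ev0 k (sum f I) = (\<Sum>i\<in>I. ev0 k (f i))"
  by (simp_all add: ev0_def sb_mult_X sb_sum)

lemma ev0_pon: "P \<in> pon A \<Longrightarrow> ev0 k P \<in> pon (A - {k})"
  unfolding ev0_def by (rule sb_pon) auto

lemma ev0_ident: "P \<in> pon A \<Longrightarrow> k \<notin> A \<Longrightarrow> ev0 k P = P"
  by (induction P rule: pol_induct_on) auto

lemma dq_additive: "additive (dq k)"
  unfolding dq_def by (rule ky_sum_additive) (simp add: additive_def single_add)

lemmas dq_add [simp] = additive.add[OF dq_additive]
  and dq_sum = additive.sum[OF dq_additive]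
  and dq_0 [simp] = additive.zero[OF dq_additive]
  and dq_minus [simp] = additive.minus[OF dq_additive]
  and dq_diff [simp] = additive.diff[OF dq_additive]

lemma dq_mono: "dq k (sgl m v) = (if lk m k = 0 then 0 else sgl (m - sgl k 1) v)"
  by (simp add: dq_def)

lemma dq_cst [simp]: "dq k (cst v) = 0"
  by (simp add: dq_mono)

lemma dq_X [simp]: "dq k (X j * P) = (if j = k then P else X j * dq k P)"
proof -
  have *: "dq k (X j * sgl m v) = (if j = k then sgl m v else X j * dq k (sgl m v))" for m v
  proof (cases "j = k")
    case True
    then show ?thesis by (simp add: X_mono dq_mono lookup_add)
  next
    case False
    have "sgl j 1 + m - sgl k 1 = sgl j 1 + (m - sgl k 1)" if "lk m k \<noteq> 0"
      by (rule poly_mapping_eqI) (use that False in \<open>auto simp: lookup_add lookup_minus lookup_single when_def\<close>)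
    then show ?thesis using False by (simp add: X_mono dq_mono lookup_add lookup_single)
  qed
  have "dq k (X j * (\<Sum>m\<in>ky P. sgl m (lk P m))) =
    (if j = k then (\<Sum>m\<in>ky P. sgl m (lk P m)) else X j * dq k (\<Sum>m\<in>ky P. sgl m (lk P m)))"
    by (simp only: sum_distrib_left dq_sum *) simp
  then show ?thesis using pm_sum[of P] by simp
qed

lemma dq_sg [simp]: "dq k (sg p * P) = sg p * dq k P"
  by (cases p) auto

lemma dq_pon: "P \<in> pon A \<Longrightarrow> dq k P \<in> pon A"
  by (induction P rule: pol_induct_on) auto

lemma dq_free: "P \<in> pon A \<Longrightarrow> k \<notin> A \<Longrightarrow> dq k P = 0"
  by (induction P rule: pol_induct_on) auto

lemma ev0_dq: "ev0 k P + X k * dq k P = P"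
proof (induction P rule: pol_induct)
  case (X j P)
  have "ev0 k (X j * P) + X k * dq k (X j * P) = X j * (ev0 k P + X k * dq k P)" if "j \<noteq> k"
    using that by (simp add: distrib_left IP_left_comm[OF IP_X, of "X k"])
  then show ?case using X by (cases "j = k") auto
next
  case (add P P')
  have "ev0 k (P + P') + X k * dq k (P + P') = (ev0 k P + X k * dq k P) + (ev0 k P' + X k * dq k P')"
    by (simp add: distrib_left add_ac)
  then show ?case using add by simp
qed simp

definition sto :: "nat \<Rightarrow> nat \<Rightarrow> 'v::ring_1 pol \<Rightarrow> 'v pol" where
  "sto k x = ren (id(k := x))"

context poisson_vertex_superalgebra
begin

text \<open>As cochains are polynomials in the fresh variable \<open>k\<close>, dividing by it means taking the divided difference
  \<open>dq k\<close>; the result is then multiplied by \<open>b\<close> in slot \<open>k\<close>, and the variable is set to zero.\<close>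

definition kap :: "nat \<Rightarrow> 'v \<Rightarrow> 'v pol \<Rightarrow> 'v pol" where
  "kap k b P = ev0 k (em k b (dq k P))"

lemma kap_simps [simp]:
  "kap k b (P + Q) = kap k b P + kap k b Q" "kap k b 0 = 0" "kap k b (- P) = - kap k b P"
  "kap k b (P - Q) = kap k b P - kap k b Q"
  "kap k b (sg p * P) = sg p * kap k b P" "kap k b (sum f I) = (\<Sum>i\<in>I. kap k b (f i))"
  by (simp_all add: kap_def dq_sum em_sum)

lemma kap_X: "j \<noteq> k \<Longrightarrow> kap k b (X j * P) = X j * kap k b P"
  by (simp add: kap_def em_X_other)

lemma kap_pon: "P \<in> pon A \<Longrightarrow> kap k b P \<in> pon (A - {k})"
  unfolding kap_def by (intro ev0_pon em_pon dq_pon)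

lemma dq_rpar: "P \<in> rpar V r \<Longrightarrow> dq k P \<in> rpar V r"
proof -
  assume "P \<in> rpar V r"
  then have "P \<in> rpar V r \<and> dq k P \<in> rpar V r" by (induction P rule: rpar_induct) auto
  then show ?thesis ..
qed

lemma dq_spol: "dq k (spol V c P) = spol V c (dq k P)"
  by (induction P rule: pol_induct) (auto simp: spol_simps spol_0)

lemma ev0_spol: "ev0 k (spol V c P) = spol V c (ev0 k P)"
  unfolding ev0_def by (rule sb_spol) simp

lemma kap_spol: "kap k b (spol V c P) = spol V c (kap k b P)"
  by (simp add: kap_def dq_spol em_spol ev0_spol)

lemma kap_rpar: "b \<in> par V p \<Longrightarrow> P \<in> rpar V r \<Longrightarrow> kap k b P \<in> rpar V (p + r)"
  unfolding kap_def ev0_def by (intro sb_rpar em_rpar dq_rpar) auto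

lemma dq_ren: "P \<in> pon A \<Longrightarrow> inj_on \<rho> (insert k A) \<Longrightarrow> ren \<rho> (dq k P) = dq (\<rho> k) (ren \<rho> P)"
  by (induction P rule: pol_induct_on) (auto simp: inj_on_def)

lemma ev0_ren: "P \<in> pon A \<Longrightarrow> inj_on \<rho> (insert k A) \<Longrightarrow> ren \<rho> (ev0 k P) = ev0 (\<rho> k) (ren \<rho> P)"
  by (induction P rule: pol_induct_on) (auto simp: inj_on_def)

lemma kap_ren:
  assumes P: "P \<in> pon A" and i: "inj_on \<rho> (insert k A)"
  shows "ren \<rho> (kap k b P) = kap (\<rho> k) b (ren \<rho> P)"
proof -
  have 1: "dq k P \<in> pon (insert k A)" using dq_pon[OF P] by (rule pon_mono) auto
  have 2: "em k b (dq k P) \<in> pon (insert k A)" by (rule em_pon[OF 1])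
  show ?thesis unfolding kap_def using ev0_ren[OF 2] em_ren[OF 1 i, of k b] dq_ren[OF P i] i by simp
qed

lemma act_ev0: "x \<noteq> k \<Longrightarrow> act a x (ev0 k P) = ev0 k (act a x P)"
  unfolding ev0_def by (subst sb_act) (auto simp: act_lft)

lemma act_dq: "x \<noteq> k \<Longrightarrow> act a x (dq k P) = dq k (act a x P)"
proof (induction P rule: pol_induct)
  case (cst v)
  then show ?case using dq_free[OF brk_item_pon, of k x a v] by simp
qed auto

lemma em_ev0_power: "ev0 k (em k b (cst c * X k ^ m)) = cst ((der V ^^ m) b * c)"
proof (induction m arbitrary: b)
  case (Suc m)
  have "cst c * X k ^ Suc m = X k * (cst c * X k ^ m)" by (simp add: IP_left_comm[OF IP_X])
  then show ?case using Suc[of "der V b"] by (simp add: em_X_same funpow_swap1)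
qed simp

definition pr :: "bit \<Rightarrow> 'v pol \<Rightarrow> 'v pol" where
  "pr p = Poly_Mapping.map (pcomp V p)"

lemma pcomp_additive: "additive (pcomp V p)"
  by (simp add: additive_def pcomp_add)

lemmas pr_simps = map_pol[OF pcomp_additive, folded pr_def]

lemma pr_additive: "additive (pr p)"
  by (simp add: additive_def pr_simps)

lemma pr_rpar: "pr p P \<in> rpar V p"
  by (simp add: rpar_def pr_simps pcomp_par)

lemma pr_hom: "P \<in> rpar V r \<Longrightarrow> pr p P = (if p = r then P else 0)"
  by (rule poly_mapping_eqI) (simp add: pr_simps pcomp_hom[where p = r] rpar_def)

lemma pr_sum: "pr 0 P + pr 1 P = P"
  by (rule poly_mapping_eqI) (simp add: lookup_add pr_simps pcomp_sum)

text \<open>Turns homogeneity into an equation, which can be carried along linear maps and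
  uniqueness statements.\<close>

lemma rpar_pr: "P \<in> rpar V r \<longleftrightarrow> pr (1 + r) P = 0"
  using pr_sum[of P] pr_rpar[of r P] pr_hom[of P r "1 + r"] by (cases r) auto

lemma pr_dpol: "pr p (dpol V P) = dpol V (pr p P)"
  by (rule poly_mapping_eqI) (simp add: pr_simps dpol_simps pcomp_der)

lemma pr_pon: "P \<in> pon A \<Longrightarrow> pr p P \<in> pon A"
  by (auto simp: pon_def in_keys_iff pr_simps additive.zero[OF pcomp_additive])

definition tot :: "nat set \<Rightarrow> 'v pol \<Rightarrow> 'v pol" where
  "tot K P = dpol V P + (\<Sum>i\<in>K. X i) * P"

lemma tot_additive: "additive (tot K)"
  by (simp add: additive_def tot_def distrib_left)

lemmas tot_add = additive.add[OF tot_additive] and tot_0 = additive.zero[OF tot_additive]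
  and tot_diff = additive.diff[OF tot_additive] and tot_minus = additive.minus[OF tot_additive]
  and tot_sum = additive.sum[OF tot_additive]

lemma tot_sg: "tot K (sg p * P) = sg p * tot K P"
  by (cases p) (auto simp: tot_minus)

lemma tot_IP: "\<Lambda> \<in> IP \<Longrightarrow> tot K (\<Lambda> * P) = \<Lambda> * tot K P"
  by (simp add: tot_def dpol_simps distrib_left IP_left_comm)

lemma tot_spol: "tot K (spol V c P) = spol V c (tot K P)"
  by (simp add: tot_def dpol_spol spol_mult(2) spol_add)

lemma tot_pon: "P \<in> pon A \<Longrightarrow> K \<subseteq> A \<Longrightarrow> tot K P \<in> pon A"
  unfolding tot_def by (intro pon_add pon_mult dpol_pon pon_sum) auto

lemma tot_rpar: "P \<in> rpar V r \<Longrightarrow> tot K P \<in> rpar V r"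
  unfolding tot_def by (intro rpar_closed dpol_rpar rpar_IP) auto

lemma tot_ren: "inj_on \<rho> K \<Longrightarrow> ren \<rho> (tot K P) = tot (\<rho> ` K) (ren \<rho> P)"
  by (simp add: tot_def ren_dpol sum.reindex)

lemma pr_tot: "pr p (tot K P) = tot K (pr p P)"
  by (simp add: tot_def pr_simps pr_dpol)

lemma act_tot: "finite K \<Longrightarrow> i \<notin> K \<Longrightarrow> act a i (tot K P) = tot (insert i K) (act a i P)"
  by (simp add: tot_def act_dpol act_IP distrib_right add_ac)

text \<open>Compare the highest power of one variable \<open>X i\<close> with \<open>i\<close> in
  \<open>K\<close>: multiplication by \<open>X i\<close> raises it, while \<partial> and the other
  variables do not.\<close>

lemma tot_inject:
  assumes K: "finite K" "K \<noteq> {}" and P: "tot K P = 0"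
  shows "P = 0"
proof (rule ccontr)
  assume "P \<noteq> 0"
  then have ne: "ky P \<noteq> {}" by (metis poly_mapping_eqI empty_iff in_keys_iff lookup_zero)
  obtain i where i: "i \<in> K" using K by auto
  define M where "M = Max ((\<lambda>m. lk m i) ` ky P)"
  have "M \<in> (\<lambda>m. lk m i) ` ky P" unfolding M_def by (rule Max_in) (use ne in auto)
  then obtain m where m: "m \<in> ky P" "lk m i = M" by auto
  have big: "lk P m' = 0" if "lk m' i > M" for m'
  proof (rule ccontr)
    assume "lk P m' \<noteq> 0"
    then have "lk m' i \<le> M" unfolding M_def by (intro Max_ge) (auto simp: in_keys_iff)
    then show False using that by simp
  qed
  define m1 where "m1 = sgl i 1 + m"
  have m1: "lk m1 i = Suc M" using m by (simp add: m1_def lookup_add)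
  \<comment> \<open>Only multiplication by \<open>X i\<close> itself reaches an exponent above the
    maximum \<open>M\<close>.\<close>
  have XP: "lk (X k * P) m1 = (if k = i then lk P m else 0)" for k
  proof -
    have "lk (X k * P) m1 = lk (\<Sum>m'\<in>ky P. sgl (sgl k 1 + m') (lk P m')) m1"
      using arg_cong[OF pm_sum[of P], of "\<lambda>P. lk (X k * P) m1"] by (simp add: sum_distrib_left X_mono)
    also have "\<dots> = (\<Sum>m'\<in>ky P. lk P m' when sgl k 1 + m' = m1)" by (simp add: lookup_sum lookup_single)
    also have "\<dots> = (\<Sum>m'\<in>ky P. lk P m' when k = i \<and> m' = m)"
    proof (rule sum.cong)
      fix m' assume m': "m' \<in> ky P"
      show "(lk P m' when sgl k 1 + m' = m1) = (lk P m' when k = i \<and> m' = m)"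
      proof (cases "k = i")
        case True
        then show ?thesis by (simp add: m1_def)
      next
        case False
        have "sgl k 1 + m' \<noteq> m1"
        proof
          assume "sgl k 1 + m' = m1"
          then have "lk (sgl k 1 + m') i = Suc M" using m1 by simp
          then have "lk m' i = Suc M" using False by (simp add: lookup_add lookup_single)
          then show False using big[of m'] m' by (simp add: in_keys_iff)
        qed
        then show ?thesis using False by simp
      qed
    qed simp
    also have "\<dots> = (if k = i then lk P m else 0)" using m by (simp add: when_def)
    finally show ?thesis .
  qed
  have "lk (tot K P) m1 = der V (lk P m1) + (\<Sum>k\<in>K. lk (X k * P) m1)"
    by (simp add: tot_def lookup_add dpol_simps sum_distrib_right lookup_sum)
  also have "\<dots> = lk P m" using i K big[of m1] m1 by (simp add: XP der_simps)
  finally show False using P m by (simp add: in_keys_iff)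
qed

lemma tot_inj: "finite K \<Longrightarrow> K \<noteq> {} \<Longrightarrow> tot K P = tot K P' \<Longrightarrow> P = P'"
  using tot_inject[of K "P - P'"] by (simp add: tot_diff)

lemma tot_rpar_iff: "finite K \<Longrightarrow> K \<noteq> {} \<Longrightarrow> tot K P \<in> rpar V r \<longleftrightarrow> P \<in> rpar V r"
  using tot_inject[of K "pr (1 + r) P"] by (auto simp: rpar_pr pr_tot tot_0)

end

section \<open>The differential on generators squares to zero\<close>

context boson
begin

lemma brk_unit: "brk V (scl V c 1) \<Lambda> b = 0"
proof -
  have "brk V (1 * 1) (X 0) b = em 0 1 (brk V 1 (X 0) b) + sg (0 * 0) * em 0 1 (brk V 1 (X 0) b)"
    by (rule brk_mult_left[OF one_even one_even])
  then have "brk V 1 (X 0) b = 0" by simp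
  then have "coeff (lbr V 1 b) k = 0" for k using lk_pev[of 0 "lbr V 1 b" k] by (simp add: brk_pev)
  then have "lbr V 1 b = 0" by (simp add: poly_eq_iff)
  then have "brk V 1 \<Lambda> b = 0" by (simp add: brk_def)
  then show ?thesis by (simp add: brk_scl spol_0)
qed

text \<open>In the Jacobi identity the right-hand side is a bracket with a multiple of 1, which
  vanishes.\<close>

lemma act_comm:
  assumes a: "a \<in> par H p" and b: "b \<in> par H q"
  shows "act (\<iota> a) i (act (\<iota> b) k P) = sg (p * q) * act (\<iota> b) k (act (\<iota> a) i P)"
proof (induction P rule: pol_induct)
  case (cst v)
  \<comment> \<open>The Jacobi identity is given for the variables 0 and 1; renaming moves it to
    \<open>i\<close> and \<open>k\<close>.\<close>
  define \<rho> where "\<rho> = (\<lambda>j. if j = 0 then i else if j = 1 then k else j)"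
  have ad: "additive (\<lambda>w. brk V w \<Lambda> v)" for \<Lambda> by (rule brk_additive(2))
  have "brkl V (brk V (\<iota> a) (X 0) (\<iota> b)) (X 0 + X 1) v = lft (\<lambda>w. brk V w (X 0 + X 1) v) (brk V (\<iota> a) (X 0) (\<iota> b))"
    by (simp add: brkl_def lft_def)
  also have "\<dots> = 0" by (simp add: brk_gens lft_X[OF ad] lft_cst[OF ad] brk_unit)
  finally have "act (\<iota> a) 0 (brk V (\<iota> b) (X 1) v) - sg (p * q) * act (\<iota> b) 1 (brk V (\<iota> a) (X 0) v) = 0"
    using jacobi[OF \<iota>_par[OF a] \<iota>_par[OF b], of v] by simp
  from arg_cong[OF this, of "ren \<rho>"] show ?case by (simp add: ren_act ren_brk \<rho>_def)
next
  case (X k P)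
  then show ?case by (simp add: sg_comm(2)[of "X _"])
qed (simp add: distrib_left)

lemma dc_add: "dc (\<lambda>l. w l + w' l) Q l = dc w Q l + dc w' Q l"
  by (induction l arbitrary: w w' Q) (simp_all add: distrib_left add_ac)

lemma dc_sg: "dc (\<lambda>l. sg e * w l) Q l = sg e * dc w Q l"
proof (induction l arbitrary: w Q)
  case (Cons x l)
  then show ?case by (cases e) simp_all
qed simp

lemma dc_spol: "dc (\<lambda>l. spol V c (w l)) Q l = spol V c (dc w Q l)"
  by (induction l arbitrary: w Q)
    (simp_all add: act_spol spol_add spol_0)

lemma dc_minus: "dc (\<lambda>l. - w l) Q l = - dc w Q l"
  using dc_sg[of 1 w Q l] by simp

lemma dc_diff: "dc (\<lambda>l. w l - w' l) Q l = dc w Q l - dc w' Q l"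
  using dc_add[of w "\<lambda>l. - w' l" Q l] by (simp add: dc_minus)

lemma dc_act:
  assumes "a \<in> par H p"
  shows "gdh l \<Longrightarrow> dc (\<lambda>l. act (\<iota> a) i (w l)) (Q + p) l = sg p * act (\<iota> a) i (dc w Q l)"
proof (induction l arbitrary: w Q)
  case (Cons x l)
  have "act (\<iota> (ag x)) (fst x) (act (\<iota> a) i (w l)) = sg (pt x * p) * act (\<iota> a) i (act (\<iota> (ag x)) (fst x) (w l))"
    by (rule act_comm) (use Cons.prems assms in auto)
  moreover have "dc (\<lambda>l. act (\<iota> a) i (w (x # l))) (Q + (1 + pt x) + p) l = sg p * act (\<iota> a) i (dc (\<lambda>l. w (x # l)) (Q + (1 + pt x)) l)"
    by (rule Cons.IH) (use Cons.prems in auto)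
  moreover have "Q + p + (1 + pt x) = Q + (1 + pt x) + p" by (simp add: add_ac)
  ultimately show ?case by (simp add: distrib_left) (cases p; cases "pt x"; cases Q; simp)
qed simp

text \<open>The contractions supercommute, while the differential sums them with the signs of the
  reversed parity; so the terms cancel in pairs.\<close>

lemma dc_dc: "gdh l \<Longrightarrow> dc (dc w Q) (Q + 1) l = 0"
proof (induction l arbitrary: w Q)
  case (Cons x l)
  define R where "R = Q + (1 + pt x)"
  have e: "Q + 1 + (1 + pt x) = R + 1" "Q + 1 + (1 + pt x) = Q + pt x" by (simp_all add: R_def add_ac)
  have "dc (\<lambda>l. dc w Q (x # l)) (R + 1) l
    = sg ((1 + pt x) * (Q + 1) + 1) * dc (\<lambda>l. act (\<iota> (ag x)) (fst x) (w l)) (R + 1) l + dc (dc (\<lambda>l. w (x # l)) R) (R + 1) l"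
    by (simp add: dc_add dc_sg R_def)
  also have "dc (dc (\<lambda>l. w (x # l)) R) (R + 1) l = 0" by (rule Cons.IH) (use Cons.prems in simp)
  also have "dc (\<lambda>l. act (\<iota> (ag x)) (fst x) (w l)) (R + 1) l = sg (pt x) * act (\<iota> (ag x)) (fst x) (dc w Q l)"
    unfolding e(1)[symmetric] e(2) by (rule dc_act) (use Cons.prems in auto)
  finally show ?case by (simp only: dc.simps e(1)) (cases "pt x"; cases Q; simp)
qed simp

text \<open>A contraction adds its label to the set in \<open>tot\<close>, by
  \<open>act_tot\<close>. The set \<open>K\<close> holds the labels of the arguments that the
  recursion has already passed.\<close>

lemma dc_tot: "gdh l \<Longrightarrow> finite K \<Longrightarrow> K \<inter> lb l = {} \<Longrightarrow>
    dc (\<lambda>l. tot (K \<union> lb l) (w l)) Q l = tot (K \<union> lb l) (dc w Q l)"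
proof (induction l arbitrary: w Q K)
  case (Cons x l)
  have "act (\<iota> (ag x)) (fst x) (tot (K \<union> lb l) (w l)) = tot (insert (fst x) (K \<union> lb l)) (act (\<iota> (ag x)) (fst x) (w l))"
    by (rule act_tot) (use Cons.prems in auto)
  moreover have "dc (\<lambda>l. tot (insert (fst x) K \<union> lb l) (w (x # l))) (Q + (1 + pt x)) l
    = tot (insert (fst x) K \<union> lb l) (dc (\<lambda>l. w (x # l)) (Q + (1 + pt x)) l)"
    by (rule Cons.IH) (use Cons.prems in auto)
  ultimately show ?case by (simp add: tot_add tot_sg)
qed (simp add: tot_0)

lemma dc_swap:
  assumes "gdh (u # x # l)" "\<And>l'. gdh l' \<Longrightarrow> Suc (length l') = length l \<Longrightarrow> lb l' \<subseteq> lb l \<Longrightarrow>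
     W (u # x # l') = sgx u x * W (x # u # l')"
  shows "dc W Q (u # x # l) = sgx u x * dc W Q (x # u # l)"
proof -
  define R where "R = Q + (1 + pt u) + (1 + pt x)"
  have "dc (\<lambda>l. W (u # x # l)) R l = dc (\<lambda>l. sgx u x * W (x # u # l)) R l"
  proof (rule dc_cong)
    fix l' assume l': "Suc (length l') = length l" "gdh l'" "set l' \<subseteq> set l"
    have "lb l' \<subseteq> lb l" using l'(3) by (rule image_mono)
    with l' show "W (u # x # l') = sgx u x * W (x # u # l')" by (intro assms(2)) auto
  qed (use assms in simp)
  then have 1: "dc (\<lambda>l. W (u # x # l)) R l = sgx u x * dc (\<lambda>l. W (x # u # l)) R l"
    by (simp add: dc_sg)
  have R: "Q + (1 + pt u) + (1 + pt x) = R" "Q + (1 + pt x) + (1 + pt u) = R" by (simp_all add: R_def add_ac)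
  show ?thesis by (simp only: dc.simps R 1) (cases "pt u"; cases "pt x"; cases Q; simp add: algebra_simps)
qed

end

context boson
begin

text \<open>By \<open>act_em\<close> the commutator contains the bracket \<lambda>_x (a|b) times the
  divided difference, in which the shift followed by \<open>X k\<close> = 0 puts \<lambda>_x in
  place of \<lambda>_k. The factor \<lambda>_x then undoes the division.\<close>

lemma kap_act:
  assumes xk: "x \<noteq> k" and a: "a \<in> par H p" and b: "b \<in> par H q"
  shows "act (\<iota> a) x (kap k (\<iota> b) P) = spol V (form a b) (sto k x P - ev0 k P) + sg (p * q) * kap k (\<iota> b) (act (\<iota> a) x P)"
proof -
  define R where "R = dq k P"
  note l = em_additive_left[of k "shift x k R"]
  have s: "ev0 k (shift x k R) = sto k x R" unfolding ev0_def shift_def sto_def ren_def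
    by (subst sb_sb, simp, simp, rule sb_cong[OF pon_UNIV]) (use xk in auto)
  have R: "X k * R = P - ev0 k P" using ev0_dq[of k P] by (simp add: R_def algebra_simps)
  have "act (\<iota> a) x (em k (\<iota> b) R) = lft (\<lambda>w. em k w (shift x k R)) (brk V (\<iota> a) (X x) (\<iota> b)) + sg (p * q) * em k (\<iota> b) (act (\<iota> a) x R)"
    by (rule act_em) (use xk a b \<iota>_par in auto)
  also have "lft (\<lambda>w. em k w (shift x k R)) (brk V (\<iota> a) (X x) (\<iota> b)) = X x * spol V (form a b) (shift x k R)"
    by (simp add: brk_gens lft_X[OF l] lft_cst[OF l] em_scl)
  finally have "act (\<iota> a) x (kap k (\<iota> b) P) = X x * spol V (form a b) (sto k x R) + sg (p * q) * kap k (\<iota> b) (act (\<iota> a) x P)"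
    using xk by (simp add: kap_def act_ev0 R_def[symmetric] s ev0_spol act_dq[symmetric])
  also have "X x * spol V (form a b) (sto k x R) = spol V (form a b) (sto k x (X k * R))"
    by (simp add: sto_def spol_simps)
  also have "sto k x (X k * R) = sto k x P - ev0 k P"
    unfolding R using ren_ident[OF ev0_pon[OF pon_UNIV, where P = P and k = k], of "id(k := x)"] by (simp add: sto_def)
  finally show ?thesis .
qed

section \<open>The contracting homotopy\<close>

text \<open>The Euler derivation: the sum over all generators and their derivatives of the generator
  times the partial derivative. On a product of derivatives of generators it counts the
  factors.\<close>

definition EV :: "'v \<Rightarrow> 'v" where
  "EV v = (\<Sum>j<N. \<Sum>m<degree (lbr V (\<iota> (us' ! j)) v). (der V ^^ m) (\<iota> (us ! j)) * cf (us' ! j) v (Suc m))"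

lemma EV_eq:
  assumes "\<And>j. j < N \<Longrightarrow> degree (lbr V (\<iota> (us' ! j)) v) \<le> M"
  shows "EV v = (\<Sum>j<N. \<Sum>m<M. (der V ^^ m) (\<iota> (us ! j)) * cf (us' ! j) v (Suc m))"
  unfolding EV_def by (intro sum.cong refl sum.mono_neutral_left) (use assms in \<open>auto simp: cf_bound not_less\<close>)

lemma EV_bound: "finite F \<Longrightarrow> \<exists>M. \<forall>v\<in>F. \<forall>j<N. degree (lbr V (\<iota> (us' ! j)) v) \<le> M"
proof -
  assume "finite F"
  then have "finite ((\<lambda>(v, j). degree (lbr V (\<iota> (us' ! j)) v)) ` (F \<times> {..<N}))" by simp
  then obtain M where "\<forall>x\<in>(\<lambda>(v, j). degree (lbr V (\<iota> (us' ! j)) v)) ` (F \<times> {..<N}). x \<le> M"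
    using finite_nat_set_iff_bounded_le by blast
  then show ?thesis by (intro exI[of _ M]) auto
qed

lemma EV_lin: "EV (scl V c v + w) = scl V c (EV v) + EV w"
proof -
  obtain M where M: "\<forall>u\<in>{v, w, scl V c v + w}. \<forall>j<N. degree (lbr V (\<iota> (us' ! j)) u) \<le> M"
    using EV_bound[of "{v, w, scl V c v + w}"] by auto
  have s: "scl V c (sum f I) = (\<Sum>i\<in>I. scl V c (f i))" for f :: "nat \<Rightarrow> 'v" and I
    by (rule additive.sum) (simp add: additive_def Vscl)
  show ?thesis using M by (simp add: EV_eq[of _ M] cf_add cf_scl distrib_left sum.distrib scale_mult_right s)
qed

lemma EV_add: "EV (v + w) = EV v + EV w"
  using EV_lin[of 1 v w] by (simp add: Vscl)

lemma EV_additive: "additive EV"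
  by (simp add: additive_def EV_add)

lemma EV_0 [simp]: "EV 0 = 0"
  by (rule additive.zero[OF EV_additive])

lemma EV_scl: "EV (scl V c v) = scl V c (EV v)"
  using EV_lin[of c v 0] by simp

lemma EV_mult:
  assumes v: "v \<in> par V p"
  shows "EV (v * w) = EV v * w + v * EV w"
proof -
  obtain M where M: "\<forall>u\<in>{v, w, v * w}. \<forall>j<N. degree (lbr V (\<iota> (us' ! j)) u) \<le> M"
    using EV_bound[of "{v, w, v * w}"] by auto
  have "(der V ^^ m) (\<iota> (us ! j)) * cf (us' ! j) (v * w) (Suc m)
    = (der V ^^ m) (\<iota> (us ! j)) * cf (us' ! j) v (Suc m) * w + v * ((der V ^^ m) (\<iota> (us ! j)) * cf (us' ! j) w (Suc m))"
    if j: "j < N" for j m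
  proof -
    have "(der V ^^ m) (\<iota> (us ! j)) * v = sg (pu j * p) * (v * (der V ^^ m) (\<iota> (us ! j)))"
      by (rule mult_comm[OF ders_par[OF \<iota>_par[OF us_par[OF j]]] v])
    then show ?thesis unfolding cf_mult[OF us'_par[OF j] v] distrib_left
      by (cases "pu j"; cases p; simp add: mult.assoc[symmetric])
  qed
  then show ?thesis using M by (simp add: EV_eq[of _ M] sum.distrib sum_distrib_left sum_distrib_right)
qed

text \<open>The two parts of \<open>cf_der\<close>, one with lowered index, are matched with the two
  terms of the product rule.\<close>

lemma EV_der: "EV (der V v) = der V (EV v)"
proof -
  obtain M where M: "\<forall>u\<in>{v, der V v}. \<forall>j<N. degree (lbr V (\<iota> (us' ! j)) u) \<le> M"
    using EV_bound[of "{v, der V v}"] by auto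
  have "(\<Sum>m<Suc M. (der V ^^ m) u * cf a (der V v) (Suc m)) = der V (\<Sum>m<Suc M. (der V ^^ m) u * cf a v (Suc m))"
    if a: "degree (lbr V (\<iota> a) v) \<le> M" for u a
  proof -
    have cM: "cf a v (Suc M) = 0" using a by (simp add: cf_bound)
    have "(\<Sum>m<Suc M. (der V ^^ m) u * cf a v m) = (\<Sum>m<M. (der V ^^ Suc m) u * cf a v (Suc m))"
      by (simp add: sum.lessThan_Suc_shift cf_zero del: sum.lessThan_Suc funpow.simps)
    also have "\<dots> = (\<Sum>m<Suc M. (der V ^^ Suc m) u * cf a v (Suc m))" using cM by simp
    finally show ?thesis
      by (simp add: cf_der distrib_left sum.distrib additive.sum[OF der_additive] der_mult del: sum.lessThan_Suc)
  qed
  moreover have "\<forall>u\<in>{v, der V v}. \<forall>j<N. degree (lbr V (\<iota> (us' ! j)) u) \<le> Suc M" using M by auto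
  ultimately show ?thesis
    using M by (simp add: EV_eq[of _ "Suc M"] additive.sum[OF der_additive] del: sum.lessThan_Suc)
qed

lemma EV_1: "EV 1 = 0"
  by (simp add: EV_def cf_1)

lemma EV_gen: "EV ((der V ^^ k) (\<iota> a)) = (der V ^^ k) (\<iota> a)"
proof (induction k)
  case 0
  have "\<forall>j<N. degree (lbr V (\<iota> (us' ! j)) (\<iota> a)) \<le> 1" by (simp add: lbr_gens degree_monom_le)
  then have "EV (\<iota> a) = (\<Sum>j<N. \<Sum>m<1. (der V ^^ m) (\<iota> (us ! j)) * cf (us' ! j) (\<iota> a) (Suc m))" by (intro EV_eq) auto
  also have "\<dots> = (\<Sum>j<N. scl V (form (us' ! j) a) (\<iota> (us ! j)))" by (simp add: cf_gen One_nat_def scale_mult_right)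
  also have "\<dots> = \<iota> (\<Sum>j<N. scl H (form (us' ! j) a) (us ! j))" by (simp add: additive.sum[OF \<iota>_additive] \<iota>_scl)
  also have "\<dots> = \<iota> a" using us_expand[of a] by simp
  finally show ?case by simp
qed (simp add: EV_der)

lemma EV_par: "v \<in> par V p \<Longrightarrow> EV v \<in> par V p"
proof -
  assume v: "v \<in> par V p"
  have "(der V ^^ m) (\<iota> (us ! j)) * cf (us' ! j) v (Suc m) \<in> par V p" if "j < N" for j m
    using mult_par[OF ders_par[OF \<iota>_par[OF us_par[OF that]]] cf_par[OF us'_par[OF that] v]] by simp
  then show ?thesis unfolding EV_def by (intro super_space.par_sum[OF VS]) auto
qed

lemma EV_pcomp: "pcomp V p (EV v) = EV (pcomp V p v)"
proof (rule pcomp_unique)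
  show "EV (pcomp V p v) \<in> par V p" by (rule EV_par[OF super_space.pcomp_par(1)[OF VS]])
  have "EV (v - pcomp V p v) \<in> par V (1 + p)" by (rule EV_par[OF super_space.pcomp_par(2)[OF VS]])
  then show "EV v - EV (pcomp V p v) \<in> par V (1 + p)" by (simp add: additive.diff[OF EV_additive])
qed

lemma cf_gen_scalar: "\<exists>s. cf a ((der V ^^ k) (\<iota> b)) k' = scl V s 1"
proof (induction k arbitrary: k')
  case 0
  then show ?case by (auto simp: cf_gen intro: exI[of _ 0] simp: Vscl)
next
  case (Suc k)
  show ?case
  proof (cases k')
    case (Suc k'')
    obtain s t where "cf a ((der V ^^ k) (\<iota> b)) k'' = scl V s 1" "cf a ((der V ^^ k) (\<iota> b)) (Suc k'') = scl V t 1"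
      using Suc.IH by metis
    then have "cf a ((der V ^^ Suc k) (\<iota> b)) k' = scl V s 1" by (simp add: Suc cf_der der_simps der_1 Vscl)
    then show ?thesis ..
  qed (use cf_zero[of a] in \<open>auto intro: exI[of _ 0] simp: Vscl\<close>)
qed

text \<open>A partial derivative lowers the degree in the generators by one. In the induction it
  matters that a partial derivative of a generator is a scalar, over which \<open>EV\<close> is
  linear.\<close>

lemma EV_cf:
  assumes a: "a \<in> par H p"
  shows "EV (cf a v k) = cf a (EV v) k - cf a v k"
proof (induction v rule: V_induct)
  case one
  then show ?case by (simp add: cf_1 EV_1 additive.zero[OF cf_additive])
next
  case (scl c v)
  then show ?case by (simp add: cf_scl EV_scl Vscl)
next
  case (add v w)
  then show ?case by (simp add: cf_add EV_add)
next
  case (gen r b m v)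
  define g where "g = (der V ^^ m) (\<iota> b)"
  have g: "g \<in> par V r" unfolding g_def by (rule ders_par[OF \<iota>_par[OF gen(1)]])
  have Eg: "EV (g * u) = g * u + g * EV u" for u using EV_mult[OF g] EV_gen by (simp add: g_def)
  obtain s where s: "cf a g k = scl V s 1" using cf_gen_scalar g_def by blast
  have sE: "EV (cf a g k * u) = cf a g k * EV u" for u by (simp add: s scale_mult_left EV_scl)
  have "EV (sg (p * r) * u) = sg (p * r) * EV u" for u
    by (cases p; cases r) (simp_all add: additive.minus[OF EV_additive])
  then have "EV (cf a (g * v) k) = cf a g k * EV v + sg (p * r) * (g * cf a v k + g * (cf a (EV v) k - cf a v k))"
    by (simp add: cf_mult[OF a g] EV_add sE Eg gen(2))
  also have "\<dots> = cf a (g * EV v) k" by (simp add: cf_mult[OF a g] right_diff_distrib)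
  also have "\<dots> = cf a (EV (g * v)) k - cf a (g * v) k" by (simp add: Eg cf_add)
  finally show ?case by (simp add: g_def)
qed

definition EVR :: "'v pol \<Rightarrow> 'v pol" where
  "EVR = lft (\<lambda>v. cst (EV v))"

lemma EVc_additive: "additive (\<lambda>v. cst (EV v))"
  by (rule cst_additive[OF EV_additive])

lemma EVR_simps [simp]:
  "EVR (P + Q) = EVR P + EVR Q" "EVR (cst v) = cst (EV v)" "EVR (X k * P) = X k * EVR P"
  "EVR 0 = 0" "EVR (- P) = - EVR P" "EVR (P - Q) = EVR P - EVR Q" "EVR (sum f I) = (\<Sum>i\<in>I. EVR (f i))"
  using lft_additive[OF EVc_additive]
  by (simp_all add: EVR_def additive.add additive.zero additive.minus additive.diff additive.sum
      lft_cst[OF EVc_additive] lft_X[OF EVc_additive])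

lemma lk_EVR: "lk (EVR P) m = EV (lk P m)"
  unfolding EVR_def by (rule lk_lft_cst[OF EV_additive])

lemma EVR_spol: "EVR (spol V c P) = spol V c (EVR P)"
  by (rule poly_mapping_eqI) (simp add: lk_EVR spol_simps EV_scl)

lemma EVR_pr: "pr p (EVR P) = EVR (pr p P)"
  by (rule poly_mapping_eqI) (simp add: lk_EVR pr_simps EV_pcomp)

lemma EVR_ren: "ren \<rho> (EVR P) = EVR (ren \<rho> P)"
  by (induction P rule: pol_induct) simp_all

text \<open>Division lowers each power of \<lambda> in the bracket by one, and the exponential of
  u_j followed by \<lambda> = 0 turns the m-th power of \<lambda> into the m-th derivative of u_j:
  the Euler derivation results.\<close>

lemma kap_brk: "(\<Sum>j<N. kap k (\<iota> (us ! j)) (brk V (\<iota> (us' ! j)) (X k) v)) = cst (EV v)"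
proof -
  obtain M where M: "\<forall>u\<in>{v}. \<forall>j<N. degree (lbr V (\<iota> (us' ! j)) u) \<le> M" using EV_bound[of "{v}"] by auto
  have "kap k (\<iota> (us ! j)) (brk V (\<iota> (us' ! j)) (X k) v) = cst (\<Sum>m<M. (der V ^^ m) (\<iota> (us ! j)) * cf (us' ! j) v (Suc m))"
    if "j < N" for j
  proof -
    have "degree (lbr V (\<iota> (us' ! j)) v) \<le> M" using M that by simp
    then show ?thesis
      by (simp add: brk_cf kap_def em_sum em_ev0_power additive.sum[OF cst_additive[of "\<lambda>v. v"]] additive_def)
  qed
  then show ?thesis using M by (simp add: EV_eq[of _ M] additive.sum[OF cst_additive[of "\<lambda>v. v"]] additive_def)
qed

lemma EVR_kap: "P \<in> pon A \<Longrightarrow> k \<notin> A \<Longrightarrow> (\<Sum>j<N. kap k (\<iota> (us ! j)) (act (\<iota> (us' ! j)) k P)) = EVR P"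
proof (induction P rule: pol_induct_on)
  case (cst v)
  show ?case by (simp add: kap_brk)
next
  case (X i P)
  then have "i \<noteq> k" by auto
  then show ?case using X by (simp add: kap_X sum_distrib_left[symmetric])
next
  case (add P P')
  then show ?case by (simp add: sum.distrib)
qed

text \<open>The label \<open>k\<close> is a parameter because it has to stay the same while the
  recursion of \<open>dc\<close> shortens the list; \<open>Kf\<close> later chooses it from the
  list.\<close>

definition Kop :: "nat \<Rightarrow> bit \<Rightarrow> ('h item list \<Rightarrow> 'v pol) \<Rightarrow> 'h item list \<Rightarrow> 'v pol" where
  "Kop k Q W l = (\<Sum>j<N. sg ((1 + pu j) * Q + 1) * kap k (\<iota> (us ! j)) (W ((k, pu j, us' ! j) # l)))"

text \<open>By induction on the arguments still to be contracted. Contracting the inserted vector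
  yields the Euler derivation; contracting another argument commutes with the insertion up to the
  term in \<open>kap_act\<close>, which contributes the difference for its variable.\<close>

lemma homotopy_pre:
  assumes w: "lch n q w"
  shows "gdh (pre @ l) \<Longrightarrow> length (pre @ l) = n \<Longrightarrow> k \<notin> lb (pre @ l) \<Longrightarrow>
    dc (Kop k Q (\<lambda>m. w (pre @ m))) (Q + 1) l + Kop k (Q + 1) (dc (\<lambda>m. w (pre @ m)) Q) l
    = EVR (w (pre @ l)) + (\<Sum>i\<in>lb l. w (pre @ l) - ev0 i (w (pre @ l)))"
proof (induction l arbitrary: pre Q)
  case Nil
  \<comment> \<open>Only the inserted vector is left to contract.\<close>
  have "w pre \<in> pon (lb pre)" by (rule lco_pon[OF w]) (use Nil in auto)
  then have "(\<Sum>j<N. kap k (\<iota> (us ! j)) (act (\<iota> (us' ! j)) k (w pre))) = EVR (w pre)"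
    by (rule EVR_kap) (use Nil in auto)
  then show ?case by (simp add: Kop_def)
next
  case (Cons x l)
  obtain i p a where x: "x = (i, p, a)" by (cases x)
  have a: "a \<in> par H p" using Cons.prems x by simp
  have ik: "i \<noteq> k" using Cons.prems x by auto
  define W where "W m = w (pre @ m)" for m
  define Wx where "Wx m = w ((pre @ [x]) @ m)" for m
  define y where "y j = W ((k, pu j, us' ! j) # l)" for j
  have sw: "W ((k, pu j, us' ! j) # x # l') = sg ((1 + pu j) * (1 + p)) * W (x # (k, pu j, us' ! j) # l')"
    if "j < N" "gdh l'" "Suc (length l') = length l" "lb l' \<subseteq> lb l" for j l'
  proof -
    have "i \<notin> lb l'" "k \<notin> lb l'" "lb pre \<inter> lb l' = {}"
    proof -
      have d: "i \<notin> lb l" "k \<notin> lb l" "lb pre \<inter> lb l = {}" using Cons.prems x by auto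
      show "i \<notin> lb l'" by (rule contra_subsetD[OF that(4) d(1)])
      show "k \<notin> lb l'" by (rule contra_subsetD[OF that(4) d(2)])
      show "lb pre \<inter> lb l' = {}" using that(4) d(3) by (metis Int_mono order_refl subset_empty)
    qed
    then have "gdh (pre @ (k, pu j, us' ! j) # x # l')" "length (pre @ (k, pu j, us' ! j) # x # l') = n"
      using that Cons.prems us'_par[of j] x by auto
    from lco_swap[OF w this] show ?thesis by (simp add: W_def x)
  qed
  have IH: "dc (Kop k (Q + (1 + p)) Wx) (Q + (1 + p) + 1) l + Kop k (Q + (1 + p) + 1) (dc Wx (Q + (1 + p))) l
    = EVR (w (pre @ x # l)) + (\<Sum>i\<in>lb l. w (pre @ x # l) - ev0 i (w (pre @ x # l)))"
    unfolding Wx_def[abs_def] using Cons.IH[of "pre @ [x]" "Q + (1 + p)"] Cons.prems by simp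
  have c1: "dc (\<lambda>l'. Kop k Q W (x # l')) R l = dc (Kop k (Q + (1 + p)) Wx) R l" for R
  proof (rule dc_cong)
    fix l' assume l': "Suc (length l') = length l" "gdh l'" "set l' \<subseteq> set l"
    have f: "lb l' \<subseteq> lb l" using l'(3) by (rule image_mono)
    show "Kop k Q W (x # l') = Kop k (Q + (1 + p)) Wx l'" unfolding Kop_def
    proof (intro sum.cong refl)
      fix j assume "j \<in> {..<N}"
      then have "W ((k, pu j, us' ! j) # x # l') = sg ((1 + pu j) * (1 + p)) * Wx ((k, pu j, us' ! j) # l')"
        using sw[of j l'] l' f by (simp add: W_def Wx_def)
      then show "sg ((1 + pu j) * Q + 1) * kap k (\<iota> (us ! j)) (W ((k, pu j, us' ! j) # x # l'))
        = sg ((1 + pu j) * (Q + (1 + p)) + 1) * kap k (\<iota> (us ! j)) (Wx ((k, pu j, us' ! j) # l'))"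
        by (cases "pu j"; cases Q; cases p; simp)
    qed
  qed (use Cons.prems in simp)
  \<comment> \<open>The inserted vector stands first; it is exchanged with \<open>x\<close>, so that
    the contraction of \<open>x\<close> splits off and the induction hypothesis covers the
    rest.\<close>
  have c2: "dc W Q ((k, pu j, us' ! j) # x # l) = sg ((1 + pu j) * (1 + p)) *
      (sg ((1 + p) * (Q + 1) + 1) * act (\<iota> a) i (y j) + dc Wx (Q + (1 + p)) ((k, pu j, us' ! j) # l))" if j: "j < N" for j
  proof -
    have "dc W Q ((k, pu j, us' ! j) # x # l) = sg ((1 + pt (k, pu j, us' ! j)) * (1 + pt x)) * dc W Q (x # (k, pu j, us' ! j) # l)"
    proof (rule dc_swap)
      show "gdh ((k, pu j, us' ! j) # x # l)" using Cons.prems us'_par[OF j] by auto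
      fix l' assume "gdh l'" "Suc (length l') = length l" "lb l' \<subseteq> lb l"
      then show "W ((k, pu j, us' ! j) # x # l') = sg ((1 + pt (k, pu j, us' ! j)) * (1 + pt x)) * W (x # (k, pu j, us' ! j) # l')"
        using sw[OF j] by (simp add: x)
    qed
    then show ?thesis by (simp only: dc.simps x) (simp add: x y_def W_def Wx_def[abs_def])
  qed
  let ?R = "\<lambda>j. sg ((1 + pu j) * (Q + 1) + 1) * (sg ((1 + pu j) * (1 + p)) * (sg ((1 + p) * (Q + 1) + 1) * kap k (\<iota> (us ! j)) (act (\<iota> a) i (y j))))"
  have ka: "act (\<iota> a) i (kap k (\<iota> (us ! j)) (y j)) = spol V (form a (us ! j)) (sto k i (y j) - ev0 k (y j))
      + sg (p * pu j) * kap k (\<iota> (us ! j)) (act (\<iota> a) i (y j))" if "j < N" for j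
    by (rule kap_act[OF ik a us_par[OF that]])
  have T1: "dc (Kop k Q W) (Q + 1) (x # l) = sg ((1 + p) * Q + 1) * act (\<iota> a) i (Kop k Q W l)
      + dc (Kop k (Q + (1 + p)) Wx) (Q + (1 + p) + 1) l" by (simp add: x c1[unfolded x] add_ac)
  have t2: "sg ((1 + pu j) * (Q + 1) + 1) * kap k (\<iota> (us ! j)) (dc W Q ((k, pu j, us' ! j) # x # l))
    = ?R j
      + sg ((1 + pu j) * (Q + (1 + p) + 1) + 1) * kap k (\<iota> (us ! j)) (dc Wx (Q + (1 + p)) ((k, pu j, us' ! j) # l))"
    if "j < N" for j
  proof -
    define D where "D = dc Wx (Q + (1 + p)) ((k, pu j, us' ! j) # l)"
    show ?thesis unfolding c2[OF that] D_def[symmetric] by (cases p; cases Q; cases "pu j"; simp)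
  qed
  have T2: "Kop k (Q + 1) (dc W Q) (x # l) = (\<Sum>j<N. ?R j)
      + Kop k (Q + (1 + p) + 1) (dc Wx (Q + (1 + p))) l" unfolding Kop_def sum.distrib[symmetric]
    by (intro sum.cong refl t2) simp
  \<comment> \<open>The contraction of \<open>x\<close> occurs outside and inside
    \<open>kap\<close>, and by \<open>ka\<close> only the commutator survives. Basis vectors of a
    parity other than \<open>p\<close> drop out since the form is even.\<close>
  have T3: "sg ((1 + p) * Q + 1) * act (\<iota> a) i (Kop k Q W l) + (\<Sum>j<N. ?R j)
     = (\<Sum>j | j < N \<and> pu j = p. spol V (form a (us ! j)) (sto k i (y j) - ev0 k (y j)))"
  proof -
    have "sg ((1 + p) * Q + 1) * act (\<iota> a) i (Kop k Q W l) + (\<Sum>j<N. ?R j)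
      = (\<Sum>j<N. sg ((1 + p) * Q + 1) * (sg ((1 + pu j) * Q + 1) * act (\<iota> a) i (kap k (\<iota> (us ! j)) (y j)))
        + ?R j)" by (simp add: Kop_def act_sum sum_distrib_left sum.distrib y_def)
    also have "\<dots> = (\<Sum>j<N. sg ((1 + p) * Q + (1 + pu j) * Q) * spol V (form a (us ! j)) (sto k i (y j) - ev0 k (y j)))"
    proof (intro sum.cong refl)
      fix j assume "j \<in> {..<N}"
      then have j: "j < N" by simp
      show "sg ((1 + p) * Q + 1) * (sg ((1 + pu j) * Q + 1) * act (\<iota> a) i (kap k (\<iota> (us ! j)) (y j)))
        + ?R j
       = sg ((1 + p) * Q + (1 + pu j) * Q) * spol V (form a (us ! j)) (sto k i (y j) - ev0 k (y j))"
        unfolding ka[OF j] by (cases p; cases Q; cases "pu j"; simp)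
    qed
    also have "\<dots> = (\<Sum>j | j < N \<and> pu j = p. spol V (form a (us ! j)) (sto k i (y j) - ev0 k (y j)))"
      by (rule sum.mono_neutral_cong_right) (auto simp: form_us(2)[OF a] spol_lin)
    finally show ?thesis .
  qed
  \<comment> \<open>Summing with the coefficients \<open>form a (us ! j)\<close> puts
    \<open>a\<close> itself into the slot \<open>k\<close>; renaming \<open>k\<close> to
    \<open>i\<close> then restores the original argument list.\<close>
  define L where "L = pre @ (k, p, a) # l"
  have L: "gdh L" "length L = n" using Cons.prems x a by (auto simp: L_def)
  have iL: "i \<notin> lb L" using Cons.prems x ik by (auto simp: L_def)
  have wL: "w L = (\<Sum>j | j < N \<and> pu j = p. spol V (form a (us ! j)) (y j))" unfolding L_def y_def W_def
    by (subst lco_expand(2)[OF w]) (use L in \<open>auto simp: L_def intro!: sum.cong\<close>)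
  have st: "sto k i (spol V c P) = spol V c (sto k i P)" "sto k i (sum f I) = (\<Sum>j\<in>I. sto k i (f j))" for c P f and I :: "nat set"
    by (simp_all add: sto_def ren_spol)
  have T4: "(\<Sum>j | j < N \<and> pu j = p. spol V (form a (us ! j)) (sto k i (y j) - ev0 k (y j))) = sto k i (w L) - ev0 k (w L)"
    by (simp add: wL st ev0_spol spol_diff sum_subtractf)
  have inj: "inj_on (id(k := i)) (lb L)" using iL by (intro inj_on_fun_updI) auto
  have "rl (id(k := i)) pre = pre" "rl (id(k := i)) l = l"
  proof -
    have "k \<notin> lb pre" "k \<notin> lb l" using Cons.prems by auto
    then have *: "j \<in> lb pre \<union> lb l \<Longrightarrow> (id(k := i)) j = j" for j by auto
    show "rl (id(k := i)) pre = pre" by (rule rl_ident, rule *, erule UnI1)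
    show "rl (id(k := i)) l = l" by (rule rl_ident, rule *, erule UnI2)
  qed
  then have T5: "sto k i (w L) = w (pre @ x # l)" using lco_rl[OF w L inj] by (simp add: sto_def L_def x)
  have wp: "w L \<in> pon (lb L)" by (rule lco_pon[OF w L])
  \<comment> \<open>Setting the variable of the slot to zero does not depend on its name.\<close>
  have T6: "ev0 k (w L) = ev0 i (w (pre @ x # l))"
  proof -
    have e: "(X(k := 0)) j = sb (X(i := 0)) (X ((id(k := i)) j))" if "j \<in> lb L" for j
      using that iL by (cases "j = k") auto
    have "ev0 i (sto k i (w L)) = sb (\<lambda>j. sb (X(i := 0)) (X ((id(k := i)) j))) (w L)"
      unfolding ev0_def sto_def ren_def by (rule sb_sb) auto
    also have "\<dots> = ev0 k (w L)" unfolding ev0_def by (rule sb_cong[OF wp _ _ e[symmetric]]) auto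
    finally show ?thesis using T5 by simp
  qed
  have "dc (Kop k Q W) (Q + 1) (x # l) + Kop k (Q + 1) (dc W Q) (x # l)
    = (sg ((1 + p) * Q + 1) * act (\<iota> a) i (Kop k Q W l) + (\<Sum>j<N. ?R j))
     + (dc (Kop k (Q + (1 + p)) Wx) (Q + (1 + p) + 1) l + Kop k (Q + (1 + p) + 1) (dc Wx (Q + (1 + p))) l)"
    unfolding T1 T2 by (simp add: add_ac)
  also have "\<dots> = (w (pre @ x # l) - ev0 i (w (pre @ x # l))) + (EVR (w (pre @ x # l)) + (\<Sum>i\<in>lb l. w (pre @ x # l) - ev0 i (w (pre @ x # l))))"
    unfolding T3 T4 T5 T6 IH by simp
  finally show ?case using Cons.prems x by (simp add: W_def[abs_def] add_ac)
qed

end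

definition fresh :: "'a item list \<Rightarrow> nat" where
  "fresh l = Suc (Max (insert 0 (lb l)))"

lemma fresh_notin: "fresh l \<notin> lb l"
proof
  assume "fresh l \<in> lb l"
  then have "fresh l \<le> Max (insert 0 (lb l))" by (intro Max_ge) auto
  then show False by (simp add: fresh_def)
qed

section \<open>The homotopy with a fresh label, and the Euler operator\<close>

context boson
begin

text \<open>\<open>kap\<close> sets the variable \<open>k\<close> to zero after dividing by it, so a
  renaming of \<open>k\<close> does not affect the result.\<close>

lemma Kop_indep:
  assumes w: "lch (Suc n) q w" and l: "gdh l" "length l = n" and k: "k \<notin> lb l" "k' \<notin> lb l"
  shows "Kop k' Q w l = Kop k Q w l"
  unfolding Kop_def
proof (intro sum.cong refl)
  fix j assume "j \<in> {..<N}"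
  then have j: "j < N" by simp
  define L where "L = (k, pu j, us' ! j) # l"
  have L: "gdh L" "length L = Suc n" using l k us'_par[OF j] by (auto simp: L_def)
  have wL: "w L \<in> pon (lb L)" by (rule lco_pon[OF w L])
  define \<rho> where "\<rho> = (id :: nat \<Rightarrow> nat)(k := k')"
  have inj: "inj_on \<rho> (lb L)"
  proof (cases "k = k'")
    case True
    then show ?thesis by (auto simp: \<rho>_def inj_on_def)
  next
    case False
    then show ?thesis unfolding \<rho>_def using k by (intro inj_on_fun_updI) (auto simp: L_def)
  qed
  have id: "rl \<rho> l = l"
  proof (rule rl_ident)
    fix i assume "i \<in> lb l"
    then have "i \<noteq> k" using k by metis
    then show "\<rho> i = i" by (simp add: \<rho>_def)
  qed
  have 1: "w ((k', pu j, us' ! j) # l) = ren \<rho> (w L)"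
    using lco_rl[OF w L inj] by (simp add: L_def id) (simp add: \<rho>_def)
  have "insert k (lb L) = lb L" by (auto simp: L_def)
  then have "ren \<rho> (kap k (\<iota> (us ! j)) (w L)) = kap (\<rho> k) (\<iota> (us ! j)) (ren \<rho> (w L))"
    using kap_ren[OF wL, of \<rho> k] inj by simp
  moreover have "ren \<rho> (kap k (\<iota> (us ! j)) (w L)) = kap k (\<iota> (us ! j)) (w L)"
    by (rule ren_ident[OF kap_pon[OF wL]]) (simp add: \<rho>_def)
  ultimately show "sg ((1 + pu j) * Q + 1) * kap k' (\<iota> (us ! j)) (w ((k', pu j, us' ! j) # l)) =
    sg ((1 + pu j) * Q + 1) * kap k (\<iota> (us ! j)) (w ((k, pu j, us' ! j) # l))"
    by (simp add: 1 L_def[symmetric]) (simp add: \<rho>_def)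
qed

definition Kf :: "bit \<Rightarrow> ('h item list \<Rightarrow> 'v pol) \<Rightarrow> 'h item list \<Rightarrow> 'v pol" where
  "Kf Q w l = Kop (fresh l) Q w l"

lemma Kf_lco:
  assumes w: "lch (Suc n) q w"
  shows "lch n (q + 1) (Kf q w)"
  unfolding lco_def
proof (intro conjI allI impI)
  fix l assume l: "gdh l \<and> length l = n"
  define k where "k = fresh l"
  have k: "k \<notin> lb l" by (simp add: k_def fresh_notin)
  have L: "gdh ((k, pu j, us' ! j) # l)" "length ((k, pu j, us' ! j) # l) = Suc n" if "j < N" for j
    using l k us'_par[OF that] by auto
  show "Kf q w l \<in> pon (lb l)" unfolding Kf_def k_def[symmetric] Kop_def
  proof (intro pon_sum pon_mult pon_sg)
    fix j assume "j \<in> {..<N}"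
    then have j: "j < N" by simp
    show "kap k (\<iota> (us ! j)) (w ((k, pu j, us' ! j) # l)) \<in> pon (lb l)"
      by (rule pon_mono[OF kap_pon[OF lco_pon[OF w L[OF j]]]]) auto
  qed
  show "Kf q w l \<in> rpar V (1 + (q + 1) + pbs l)" unfolding Kf_def k_def[symmetric] Kop_def
  proof (intro rpar_sum rpar_IP IP_sg)
    fix j assume "j \<in> {..<N}"
    then have j: "j < N" by simp
    have "kap k (\<iota> (us ! j)) (w ((k, pu j, us' ! j) # l)) \<in> rpar V (pu j + (1 + q + pbs ((k, pu j, us' ! j) # l)))"
      by (rule kap_rpar[OF \<iota>_par[OF us_par[OF j]] lco_rpar[OF w L[OF j]]])
    moreover have "pu j + (1 + q + pbs ((k, pu j, us' ! j) # l)) = 1 + (q + 1) + pbs l"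
      by (cases "pu j"; simp add: add_ac)
    ultimately show "kap k (\<iota> (us ! j)) (w ((k, pu j, us' ! j) # l)) \<in> rpar V (1 + (q + 1) + pbs l)" by (simp only:)
  qed
  fix \<rho> :: "nat \<Rightarrow> nat" assume inj: "inj_on \<rho> (lb l)"
  define k' where "k' = fresh (rl \<rho> l)"
  have k': "k' \<notin> \<rho> ` lb l" using fresh_notin[of "rl \<rho> l"] by (simp add: k'_def rl_set)
  \<comment> \<open>Extends the given renaming by sending the fresh label of \<open>l\<close> to
    that of the renamed list.\<close>
  define \<rho>' where "\<rho>' = \<rho>(k := k')"
  have inj': "inj_on \<rho>' (insert k (lb l))" using inj k k' by (auto simp: \<rho>'_def inj_on_def)
  have rl': "rl \<rho>' l = rl \<rho> l"
  proof (rule rl_cong)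
    fix i assume "i \<in> lb l"
    then have "i \<noteq> k" using k by metis
    then show "\<rho>' i = \<rho> i" by (simp add: \<rho>'_def)
  qed
  show "Kf q w (rl \<rho> l) = ren \<rho> (Kf q w l)" unfolding Kf_def k_def[symmetric] k'_def[symmetric] Kop_def ren_simps
  proof (intro sum.cong refl)
    fix j assume "j \<in> {..<N}"
    then have j: "j < N" by simp
    define L where "L = (k, pu j, us' ! j) # l"
    have wL: "w L \<in> pon (lb L)" unfolding L_def by (rule lco_pon[OF w L[OF j]])
    have setL: "insert k (lb L) = insert k (lb l)" "lb L = insert k (lb l)" by (auto simp: L_def)
    have "w (rl \<rho>' L) = ren \<rho>' (w L)" unfolding L_def by (rule lco_rl[OF w L[OF j]]) (use inj' in simp)
    then have 1: "w ((k', pu j, us' ! j) # rl \<rho> l) = ren \<rho>' (w L)" by (simp add: L_def rl') (simp add: \<rho>'_def)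
    have "ren \<rho>' (kap k (\<iota> (us ! j)) (w L)) = kap (\<rho>' k) (\<iota> (us ! j)) (ren \<rho>' (w L))"
      by (rule kap_ren[OF wL]) (use inj' setL in simp)
    moreover have "ren \<rho>' (kap k (\<iota> (us ! j)) (w L)) = ren \<rho> (kap k (\<iota> (us ! j)) (w L))"
      by (rule ren_cong[OF kap_pon[OF wL]]) (simp add: \<rho>'_def)
    ultimately show "sg ((1 + pu j) * q + 1) * kap k' (\<iota> (us ! j)) (w ((k', pu j, us' ! j) # rl \<rho> l)) =
      sg ((1 + pu j) * q + 1) * ren \<rho> (kap k (\<iota> (us ! j)) (w ((k, pu j, us' ! j) # l)))"
      by (simp add: 1 L_def[symmetric]) (simp add: \<rho>'_def)
  qed
next
  fix l1 x z l2 assume g: "gdh (l1 @ x # z # l2) \<and> length (l1 @ x # z # l2) = n"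
  define k where "k = fresh (l1 @ x # z # l2)"
  have k: "k \<notin> lb (l1 @ x # z # l2)" unfolding k_def by (rule fresh_notin)
  have k': "fresh (l1 @ z # x # l2) = k" by (simp add: k_def fresh_def insert_commute)
  have "w ((k, pu j, us' ! j) # l1 @ x # z # l2) = sgx x z * w ((k, pu j, us' ! j) # l1 @ z # x # l2)"
    if "j < N" for j using lco_swap[OF w, of "(k, pu j, us' ! j) # l1" x z l2] g k us'_par[OF that] by simp
  then show "Kf q w (l1 @ x # z # l2) = sgx x z * Kf q w (l1 @ z # x # l2)"
    unfolding Kf_def k_def[symmetric] k' Kop_def sum_distrib_left
    by (intro sum.cong refl) (cases "pt x"; cases "pt z"; simp)
next
  fix i p a b c l assume g: "gdh ((i, p, a) # l) \<and> gdh ((i, p, b) # l) \<and> Suc (length l) = n"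
  define k where "k = fresh ((i, p, a) # l)"
  have k: "k \<notin> lb ((i, p, a) # l)" unfolding k_def by (rule fresh_notin)
  have k': "fresh ((i, p, b) # l) = k" "fresh ((i, p, scl H c a + b) # l) = k" by (simp_all add: k_def fresh_def)
  have "w ((k, pu j, us' ! j) # (i, p, scl H c a + b) # l) = spol V c (w ((k, pu j, us' ! j) # (i, p, a) # l)) + w ((k, pu j, us' ! j) # (i, p, b) # l)"
    if "j < N" for j
    using lco_lin[OF w, of "[(k, pu j, us' ! j)]" i p a l b c] g k us'_par[OF that] by (simp add: Hpar)
  then show "Kf q w ((i, p, scl H c a + b) # l) = spol V c (Kf q w ((i, p, a) # l)) + Kf q w ((i, p, b) # l)"
    by (simp add: Kf_def k_def[symmetric] k' Kop_def kap_spol distrib_left sum.distrib spol_sum)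
qed

text \<open>\<open>P - ev0 i P\<close> retains the monomials in which \<open>X i\<close> occurs,
  whatever the exponent; so each occurring variable counts once.\<close>

definition Eop :: "nat set \<Rightarrow> 'v pol \<Rightarrow> 'v pol" where
  "Eop A P = EVR P + (\<Sum>i\<in>A. P - ev0 i P)"

lemma homotopy:
  assumes w: "lch (Suc n) q w" and d: "\<And>l. gdh l \<Longrightarrow> length l = Suc (Suc n) \<Longrightarrow> dc w q l = 0"
    and l: "gdh l" "length l = Suc n"
  shows "dc (Kf q w) (q + 1) l = Eop (lb l) (w l)"
proof -
  define k where "k = fresh l"
  have k: "k \<notin> lb l" by (simp add: k_def fresh_notin)
  have "dc (Kop k q w) (q + 1) l + Kop k (q + 1) (dc w q) l = Eop (lb l) (w l)"
    using homotopy_pre[OF w, of "[]" l k q] l k by (simp add: Eop_def)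
  moreover have "Kop k (q + 1) (dc w q) l = 0" unfolding Kop_def
  proof (rule sum.neutral, rule ballI)
    fix j assume "j \<in> {..<N}"
    then have "dc w q ((k, pu j, us' ! j) # l) = 0" by (intro d) (use l k us'_par in auto)
    then show "sg ((1 + pu j) * (q + 1) + 1) * kap k (\<iota> (us ! j)) (dc w q ((k, pu j, us' ! j) # l)) = 0" by simp
  qed
  moreover have "dc (Kop k q w) (q + 1) l = dc (Kf q w) (q + 1) l"
  proof (rule dc_cong[OF l(1)])
    fix l' assume l': "Suc (length l') = length l" "gdh l'" "set l' \<subseteq> set l"
    have f: "lb l' \<subseteq> lb l" using l'(3) by (rule image_mono)
    show "Kop k q w l' = Kf q w l'" unfolding Kf_def
    proof (rule Kop_indep[OF w l'(2) _ fresh_notin])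
      show "k \<notin> lb l'" by (rule contra_subsetD[OF f k])
    qed (use l' l in auto)
  qed
  ultimately show ?thesis by simp
qed

text \<open>In degree 0 the homotopy formula has no term \<open>dc\<close> of \<open>Kop\<close>, so
  the Euler operator kills the cocycle outright.\<close>

lemma homotopy0:
  assumes w: "lch 0 q w" and d: "\<And>l. gdh l \<Longrightarrow> length l = 1 \<Longrightarrow> dc w q l = 0"
  shows "Eop {} (w []) = 0"
proof -
  have "Kop 0 (q + 1) (dc w q) [] = 0" unfolding Kop_def
  proof (rule sum.neutral, rule ballI)
    fix j assume "j \<in> {..<N}"
    then have "dc w q [(0, pu j, us' ! j)] = 0" by (intro d) (use us'_par in auto)
    then show "sg ((1 + pu j) * (q + 1) + 1) * kap 0 (\<iota> (us ! j)) (dc w q [(0, pu j, us' ! j)]) = 0" by simp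
  qed
  then show ?thesis using homotopy_pre[OF w, of "[]" "[]" 0 q] by (simp add: Eop_def)
qed

lemma Eop_add: "Eop A (P + Q) = Eop A P + Eop A Q"
  by (simp add: Eop_def sum.distrib[symmetric] algebra_simps)

lemma Eop_additive: "additive (Eop A)"
  by (simp add: additive_def Eop_add)

lemma Eop_spol: "Eop A (spol V c P) = spol V c (Eop A P)"
  by (simp add: Eop_def EVR_spol ev0_spol spol_add spol_diff
      spol_sum)

lemma Eop_const: "Eop A (cst (scl V c 1)) = 0"
  by (simp add: Eop_def EV_scl EV_1 Vscl)

lemma Eop_ren: "P \<in> pon A \<Longrightarrow> inj_on \<rho> A \<Longrightarrow> ren \<rho> (Eop A P) = Eop (\<rho> ` A) (ren \<rho> P)"
  by (simp add: Eop_def EVR_ren sum.reindex) (intro sum.cong refl, simp add: ev0_ren insert_absorb)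

lemma ev0_pr: "pr p (ev0 k P) = ev0 k (pr p P)"
  by (induction P rule: pol_induct) (simp_all add: pr_simps additive.zero[OF pr_additive])

lemma Eop_pr: "pr p (Eop A P) = Eop A (pr p P)"
  by (simp add: Eop_def EVR_pr ev0_pr additive.sum[OF pr_additive] additive.add[OF pr_additive] additive.diff[OF pr_additive])

lemma EVR_act:
  assumes a: "a \<in> par H p"
  shows "P \<in> pon A \<Longrightarrow> i \<notin> A \<Longrightarrow> EVR (act (\<iota> a) i P) = act (\<iota> a) i (EVR P) - act (\<iota> a) i P"
proof (induction P rule: pol_induct_on)
  case (cst v)
  have l: "lk (brk V (\<iota> a) (X i) u) m = (if m \<in> range (sgl i) then cf a u (lk m i) else 0)" for u m
  proof (cases "m \<in> range (sgl i)")
    case True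
    then show ?thesis by (auto simp: cf_brk[symmetric])
  next
    case False
    then show ?thesis
    proof -
      have "sgl i k \<noteq> m" for k using False by auto
      then show ?thesis using False by (simp add: brk_def lk_X_power lookup_sum lookup_single)
    qed
  qed
  show ?case by (rule poly_mapping_eqI) (simp add: lk_EVR lookup_minus l EV_cf[OF a])
next
  case (X k P)
  then show ?case by (simp add: right_diff_distrib)
next
  case (add P P')
  then show ?case by simp
qed

lemma ev0_act: "P \<in> pon A \<Longrightarrow> i \<notin> A \<Longrightarrow> ev0 i (act (\<iota> a) i P) = 0"
proof (induction P rule: pol_induct_on)
  case (cst v)
  show ?case by (simp add: brk_cf[OF order_refl])
qed auto

text \<open>A contraction lowers the degree in the generators by one, and since its values are
  divisible by the new variable, it raises the number of occurring variables by one.\<close>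

lemma Eop_act:
  assumes a: "a \<in> par H p" and P: "P \<in> pon A" and i: "i \<notin> A" and A: "finite A"
  shows "Eop (insert i A) (act (\<iota> a) i P) = act (\<iota> a) i (Eop A P)"
proof -
  have "(\<Sum>k\<in>A. act (\<iota> a) i P - ev0 k (act (\<iota> a) i P)) = act (\<iota> a) i (\<Sum>k\<in>A. P - ev0 k P)"
    unfolding act_sum by (intro sum.cong refl) (metis act_diff act_ev0 i)
  then show ?thesis using i A by (simp add: Eop_def EVR_act[OF a P i] ev0_act[OF P i])
qed

section \<open>Inverting the Euler operator off the constants\<close>

definition eig :: "nat set \<Rightarrow> nat \<Rightarrow> 'v pol \<Rightarrow> bool" where
  "eig A e P \<longleftrightarrow> P \<in> pon A \<and> Eop A P = spol V (of_nat e) P"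

text \<open>Requiring \<open>g\<close> to be a finite sum of eigenvectors with positive eigenvalues
  makes it unique. The relation is thus the graph of a linear map, the inverse of the Euler operator
  on the complement of the constants, and whatever holds for \<open>P\<close> passes to
  \<open>g\<close> by uniqueness.\<close>

definition dec :: "nat set \<Rightarrow> 'v pol \<Rightarrow> 'v pol \<Rightarrow> bool" where
  "dec A P g \<longleftrightarrow> (\<exists>c M f. P = cst (scl V c 1) + Eop A g \<and> g = (\<Sum>e<M. f e) \<and>
     (\<forall>e. eig A (Suc e) (f e)) \<and> (\<forall>e\<ge>M. f e = 0))"

lemma eig_0: "eig A e 0"
  by (simp add: eig_def additive.zero[OF Eop_additive] spol_0)

lemma eig_add: "eig A e P \<Longrightarrow> eig A e Q \<Longrightarrow> eig A e (P + Q)"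
  by (simp add: eig_def Eop_add spol_add)

lemma eig_spol: "eig A e P \<Longrightarrow> eig A e (spol V c P)"
  by (simp add: eig_def Eop_spol spol_lin mult.commute spol_pon)

lemma spol_eq_0: "c \<noteq> 0 \<Longrightarrow> spol V c P = 0 \<Longrightarrow> P = 0"
  by (metis spol_0 spol_lin(2,3) left_inverse)

lemma eig_indep: "(\<And>e. e < M \<Longrightarrow> eig A e (P e)) \<Longrightarrow> (\<Sum>e<M. P e) = 0 \<Longrightarrow> e < M \<Longrightarrow> P e = 0"
proof (induction M arbitrary: P e)
  case (Suc M)
  \<comment> \<open>Subtracting the last eigenvalue from the Euler operator removes the last summand
    and multiplies the others by nonzero numbers.\<close>
  define P' where "P' e = spol V (of_nat e - of_nat M) (P e)" for e
  have "Eop A (\<Sum>e<Suc M. P e) - spol V (of_nat M) (\<Sum>e<Suc M. P e) = (\<Sum>e<Suc M. P' e)" using Suc.prems(1)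
    by (simp only: additive.sum[OF Eop_additive] spol_sum sum_subtractf[symmetric])
      (intro sum.cong refl, simp add: P'_def eig_def, metis add_diff_cancel_right' diff_add_cancel spol_lin(1))
  then have "(\<Sum>e<M. P' e) = 0"
    by (simp only: Suc.prems(2)) (simp add: P'_def spol_lin additive.zero[OF Eop_additive] spol_0)
  moreover have "eig A e (P' e)" if "e < M" for e unfolding P'_def by (rule eig_spol) (use Suc.prems that in auto)
  ultimately have "P' e = 0" if "e < M" for e using Suc.IH[of P' e] that by blast
  then have z: "P e = 0" if "e < M" for e using that spol_eq_0[of "of_nat e - of_nat M" "P e"] by (simp add: P'_def)
  then have "P M = 0" using Suc.prems(2) by simp
  then show ?case using z Suc.prems(3) by (cases "e = M") auto
qed simp

lemma dec_unique:
  assumes "dec A 0 g"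
  shows "g = 0"
proof -
  obtain c M f where d: "0 = cst (scl V c 1) + Eop A g" "g = (\<Sum>e<M. f e)" "\<forall>e. eig A (Suc e) (f e)" "\<forall>e\<ge>M. f e = 0"
    using assms unfolding dec_def by blast
  \<comment> \<open>The constant sits at eigenvalue 0, and the Euler image of \<open>f e\<close> at
    \<open>Suc e\<close>; independence then kills all of them.\<close>
  define P where "P e = (case e of 0 \<Rightarrow> cst (scl V c 1) | Suc e' \<Rightarrow> spol V (of_nat (Suc e')) (f e'))" for e
  have "eig A e (P e)" for e using d(3) by (cases e) (auto simp: P_def eig_spol, simp add: eig_def Eop_const spol_lin)
  moreover have "(\<Sum>e<Suc M. P e) = 0"
  proof -
    have "Eop A g = (\<Sum>e<M. spol V (of_nat (Suc e)) (f e))"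
      unfolding d(2) additive.sum[OF Eop_additive] using d(3) by (simp add: eig_def)
    then show ?thesis using d(1) by (simp add: sum.lessThan_Suc_shift P_def del: sum.lessThan_Suc of_nat_Suc)
  qed
  ultimately have "P (Suc e) = 0" if "e < M" for e using eig_indep[of "Suc M" A P "Suc e"] that by simp
  then have "f e = 0" if "e < M" for e
    using that spol_eq_0[of "of_nat (Suc e)" "f e"] by (simp add: P_def del: of_nat_Suc)
  then show ?thesis using d(2) by simp
qed

lemma dec_add:
  assumes "dec A P g" "dec A Q h"
  shows "dec A (P + Q) (g + h)"
proof -
  obtain c M f where d: "P = cst (scl V c 1) + Eop A g" "g = (\<Sum>e<M. f e)" "\<forall>e. eig A (Suc e) (f e)" "\<forall>e\<ge>M. f e = 0"
    using assms(1) unfolding dec_def by blast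
  obtain c' M' f' where d': "Q = cst (scl V c' 1) + Eop A h" "h = (\<Sum>e<M'. f' e)" "\<forall>e. eig A (Suc e) (f' e)" "\<forall>e\<ge>M'. f' e = 0"
    using assms(2) unfolding dec_def by blast
  define K where "K = max M M'"
  have "g = (\<Sum>e<K. f e)" unfolding d(2) by (rule sum.mono_neutral_left) (use d(4) in \<open>auto simp: K_def\<close>)
  moreover have "h = (\<Sum>e<K. f' e)" unfolding d'(2) by (rule sum.mono_neutral_left) (use d'(4) in \<open>auto simp: K_def\<close>)
  ultimately have "g + h = (\<Sum>e<K. f e + f' e)" by (simp add: sum.distrib)
  moreover have "P + Q = cst (scl V (c + c') 1) + Eop A (g + h)" by (simp add: d(1) d'(1) Eop_add Vscl single_add)
  ultimately show ?thesis
    unfolding dec_def using d d' by (intro exI[of _ "c + c'"] exI[of _ K] exI[of _ "\<lambda>e. f e + f' e"]) (auto simp: eig_add K_def)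
qed

text \<open>Naturality: linear maps that intertwine the Euler operators and preserve constants
  respect the decomposition. Scalars, parity projections, renamings and contractions are the
  instances.\<close>

lemma dec_map:
  assumes "dec A P g" and \<Phi>: "additive \<Phi>" "\<And>c P. \<Phi> (spol V c P) = spol V c (\<Phi> P)"
    and B: "\<And>P. P \<in> pon A \<Longrightarrow> \<Phi> P \<in> pon B" "\<And>P. P \<in> pon A \<Longrightarrow> Eop B (\<Phi> P) = \<Phi> (Eop A P)"
    and c: "\<And>c. \<exists>c'. \<Phi> (cst (scl V c 1)) = cst (scl V c' 1)"
  shows "dec B (\<Phi> P) (\<Phi> g)"
proof -
  obtain c M f where d: "P = cst (scl V c 1) + Eop A g" "g = (\<Sum>e<M. f e)" "\<forall>e. eig A (Suc e) (f e)" "\<forall>e\<ge>M. f e = 0"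
    using assms(1) unfolding dec_def by blast
  obtain c' where c': "\<Phi> (cst (scl V c 1)) = cst (scl V c' 1)" using c by blast
  have g: "g \<in> pon A" unfolding d(2) using d(3) by (intro pon_sum) (auto simp: eig_def)
  have "eig B (Suc e) (\<Phi> (f e))" for e using d(3) B by (auto simp: eig_def \<Phi>(2))
  then show ?thesis unfolding dec_def using d c' B(2)[OF g]
    by (intro exI[of _ c'] exI[of _ M] exI[of _ "\<lambda>e. \<Phi> (f e)"])
      (auto simp: additive.add[OF \<Phi>(1)] additive.sum[OF \<Phi>(1)] additive.zero[OF \<Phi>(1)])
qed

lemma dec_spol: "dec A P g \<Longrightarrow> dec A (spol V c P) (spol V c g)"
  by (rule dec_map[where A = A])
    (auto simp: spol_additive spol_lin mult.commute spol_pon Eop_spol spol_simps Vscl)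

lemma dec_sg: "dec A P g \<Longrightarrow> dec A (sg p * P) (sg p * g)"
  using dec_spol[of A P g "sg p"] by (simp add: spol_sg_eq)

lemma dec_diff: "dec A P g \<Longrightarrow> dec A Q h \<Longrightarrow> dec A (P - Q) (g - h)"
  using dec_add[of A P g "- Q" "- h"] dec_sg[of A Q h 1] by simp

lemma dec_inj: "dec A P g \<Longrightarrow> dec A P h \<Longrightarrow> g = h"
  using dec_unique[of A "g - h"] dec_diff[of A P g P h] by simp

lemma dec_pr: "dec A P g \<Longrightarrow> dec A (pr p P) (pr p g)"
proof (rule dec_map[where A = A and B = A and \<Phi> = "pr p"])
  fix c :: 'f
  have "pr p (cst (scl V c 1)) = cst (scl V (if p = 0 then c else 0) 1)"
    using pcomp_hom[OF scl1_even, of p c] by (auto simp: pr_simps Vscl)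
  then show "\<exists>c'. pr p (cst (scl V c 1)) = cst (scl V c' 1)" ..
next
  show "pr p (spol V c P) = spol V c (pr p P)" for c P
    by (rule poly_mapping_eqI) (simp add: pr_simps spol_simps super_space.pcomp_scl[OF VS])
qed (auto simp: pr_additive pr_pon Eop_pr)

lemma dec_ren: "dec A P g \<Longrightarrow> inj_on \<rho> A \<Longrightarrow> dec (\<rho> ` A) (ren \<rho> P) (ren \<rho> g)"
  by (rule dec_map[where A = A]) (auto simp: additive_def ren_spol ren_pon Eop_ren)

lemma dec_act:
  assumes "dec A P g" "a \<in> par H p" "finite A" "i \<notin> A"
  shows "dec (insert i A) (act (\<iota> a) i P) (act (\<iota> a) i g)"
proof (rule dec_map[where A = A, OF assms(1)])
  show "\<exists>c'. act (\<iota> a) i (cst (scl V c 1)) = cst (scl V c' 1)" for c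
  proof -
    have "brk V (\<iota> a) (X i) 1 = 0" by (simp add: brk_cf[OF order_refl] cf_1)
    then show ?thesis by (intro exI[of _ 0]) (simp add: brk_scl spol_0 Vscl)
  qed
qed (use assms in \<open>auto simp: act_additive act_spol Eop_act intro: act_pon pon_mono\<close>)

lemma dec_eig: "eig A e P \<Longrightarrow> e \<noteq> 0 \<or> (\<exists>c. P = cst (scl V c 1)) \<Longrightarrow> \<exists>g. dec A P g"
proof (cases "e = 0")
  case True
  assume "e \<noteq> 0 \<or> (\<exists>c. P = cst (scl V c 1))"
  then obtain c where "P = cst (scl V c 1)" using True by auto
  then have "dec A P 0"
    unfolding dec_def by (intro exI[of _ c] exI[of _ 0] exI[of _ "\<lambda>_. 0"]) (auto simp: eig_0 additive.zero[OF Eop_additive])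
  then show ?thesis ..
next
  case False
  assume P: "eig A e P"
  obtain e' where e': "e = Suc e'" using False by (cases e) auto
  define g where "g = spol V (1 / of_nat e) P"
  have "Eop A g = P" using P False by (simp add: g_def Eop_spol eig_def spol_lin)
  moreover have "eig A e g" unfolding g_def by (rule eig_spol[OF P])
  moreover have "g = (\<Sum>k<Suc e'. if k = e' then g else 0)" by simp
  ultimately have "dec A P g"
    unfolding dec_def e' by (intro exI[of _ 0] exI[of _ "Suc e'"] exI[of _ "\<lambda>k. if k = e' then g else 0"]) (auto simp: eig_0 Vscl)
  then show ?thesis ..
qed

text \<open>A grading obtained from generation alone: \<open>EV\<close> is a derivation fixing the
  derivatives of generators, so multiplication by one of them raises the eigenvalue by one, and
  eigenvalue 0 is left to the scalars.\<close>

lemma V_eigen: "\<exists>M f. v = (\<Sum>k<M. f k) \<and> (\<forall>k. EV (f k) = scl V (of_nat k) (f k)) \<and> (\<forall>k\<ge>M. f k = 0) \<and> (\<exists>c. f 0 = scl V c 1)"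
proof (induction v rule: V_induct)
  case one
  show ?case by (intro exI[of _ 1] exI[of _ "\<lambda>k. if k = 0 then 1 else 0"])
      (auto simp: EV_1 Vscl One_nat_def intro: exI[of _ 1])
next
  case (scl c v)
  then obtain M f c0 where f: "v = (\<Sum>k<M. f k)" "\<forall>k. EV (f k) = scl V (of_nat k) (f k)" "\<forall>k\<ge>M. f k = 0" "f 0 = scl V c0 1" by blast
  have "scl V c (\<Sum>k<M. f k) = (\<Sum>k<M. scl V c (f k))" by (rule additive.sum) (simp add: additive_def Vscl)
  then show ?case using f by (intro exI[of _ M] exI[of _ "\<lambda>k. scl V c (f k)"]) (auto simp: EV_scl Vscl mult.commute)
next
  case (add v w)
  then obtain M f c0 M' f' c0' where f: "v = (\<Sum>k<M. f k)" "\<forall>k. EV (f k) = scl V (of_nat k) (f k)" "\<forall>k\<ge>M. f k = 0" "f 0 = scl V c0 1"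
    "w = (\<Sum>k<M'. f' k)" "\<forall>k. EV (f' k) = scl V (of_nat k) (f' k)" "\<forall>k\<ge>M'. f' k = 0" "f' 0 = scl V c0' 1" by blast
  define K where "K = max M M'"
  have "v = (\<Sum>e<K. f e)" unfolding f(1) by (rule sum.mono_neutral_left) (use f in \<open>auto simp: K_def\<close>)
  moreover have "w = (\<Sum>e<K. f' e)" unfolding f(5) by (rule sum.mono_neutral_left) (use f in \<open>auto simp: K_def\<close>)
  ultimately show ?case using f
    by (intro exI[of _ K] exI[of _ "\<lambda>k. f k + f' k"]) (auto simp: EV_add Vscl(1) sum.distrib K_def simp flip: Vscl(2))
next
  case (gen p a m v)
  then obtain M f c0 where f: "v = (\<Sum>k<M. f k)" "\<forall>k. EV (f k) = scl V (of_nat k) (f k)" "\<forall>k\<ge>M. f k = 0" "f 0 = scl V c0 1" by blast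
  define g where "g = (der V ^^ m) (\<iota> a)"
  define h where "h k = (case k of 0 \<Rightarrow> 0 | Suc k' \<Rightarrow> g * f k')" for k
  have E: "EV (g * u) = g * u + g * EV u" for u
    using EV_mult[OF ders_par[OF \<iota>_par[OF gen(1)]], of m u] EV_gen by (simp add: g_def)
  have "EV (h k) = scl V (of_nat k) (h k)" for k using f(2) by (cases k) (auto simp: h_def E Vscl scale_mult_right)
  moreover have "g * v = (\<Sum>k<Suc M. h k)"
    by (simp add: f(1) sum_distrib_left sum.lessThan_Suc_shift h_def del: sum.lessThan_Suc)
  moreover have "\<forall>k\<ge>Suc M. h k = 0" using f(3) by (auto simp: h_def split: nat.split)
  moreover have "h 0 = scl V 0 1" by (simp add: h_def Vscl)
  ultimately show ?case unfolding g_def[symmetric] by blast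
qed

lemma ev0_mono: "ev0 k (sgl m v) = (if k \<in> ky m then 0 else sgl m v)"
proof (cases "k \<in> ky m")
  case True
  then have "sgl k 1 + (m - sgl k 1) = m"
    by (intro poly_mapping_eqI) (auto simp: lookup_add lookup_minus lookup_single when_def in_keys_iff)
  then have "sgl m v = X k * sgl (m - sgl k 1) v" by (simp add: X_mono)
  then show ?thesis using True by (metis ev0_simps(6))
next
  case False
  then show ?thesis using ev0_ident[of "sgl m v" "ky m" k] by (simp add: pon_mono1)
qed

lemma dec_ex:
  assumes A: "finite A" and P: "P \<in> pon A"
  shows "\<exists>g. dec A P g"
proof -
  have d0: "dec A 0 0"
    unfolding dec_def by (intro exI[of _ 0] exI[of _ "\<lambda>_. 0"]) (auto simp: eig_0 additive.zero[OF Eop_additive] Vscl)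
  have dsum: "\<exists>g. dec A (sum f I) g" if "\<And>i. i \<in> I \<Longrightarrow> \<exists>g. dec A (f i) g" for f and I :: "'i set" using that
  proof (induction I rule: infinite_finite_induct)
    case (insert i I)
    then obtain g h where "dec A (f i) g" "dec A (sum f I) h" by (metis insertI1 insertI2)
    then have "dec A (f i + sum f I) (g + h)" by (rule dec_add)
    then show ?case using insert.hyps by auto
  qed (use d0 in auto)
  have "\<exists>g. dec A (sgl m v) g" if m: "ky m \<subseteq> A" for m v
  proof -
    obtain M f where f: "v = (\<Sum>k<M. f k)" "\<forall>k. EV (f k) = scl V (of_nat k) (f k)" "\<exists>c. f 0 = scl V c 1"
      using V_eigen by blast
    \<comment> \<open>The eigenvalue vanishes only if the monomial is trivial and the coefficient
      has degree 0, hence is a scalar; this is the exceptional case in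
      \<open>dec_eig\<close>.\<close>
    have E: "eig A (k + card (ky m)) (sgl m (f k))" for k
    proof -
      have "EVR (sgl m (f k)) = spol V (of_nat k) (sgl m (f k))"
        by (rule poly_mapping_eqI) (use f(2) in \<open>simp add: lk_EVR spol_simps lookup_single when_def Vscl\<close>)
      moreover have "(\<Sum>i\<in>A. sgl m (f k) - ev0 i (sgl m (f k))) = (\<Sum>i\<in>ky m. sgl m (f k))"
        by (rule sum.mono_neutral_cong_right[OF A m]) (auto simp: ev0_mono)
      ultimately have "Eop A (sgl m (f k)) = spol V (of_nat (k + card (ky m))) (sgl m (f k))"
        by (simp add: Eop_def of_nat_spol spol_lin)
      then show ?thesis using m by (simp add: eig_def pon_mono1)
    qed
    have "\<exists>g. dec A (sgl m (f k)) g" for k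
    proof (rule dec_eig[OF E])
      show "k + card (ky m) \<noteq> 0 \<or> (\<exists>c. sgl m (f k) = cst (scl V c 1))"
      proof (cases "k + card (ky m) = 0")
        case True
        then have "ky m = {}" by simp
        then have "m = 0" by (metis empty_iff in_keys_iff lookup_zero poly_mapping_eqI)
        then show ?thesis using True f(3) by auto
      qed simp
    qed
    moreover have "sgl m v = (\<Sum>k<M. sgl m (f k))"
      unfolding f(1) by (rule additive.sum) (simp add: additive_def single_add)
    ultimately show ?thesis using dsum[of "{..<M}" "\<lambda>k. sgl m (f k)"] by simp
  qed
  then have "\<exists>g. dec A (\<Sum>m\<in>ky P. sgl m (lk P m)) g" using P by (intro dsum) (auto simp: pon_def)
  then show ?thesis using pm_sum[of P] by simp
qed

lemma dec_pon: "dec A P g \<Longrightarrow> g \<in> pon A"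
  unfolding dec_def by (auto simp: eig_def intro!: pon_sum)

lemma dec_zero: "dec A 0 0"
  unfolding dec_def by (intro exI[of _ 0] exI[of _ "\<lambda>_. 0"]) (auto simp: eig_0 additive.zero[OF Eop_additive] Vscl)

text \<open>\<open>dc\<close> is built from contractions, each of which respects the decomposition;
  \<open>K\<close> collects the labels already passed.\<close>

lemma dc_dec:
  assumes "gdh l" "finite K" "K \<inter> lb l = {}"
    "\<And>l'. Suc (length l') = length l \<Longrightarrow> gdh l' \<Longrightarrow> set l' \<subseteq> set l \<Longrightarrow> dec (K \<union> lb l') (w l') (g l')"
  shows "dec (K \<union> lb l) (dc w Q l) (dc g Q l)"
  using assms
proof (induction l arbitrary: w g Q K)
  case Nil
  show ?case by (simp add: dec_zero)
next
  case (Cons x l)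
  have "dec (K \<union> lb l) (w l) (g l)" by (rule Cons.prems(4)) (use Cons.prems in auto)
  then have "dec (insert (fst x) (K \<union> lb l)) (act (\<iota> (ag x)) (fst x) (w l)) (act (\<iota> (ag x)) (fst x) (g l))"
    by (rule dec_act) (use Cons.prems in auto)
  moreover have "dec (insert (fst x) K \<union> lb l) (dc (\<lambda>l. w (x # l)) (Q + (1 + pt x)) l) (dc (\<lambda>l. g (x # l)) (Q + (1 + pt x)) l)"
  proof (rule Cons.IH)
    fix l' assume l': "Suc (length l') = length l" "gdh l'" "set l' \<subseteq> set l"
    have f: "lb l' \<subseteq> lb l" using l'(3) by (rule image_mono)
    have "dec (K \<union> lb (x # l')) (w (x # l')) (g (x # l'))" by (rule Cons.prems(4)) (use Cons.prems l' f in auto)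
    then show "dec (insert (fst x) K \<union> lb l') (w (x # l')) (g (x # l'))" by simp
  qed (use Cons.prems in auto)
  ultimately show ?case by (simp add: dec_add dec_sg)
qed

text \<open>The complex of generator-level cochains with values in polynomials is acyclic up to constants: split off
  the kernel of the Euler operator and invert it on the rest before applying the contracting homotopy.\<close>

theorem dc_acyclic:
  assumes w: "lch n q w" and d: "\<And>l. gdh l \<Longrightarrow> length l = Suc n \<Longrightarrow> dc w q l = 0"
  shows "\<exists>c z. (\<forall>l. gdh l \<and> length l = n \<longrightarrow> w l = cst (scl V (c l) 1) + dc z (q + 1) l) \<and>
    (\<forall>m. n = Suc m \<longrightarrow> lch m (q + 1) z)"
proof -
  define ok where "ok l \<longleftrightarrow> gdh l \<and> length l = n" for l :: "'h item list"
  define g where "g l = (SOME g. dec (lb l) (w l) g)" for l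
  have g: "dec (lb l) (w l) (g l)" if "ok l" for l
    unfolding g_def by (rule someI_ex, rule dec_ex) (use that lco_pon[OF w] in \<open>auto simp: ok_def\<close>)
  have gl: "lch n q g" unfolding lco_def
  proof (intro conjI allI impI)
    fix l assume l: "gdh l \<and> length l = n"
    then have ok: "ok l" by (simp add: ok_def)
    show "g l \<in> pon (lb l)" by (rule dec_pon[OF g[OF ok]])
    \<comment> \<open>The component of wrong parity of \<open>w l\<close> is zero, so by uniqueness
      that of \<open>g l\<close> is zero as well.\<close>
    have "pr (1 + (1 + q + pbs l)) (w l) = 0" using lco_rpar[OF w, of l] l by (simp only: rpar_pr)
    then have "dec (lb l) 0 (pr (1 + (1 + q + pbs l)) (g l))" using dec_pr[OF g[OF ok]] by metis
    then show "g l \<in> rpar V (1 + q + pbs l)" unfolding rpar_pr by (rule dec_unique)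
    fix \<rho> :: "nat \<Rightarrow> nat" assume \<rho>: "inj_on \<rho> (lb l)"
    have "dec (lb (rl \<rho> l)) (w (rl \<rho> l)) (ren \<rho> (g l))"
      using dec_ren[OF g[OF ok] \<rho>] lco_rl[OF w, of l \<rho>] l \<rho> by (simp add: rl_set)
    moreover have "ok (rl \<rho> l)" using gd_rl[of _ l \<rho>] l \<rho> by (simp add: ok_def)
    ultimately show "g (rl \<rho> l) = ren \<rho> (g l)" using g dec_inj by blast
  next
    fix l1 x z l2 assume l: "gdh (l1 @ x # z # l2) \<and> length (l1 @ x # z # l2) = n"
    then have ok: "ok (l1 @ x # z # l2)" "ok (l1 @ z # x # l2)" by (auto simp: ok_def)
    have "lb (l1 @ z # x # l2) = lb (l1 @ x # z # l2)" by auto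
    then have "dec (lb (l1 @ x # z # l2)) (w (l1 @ x # z # l2)) (sgx x z * g (l1 @ z # x # l2))"
      using dec_sg[OF g[OF ok(2)], of "(1 + pt x) * (1 + pt z)"] lco_swap[OF w, of l1 x z l2] l by simp
    then show "g (l1 @ x # z # l2) = sgx x z * g (l1 @ z # x # l2)"
      using g[OF ok(1)] dec_inj by blast
  next
    fix i p a b c l assume l: "gdh ((i, p, a) # l) \<and> gdh ((i, p, b) # l) \<and> Suc (length l) = n"
    then have ok: "ok ((i, p, a) # l)" "ok ((i, p, b) # l)" "ok ((i, p, scl H c a + b) # l)" by (auto simp: ok_def Hpar)
    have "dec (lb ((i, p, a) # l)) (w ((i, p, scl H c a + b) # l)) (spol V c (g ((i, p, a) # l)) + g ((i, p, b) # l))"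
      using dec_add[OF dec_spol[OF g[OF ok(1)], of c]] g[OF ok(2)] lco_lin_front[OF w, of i p a l b c] l by simp
    then show "g ((i, p, scl H c a + b) # l) = spol V c (g ((i, p, a) # l)) + g ((i, p, b) # l)"
      using g[OF ok(3)] dec_inj by simp
  qed
  have dg: "dc g q l = 0" if l: "gdh l" "length l = Suc n" for l
  proof -
    have "dec ({} \<union> lb l) (dc w q l) (dc g q l)" by (rule dc_dec[OF l(1)]) (use l g in \<open>auto simp: ok_def\<close>)
    then show ?thesis using d[OF l] dec_unique by simp
  qed
  have "\<exists>c. w l = cst (scl V c 1) + Eop (lb l) (g l)" if "ok l" for l using g[OF that] unfolding dec_def by blast
  then obtain c where c: "\<And>l. ok l \<Longrightarrow> w l = cst (scl V (c l) 1) + Eop (lb l) (g l)" by metis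
  show ?thesis
  proof (cases n)
    \<comment> \<open>There is nothing to contract here: \<open>homotopy0\<close> shows that
      \<open>w\<close> is constant, and the coboundary term in the claim is zero on the empty
      list.\<close>
    case 0
    have "Eop {} (g []) = 0" by (rule homotopy0[of q]) (use gl dg 0 in \<open>auto simp: One_nat_def\<close>)
    then have "w l = cst (scl V (c l) 1) + dc g (q + 1) l" if "ok l" for l
      using c[OF that] that 0 by (simp add: ok_def)
    then show ?thesis using 0 by (auto simp: ok_def)
  next
    case (Suc m)
    have "lch m (q + 1) (Kf q g)" by (rule Kf_lco) (use gl Suc in simp)
    moreover have "dc (Kf q g) (q + 1) l = Eop (lb l) (g l)" if "ok l" for l
      by (rule homotopy[of m]) (use gl dg that Suc in \<open>auto simp: ok_def\<close>)
    ultimately show ?thesis using c Suc by (intro exI[of _ c] exI[of _ "Kf q g"]) (auto simp: ok_def)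
  qed
qed

end

context boson
begin

section \<open>The connecting map\<close>

lemma lco_comb:
  assumes w: "lch n q w" and w': "lch n q w'"
  shows "lch n q (\<lambda>l. spol V c (w l) + w' l)"
  unfolding lco_def
proof (intro conjI allI impI)
  fix l assume l: "gdh l \<and> length l = n"
  show "spol V c (w l) + w' l \<in> pon (lb l)" using lco_pon[OF w] lco_pon[OF w'] l by (intro pon_add spol_pon) auto
  show "spol V c (w l) + w' l \<in> rpar V (1 + q + pbs l)"
    using lco_rpar[OF w] lco_rpar[OF w'] l by (intro rpar_closed spol_rpar) auto
  fix \<rho> :: "nat \<Rightarrow> nat" assume "inj_on \<rho> (lb l)"
  then show "spol V c (w (rl \<rho> l)) + w' (rl \<rho> l) = ren \<rho> (spol V c (w l) + w' l)"
    using lco_rl[OF w] lco_rl[OF w'] l by (simp add: ren_spol)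
next
  fix l1 x z l2 assume g: "gdh (l1 @ x # z # l2) \<and> length (l1 @ x # z # l2) = n"
  show "spol V c (w (l1 @ x # z # l2)) + w' (l1 @ x # z # l2)
    = sgx x z * (spol V c (w (l1 @ z # x # l2)) + w' (l1 @ z # x # l2))"
    using lco_swap[OF w, of l1 x z l2] lco_swap[OF w', of l1 x z l2] g by (simp add: distrib_left)
next
  fix i p a b d l assume g: "gdh ((i, p, a) # l) \<and> gdh ((i, p, b) # l) \<and> Suc (length l) = n"
  show "spol V c (w ((i, p, scl H d a + b) # l)) + w' ((i, p, scl H d a + b) # l)
    = spol V d (spol V c (w ((i, p, a) # l)) + w' ((i, p, a) # l)) + (spol V c (w ((i, p, b) # l)) + w' ((i, p, b) # l))"
    using lco_lin_front[OF w, of i p a l b d] lco_lin_front[OF w', of i p a l b d] g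
    by (simp add: spol_add spol_lin mult.commute)
qed

lemma lco_add: "lch n q w \<Longrightarrow> lch n q w' \<Longrightarrow> lch n q (\<lambda>l. w l + w' l)"
  using lco_comb[of n q w w' 1] by (simp add: spol_lin)

lemma spol_neg1: "spol V (- 1) P = - P"
  using spol_sg_eq[of 1 P] by simp

lemma lco_diff: "lch n q w \<Longrightarrow> lch n q w' \<Longrightarrow> lch n q (\<lambda>l. w l - w' l)"
  using lco_comb[of n q w' w "- 1"] by (simp add: spol_neg1)

lemma lco_null: "lch n q (\<lambda>_. 0)"
  by (simp add: lco_def spol_0)

lemma lco_tot:
  assumes z: "lch n q z"
  shows "lch n q (\<lambda>l. tot (lb l) (z l))"
  unfolding lco_def
proof (intro conjI allI impI)
  fix l assume l: "gdh l \<and> length l = n"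
  show "tot (lb l) (z l) \<in> pon (lb l)" using lco_pon[OF z] l by (intro tot_pon) auto
  show "tot (lb l) (z l) \<in> rpar V (1 + q + pbs l)" using lco_rpar[OF z] l by (intro tot_rpar) auto
  fix \<rho> :: "nat \<Rightarrow> nat" assume "inj_on \<rho> (lb l)"
  then show "tot (lb (rl \<rho> l)) (z (rl \<rho> l)) = ren \<rho> (tot (lb l) (z l))"
    using lco_rl[OF z] l by (simp add: tot_ren rl_set)
next
  fix l1 x u l2 assume g: "gdh (l1 @ x # u # l2) \<and> length (l1 @ x # u # l2) = n"
  have e: "lb (l1 @ u # x # l2) = lb (l1 @ x # u # l2)" by auto
  show "tot (lb (l1 @ x # u # l2)) (z (l1 @ x # u # l2))
    = sgx x u * tot (lb (l1 @ u # x # l2)) (z (l1 @ u # x # l2))"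
    unfolding e using lco_swap[OF z, of l1 x u l2] g by (simp only: tot_sg)
next
  fix i p a b d l assume g: "gdh ((i, p, a) # l) \<and> gdh ((i, p, b) # l) \<and> Suc (length l) = n"
  then show "tot (lb ((i, p, scl H d a + b) # l)) (z ((i, p, scl H d a + b) # l))
    = spol V d (tot (lb ((i, p, a) # l)) (z ((i, p, a) # l))) + tot (lb ((i, p, b) # l)) (z ((i, p, b) # l))"
    using lco_lin_front[OF z, of i p a l b d] by (simp add: tot_add tot_spol)
qed

lemma scl1_eq: "scl V c 1 = scl V d 1 \<longleftrightarrow> c = d"
proof -
  have "scl V (c - d) 1 = scl V c 1 - scl V d 1" using Vscl(2)[of "c - d" d 1] by simp
  then show ?thesis using super_space.scl_eq_0[OF VS, of "c - d" 1] by auto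
qed

lemma sc_eq: "(cst (scl V c 1) :: 'v pol) = cst (scl V d 1) \<longleftrightarrow> c = d"
  by (metis scl1_eq lookup_single_eq)

lemma sc_eq_0: "(cst (scl V c 1) :: 'v pol) = 0 \<longleftrightarrow> c = 0"
  using sc_eq[of c 0] by (simp add: Vscl)

abbreviation "sc \<equiv> (\<lambda>b (l :: 'h item list). cst (scl V (b l) 1) :: 'v pol)"

text \<open>The values of a scalar cochain do not depend on the labels, by \<open>b_rl\<close>; the
  fresh label only keeps the list good.\<close>

definition yb :: "('h item list \<Rightarrow> 'f) \<Rightarrow> 'h item list \<Rightarrow> 'v pol" where
  "yb b l = (\<Sum>j<N. cst (scl V (b (l @ [(fresh l, pu j, us' ! j)])) (\<iota> (us ! j))))"

lemma spol_scal: "spol V c (cst (scl V d 1)) = cst (scl V (c * d) 1)"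
  by (simp add: spol_simps Vscl)

lemma b_rl:
  assumes b: "lch n r (sc b)" and l: "gdh l" "length l = n" "inj_on \<rho> (lb l)"
  shows "b (rl \<rho> l) = b l"
  using lco_rl[OF b l] by (simp add: sc_eq)

lemma b_lin:
  assumes b: "lch n r (sc b)" and g: "gdh (l1 @ (i, p, a) # l2)" "gdh (l1 @ (i, p, a') # l2)"
    and n: "length (l1 @ (i, p, a) # l2) = n"
  shows "b (l1 @ (i, p, scl H c a + a') # l2) = c * b (l1 @ (i, p, a) # l2) + b (l1 @ (i, p, a') # l2)"
proof -
  have "sc b (l1 @ (i, p, scl H c a + a') # l2) = spol V c (sc b (l1 @ (i, p, a) # l2)) + sc b (l1 @ (i, p, a') # l2)"
    by (rule lco_lin[OF b]) (use g n in \<open>auto simp: Hpar\<close>)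
  then show ?thesis by (simp only: spol_scal single_add[symmetric] Vscl(2)[symmetric] sc_eq)
qed

lemma b_swap:
  assumes b: "lch n r (sc b)" and g: "gdh (l1 @ x # z # l2)" "length (l1 @ x # z # l2) = n"
  shows "b (l1 @ x # z # l2) = sgx x z * b (l1 @ z # x # l2)"
  using lco_swap[OF b g] by (simp only: spol_sg_eq[symmetric] spol_scal sc_eq)

text \<open>Scalars are even, so a scalar cochain vanishes wherever its value should be odd.\<close>

lemma b_par:
  assumes b: "lch n r (sc b)" and l: "gdh l" "length l = n" "1 + r + pbs l \<noteq> 0"
  shows "b l = 0"
proof -
  have "sc b l \<in> rpar V (1 + r + pbs l)" by (rule lco_rpar[OF b l(1,2)])
  moreover have "1 + r + pbs l = 1 + 0" using l(3) by simp
  ultimately have "sc b l \<in> rpar V (1 + 0)" by metis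
  then have "sc b l = 0" by (rule rpar_01[of _ 0, rotated]) (simp add: scl1_even)
  then show ?thesis by (simp add: sc_eq_0)
qed

lemma b_indep:
  assumes b: "lch (Suc n) r (sc b)" and l: "gdh l" "length l = n" "a \<in> par H p"
    and k: "k \<notin> lb l" "k' \<notin> lb l"
  shows "b (l @ [(k, p, a)]) = b (l @ [(k', p, a)])"
proof -
  define \<rho> where "\<rho> = (id :: nat \<Rightarrow> nat)(k := k')"
  have id: "rl \<rho> l = l"
  proof (rule rl_ident)
    fix i assume "i \<in> lb l"
    then have "i \<noteq> k" using k by metis
    then show "\<rho> i = i" by (simp add: \<rho>_def)
  qed
  have "inj_on \<rho> (insert k (lb l))"
  proof (cases "k = k'")
    case True
    then show ?thesis by (auto simp: \<rho>_def inj_on_def)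
  next
    case False
    then show ?thesis unfolding \<rho>_def using k by (intro inj_on_fun_updI) auto
  qed
  then have "b (rl \<rho> (l @ [(k, p, a)])) = b (l @ [(k, p, a)])" by (intro b_rl[OF b]) (use l k in auto)
  then show ?thesis by (simp add: id) (simp add: \<rho>_def)
qed

lemma yb_lco:
  assumes b: "lch (Suc n) r (sc b)"
  shows "lch n (r + 1) (yb b)"
  unfolding lco_def
proof (intro conjI allI impI)
  fix l assume l: "gdh l \<and> length l = n"
  have L: "gdh (l @ [(fresh l, pu j, us' ! j)])" if "j < N" for j using l us'_par[OF that] fresh_notin[of l] by auto
  show "yb b l \<in> pon (lb l)" by (simp add: yb_def)
  show "yb b l \<in> rpar V (1 + (r + 1) + pbs l)" unfolding yb_def
  proof (intro rpar_sum)
    fix j assume "j \<in> {..<N}"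
    then have j: "j < N" by simp
    show "cst (scl V (b (l @ [(fresh l, pu j, us' ! j)])) (\<iota> (us ! j))) \<in> rpar V (1 + (r + 1) + pbs l)"
    proof (cases "b (l @ [(fresh l, pu j, us' ! j)]) = 0")
      \<comment> \<open>A nonzero scalar value fixes the total parity of the arguments, and thereby
        the parity of \<open>us ! j\<close>.\<close>
      case False
      then have "1 + r + pbs (l @ [(fresh l, pu j, us' ! j)]) = 0"
        using b_par[OF b L[OF j]] l by (metis length_append_singleton)
      then have "pu j = 1 + (r + 1) + pbs l" by (cases "pu j"; cases r; cases "pbs l"; simp)
      then show ?thesis using \<iota>_par[OF us_par[OF j]] by (metis Vpar(3) rpar_closed(5))
    qed (simp add: Vscl)
  qed
  fix \<rho> :: "nat \<Rightarrow> nat" assume \<rho>: "inj_on \<rho> (lb l)"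
  define k where "k = fresh l"
  define k' where "k' = fresh (rl \<rho> l)"
  have k: "k \<notin> lb l" unfolding k_def by (rule fresh_notin)
  have k': "k' \<notin> \<rho> ` lb l" using fresh_notin[of "rl \<rho> l"] by (simp add: k'_def rl_set)
  define \<rho>' where "\<rho>' = \<rho>(k := k')"
  have inj': "inj_on \<rho>' (insert k (lb l))" using \<rho> k k' by (auto simp: \<rho>'_def inj_on_def)
  have rl': "rl \<rho>' l = rl \<rho> l"
  proof (rule rl_cong)
    fix i assume "i \<in> lb l"
    then have "i \<noteq> k" using k by metis
    then show "\<rho>' i = \<rho> i" by (simp add: \<rho>'_def)
  qed
  have "b (rl \<rho> l @ [(k', pu j, us' ! j)]) = b (l @ [(k, pu j, us' ! j)])" if "j < N" for j
    using b_rl[OF b L[OF that], of \<rho>'] inj' l by (simp add: rl' k_def[symmetric]) (simp add: \<rho>'_def)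
  then show "yb b (rl \<rho> l) = ren \<rho> (yb b l)" by (simp add: yb_def k_def[symmetric] k'_def[symmetric])
next
  fix l1 x z l2 assume g: "gdh (l1 @ x # z # l2) \<and> length (l1 @ x # z # l2) = n"
  define k where "k = fresh (l1 @ x # z # l2)"
  have k: "k \<notin> lb (l1 @ x # z # l2)" unfolding k_def by (rule fresh_notin)
  have k': "fresh (l1 @ z # x # l2) = k" by (simp add: k_def fresh_def insert_commute)
  have "b (l1 @ x # z # l2 @ [(k, pu j, us' ! j)]) = sgx x z * b (l1 @ z # x # l2 @ [(k, pu j, us' ! j)])"
    if "j < N" for j by (rule b_swap[OF b]) (use g k us'_par[OF that] in auto)
  then show "yb b (l1 @ x # z # l2) = sgx x z * yb b (l1 @ z # x # l2)"
    by (simp add: yb_def k_def[symmetric] k' sum_distrib_left)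
      (intro sum.cong refl, cases "pt x"; cases "pt z"; simp add: Vscl single_uminus)
next
  fix i p a a' c l assume g: "gdh ((i, p, a) # l) \<and> gdh ((i, p, a') # l) \<and> Suc (length l) = n"
  define k where "k = fresh ((i, p, a) # l)"
  have k: "k \<notin> lb ((i, p, a) # l)" unfolding k_def by (rule fresh_notin)
  have k': "fresh ((i, p, a') # l) = k" "fresh ((i, p, scl H c a + a') # l) = k" by (simp_all add: k_def fresh_def)
  have "b ((i, p, scl H c a + a') # l @ [(k, pu j, us' ! j)]) = c * b ((i, p, a) # l @ [(k, pu j, us' ! j)]) + b ((i, p, a') # l @ [(k, pu j, us' ! j)])"
    if "j < N" for j using b_lin[OF b, of "[]" i p a "l @ [(k, pu j, us' ! j)]" a' c] g k us'_par[OF that] by simp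
  then show "yb b ((i, p, scl H c a + a') # l) = spol V c (yb b ((i, p, a) # l)) + yb b ((i, p, a') # l)"
    by (simp add: yb_def k_def[symmetric] k' spol_sum spol_simps Vscl single_add sum.distrib)
qed

text \<open>The class of \<open>\<beta>\<close> in degree \<open>n + 1\<close> is the image of the Casimir cochain \<open>yb \<beta>\<close> under the connecting map.\<close>

lemma dc_yb_pre:
  assumes b: "lch (Suc n) r (sc b)"
  shows "gdh (pre @ l) \<Longrightarrow> length (pre @ l) = Suc n \<Longrightarrow>
    dc (\<lambda>m. yb b (pre @ m)) (r + 1 + pbs pre) l = - ((\<Sum>i\<in>lb l. X i) * sc b (pre @ l))"
proof (induction l arbitrary: pre)
  case (Cons x l)
  obtain i p a where x: "x = (i, p, a)" by (cases x)
  have a: "a \<in> par H p" using Cons.prems x by simp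
  define m where "m = pre @ l"
  define k where "k = fresh m"
  have k: "k \<notin> lb m" unfolding k_def by (rule fresh_notin)
  have m: "gdh m" "length m = n" "i \<notin> lb m" using Cons.prems x by (auto simp: m_def)
  have "act (\<iota> a) i (yb b m) = (\<Sum>j<N. X i * cst (scl V (b (m @ [(k, pu j, us' ! j)]) * form a (us ! j)) 1))"
    by (simp add: yb_def k_def[symmetric] act_sum brk_scl brk_gens spol_simps Vscl)
  also have "\<dots> = X i * sc b (m @ [(k, p, a)])"
  proof -
    \<comment> \<open>Here the order of the arguments in the duality enters: the sum over the basis
      gives back \<open>a\<close> without a sign.\<close>
    have "sc b (m @ (k, p, a) # []) = (\<Sum>j | j < N \<and> pu j = p. spol V (form a (us ! j)) (sc b (m @ (k, p, us' ! j) # [])))"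
      by (rule lco_expand(2)[OF b]) (use m k a in auto)
    also have "\<dots> = (\<Sum>j<N. cst (scl V (b (m @ [(k, pu j, us' ! j)]) * form a (us ! j)) 1))"
      by (rule sum.mono_neutral_cong_left) (auto simp: form_us(2)[OF a] spol_scal mult.commute Vscl)
    finally show ?thesis by (simp add: sum_distrib_left)
  qed
  also have "b (m @ [(k, p, a)]) = b (m @ [(i, p, a)])" by (rule b_indep[OF b m(1,2) a k m(3)])
  finally have A: "act (\<iota> a) i (yb b m) = X i * sc b (m @ [x])" by (simp add: x)
  \<comment> \<open>Moving \<open>x\<close> to the end produces the parity of \<open>l\<close>,
    whereas the sign of the differential involves that of \<open>pre\<close>. The two agree because,
    where the cochain is not zero, the total parity is fixed by \<open>r\<close>.\<close>
  have S: "sg ((1 + p) * (r + 1 + pbs pre + 1) + 1) * sc b (m @ [x]) = - sc b (pre @ x # l)"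
  proof (cases "b (pre @ x # l) = 0 \<and> b (m @ [x]) = 0")
    case False
    have g: "gdh (pre @ x # l)" "length (pre @ x # l) = Suc n" "gdh (m @ [x])" "length (m @ [x]) = Suc n"
      using Cons.prems by (auto simp: m_def)
    have "pbs (m @ [x]) = pbs (pre @ x # l)" by (simp add: m_def add_ac)
    then have "1 + r + pbs (pre @ x # l) = 0" using False b_par[OF b g(1,2)] b_par[OF b g(3,4)] by metis
    moreover have "sc b (pre @ x # l) = sg ((1 + pt x) * pbs pre) * sc b (x # pre @ l)"
      by (rule lco_front[OF b g(1,2)])
    moreover have "sc b (m @ x # []) = sg ((1 + pt x) * pbs m) * sc b (x # m @ [])"
      by (rule lco_front[OF b]) (use g in auto)
    ultimately show ?thesis by (simp add: x m_def) (cases p; cases r; cases "pbs pre"; cases "pbs l"; simp)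
  qed (simp add: Vscl)
  have S': "sg ((1 + p) * (r + 1 + pbs pre + 1) + 1) * (X i * sc b (m @ [x])) = - (X i * sc b (pre @ x # l))"
    unfolding sg_comm(2)[of "X i", symmetric] S by simp
  have IH: "dc (\<lambda>m. yb b ((pre @ [x]) @ m)) (r + 1 + pbs (pre @ [x])) l = - ((\<Sum>i\<in>lb l. X i) * sc b ((pre @ [x]) @ l))"
    by (rule Cons.IH) (use Cons.prems in auto)
  have "i \<notin> lb l" using Cons.prems x by simp
  then show ?case using IH A S' by (simp add: x m_def distrib_right add.assoc)
qed simp

lemma tot_sc: "tot K (sc b l) = (\<Sum>i\<in>K. X i) * sc b l"
  by (simp add: tot_def dpol_simps der_simps der_1 Vscl)

lemma dc_yb:
  assumes b: "lch (Suc n) r (sc b)" and l: "gdh l" "length l = Suc n"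
  shows "dc (yb b) (r + 1) l = - tot (lb l) (sc b l)"
  using dc_yb_pre[OF b, of "[]" l] l by (simp add: tot_sc)

lemma brk_one: "brk V (\<iota> a) (X i) (scl V c 1) = 0"
proof -
  have "brk V (\<iota> a) (X i) 1 = 0" by (simp add: brk_cf[OF order_refl] cf_1)
  then show ?thesis by (simp add: brk_scl spol_0)
qed

lemma dc_sc: "dc (sc b) Q l = 0"
proof -
  have "dc (\<lambda>l. sc b (pre @ l)) Q l = 0" for pre
  proof (induction l arbitrary: pre Q)
    case (Cons x l)
    then show ?case using Cons[of "pre @ [x]"] by (simp add: brk_one)
  qed simp
  from this[of "[]"] show ?thesis by simp
qed

text \<open>All variables are set to zero. Contractions by generators, and so the coboundaries
  \<open>dc\<close>, vanish there, and \<open>tot\<close> becomes \<partial>; this isolates the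
  scalars.\<close>

definition evz :: "'v pol \<Rightarrow> 'v pol" where
  "evz = sb (\<lambda>_. 0)"

lemma evz_simps [simp]: "evz (P + Q) = evz P + evz Q" "evz (cst v) = cst v" "evz (X i * P) = 0" "evz 0 = 0"
  "evz (- P) = - evz P" "evz (sg p * P) = sg p * evz P" by (simp_all add: evz_def sb_mult_X)

lemma evz_act: "evz (act (\<iota> a) i P) = 0"
proof (induction P rule: pol_induct)
  case (cst v)
  show ?case by (simp add: brk_cf[OF order_refl])
qed auto

lemma evz_dc: "evz (dc w Q l) = 0"
  by (induction l arbitrary: w Q) (simp_all add: evz_act)

lemma evz_tot: "evz (tot K P) = dpol V (evz P)"
proof -
  have "evz ((\<Sum>i\<in>K. X i) * P) = 0" by (induction K rule: infinite_finite_induct) (simp_all add: distrib_right)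
  moreover have "evz (dpol V P) = dpol V (evz P)" unfolding evz_def by (rule sb_dpol) simp
  ultimately show ?thesis by (simp add: tot_def)
qed

lemma evz_cst: "\<exists>v. evz P = cst v"
proof (induction P rule: pol_induct)
  case (X k P)
  show ?case by (intro exI[of _ 0]) simp
next
  case (add P P')
  then show ?case by (metis evz_simps(1) single_add)
qed auto

text \<open>\<partial> preserves the degree in the generators, and the part of degree 0 consists of
  scalars, which \<partial> kills; so no derivative has a part of degree 0.\<close>

lemma one_not_der: "scl V c 1 = der V v \<Longrightarrow> c = 0"
proof -
  assume c: "scl V c 1 = der V v"
  obtain M f c0 where f: "v = (\<Sum>k<M. f k)" "\<forall>k. EV (f k) = scl V (of_nat k) (f k)" "f 0 = scl V c0 1"
    using V_eigen by blast
  \<comment> \<open>The homogeneous parts of the difference of both sides: the scalar in degree 0,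
    the derivatives of the parts of \<open>v\<close> in positive degrees.\<close>
  define P where "P k = (case k of 0 \<Rightarrow> cst (scl V c 1) | Suc k' \<Rightarrow> if k < M then - cst (der V (f k)) else 0)" for k
  have "eig {} k (P k)" for k
    using f(2) by (cases k) (auto simp: P_def eig_0 eig_def Eop_def EV_scl EV_1 EV_der spol_minus spol_0 spol_simps Vscl der_simps)
  moreover have "(\<Sum>k<Suc M. P k) = 0"
  proof -
    have "der V v = (\<Sum>k<Suc M. if k < M then der V (f k) else 0)" by (simp add: f(1) additive.sum[OF der_additive])
    also have "\<dots> = (\<Sum>k<M. if Suc k < M then der V (f (Suc k)) else 0)"
      by (simp add: sum.lessThan_Suc_shift f(3) der_simps der_1 Vscl del: sum.lessThan_Suc)
    finally have dv: "der V v = (\<Sum>k<M. if Suc k < M then der V (f (Suc k)) else 0)" .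
    have "(\<Sum>k<Suc M. P k) = cst (scl V c 1) - (\<Sum>k<M. cst (if Suc k < M then der V (f (Suc k)) else 0))"
      by (simp add: sum.lessThan_Suc_shift P_def sum_negf[symmetric] del: sum.lessThan_Suc)
        (intro sum.cong refl, simp)
    also have "\<dots> = 0" unfolding c dv by (simp add: additive.sum[OF cst_additive[of "\<lambda>v. v"]] additive_def spol_0)
    finally show ?thesis .
  qed
  ultimately have "P 0 = 0" using eig_indep[of "Suc M" "{}" P 0] by blast
  then have "scl V c 1 = 0" by (simp add: P_def) (metis lookup_single_eq lookup_zero)
  then show "c = 0" using scl1_eq[of c 0] by (simp add: Vscl)
qed

text \<open>Applying the differential leaves, after cancelling the injective \<open>tot\<close>, a
  coboundary equal to -b; at zero variables this gives b = 0. The given equation at zero variables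
  then presents \<open>c\<close> as a total derivative.\<close>

lemma les_inj:
  assumes b: "lch (Suc n) (q + 1) (sc b)"
    and e: "\<And>l. gdh l \<Longrightarrow> length l = n \<Longrightarrow> sc c l + yb b l = tot (lb l) (z l) + dc x (q + 1) l"
  shows "gdh l \<Longrightarrow> length l = Suc n \<Longrightarrow> b l = 0" and "gdh l \<Longrightarrow> length l = n \<Longrightarrow> c l = 0"
proof -
  have b0: "b l = 0" if l: "gdh l" "length l = Suc n" for l
  proof -
    have "dc (\<lambda>l. sc c l + yb b l) q l = dc (\<lambda>l. tot (lb l) (z l) + dc x (q + 1) l) q l"
      by (rule dc_cong[OF l(1)]) (use l e in auto)
    moreover have "dc (yb b) q l = - tot (lb l) (sc b l)" using dc_yb[OF b l] by (simp add: add.assoc)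
    moreover have "dc (dc x (q + 1)) q l = 0" using dc_dc[OF l(1), of x "q + 1"] by (simp add: add.assoc)
    moreover have "dc (\<lambda>l. tot (lb l) (z l)) q l = tot (lb l) (dc z q l)" using dc_tot[OF l(1), of "{}" z q] by simp
    ultimately have "tot (lb l) (dc z q l) = tot (lb l) (- sc b l)" by (simp add: dc_add dc_sc tot_minus)
    then have "dc z q l = - sc b l" by (rule tot_inj[rotated 2]) (use l in auto)
    then have "evz (- sc b l) = 0" using evz_dc by metis
    then have "scl V (b l) 1 = 0" by simp (metis lookup_single_eq lookup_zero)
    then show ?thesis using scl1_eq[of "b l" 0] by (simp add: Vscl)
  qed
  show "gdh l \<Longrightarrow> length l = Suc n \<Longrightarrow> b l = 0" by (rule b0)
  assume l: "gdh l" "length l = n"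
  have "yb b l = 0" unfolding yb_def
  proof (rule sum.neutral, rule ballI)
    fix j assume "j \<in> {..<N}"
    then have "b (l @ [(fresh l, pu j, us' ! j)]) = 0" by (intro b0) (use l us'_par fresh_notin[of l] in auto)
    then show "cst (scl V (b (l @ [(fresh l, pu j, us' ! j)])) (\<iota> (us ! j))) = 0" by (simp add: Vscl)
  qed
  then have "evz (sc c l) = evz (tot (lb l) (z l) + dc x (q + 1) l)" using e[OF l] by simp
  then have "sc c l = dpol V (evz (z l))" by (simp add: evz_tot evz_dc)
  moreover obtain v where "evz (z l) = cst v" using evz_cst by blast
  ultimately have "scl V (c l) 1 = der V v" by (simp add: dpol_simps) (metis lookup_single_eq)
  then show "c l = 0" by (rule one_not_der)
qed

text \<open>The usual zigzag. The differential of \<open>w\<close> is \<open>tot\<close> of some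
  \<open>W\<close>, which is a cocycle because \<open>tot\<close> is injective; so it is a scalar
  cochain plus the differential of some \<open>z\<close>. Subtracting \<open>tot\<close> of
  \<open>z\<close> and adding \<open>yb\<close> corrects \<open>w\<close> to a cocycle of the basic
  complex, where acyclicity applies again.\<close>

theorem les_surj:
  assumes w: "lch n q w"
    and d: "\<And>l. gdh l \<Longrightarrow> length l = Suc n \<Longrightarrow> \<exists>P\<in>pon (lb l). dc w q l = tot (lb l) P"
  shows "\<exists>c b z x. lch n q (sc c) \<and> lch (Suc n) (q + 1) (sc b) \<and> lch n q z \<and>
    (\<forall>m. n = Suc m \<longrightarrow> lch m (q + 1) x) \<and>
    (\<forall>l. gdh l \<and> length l = n \<longrightarrow> w l = sc c l - yb b l + tot (lb l) (z l) + dc x (q + 1) l)"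
proof -
  define ok where "ok l \<longleftrightarrow> gdh l \<and> length l = Suc n" for l :: "'h item list"
  obtain W where W: "\<And>l. ok l \<Longrightarrow> W l \<in> pon (lb l) \<and> dc w q l = tot (lb l) (W l)" using d unfolding ok_def by metis
  have D: "lch (Suc n) (q + 1) (dc w q)" by (rule dc_lco[OF w])
  have inj: "P = P'" if "ok l" "tot (lb l) P = tot (lb l) P'" for l P P'
    using tot_inj[of "lb l" P P'] that by (cases l) (auto simp: ok_def)
  \<comment> \<open>\<open>W\<close> is merely chosen pointwise, but each cochain condition holds
    after applying the injective \<open>tot\<close>, where it is one for the differential of
    \<open>w\<close>.\<close>
  have Wl: "lch (Suc n) (q + 1) W" unfolding lco_def
  proof (intro conjI allI impI)
    fix l assume l: "gdh l \<and> length l = Suc n"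
    then have ok: "ok l" by (simp add: ok_def)
    show "W l \<in> pon (lb l)" using W[OF ok] by simp
    have "tot (lb l) (W l) \<in> rpar V (1 + (q + 1) + pbs l)" using lco_rpar[OF D, of l] l W[OF ok] by simp
    then show "W l \<in> rpar V (1 + (q + 1) + pbs l)" by (subst (asm) tot_rpar_iff) (use l in auto)
    fix \<rho> :: "nat \<Rightarrow> nat" assume \<rho>: "inj_on \<rho> (lb l)"
    have ok': "ok (rl \<rho> l)" using gd_rl[of _ l \<rho>] l \<rho> by (simp add: ok_def)
    have "tot (lb (rl \<rho> l)) (W (rl \<rho> l)) = tot (lb (rl \<rho> l)) (ren \<rho> (W l))"
      using lco_rl[OF D, of l \<rho>] l \<rho> W[OF ok] W[OF ok'] by (simp add: tot_ren rl_set)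
    then show "W (rl \<rho> l) = ren \<rho> (W l)" by (rule inj[OF ok'])
  next
    fix l1 x z l2 assume l: "gdh (l1 @ x # z # l2) \<and> length (l1 @ x # z # l2) = Suc n"
    then have ok: "ok (l1 @ x # z # l2)" "ok (l1 @ z # x # l2)" by (auto simp: ok_def)
    have e: "lb (l1 @ z # x # l2) = lb (l1 @ x # z # l2)" by auto
    have "tot (lb (l1 @ x # z # l2)) (W (l1 @ x # z # l2)) = tot (lb (l1 @ x # z # l2)) (sgx x z * W (l1 @ z # x # l2))"
      using lco_swap[OF D, of l1 x z l2] l W[OF ok(1)] W[OF ok(2)] unfolding e tot_sg by simp
    then show "W (l1 @ x # z # l2) = sgx x z * W (l1 @ z # x # l2)" by (rule inj[OF ok(1)])
  next
    fix i p a b c l assume l: "gdh ((i, p, a) # l) \<and> gdh ((i, p, b) # l) \<and> Suc (length l) = Suc n"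
    then have ok: "ok ((i, p, a) # l)" "ok ((i, p, b) # l)" "ok ((i, p, scl H c a + b) # l)" by (auto simp: ok_def Hpar)
    have "tot (lb ((i, p, scl H c a + b) # l)) (W ((i, p, scl H c a + b) # l))
      = tot (lb ((i, p, scl H c a + b) # l)) (spol V c (W ((i, p, a) # l)) + W ((i, p, b) # l))"
      using lco_lin_front[OF D, of i p a l b c] l W[OF ok(1)] W[OF ok(2)] W[OF ok(3)] by (simp add: tot_add tot_spol)
    then show "W ((i, p, scl H c a + b) # l) = spol V c (W ((i, p, a) # l)) + W ((i, p, b) # l)" by (rule inj[OF ok(3)])
  qed
  have "dc W (q + 1) l = 0" if l: "gdh l" "length l = Suc (Suc n)" for l
  proof -
    have "tot (lb l) (dc W (q + 1) l) = dc (\<lambda>l. tot (lb l) (W l)) (q + 1) l"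
      using dc_tot[OF l(1), of "{}" W "q + 1"] by simp
    also have "\<dots> = dc (dc w q) (q + 1) l" by (rule dc_cong[OF l(1)]) (use W l in \<open>auto simp: ok_def\<close>)
    also have "\<dots> = 0" by (rule dc_dc[OF l(1)])
    finally show ?thesis by (rule tot_inject[rotated 2]) (use l in auto)
  qed
  from dc_acyclic[OF Wl this] obtain b z where b: "\<And>l. ok l \<Longrightarrow> W l = sc b l + dc z (q + 1 + 1) l"
    and z0: "lch n (q + 1 + 1) z" by (auto simp: ok_def)
  have z: "lch n q z" using z0 by (simp add: add.assoc)
  have dz: "lch (Suc n) (q + 1) (dc z q)" by (rule dc_lco[OF z])
  have bl: "lch (Suc n) (q + 1) (sc b)"
    by (rule lco_cong[OF lco_diff[OF Wl dz]]) (use b in \<open>auto simp: ok_def Hpar add.assoc\<close>)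
  have ybl: "lch n q (yb b)" using yb_lco[OF bl] by (simp add: add.assoc)
  \<comment> \<open>The differential of \<open>yb b\<close> is minus \<open>tot\<close> of the
    scalar part of \<open>W\<close>, so the two corrections together cancel the differential of
    \<open>w\<close>.\<close>
  define w' where "w' l = w l - tot (lb l) (z l) + yb b l" for l
  have w'l: "lch n q w'" unfolding w'_def by (rule lco_add[OF lco_diff[OF w lco_tot[OF z]] ybl])
  have "dc w' q l = 0" if l: "gdh l" "length l = Suc n" for l
  proof -
    have "dc (\<lambda>l. tot (lb l) (z l)) q l = tot (lb l) (dc z q l)" using dc_tot[OF l(1), of "{}" z q] by simp
    moreover have "dc (yb b) q l = - tot (lb l) (sc b l)" using dc_yb[OF bl l] by (simp add: add.assoc)
    moreover have "dc w q l = tot (lb l) (sc b l + dc z q l)" using W[of l] b[of l] l by (simp add: ok_def add.assoc)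
    ultimately show ?thesis unfolding w'_def[abs_def] dc_add dc_diff by (simp add: tot_add)
  qed
  from dc_acyclic[OF w'l this] obtain c x where c: "\<And>l. gdh l \<Longrightarrow> length l = n \<Longrightarrow> w' l = sc c l + dc x (q + 1) l"
    and x: "\<And>m. n = Suc m \<Longrightarrow> lch m (q + 1) x" by auto
  \<comment> \<open>Only the sum with the coboundary is known to be a cochain. Subtracting the
    coboundary settles positive degrees; in degree 0 it is zero.\<close>
  have cl: "lch n q (sc c)"
  proof (cases n)
    case 0
    show ?thesis by (rule lco_cong[OF w'l]) (use c 0 in \<open>auto simp: Hpar\<close>)
  next
    case (Suc m)
    have "lch n q (dc x (q + 1))" using dc_lco[OF x[OF Suc]] Suc by (simp add: add.assoc)
    from lco_diff[OF w'l this] show ?thesis by (rule lco_cong) (use c in \<open>auto simp: Hpar\<close>)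
  qed
  have "w l = sc c l - yb b l + tot (lb l) (z l) + dc x (q + 1) l" if "gdh l" "length l = n" for l
    using c[OF that] by (simp add: w'_def algebra_simps)
  then show ?thesis using cl bl z x by blast
qed

end

section \<open>Cochains with values in the quotient\<close>

text \<open>Passes from special to general arguments one slot at a time, for instance from
  generators to elements of the algebra.\<close>

lemma slot_induct:
  assumes ST: "S \<subseteq> T"
    and step: "\<And>as i a. length as = n \<Longrightarrow> i < n \<Longrightarrow> set as \<subseteq> T \<Longrightarrow> a \<in> T \<Longrightarrow> (\<And>b. b \<in> S \<Longrightarrow> P (as[i := b])) \<Longrightarrow> P (as[i := a])"
    and base: "\<And>as. length as = n \<Longrightarrow> set as \<subseteq> S \<Longrightarrow> P as"
    and as: "length as = n" "set as \<subseteq> T"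
  shows "P as"
proof -
  \<comment> \<open>After \<open>k\<close> rounds the first \<open>k\<close> entries are arbitrary
    in \<open>T\<close>, while the others are still in \<open>S\<close>.\<close>
  have "\<forall>as. length as = n \<and> set as \<subseteq> T \<and> set (drop k as) \<subseteq> S \<longrightarrow> P as" if "k \<le> n" for k using that
  proof (induction k)
    case 0
    then show ?case using base by simp
  next
    case (Suc k)
    show ?case
    proof (intro allI impI)
      fix as assume as: "length as = n \<and> set as \<subseteq> T \<and> set (drop (Suc k) as) \<subseteq> S"
      have "P (as[k := as ! k])"
      proof (rule step)
        fix b assume b: "b \<in> S"
        have "set (as[k := b]) \<subseteq> T" using as b ST by (intro set_update_subsetI) auto
        moreover have "drop k (as[k := b]) = b # drop (Suc k) as"
          using as Suc.prems by (subst Cons_nth_drop_Suc[symmetric]) auto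
        ultimately show "P (as[k := b])" using Suc as b by auto
      qed (use as Suc.prems in \<open>auto simp: subset_iff\<close>)
      then show "P as" by simp
    qed
  qed
  from this[of n] show ?thesis using as by simp
qed

text \<open>The standard labelling by positions; it links the given cochains, with variables
  \<open>X 0\<close> to \<open>X (n - 1)\<close>, to items.\<close>

definition zit :: "bit list \<Rightarrow> 'a list \<Rightarrow> 'a item list" where
  "zit ps as = map (\<lambda>k. (k, ps ! k, as ! k)) [0..<length as]"

lemma zit_len [simp]: "length (zit ps as) = length as"
  and zit_nth [simp]: "i < length as \<Longrightarrow> zit ps as ! i = (i, ps ! i, as ! i)"
  and zit_set [simp]: "lb (zit ps as) = {..<length as}"
  by (auto simp: zit_def image_image)

lemma zit_gd: "gd A (zit ps as) \<longleftrightarrow> (\<forall>i<length as. as ! i \<in> A (ps ! i))"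
proof -
  have "map fst (zit ps as) = [0..<length as]" by (simp add: zit_def comp_def)
  then show ?thesis by (auto simp: gd_def) (auto simp: zit_def)
qed

lemma zit_homs: "homs S ps as \<Longrightarrow> gd (par S) (zit ps as)"
  unfolding zit_gd homs_def by (auto dest: list_all2_nthD2)

lemma homs_length: "homs S ps as \<Longrightarrow> length ps = length as"
  by (simp add: homs_def list_all2_lengthD)

lemma homs_nth: "homs S ps as \<Longrightarrow> i < length as \<Longrightarrow> as ! i \<in> par S (ps ! i)"
  unfolding homs_def by (auto dest: list_all2_nthD2)

lemma homs_update: "homs S ps as \<Longrightarrow> a \<in> par S p \<Longrightarrow> homs S (ps[i := p]) (as[i := a])"
  unfolding homs_def by (rule list_all2_update_cong)

lemma pbs_zit: "length ps = length as \<Longrightarrow> pbs (zit ps as) = (\<Sum>p\<leftarrow>ps. 1 + p)"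
proof -
  assume l: "length ps = length as"
  have "map (\<lambda>x. 1 + pt x) (zit ps as) = map (\<lambda>p. 1 + p) ps" by (rule nth_equalityI) (use l in auto)
  then show ?thesis by (simp add: pbs_def)
qed

lemma take_zit: "i \<le> length as \<Longrightarrow> take i (zit ps as) = zit (take i ps) (take i as)"
  by (rule nth_equalityI) auto

lemma zit_update:
  assumes "i < length as" "length ps = length as"
  shows "zit (ps[i := p]) (as[i := a]) = take i (zit ps as) @ (i, p, a) # drop (Suc i) (zit ps as)"
proof -
  have "zit (ps[i := p]) (as[i := a]) = (zit ps as)[i := (i, p, a)]"
    by (rule nth_equalityI) (use assms in \<open>auto simp: nth_list_update\<close>)
  then show ?thesis using assms by (simp add: upd_conv_take_nth_drop)
qed

lemma homs_exist:
  assumes "super_space S" "set as \<subseteq> par S 0 \<union> par S 1"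
  shows "\<exists>ps. homs S ps as"
proof -
  have "\<forall>a\<in>set as. \<exists>p. a \<in> par S p" using assms(2) by blast
  then show ?thesis
  proof (induction as)
    case (Cons a as)
    then obtain p ps where "a \<in> par S p" "homs S ps as" by auto
    then show ?case by (intro exI[of _ "p # ps"]) (simp add: homs_def)
  qed (auto simp: homs_def)
qed

lemma (in super_space) slot_induct_par:
  assumes base: "\<And>as. length as = n \<Longrightarrow> set as \<subseteq> par S 0 \<union> par S 1 \<Longrightarrow> P as"
    and add: "\<And>as i a b. length as = n \<Longrightarrow> i < n \<Longrightarrow> P (as[i := a]) \<Longrightarrow> P (as[i := b]) \<Longrightarrow> P (as[i := a + b])"
    and n: "length as = n"
  shows "P as"
proof (rule slot_induct[where P = P and S = "par S 0 \<union> par S 1" and T = UNIV, OF _ _ base n])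
  fix as i a
  assume as: "length as = n" "i < n" and h: "\<And>b. b \<in> par S 0 \<union> par S 1 \<Longrightarrow> P (as[i := b])"
  have "pcomp S p a \<in> par S 0 \<union> par S 1" for p using pcomp_par(1)[of p a] by (cases p) auto
  then show "P (as[i := a])" using add[OF as h h] pcomp_sum by metis
qed auto

definition tau :: "nat \<Rightarrow> nat \<Rightarrow> nat" where
  "tau i = id(i := Suc i, Suc i := i)"

lemma tau_simps [simp]: "tau i i = Suc i" "tau i (Suc i) = i" "k \<noteq> i \<Longrightarrow> k \<noteq> Suc i \<Longrightarrow> tau i k = k"
  by (auto simp: tau_def)

lemma tau_image: "Suc i < n \<Longrightarrow> tau i ` {..<n} = {..<n}"
proof -
  assume i: "Suc i < n"
  have "k \<in> tau i ` {..<n}" if "k < n" for k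
    by (rule image_eqI[of _ _ "tau i k"]) (use i that in \<open>auto simp: tau_def\<close>)
  then show ?thesis using i by (auto simp: tau_def)
qed

lemma tau_inj: "inj (tau i)"
  by (auto simp: inj_def tau_def)

lemma lswap_len [simp]: "length (lswap i xs) = length xs"
  by (simp add: lswap_def)

text \<open>Extends a function of homogeneous arguments to all arguments by summing over their
  parity components, as \<open>d_ext\<close> does.\<close>

definition flat :: "('f, 'a::ab_group_add, 'm) superspace_scheme \<Rightarrow> nat \<Rightarrow> ('a item list \<Rightarrow> 'b::comm_monoid_add) \<Rightarrow> 'a list \<Rightarrow> 'b" where
  "flat S n y as = (\<Sum>ps\<leftarrow>List.n_lists n [0, 1]. y (zit ps (map2 (pcomp S) ps as)))"

lemma set_bits: "set (List.n_lists n [0, 1]) = {ps :: bit list. length ps = n}"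
proof -
  have "set ps \<subseteq> {0, 1}" for ps :: "bit list" by (metis bit_not_one_iff insertCI subsetI)
  then show ?thesis by (auto simp: set_n_lists)
qed

lemma flat_sum: "flat S n y as = (\<Sum>ps | length ps = n. y (zit ps (map2 (pcomp S) ps as)))"
proof -
  have "distinct (List.n_lists n [0, 1 :: bit])" by (rule distinct_n_lists) simp
  then show ?thesis unfolding flat_def by (subst sum_list_distinct_conv_sum_set) (simp_all add: set_bits)
qed

lemma flat_slot:
  assumes n: "length as = n" "i < n" and ps: "length ps = n"
  shows "zit ps (map2 (pcomp S) ps (as[i := a]))
    = take i (zit ps (map2 (pcomp S) ps as)) @ (i, ps ! i, pcomp S (ps ! i) a) # drop (Suc i) (zit ps (map2 (pcomp S) ps as))"
proof -
  have "map2 (pcomp S) ps (as[i := a]) = (map2 (pcomp S) ps as)[i := pcomp S (ps ! i) a]"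
    by (rule nth_equalityI) (use assms in \<open>auto simp: nth_list_update\<close>)
  then show ?thesis using zit_update[of i "map2 (pcomp S) ps as" ps "ps ! i" "pcomp S (ps ! i) a"] assms by simp
qed

lemma slot_gd:
  assumes g: "gd A L" and i: "i < length L" and a: "a \<in> A p" and f: "fst (L ! i) = i"
  shows "gd A (take i L @ (i, p, a) # drop (Suc i) L)"
proof -
  have "gd A (take i L @ L ! i # drop (Suc i) L)" using g i by (simp add: id_take_nth_drop[symmetric])
  then show ?thesis using a f by auto
qed

context super_space
begin

lemma pcomps_gd: "length ps = length as \<Longrightarrow> gd (par S) (zit ps (map2 (pcomp S) ps as))"
  by (simp add: zit_gd pcomp_par)

text \<open>For homogeneous arguments, any other choice of parities has a zero component in some
  slot.\<close>

lemma flat_homs: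
  assumes z: "\<And>l1 i p l2. gd (par S) (l1 @ (i, p, 0) # l2) \<Longrightarrow> length (l1 @ (i, p, 0) # l2) = n \<Longrightarrow> y (l1 @ (i, p, 0) # l2) = 0"
    and h: "homs S ps as" and n: "length as = n"
  shows "flat S n y as = y (zit ps as)"
proof -
  have lp: "length ps = n" using homs_length[OF h] n by simp
  have fin: "finite {ps :: bit list. length ps = n}" unfolding set_bits[symmetric] by simp
  have "y (zit qs (map2 (pcomp S) qs as)) = 0" if qs: "length qs = n" "qs \<noteq> ps" for qs
  proof -
    obtain i where i: "i < n" "qs ! i \<noteq> ps ! i" using qs lp nth_equalityI[of qs ps] by auto
    let ?bs = "map2 (pcomp S) qs as"
    have bi: "?bs ! i = 0" using i qs n homs_nth[OF h, of i] by (simp add: pcomp_hom)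
    have g: "gd (par S) (zit qs ?bs)" by (rule pcomps_gd) (simp add: qs n)
    have "zit qs ?bs = zit (qs[i := qs ! i]) (?bs[i := ?bs ! i])" by simp
    also have "\<dots> = take i (zit qs ?bs) @ (i, qs ! i, 0) # drop (Suc i) (zit qs ?bs)"
      unfolding bi by (rule zit_update) (use i qs n in auto)
    finally have e: "zit qs ?bs = take i (zit qs ?bs) @ (i, qs ! i, 0) # drop (Suc i) (zit qs ?bs)" .
    have "length (zit qs ?bs) = n" using qs n by simp
    then show ?thesis using g z e by metis
  qed
  then have "flat S n y as = y (zit ps (map2 (pcomp S) ps as))"
    unfolding flat_sum using lp fin by (subst sum.remove[of _ ps]) (auto intro!: sum.neutral)
  moreover have "map2 (pcomp S) ps as = as" by (rule nth_equalityI) (use pcomp_hom[OF homs_nth[OF h]] lp n in auto)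
  ultimately show ?thesis by simp
qed

lemma flat_lin:
  assumes lin: "\<And>l1 i p a b l2. gd (par S) (l1 @ (i, p, a) # l2) \<Longrightarrow> gd (par S) (l1 @ (i, p, b) # l2) \<Longrightarrow> length (l1 @ (i, p, a) # l2) = n \<Longrightarrow>
      y (l1 @ (i, p, scl S c a + b) # l2) = f (y (l1 @ (i, p, a) # l2)) + y (l1 @ (i, p, b) # l2)"
    and f: "additive f" and as: "length as = n" "i < n"
  shows "flat S n y (as[i := scl S c a + b]) = f (flat S n y (as[i := a])) + flat S n y (as[i := b])"
proof -
  let ?L = "\<lambda>ps as. zit ps (map2 (pcomp S) ps as)"
  have "y (?L ps (as[i := scl S c a + b])) = f (y (?L ps (as[i := a]))) + y (?L ps (as[i := b]))"
    if ps: "length ps = n" for ps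
  proof -
    have g: "gd (par S) (take i (?L ps as) @ (i, ps ! i, pcomp S (ps ! i) d) # drop (Suc i) (?L ps as))" for d
      by (rule slot_gd) (use as ps pcomps_gd in \<open>auto simp: pcomp_par\<close>)
    show ?thesis unfolding flat_slot[OF as ps] pcomp_add pcomp_scl by (rule lin[OF g g]) (use as ps in auto)
  qed
  then show ?thesis by (simp add: flat_sum additive.sum[OF f] sum.distrib[symmetric])
qed

end

text \<open>Exchanging arguments in a standard list leaves the labels in place; after renaming by
  \<open>tau i\<close> the items themselves are exchanged, and the symmetry of \<open>y\<close>
  applies.\<close>

lemma lco_zit_swap:
  assumes y: "lco V (par S) s n q y" and as: "length as = n" "homs S ps as" "Suc i < n"
  shows "homs S (lswap i ps) (lswap i as)"
    and "ren (tau i) (y (zit (lswap i ps) (lswap i as))) = sg ((1 + ps ! i) * (1 + ps ! Suc i)) * y (zit ps as)"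
proof -
  let ?l1 = "take i (zit ps as)" and ?l2 = "drop (Suc (Suc i)) (zit ps as)"
  have lp: "length ps = n" using homs_length as by metis
  show h': "homs S (lswap i ps) (lswap i as)" unfolding lswap_def homs_def using as lp homs_nth[OF as(2)]
    by (intro list_all2_update_cong) (auto simp: homs_def)
  have e: "zit ps as = ?l1 @ (i, ps ! i, as ! i) # (Suc i, ps ! Suc i, as ! Suc i) # ?l2"
    using id_take_nth_drop[of i "zit ps as"] Cons_nth_drop_Suc[of "Suc i" "zit ps as"] as by simp
  have minus_Suc: "m - i = Suc x \<longleftrightarrow> m = Suc (i + x)" for m x by auto
  have e': "rl (tau i) (zit (lswap i ps) (lswap i as)) = ?l1 @ (Suc i, ps ! Suc i, as ! Suc i) # (i, ps ! i, as ! i) # ?l2"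
    by (rule nth_equalityI) (use as lp in \<open>auto simp: rl_def lswap_def nth_list_update nth_append nth_Cons tau_def minus_Suc split: nat.split\<close>)
  have g: "gd (par S) (?l1 @ (i, ps ! i, as ! i) # (Suc i, ps ! Suc i, as ! Suc i) # ?l2)"
    using zit_homs[OF as(2)] e by metis
  have "ren (tau i) (y (zit (lswap i ps) (lswap i as))) = y (rl (tau i) (zit (lswap i ps) (lswap i as)))"
    using lco_rl[OF y zit_homs[OF h'] _ inj_on_subset[OF tau_inj subset_UNIV], of i] as by simp
  also have "\<dots> = sg ((1 + ps ! i) * (1 + ps ! Suc i)) * y (zit ps as)"
    unfolding e' using lco_swap[OF y g] e as by (simp add: min_def split: if_splits)
  finally show "ren (tau i) (y (zit (lswap i ps) (lswap i as))) = sg ((1 + ps ! i) * (1 + ps ! Suc i)) * y (zit ps as)" .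
qed

section \<open>Classes in the quotient, and the cochains induced by basic ones\<close>

context poisson_vertex_superalgebra
begin

abbreviation "I n \<equiv> tot_der_image V n"
abbreviation "Cl \<equiv> cls V"

lemma I_tot: "I n = tot {..<n} ` pon {..<n}"
  by (simp add: tot_der_image_def tot_def[abs_def] pols_pon)

lemma I_closed [simp]: "0 \<in> I n" "P \<in> I n \<Longrightarrow> Q \<in> I n \<Longrightarrow> P + Q \<in> I n" "P \<in> I n \<Longrightarrow> Q \<in> I n \<Longrightarrow> P - Q \<in> I n"
  "P \<in> I n \<Longrightarrow> spol V c P \<in> I n" "P \<in> I n \<Longrightarrow> - P \<in> I n" "P \<in> I n \<Longrightarrow> sg p * P \<in> I n"
proof -
  have z: "0 \<in> I n" unfolding I_tot by (rule image_eqI[of _ _ 0]) (simp_all add: tot_0)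
  show "0 \<in> I n" by (rule z)
  show d: "P \<in> I n \<Longrightarrow> Q \<in> I n \<Longrightarrow> P - Q \<in> I n" for P Q unfolding I_tot by (clarsimp simp: tot_diff[symmetric])
  show m: "P \<in> I n \<Longrightarrow> - P \<in> I n" for P using d[OF z, of P] by simp
  show "P \<in> I n \<Longrightarrow> Q \<in> I n \<Longrightarrow> P + Q \<in> I n" using d[OF _ m, of P Q] by simp
  show "P \<in> I n \<Longrightarrow> spol V c P \<in> I n" unfolding I_tot by (clarsimp simp: tot_spol[symmetric] spol_pon)
  show "P \<in> I n \<Longrightarrow> sg p * P \<in> I n" using m by (cases p) simp_all
qed

lemma I_pr: "P \<in> I n \<Longrightarrow> pr p P \<in> I n"
  unfolding I_tot by (auto simp: pr_tot intro: pr_pon)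

lemma Cl_def: "Cl n P = {P + u | u. u \<in> I n}"
  by (simp add: cls_def lcoset_def pol_space_def)

lemma Cl_mem: "Q \<in> Cl n P \<longleftrightarrow> Q - P \<in> I n"
  unfolding Cl_def by (auto intro: exI[of _ "Q - P"])

lemma Cl_eq: "Cl n P = Cl n Q \<longleftrightarrow> P - Q \<in> I n"
proof
  assume "Cl n P = Cl n Q"
  moreover have "P \<in> Cl n P" by (simp add: Cl_mem)
  ultimately show "P - Q \<in> I n" by (simp add: Cl_mem)
next
  assume d: "P - Q \<in> I n"
  have "R - P \<in> I n \<longleftrightarrow> R - Q \<in> I n" for R
    using I_closed(2)[OF _ d, of "R - P"] I_closed(3)[OF _ d, of "R - Q"] by (auto simp: algebra_simps)
  then show "Cl n P = Cl n Q" by (auto simp: Cl_mem)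
qed

lemma tgt_simps [simp]:
  "ladd (tgt V n) (Cl n P) (Cl n Q) = Cl n (P + Q)"
  "lsmul (tgt V n) c (Cl n P) = Cl n (spol V c P)"
  "lzero (tgt V n) = Cl n 0"
  "lcarr (tgt V n) = Cl n ` pon {..<n}"
proof -
  show "ladd (tgt V n) (Cl n P) (Cl n Q) = Cl n (P + Q)"
  proof (rule set_eqI)
    fix R
    have "R \<in> ladd (tgt V n) (Cl n P) (Cl n Q) \<longleftrightarrow> (\<exists>A B. R = A + B \<and> A - P \<in> I n \<and> B - Q \<in> I n)"
      by (simp add: tgt_def lquot_def pol_space_def Cl_mem)
    also have "\<dots> \<longleftrightarrow> R - (P + Q) \<in> I n"
    proof
      assume "\<exists>A B. R = A + B \<and> A - P \<in> I n \<and> B - Q \<in> I n"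
      then obtain A B where "R = A + B" "A - P \<in> I n" "B - Q \<in> I n" by blast
      then show "R - (P + Q) \<in> I n" using I_closed(2)[of "A - P" n "B - Q"] by (simp add: algebra_simps)
    next
      assume "R - (P + Q) \<in> I n"
      then show "\<exists>A B. R = A + B \<and> A - P \<in> I n \<and> B - Q \<in> I n"
        by (intro exI[of _ "R - Q"] exI[of _ Q]) (simp add: algebra_simps)
    qed
    finally show "R \<in> ladd (tgt V n) (Cl n P) (Cl n Q) \<longleftrightarrow> R \<in> Cl n (P + Q)" by (simp add: Cl_mem)
  qed
  show "lsmul (tgt V n) c (Cl n P) = Cl n (spol V c P)"
  proof (rule set_eqI)
    fix R
    have "R \<in> lsmul (tgt V n) c (Cl n P) \<longleftrightarrow> (\<exists>A u. R = spol V c A + u \<and> A - P \<in> I n \<and> u \<in> I n)"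
      by (simp add: tgt_def lquot_def pol_space_def Cl_mem)
    also have "\<dots> \<longleftrightarrow> R - spol V c P \<in> I n"
    proof
      assume "\<exists>A u. R = spol V c A + u \<and> A - P \<in> I n \<and> u \<in> I n"
      then obtain A u where "R = spol V c A + u" "A - P \<in> I n" "u \<in> I n" by blast
      then show "R - spol V c P \<in> I n"
        using I_closed(2)[OF I_closed(4)[of "A - P" n c], of u] by (simp add: spol_diff algebra_simps)
    next
      assume "R - spol V c P \<in> I n"
      then show "\<exists>A u. R = spol V c A + u \<and> A - P \<in> I n \<and> u \<in> I n"
        by (intro exI[of _ P] exI[of _ "R - spol V c P"]) simp
    qed
    finally show "R \<in> lsmul (tgt V n) c (Cl n P) \<longleftrightarrow> R \<in> Cl n (spol V c P)" by (simp add: Cl_mem)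
  qed
  show "lzero (tgt V n) = Cl n 0" by (simp add: Cl_def tgt_def lquot_def)
  show "lcarr (tgt V n) = Cl n ` pon {..<n}" by (simp add: tgt_def lquot_def cls_def pol_space_def pols_pon)
qed

lemma lsum_Cl: "lsum (tgt V n) (map (\<lambda>x. Cl n (f x)) xs) = Cl n (\<Sum>x\<leftarrow>xs. f x)"
  by (induction xs) (simp_all add: lsum_def)

lemma tgt_par_Cl: "tgt_par V n p = Cl n ` (pon {..<n} \<inter> rpar V p)"
  by (simp add: tgt_par_def pols_pon rpar_def Collect_conj_eq[symmetric]) (simp add: Int_def)

text \<open>If \<open>f\<close> maps the image of \<open>tot\<close> into the subspace divided out,
  the classes in the union over all representatives coincide.\<close>

lemma qmap_Cl:
  assumes "additive f" "\<And>P. P \<in> pon {..<n} \<Longrightarrow> f (tot {..<n} P) \<in> I m"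
  shows "qmap V m f (Cl n P) = Cl m (f P)"
proof -
  have "Cl m (f Q) = Cl m (f P)" if "Q \<in> Cl n P" for Q
    using that assms by (auto simp: Cl_eq Cl_mem I_tot[of n] additive.diff[symmetric])
  moreover have "P \<in> Cl n P" by (simp add: Cl_mem)
  ultimately show ?thesis unfolding qmap_def by blast
qed

lemma I_X: "i < n \<Longrightarrow> P \<in> I n \<Longrightarrow> X i * P \<in> I n"
  unfolding I_tot by (clarsimp simp: tot_IP[symmetric])

lemma tot_in_I: "P \<in> pon {..<n} \<Longrightarrow> tot {..<n} P \<in> I n"
  by (simp add: I_tot)

text \<open>The commutators of \<open>em i b\<close> with \<partial> and with \<lambda>_i are
  opposite, so they cancel in the sum \<partial> + \<lambda>_i.\<close>

lemma em_tot: "i \<in> K \<Longrightarrow> finite K \<Longrightarrow> em i b (tot K P) = tot K (em i b P)"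
proof -
  assume i: "i \<in> K" "finite K"
  have s: "em i b ((\<Sum>k\<in>K - {i}. X k) * P) = (\<Sum>k\<in>K - {i}. X k) * em i b P"
    by (simp add: sum_distrib_right em_sum em_X_other)
  have "(\<Sum>k\<in>K. X k) = X i + (\<Sum>k\<in>K - {i}. X k :: 'v pol)" using i by (simp add: sum.remove)
  then show ?thesis using s em_dpol[of i b P] by (simp add: tot_def distrib_right em_X_same)
qed

lemma qmap_X: "i < n \<Longrightarrow> qmap V n (\<lambda>P. - (X i * P)) (Cl n P) = Cl n (- (X i * P))"
  by (rule qmap_Cl) (auto intro: additiveI I_X tot_in_I I_closed simp: distrib_left)

lemma qmap_em: "i < n \<Longrightarrow> qmap V n (em i b) (Cl n P) = Cl n (em i b P)"
  by (rule qmap_Cl) (auto intro: em_additive tot_in_I em_pon simp: em_tot)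

lemma subst_ren: "P \<in> pon {..<length ks} \<Longrightarrow> subst (map X ks) P = ren ((!) ks) P"
  unfolding subst_sb ren_def by (rule sb_cong) auto

lemma lswap_upt: "Suc i < n \<Longrightarrow> lswap i [0..<n] = map (tau i) [0..<n]"
  by (rule nth_equalityI) (auto simp: lswap_def nth_list_update tau_def)

lemma lswap_map: "Suc i < length xs \<Longrightarrow> lswap i (map f xs) = map f (lswap i xs)"
  by (simp add: lswap_def map_update)

lemma subst_additive: "additive (subst \<Lambda>)"
  unfolding subst_sb[abs_def] by (rule sb_additive)

lemma subst_tau: "Suc i < n \<Longrightarrow> P \<in> pon {..<n} \<Longrightarrow> subst (lswap i (map X [0..<n])) P = ren (tau i) P"
  unfolding lswap_map[of i "[0..<n]", simplified] lswap_upt by (subst subst_ren) (auto intro: ren_cong)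

lemma qmap_tau:
  assumes i: "Suc i < n" and P: "P \<in> pon {..<n}"
  shows "qmap V n (subst (lswap i (map X [0..<n]))) (Cl n P) = Cl n (ren (tau i) P)"
proof -
  have "qmap V n (subst (lswap i (map X [0..<n]))) (Cl n P) = Cl n (subst (lswap i (map X [0..<n])) P)"
  proof (rule qmap_Cl)
    fix Q :: "'v pol" assume Q: "Q \<in> pon {..<n}"
    have "ren (tau i) (tot {..<n} Q) = tot {..<n} (ren (tau i) Q)"
      using tot_ren[OF inj_on_subset[OF tau_inj subset_UNIV], of i "{..<n}" Q] tau_image[OF i] by simp
    moreover have "ren (tau i) Q \<in> pon {..<n}" using ren_pon[OF Q, of "tau i"] tau_image[OF i] by simp
    ultimately show "subst (lswap i (map X [0..<n])) (tot {..<n} Q) \<in> I n"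
      using Q by (simp add: subst_tau[OF i] tot_pon tot_in_I)
  qed (rule subst_additive)
  then show ?thesis by (simp add: subst_tau[OF i P])
qed

definition fl :: "nat \<Rightarrow> ('v item list \<Rightarrow> 'v pol) \<Rightarrow> 'v list \<Rightarrow> 'v pol set" where
  "fl n y = (\<lambda>as\<in>lists_of_length n. Cl n (flat V n y as))"

lemma bco_zero_entry:
  assumes y: "bco V n q y" and g: "gdv (l1 @ (i, p, 0) # l2)" "length (l1 @ (i, p, 0) # l2) = n"
  shows "y (l1 @ (i, p, 0) # l2) = 0"
  using bco_lin[OF y g(1,1,2), of 1] by (simp add: spol_lin scl_simps)

lemma fl_homs:
  assumes y: "bco V n q y" and h: "homs V ps as" and n: "length as = n"
  shows "fl n y as = Cl n (y (zit ps as))"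
proof -
  have "flat V n y as = y (zit ps as)" by (rule flat_homs[OF _ h n]) (rule bco_zero_entry[OF y])
  then show ?thesis using n by (simp add: fl_def lists_of_length_def)
qed

lemma fl_multilinear:
  assumes y: "bco V n q y"
  shows "fl n y \<in> multilinear (scl V) n (tgt V n)"
proof -
  let ?L = "\<lambda>ps as. zit ps (map2 (pcomp V) ps as)"
  have car: "flat V n y as \<in> pon {..<n}" if "length as = n" for as unfolding flat_sum
  proof (rule pon_sum)
    fix ps :: "bit list" assume ps: "ps \<in> {ps. length ps = n}"
    show "y (?L ps as) \<in> pon {..<n}"
      using lco_pon[OF bco_lco[OF y], of "?L ps as"] pcomps_gd[of ps as] ps that by simp
  qed
  have lin: "flat V n y (as[i := scl V c a + b]) = spol V c (flat V n y (as[i := a])) + flat V n y (as[i := b])"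
    if "length as = n" "i < n" for as i a b c
    by (rule flat_lin[where f = "spol V c"]) (use bco_lin[OF y] spol_additive that in auto)
  have add: "flat V n y (as[i := a + b]) = flat V n y (as[i := a]) + flat V n y (as[i := b])" if "length as = n" "i < n" for as i a b
    using lin[OF that, of 1 a b] by (simp add: scl_simps spol_lin)
  have z: "flat V n y (as[i := 0]) = 0" if "length as = n" "i < n" for as i using add[OF that, of 0 0] by simp
  have sc: "flat V n y (as[i := scl V c a]) = spol V c (flat V n y (as[i := a]))" if "length as = n" "i < n" for as i a c
    using lin[OF that, of c a 0] z[OF that] by simp
  show ?thesis unfolding multilinear_def by (auto simp: fl_def lists_of_length_def add sc car)
qed

theorem fl_hcochain:
  assumes y: "bco V n q y"
  shows "fl n y \<in> hcochains V n q"
proof -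
  note ly = bco_lco[OF y]
  have one: "fl n y as \<in> tgt_par V n (1 + (q + (\<Sum>p\<leftarrow>ps. 1 + p)))" if "length as = n" "homs V ps as" for as ps
    unfolding fl_homs[OF y that(2,1)] tgt_par_Cl
    using lco_pon[OF ly zit_homs[OF that(2)]] lco_rpar[OF ly zit_homs[OF that(2)]] that homs_length[OF that(2)]
    by (intro imageI) (simp add: pbs_zit add.assoc)
  have der: "fl n y (as[i := der V a]) = qmap V n (\<lambda>P. - (X i * P)) (fl n y (as[i := a]))" if as: "length as = n" "i < n" for as i a
  proof -
    have "flat V n y (as[i := der V a]) = - (X i * flat V n y (as[i := a]))"
      unfolding flat_sum sum_distrib_left sum_negf[symmetric]
    proof (rule sum.cong[OF refl])
      fix ps :: "bit list" assume ps0: "ps \<in> {ps. length ps = n}"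
      then have ps: "length ps = n" by simp
      show "y (zit ps (map2 (pcomp V) ps (as[i := der V a]))) = - (X i * y (zit ps (map2 (pcomp V) ps (as[i := a]))))"
        unfolding flat_slot[OF as ps] pcomp_der
        by (rule bco_der[OF y slot_gd]) (use as ps pcomps_gd in \<open>auto simp: pcomp_par\<close>)
    qed
    then show ?thesis using as by (simp add: fl_def lists_of_length_def qmap_X)
  qed
  have sym: "qmap V n (subst (lswap i (map X [0..<n]))) (fl n y (lswap i as)) = lsmul (tgt V n) (sg ((1 + ps ! i) * (1 + ps ! Suc i))) (fl n y as)"
    if as: "length as = n" "homs V ps as" "Suc i < n" for as ps i
  proof -
    note h' = lco_zit_swap(1)[OF ly as]
    have P: "y (zit (lswap i ps) (lswap i as)) \<in> pon {..<n}" using lco_pon[OF ly zit_homs[OF h']] as by simp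
    show ?thesis
      using as lco_zit_swap(2)[OF ly as] by (simp add: fl_homs[OF y h'] fl_homs[OF y as(2)] qmap_tau[OF as(3) P] spol_sg_eq)
  qed
  have leib: "fl n y (as[i := b * c]) = ladd (tgt V n)
            (lsmul (tgt V n) (sg (pb * (q + (\<Sum>p\<leftarrow>take i ps. 1 + p)))) (qmap V n (em i b) (fl n y (as[i := c]))))
            (lsmul (tgt V n) (sg (pc * (pb + (q + (\<Sum>p\<leftarrow>take i ps. 1 + p))))) (qmap V n (em i c) (fl n y (as[i := b]))))"
    if as: "length as = n" "homs V ps as" "i < n" "b \<in> par V pb" "c \<in> par V pc" for as ps i b c pb pc
  proof -
    have lp: "length ps = length as" using homs_length as by metis
    note hb = homs_update[OF as(2,4), of i] and hc = homs_update[OF as(2,5), of i]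
    note hbc = homs_update[OF as(2) mult_par[OF as(4,5)], of i]
    have g: "gdv (take i (zit ps as) @ (i, p, d) # drop (Suc i) (zit ps as))" if "d \<in> par V p" for d p
      by (rule slot_gd) (use zit_homs[OF as(2)] that as in auto)
    have pb: "pbs (take i (zit ps as)) = (\<Sum>p\<leftarrow>take i ps. 1 + p)" using as lp by (simp add: take_zit pbs_zit)
    have "y (zit (ps[i := pb + pc]) (as[i := b * c])) = sg (pb * (q + pbs (take i (zit ps as)))) * em i b (y (zit (ps[i := pc]) (as[i := c])))
      + sg (pc * (pb + q + pbs (take i (zit ps as)))) * em i c (y (zit (ps[i := pb]) (as[i := b])))"
      using bco_leib[OF y g[OF as(4)] g[OF as(5)]] as lp by (simp add: zit_update)
    then show ?thesis
      using as by (simp add: fl_homs[OF y hb] fl_homs[OF y hc] fl_homs[OF y hbc] qmap_em spol_sg_eq pb add.assoc)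
  qed
  show ?thesis unfolding hcochains_def Let_def using fl_multilinear[OF y] one der sym leib by blast
qed

end

section \<open>Comparison with the given differential\<close>

definition iti :: "bit list \<Rightarrow> 'a list \<Rightarrow> nat \<Rightarrow> 'a item" where
  "iti ps as k = (k, ps ! k, as ! k)"

lemma iti_simps [simp]: "fst (iti ps as k) = k" "pt (iti ps as k) = ps ! k" "ag (iti ps as k) = as ! k"
  by (simp_all add: iti_def)

lemma zit_iti: "zit ps as = map (iti ps as) [0..<length as]"
  by (simp add: zit_def iti_def[abs_def])

lemma omit_set [simp]: "set (omit n J) = {..n} - J"
  and omit_distinct [simp]: "distinct (omit n J)"
  by (auto simp: omit_def simp del: upt_Suc)

lemma omit_len: "length (omit n J) = card ({..n} - J)"
  by (metis distinct_card omit_set omit_distinct)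

lemma upt_split: "a \<le> b \<Longrightarrow> b \<le> c \<Longrightarrow> [a..<c] = [a..<b] @ [b..<c]"
  by (metis le_Suc_ex upt_add_eq_append)

lemma omit_1: "i \<le> n \<Longrightarrow> omit n {i} = [0..<i] @ [Suc i..<Suc n]"
proof -
  assume "i \<le> n"
  then have "[0..<Suc n] = [0..<i] @ i # [Suc i..<Suc n]"
    using upt_split[of 0 i "Suc n"] upt_conv_Cons[of i "Suc n"] by (simp del: upt_Suc)
  then show ?thesis by (simp only: omit_def) (simp del: upt_Suc)
qed

lemma omit_2: "i < j \<Longrightarrow> j \<le> n \<Longrightarrow> omit n {i, j} = [0..<i] @ [Suc i..<j] @ [Suc j..<Suc n]"
proof -
  assume ij: "i < j" "j \<le> n"
  then have "[0..<Suc n] = [0..<i] @ i # [Suc i..<j] @ j # [Suc j..<Suc n]"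
    using upt_split[of 0 i "Suc n"] upt_conv_Cons[of i "Suc n"] upt_split[of "Suc i" j "Suc n"] upt_conv_Cons[of j "Suc n"]
    by (simp del: upt_Suc)
  then show ?thesis using ij by (simp only: omit_def) (simp del: upt_Suc)
qed

lemma omit_args_homs: "homs S ps as \<Longrightarrow> length as = Suc n \<Longrightarrow> homs S (omit_args n I ps) (omit_args n I as)"
  using homs_nth[of S ps as] unfolding omit_args_def homs_def list_all2_map1 list_all2_map2
  by (intro list.rel_refl_strong) (auto simp: less_Suc_eq_le)

lemma sum_triangle: "(\<Sum>i\<in>{0..<m}. \<Sum>j\<in>{Suc i..<m}. f i j) = (\<Sum>j\<in>{0..<m}. \<Sum>i<j. f i j :: 'a::comm_monoid_add)"
  by (simp add: sum.Sigma) (rule sum.reindex_bij_witness[where i = prod.swap and j = prod.swap], auto)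

text \<open>\<open>a\<close> and \<open>b\<close> are the parities of the two bracketed arguments,
  \<open>r\<close> and \<open>s\<close> the total parities before the first and between them. On the
  right stand the sign in \<open>dd\<close>, that of passing the arguments in between, and that of
  moving the bracket to the front.\<close>

lemma gamma_bits: "q + (1 + a) * (r + 1) + (1 + b) * (r + s) = q + r + 1 + a + (a * s + (1 + a + b) * (r + s))" for a b q r s :: bit
  by (cases a; cases b; cases r; cases s; cases q; simp)

context poisson_vertex_superalgebra
begin

lemma pbs_iti: "distinct xs \<Longrightarrow> pbs (map (iti ps as) xs) = (\<Sum>k\<in>set xs. 1 + ps ! k)"
  by (simp add: pbs_def comp_def sum_list_distinct_conv_sum_set)

lemma dd_unroll:
  "i \<le> m \<Longrightarrow> dd y q (map (iti ps as) [0..<i]) (map (iti ps as) [i..<m]) = (\<Sum>j\<in>{i..<m}.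
     sg ((1 + ps ! j) * (q + (\<Sum>k<j. 1 + ps ! k) + 1) + 1) * act (as ! j) j (y (map (iti ps as) ([0..<j] @ [Suc j..<m])))
     + sg (q + (\<Sum>k<j. 1 + ps ! k) + 1 + ps ! j) * BB y (iti ps as j) (map (iti ps as) [0..<j]) (map (iti ps as) [Suc j..<m]))"
proof (induction rule: inc_induct)
  case (step i)
  have e: "map (iti ps as) [i..<m] = iti ps as i # map (iti ps as) [Suc i..<m]"
    using step.hyps by (simp add: upt_conv_Cons)
  have "pbs (map (iti ps as) [0..<i]) = (\<Sum>k<i. 1 + ps ! k)" by (subst pbs_iti) (auto simp: atLeast0LessThan)
  moreover have "{i..<m} = insert i {Suc i..<m}" using step.hyps by auto
  moreover have "map (iti ps as) [0..<i] @ [iti ps as i] = map (iti ps as) [0..<Suc i]" by simp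
  ultimately show ?case using step.IH unfolding e dd.simps by (simp del: upt_Suc)
qed simp

lemma BB_unroll:
  "s \<le> j \<Longrightarrow> j \<le> m \<Longrightarrow> BB y x (map (iti ps as) (xs @ [s..<j])) (map (iti ps as) [j..<m]) = (\<Sum>k\<in>{j..<m}.
     sg (pt x * (\<Sum>t\<in>{j..<k}. 1 + ps ! t)) * br y x (iti ps as k) (map (iti ps as) (xs @ [s..<k])) (map (iti ps as) [Suc k..<m]))"
proof (induction "m - j" arbitrary: j)
  case (Suc d)
  have j: "j < m" using Suc by simp
  have e: "map (iti ps as) [j..<m] = iti ps as j # map (iti ps as) [Suc j..<m]" using j by (simp add: upt_conv_Cons)
  have a: "map (iti ps as) (xs @ [s..<j]) @ [iti ps as j] = map (iti ps as) (xs @ [s..<Suc j])"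
    using Suc.prems by simp
  have IH: "BB y x (map (iti ps as) (xs @ [s..<Suc j])) (map (iti ps as) [Suc j..<m]) = (\<Sum>k\<in>{Suc j..<m}.
     sg (pt x * (\<Sum>t\<in>{Suc j..<k}. 1 + ps ! t)) * br y x (iti ps as k) (map (iti ps as) (xs @ [s..<k])) (map (iti ps as) [Suc k..<m]))"
    by (rule Suc.hyps(1)) (use Suc j in auto)
  have t: "(\<Sum>t\<in>{j..<k}. 1 + ps ! t) = 1 + ps ! j + (\<Sum>t\<in>{Suc j..<k}. 1 + ps ! t)" if "k \<in> {Suc j..<m}" for k
    using that by (subst sum.atLeast_Suc_lessThan) auto
  have m: "{j..<m} = insert j {Suc j..<m}" using j by auto
  have s: "(\<Sum>k\<in>{Suc j..<m}. sg (pt x * (\<Sum>t\<in>{j..<k}. 1 + ps ! t)) * br y x (iti ps as k) (map (iti ps as) (xs @ [s..<k])) (map (iti ps as) [Suc k..<m]))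
    = sg (pt x * (1 + ps ! j)) * BB y x (map (iti ps as) (xs @ [s..<Suc j])) (map (iti ps as) [Suc j..<m])"
    unfolding IH sum_distrib_left[of "sg _"]
  proof (rule sum.cong[OF refl])
    fix k assume k: "k \<in> {Suc j..<m}"
    have "(sg (pt x * (1 + ps ! j + S)) :: 'v pol) = sg (pt x * (1 + ps ! j)) * sg (pt x * S)" for S
      by (simp only: distrib_left[of _ "1 + ps ! j" S] sg_add)
    then show "sg (pt x * (\<Sum>t\<in>{j..<k}. 1 + ps ! t)) * br y x (iti ps as k) (map (iti ps as) (xs @ [s..<k])) (map (iti ps as) [Suc k..<m])
      = sg (pt x * (1 + ps ! j)) * (sg (pt x * (\<Sum>t\<in>{Suc j..<k}. 1 + ps ! t)) * br y x (iti ps as k) (map (iti ps as) (xs @ [s..<k])) (map (iti ps as) [Suc k..<m]))"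
      unfolding t[OF k] by (simp only: mult.assoc)
  qed
  show ?case unfolding e BB.simps a by (simp only: iti_simps m) (simp del: upt_Suc map_append add: s)
qed simp

lemma rl_omit:
  "rl ((!) (omit n J)) (zit (omit_args n J ps) (omit_args n J as)) = map (iti ps as) (omit n J)"
  by (rule nth_equalityI) (auto simp: rl_def omit_args_def iti_def)

lemma lsum_concat: "lsum (tgt V m) (concat (map (\<lambda>x. map (\<lambda>z. Cl m (f x z)) (g x)) xs)) = Cl m (\<Sum>x\<leftarrow>xs. \<Sum>z\<leftarrow>g x. f x z)"
proof -
  have "concat (map (\<lambda>x. map (\<lambda>z. Cl m (f x z)) (g x)) xs) = map (\<lambda>(x, z). Cl m (f x z)) (concat (map (\<lambda>x. map (Pair x) (g x)) xs))"
    by (simp add: map_concat comp_def)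
  moreover have "(\<Sum>(x, z)\<leftarrow>concat (map (\<lambda>x. map (Pair x) (g x)) xs). f x z) = (\<Sum>x\<leftarrow>xs. \<Sum>z\<leftarrow>g x. f x z)"
    by (induction xs) (simp_all add: comp_def)
  ultimately show ?thesis using lsum_Cl[of m "\<lambda>(x, z). f x z"] by (simp add: case_prod_unfold)
qed

lemma sb_tot:
  assumes "\<And>k. \<sigma> k \<in> IP"
  shows "sb \<sigma> (tot {..<n} P) = dpol V (sb \<sigma> P) + (\<Sum>k<n. \<sigma> k) * sb \<sigma> P"
  by (simp add: tot_def sb_dpol assms sum_distrib_right sb_sum sb_mult_X)

lemma d_first:
  assumes y: "bco V n q y" and h: "homs V ps as" and n: "length as = Suc n" and i: "i \<le> n"
  shows "qmap V (Suc n) (\<lambda>P. brkr V (as ! i) (X i) (subst (map X (omit n {i})) P)) (fl n y (omit_args n {i} as))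
    = Cl (Suc n) (act (as ! i) i (y (map (iti ps as) ([0..<i] @ [Suc i..<Suc n]))))"
proof -
  let ?L = "zit (omit_args n {i} ps) (omit_args n {i} as)" and ?\<rho> = "(!) (omit n {i})"
  note h' = omit_args_homs[OF h n, of "{i}"]
  have l: "length (omit n {i}) = n" "length (omit_args n {i} as) = n" using i by (simp_all add: omit_len omit_args_def)
  have im: "?\<rho> ` {..<n} = {..<Suc n} - {i}"
    using nth_image[of n "omit n {i}"] l by (simp add: atLeast0LessThan lessThan_Suc_atMost)
  have inj: "inj_on ?\<rho> {..<n}" using inj_on_nth[OF omit_distinct[of n "{i}"], of "{..<n}"] l by auto
  have P: "y ?L \<in> pon {..<n}" using lco_pon[OF bco_lco[OF y] zit_homs[OF h']] l by simp
  have s: "subst (map X (omit n {i})) Q = ren ?\<rho> Q" if "Q \<in> pon {..<n}" for Q :: "'v pol"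
    using subst_ren[of Q "omit n {i}"] that l by simp
  have "qmap V (Suc n) (\<lambda>P. act (as ! i) i (subst (map X (omit n {i})) P)) (Cl n (y ?L))
    = Cl (Suc n) (act (as ! i) i (subst (map X (omit n {i})) (y ?L)))"
  proof (rule qmap_Cl)
    show "additive (\<lambda>P. act (as ! i) i (subst (map X (omit n {i})) P))"
      by (intro additiveI) (simp add: additive.add[OF subst_additive])
    fix Q :: "'v pol" assume Q: "Q \<in> pon {..<n}"
    have "act (as ! i) i (ren ?\<rho> (tot {..<n} Q)) = tot (insert i ({..<Suc n} - {i})) (act (as ! i) i (ren ?\<rho> Q))"
      by (subst tot_ren[OF inj], subst im, rule act_tot) auto
    also have "insert i ({..<Suc n} - {i}) = {..<Suc n}" using i by auto
    finally have "act (as ! i) i (subst (map X (omit n {i})) (tot {..<n} Q)) = tot {..<Suc n} (act (as ! i) i (ren ?\<rho> Q))"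
      using s[OF tot_pon[OF Q]] by simp
    moreover have "act (as ! i) i (ren ?\<rho> Q) \<in> pon {..<Suc n}"
      by (rule act_pon) (use pon_mono[OF ren_pon[OF Q, of ?\<rho>]] im i in auto)
    ultimately show "act (as ! i) i (subst (map X (omit n {i})) (tot {..<n} Q)) \<in> I (Suc n)" by (simp add: tot_in_I)
  qed
  also have "subst (map X (omit n {i})) (y ?L) = y (map (iti ps as) ([0..<i] @ [Suc i..<Suc n]))"
    unfolding s[OF P] omit_1[OF i, symmetric] rl_omit[symmetric]
    by (rule lco_rl[OF bco_lco[OF y] zit_homs[OF h'], symmetric]) (use l inj in auto)
  finally show ?thesis by (simp add: fl_homs[OF y h' l(2)])
qed

text \<open>The front slot is given the label \<open>j\<close>, and then its variable becomes the
  sum of \<open>X i\<close> and \<open>X j\<close> by \<open>shift\<close>; the composite is the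
  substitution in the given formula.\<close>

lemma d_second:
  assumes y: "bco V n q y" and h: "homs V ps as" and n: "length as = Suc n" and ij: "i < j" "j \<le> n"
    and c: "c \<in> par V (ps ! i + ps ! j)"
  shows "qmap V (Suc n) (\<lambda>P. X i ^ k * subst ((X i + X j) # map X (omit n {i, j})) P) (fl n y (c # omit_args n {i, j} as))
    = Cl (Suc n) (X i ^ k * shift i j (y ((j, ps ! i + ps ! j, c) # map (iti ps as) ([0..<i] @ [Suc i..<j] @ [Suc j..<Suc n]))))"
proof -
  define p where "p = ps ! i + ps ! j"
  let ?ks = "j # omit n {i, j}"
  let ?qs = "p # omit_args n {i, j} ps" and ?bs = "c # omit_args n {i, j} as"
  have h': "homs V ?qs ?bs" using omit_args_homs[OF h n, of "{i, j}"] c by (simp add: homs_def p_def)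
  have cd: "card ({..n} - {i, j}) = n - 1" using ij by (subst card_Diff_subset) auto
  have l: "length ?ks = n" "length ?bs = n" using ij by (simp_all add: omit_len omit_args_def cd)
  define \<sigma> where "\<sigma> k = (if k < n then ((X i + X j) # map X (omit n {i, j})) ! k else 1 :: 'v pol)" for k
  have \<sigma>: "\<sigma> k \<in> IP" for k using l by (auto simp: \<sigma>_def nth_Cons split: nat.split)
  have s: "subst ((X i + X j) # map X (omit n {i, j})) Q = sb \<sigma> Q" for Q :: "'v pol"
    unfolding subst_sb using l by (simp add: \<sigma>_def[abs_def])
  have im: "((!) ?ks) ` {..<n} = insert j ({..n} - {i, j})"
    using nth_image[of n ?ks] l by (simp add: atLeast0LessThan)
  have inj: "inj_on ((!) ?ks) {..<n}" using inj_on_nth[of ?ks "{..<n}"] l by auto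
  \<comment> \<open>The substituted values add up to the sum of all variables, so the substitution
    carries \<open>tot\<close> to \<open>tot\<close> and passes to the quotients.\<close>
  have sum\<sigma>: "(\<Sum>k<n. \<sigma> k) = (\<Sum>k<Suc n. X k)"
  proof -
    obtain n' where n': "n = Suc n'" using ij by (cases n) auto
    have "(\<Sum>k<n. \<sigma> k) = X i + X j + (\<Sum>k<n'. X (omit n {i, j} ! k))"
      unfolding n' sum.lessThan_Suc_shift using l n' by (simp add: \<sigma>_def)
    also have "(\<Sum>k<n'. X (omit n {i, j} ! k)) = (\<Sum>k\<in>{..n} - {i, j}. X k :: 'v pol)"
      using sum_list_distinct_conv_sum_set[OF omit_distinct[of n "{i, j}"], of X]
      using l n' by (simp add: sum_list_sum_nth atLeast0LessThan)
    also have "X i + X j + \<dots> = (\<Sum>k\<in>insert i (insert j ({..n} - {i, j})). X k)" using ij by (simp add: add.assoc)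
    also have "insert i (insert j ({..n} - {i, j})) = {..<Suc n}" using ij by auto
    finally show ?thesis .
  qed
  have pon: "sb \<sigma> Q \<in> pon {..<Suc n}" if "Q \<in> pon {..<n}" for Q :: "'v pol"
  proof (rule sb_pon[OF that \<sigma>])
    fix k assume k: "k \<in> {..<n}"
    then have "?ks ! k \<in> insert j ({..n} - {i, j})" using im by blast
    then show "\<sigma> k \<in> pon {..<Suc n}" using k ij l by (cases k) (auto simp: \<sigma>_def)
  qed
  have P: "y (zit ?qs ?bs) \<in> pon {..<n}" using lco_pon[OF bco_lco[OF y] zit_homs[OF h']] l by simp
  have "qmap V (Suc n) (\<lambda>P. X i ^ k * sb \<sigma> P) (Cl n (y (zit ?qs ?bs))) = Cl (Suc n) (X i ^ k * sb \<sigma> (y (zit ?qs ?bs)))"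
  proof (rule qmap_Cl)
    show "additive (\<lambda>P. X i ^ k * sb \<sigma> P)" by (intro additiveI) (simp add: distrib_left)
    fix Q :: "'v pol" assume Q: "Q \<in> pon {..<n}"
    have "X i ^ k * sb \<sigma> (tot {..<n} Q) = tot {..<Suc n} (X i ^ k * sb \<sigma> Q)"
      by (simp only: tot_IP[OF IP_power[OF IP_X]] sb_tot[OF \<sigma>] sum\<sigma>) (simp only: tot_def)
    moreover have "X i ^ k * sb \<sigma> Q \<in> pon {..<Suc n}" using pon[OF Q] ij by (intro pon_mult pon_power) auto
    ultimately show "X i ^ k * sb \<sigma> (tot {..<n} Q) \<in> I (Suc n)" by (simp add: tot_in_I)
  qed
  also have "sb \<sigma> (y (zit ?qs ?bs)) = shift i j (ren ((!) ?ks) (y (zit ?qs ?bs)))" unfolding shift_def ren_def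
  proof (subst sb_sb)
    show "sb \<sigma> (y (zit ?qs ?bs)) = sb (\<lambda>k. sb (X(j := X i + X j)) (X (?ks ! k))) (y (zit ?qs ?bs))"
    proof (rule sb_cong[OF P \<sigma>])
      fix k assume k: "k \<in> {..<n}"
      show "\<sigma> k = sb (X(j := X i + X j)) (X (?ks ! k))"
      proof (cases k)
        case (Suc k')
        have "omit n {i, j} ! k' \<in> set (omit n {i, j})" using k l Suc by (intro nth_mem) simp
        then show ?thesis using k l Suc by (simp add: \<sigma>_def)
      qed (use k in \<open>simp add: \<sigma>_def\<close>)
    qed simp
  qed simp_all
  also have "ren ((!) ?ks) (y (zit ?qs ?bs)) = y (rl ((!) ?ks) (zit ?qs ?bs))"
    by (rule lco_rl[OF bco_lco[OF y] zit_homs[OF h'], symmetric]) (use l inj in auto)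
  also have "rl ((!) ?ks) (zit ?qs ?bs) = (j, p, c) # map (iti ps as) (omit n {i, j})"
    by (rule nth_equalityI) (auto simp: rl_def omit_args_def iti_def nth_Cons split: nat.split)
  finally show ?thesis unfolding p_def[symmetric] omit_2[OF ij, symmetric] s fl_homs[OF y h' l(2)] .
qed

lemma pow_IP: "X i ^ k * P = P * (X i ^ k :: 'v pol)"
  by (rule IP_comm) simp

lemma lft_brk:
  fixes G :: "'v \<Rightarrow> 'v pol"
  assumes a: "additive G"
  shows "lft G (brk V a (X i) b) = (\<Sum>k\<le>degree (lbr V a b). X i ^ k * G (coeff (lbr V a b) k))"
  unfolding brk_def
  by (simp add: additive.sum[OF lft_additive[OF a]] pow_IP[symmetric] lft_IP[OF a IP_power[OF IP_X]] lft_cst[OF a])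

lemma iti_gd: "homs V ps as \<Longrightarrow> set xs \<subseteq> {..<length as} \<Longrightarrow> distinct xs \<Longrightarrow> gdv (map (iti ps as) xs)"
proof -
  assume h: "homs V ps as" and xs: "set xs \<subseteq> {..<length as}" "distinct xs"
  have "map fst (map (iti ps as) xs) = xs" by (simp add: comp_def)
  then show ?thesis using xs homs_nth[OF h] by (auto simp: gd_def)
qed

text \<open>In \<open>dd\<close> the bracket stays in the slot of the second argument; symmetry
  moves it to the front, where the given formula has it.\<close>

lemma br_front:
  assumes y: "bco V n q y" and h: "homs V ps as" and n: "length as = Suc n" and ij: "i < j" "j \<le> n"
  shows "br y (iti ps as i) (iti ps as j) (map (iti ps as) ([0..<i] @ [Suc i..<j])) (map (iti ps as) [Suc j..<Suc n])
    = sg ((1 + ps ! i + ps ! j) * ((\<Sum>k<i. 1 + ps ! k) + (\<Sum>k\<in>{Suc i..<j}. 1 + ps ! k)))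
      * (\<Sum>k\<le>degree (lbr V (as ! i) (as ! j)). X i ^ k * shift i j (y ((j, ps ! i + ps ! j, coeff (lbr V (as ! i) (as ! j)) k)
          # map (iti ps as) ([0..<i] @ [Suc i..<j] @ [Suc j..<Suc n]))))"
proof -
  let ?pre = "map (iti ps as) ([0..<i] @ [Suc i..<j])" and ?l = "map (iti ps as) [Suc j..<Suc n]"
  let ?p = "ps ! i + ps ! j"
  have g: "gdv (?pre @ (j, ?p, pcomp V ?p c) # ?l)" for c
  proof -
    have "gdv (map (iti ps as) ([0..<i] @ [Suc i..<j] @ [Suc j..<Suc n]))" by (rule iti_gd[OF h]) (use ij n in auto)
    then show ?thesis using ij by (auto simp: pcomp_par image_image simp del: upt_Suc)
  qed
  have len: "Suc (length ?pre + length ?l) = n" using ij by simp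
  have add: "additive (\<lambda>c. shift i j (y (?pre @ (j, ?p, pcomp V ?p c) # ?l)))"
  proof (rule additiveI)
    fix c d
    have "y (?pre @ (j, ?p, pcomp V ?p c + pcomp V ?p d) # ?l) = y (?pre @ (j, ?p, pcomp V ?p c) # ?l) + y (?pre @ (j, ?p, pcomp V ?p d) # ?l)"
      using bco_lin[OF y g[of c] g[of d], where c = 1] len by (simp add: scl_simps spol_lin del: map_append upt_Suc)
    then show "shift i j (y (?pre @ (j, ?p, pcomp V ?p (c + d)) # ?l))
      = shift i j (y (?pre @ (j, ?p, pcomp V ?p c) # ?l)) + shift i j (y (?pre @ (j, ?p, pcomp V ?p d) # ?l))"
      by (simp only: pcomp_add shift_simps)
  qed
  have pb: "pbs ?pre = (\<Sum>k<i. 1 + ps ! k) + (\<Sum>k\<in>{Suc i..<j}. 1 + ps ! k)"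
    by (simp only: map_append pbs_simps) (subst pbs_iti pbs_iti, auto simp: atLeast0LessThan)+
  have fr: "y (?pre @ (j, ?p, pcomp V ?p c) # ?l) = sg ((1 + ?p) * pbs ?pre) * y ((j, ?p, pcomp V ?p c) # ?pre @ ?l)" for c
    using lco_front[OF bco_lco[OF y] g] len by (simp del: map_append upt_Suc)
  have c: "pcomp V ?p (coeff (lbr V (as ! i) (as ! j)) k) = coeff (lbr V (as ! i) (as ! j)) k" for k
    by (intro pcomp_par_id lbr_par homs_nth[OF h]) (use ij n in auto)
  show ?thesis unfolding br_def iti_simps lft_brk[OF add] unfolding fr unfolding c pb shift_simps
    by (simp only: sg_comm(2) sum_distrib_left map_append append.assoc add.assoc)
qed

text \<open>Term by term by \<open>d_first\<close>, \<open>d_second\<close> and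
  \<open>br_front\<close>. The recursion groups the brackets by their first index, the given formula
  by the second; \<open>gam\<close> is the agreement of the signs.\<close>

lemma d_hom_eq:
  assumes y: "bco V n q y" and h: "homs V ps as" and n: "length as = Suc n"
  shows "d_hom V n q (fl n y) ps as = Cl (Suc n) (dd y q [] (zit ps as))"
proof -
  define F where "F i = sg (gamma1 q ps i) * act (as ! i) i (y (map (iti ps as) ([0..<i] @ [Suc i..<Suc n])))" for i
  define G where "G i j k = sg (gamma2 q ps i j) * (X i ^ k * shift i j (y ((j, ps ! i + ps ! j, coeff (lbr V (as ! i) (as ! j)) k)
          # map (iti ps as) ([0..<i] @ [Suc i..<j] @ [Suc j..<Suc n]))))" for i j k
  let ?D = "\<lambda>i j. [0..<Suc (degree (lbr V (as ! i) (as ! j)))]"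
  have 1: "[lsmul (tgt V (Suc n)) (sg (gamma1 q ps i))
          (qmap V (Suc n) (\<lambda>P. brkr V (as ! i) (X i) (subst (map X (omit n {i})) P))
            (fl n y (omit_args n {i} as))). i \<leftarrow> [0..<Suc n]] = map (\<lambda>i. Cl (Suc n) (F i)) [0..<Suc n]"
    by (rule map_cong[OF refl]) (simp add: d_first[OF y h n] F_def spol_sg_eq del: upt_Suc)
  have e: "lsmul (tgt V (Suc n)) (sg (gamma2 q ps i j))
          (qmap V (Suc n) (\<lambda>P. X i ^ k * subst ((X i + X j) # map X (omit n {i, j})) P)
            (fl n y (coeff (lbr V (as ! i) (as ! j)) k # omit_args n {i, j} as))) = Cl (Suc n) (G i j k)"
    if "i < j" "j \<le> n" for i j k
  proof -
    have "coeff (lbr V (as ! i) (as ! j)) k \<in> par V (ps ! i + ps ! j)"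
      by (intro lbr_par homs_nth[OF h]) (use that n in auto)
    then show ?thesis by (simp only: d_second[OF y h n that] tgt_simps G_def spol_sg_eq)
  qed
  have 2: "[lsmul (tgt V (Suc n)) (sg (gamma2 q ps i j))
          (qmap V (Suc n) (\<lambda>P. X i ^ k * subst ((X i + X j) # map X (omit n {i, j})) P)
            (fl n y (coeff (lbr V (as ! i) (as ! j)) k # omit_args n {i, j} as))).
        j \<leftarrow> [0..<Suc n], i \<leftarrow> [0..<j], k \<leftarrow> ?D i j]
    = concat (map (\<lambda>j. map (\<lambda>z. Cl (Suc n) (case z of (i, k) \<Rightarrow> G i j k)) (concat (map (\<lambda>i. map (Pair i) (?D i j)) [0..<j]))) [0..<Suc n])"
    by (rule arg_cong[where f = concat], rule map_cong[OF refl])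
      (auto simp: e map_concat comp_def simp del: upt_Suc intro!: arg_cong[where f = concat] map_cong)
  have 3: "(\<Sum>z\<leftarrow>concat (map (\<lambda>i. map (Pair i) (?D i j)) [0..<j]). case z of (i, k) \<Rightarrow> G i j k)
    = (\<Sum>i<j. \<Sum>k\<le>degree (lbr V (as ! i) (as ! j)). G i j k)" for j
  proof -
    have "(\<Sum>z\<leftarrow>concat (map (\<lambda>i. map (Pair i) (?D i j)) xs). case z of (i, k) \<Rightarrow> G i j k) = (\<Sum>i\<leftarrow>xs. \<Sum>k\<leftarrow>?D i j. G i j k)" for xs
      by (induction xs) (simp_all add: comp_def del: upt_Suc)
    then show ?thesis
      by (simp add: interv_sum_list_conv_sum_set_nat atLeast0LessThan lessThan_Suc_atMost del: upt_Suc)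
  qed
  have gam: "gamma2 q ps i j = q + (\<Sum>k<i. 1 + ps ! k) + 1 + ps ! i + (ps ! i * (\<Sum>t\<in>{Suc i..<j}. 1 + ps ! t)
      + (1 + ps ! i + ps ! j) * ((\<Sum>k<i. 1 + ps ! k) + (\<Sum>k\<in>{Suc i..<j}. 1 + ps ! k)))" if "i < j" for i j
  proof -
    have e: "{..<j} - {i} = {..<i} \<union> {Suc i..<j}" using that by auto
    have s: "(\<Sum>k\<in>{..<j} - {i}. 1 + ps ! k) = (\<Sum>k<i. 1 + ps ! k) + (\<Sum>k\<in>{Suc i..<j}. 1 + ps ! k)"
      unfolding e by (rule sum.union_disjoint) auto
    show ?thesis unfolding gamma2_def s by (rule gamma_bits)
  qed
  have B: "sg (q + (\<Sum>k<i. 1 + ps ! k) + 1 + ps ! i) * BB y (iti ps as i) (map (iti ps as) [0..<i]) (map (iti ps as) [Suc i..<Suc n])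
    = (\<Sum>j\<in>{Suc i..<Suc n}. \<Sum>k\<le>degree (lbr V (as ! i) (as ! j)). G i j k)" if i: "i \<le> n" for i
  proof -
    have "BB y (iti ps as i) (map (iti ps as) [0..<i]) (map (iti ps as) [Suc i..<Suc n])
      = (\<Sum>j\<in>{Suc i..<Suc n}. sg (ps ! i * (\<Sum>t\<in>{Suc i..<j}. 1 + ps ! t)) *
          br y (iti ps as i) (iti ps as j) (map (iti ps as) ([0..<i] @ [Suc i..<j])) (map (iti ps as) [Suc j..<Suc n]))"
      using BB_unroll[of "Suc i" "Suc i" "Suc n" y "iti ps as i" ps as "[0..<i]"] i by (simp del: upt_Suc map_append)
    moreover have "sg (q + (\<Sum>k<i. 1 + ps ! k) + 1 + ps ! i) * (sg (ps ! i * (\<Sum>t\<in>{Suc i..<j}. 1 + ps ! t)) *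
          br y (iti ps as i) (iti ps as j) (map (iti ps as) ([0..<i] @ [Suc i..<j])) (map (iti ps as) [Suc j..<Suc n]))
        = (\<Sum>k\<le>degree (lbr V (as ! i) (as ! j)). G i j k)" if "j \<in> {Suc i..<Suc n}" for j
    proof -
      have ij: "i < j" "j \<le> n" using that by auto
      show ?thesis unfolding br_front[OF y h n ij] G_def gam[OF ij(1)] sg_add sum_distrib_left[symmetric] mult.assoc ..
    qed
    ultimately show ?thesis by (simp only: sum_distrib_left[of "sg _"] cong: sum.cong)
  qed
  have "dd y q [] (zit ps as) = (\<Sum>i\<in>{0..<Suc n}. F i + (\<Sum>j\<in>{Suc i..<Suc n}. \<Sum>k\<le>degree (lbr V (as ! i) (as ! j)). G i j k))"
  proof -
    have z: "map (iti ps as) [0..<0] = []" by simp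
    have "F i + (\<Sum>j\<in>{Suc i..<Suc n}. \<Sum>k\<le>degree (lbr V (as ! i) (as ! j)). G i j k) = F i + sg (q + (\<Sum>k<i. 1 + ps ! k) + 1 + ps ! i) * BB y (iti ps as i) (map (iti ps as) [0..<i]) (map (iti ps as) [Suc i..<Suc n])"
      if "i \<in> {0..<Suc n}" for i using B[of i] that by (simp only: atLeastLessThan_iff less_Suc_eq_le)
    then show ?thesis
      unfolding zit_iti n using dd_unroll[OF le0, where m = "Suc n" and y = y and q = q and ps = ps and as = as]
      by (simp only: z F_def gamma1_def cong: sum.cong)
  qed
  also have "\<dots> = (\<Sum>i\<in>{0..<Suc n}. F i) + (\<Sum>j\<in>{0..<Suc n}. \<Sum>i<j. \<Sum>k\<le>degree (lbr V (as ! i) (as ! j)). G i j k)"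
    unfolding sum.distrib by (simp only: sum_triangle)
  finally have D: "dd y q [] (zit ps as) = \<dots>" .
  show ?thesis unfolding d_hom_def Let_def 1 2 lsum_Cl lsum_concat 3 D tgt_simps
    by (simp only: interv_sum_list_conv_sum_set_nat set_upt)
qed

theorem d_ext_fl:
  assumes y: "bco V n q y"
  shows "d_ext V n q (fl n y) = fl (Suc n) (dd y q [])"
  unfolding d_ext_def fl_def
proof (rule restrict_ext)
  fix as :: "'v list" assume "as \<in> lists_of_length (Suc n)"
  then have as: "length as = Suc n" by (simp add: lists_of_length_def)
  have "d_hom V n q (fl n y) ps (map2 (pcomp V) ps as) = Cl (Suc n) (dd y q [] (zit ps (map2 (pcomp V) ps as)))"
    if "ps \<in> set (List.n_lists (Suc n) [0, 1])" for ps
  proof (rule d_hom_eq[OF y])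
    have "length ps = Suc n" using that set_bits by blast
    then show "homs V ps (map2 (pcomp V) ps as)" using as by (auto simp: homs_def list_all2_conv_all_nth pcomp_par)
    then show "length (map2 (pcomp V) ps as) = Suc n" using homs_length[of V ps "map2 (pcomp V) ps as"] \<open>length ps = Suc n\<close> by simp
  qed
  then have "map (\<lambda>ps. d_hom V n q (fl n y) ps (map2 (pcomp V) ps as)) (List.n_lists (Suc n) [0, 1])
    = map (\<lambda>ps. Cl (Suc n) (dd y q [] (zit ps (map2 (pcomp V) ps as)))) (List.n_lists (Suc n) [0, 1])"
    by (intro map_cong refl)
  then show "lsum (tgt V (Suc n)) (map (\<lambda>ps. d_hom V n q (\<lambda>as\<in>lists_of_length n. Cl n (flat V n y as)) ps (map2 (pcomp V) ps as)) (List.n_lists (Suc n) [0, 1]))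
    = Cl (Suc n) (flat V (Suc n) (dd y q []) as)" by (simp only: fl_def[symmetric] flat_def[of V "Suc n"] lsum_Cl)
qed

end

section \<open>Lifting cochains to polynomial values\<close>

context poisson_vertex_superalgebra
begin

lemma hc_multilinear: "Y \<in> hcochains V n q \<Longrightarrow> Y \<in> multilinear (scl V) n (tgt V n)"
  by (simp add: hcochains_def)

lemma hc_car: "Y \<in> hcochains V n q \<Longrightarrow> length as = n \<Longrightarrow> \<exists>P\<in>pon {..<n}. Y as = Cl n P"
  using PiE_mem[of Y "lists_of_length n" "\<lambda>_. lcarr (tgt V n)" as] hc_multilinear[of Y n q]
  by (auto simp: multilinear_def lists_of_length_def)

lemma hc_add: "Y \<in> hcochains V n q \<Longrightarrow> length as = n \<Longrightarrow> i < n \<Longrightarrow> Y (as[i := a + b]) = ladd (tgt V n) (Y (as[i := a])) (Y (as[i := b]))"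
  and hc_scl: "Y \<in> hcochains V n q \<Longrightarrow> length as = n \<Longrightarrow> i < n \<Longrightarrow> Y (as[i := scl V c a]) = lsmul (tgt V n) c (Y (as[i := a]))"
  using hc_multilinear[of Y n q] by (simp_all add: multilinear_def lists_of_length_def)

lemma hc_par: "Y \<in> hcochains V n q \<Longrightarrow> length as = n \<Longrightarrow> homs V ps as \<Longrightarrow> Y as \<in> tgt_par V n (1 + (q + (\<Sum>p\<leftarrow>ps. 1 + p)))"
  and hc_der: "Y \<in> hcochains V n q \<Longrightarrow> length as = n \<Longrightarrow> i < n \<Longrightarrow> Y (as[i := der V a]) = qmap V n (\<lambda>P. - (X i * P)) (Y (as[i := a]))"
  and hc_sym: "Y \<in> hcochains V n q \<Longrightarrow> length as = n \<Longrightarrow> homs V ps as \<Longrightarrow> Suc i < n \<Longrightarrow>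
        qmap V n (subst (lswap i (map X [0..<n]))) (Y (lswap i as)) = lsmul (tgt V n) (sg ((1 + ps ! i) * (1 + ps ! Suc i))) (Y as)"
  unfolding hcochains_def by blast+

lemma hc_leib: "Y \<in> hcochains V n q \<Longrightarrow> length as = n \<Longrightarrow> homs V ps as \<Longrightarrow> i < n \<Longrightarrow> b \<in> par V pb \<Longrightarrow> c \<in> par V pc \<Longrightarrow>
    Y (as[i := b * c]) = ladd (tgt V n)
      (lsmul (tgt V n) (sg (pb * (q + (\<Sum>p\<leftarrow>take i ps. 1 + p)))) (qmap V n (em i b) (Y (as[i := c]))))
      (lsmul (tgt V n) (sg (pc * (pb + (q + (\<Sum>p\<leftarrow>take i ps. 1 + p))))) (qmap V n (em i c) (Y (as[i := b]))))"
  unfolding hcochains_def Let_def by blast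

lemma hc_extensional: "Y \<in> hcochains V n q \<Longrightarrow> Y \<in> extensional (lists_of_length n)"
  using hc_multilinear[of Y n q] by (simp add: multilinear_def PiE_def)

lemma hc_one:
  assumes Y: "Y \<in> hcochains V n q" and as: "length as = n" "homs V ps as" "i < n"
  shows "Y (as[i := 1]) = Cl n 0"
proof -
  obtain P where P: "Y (as[i := 1]) = Cl n P" using hc_car[OF Y, of "as[i := 1]"] as by auto
  have "Cl n P = Cl n (P + P)" using hc_leib[OF Y as one_even one_even] as(3) by (simp add: P qmap_em spol_lin)
  then have "P \<in> I n" using I_closed(5)[of "P - (P + P)" n] by (simp only: Cl_eq) simp
  then show ?thesis by (simp add: P Cl_eq)
qed

text \<open>\<open>sig n\<close> substitutes \<open>X k - (\<partial> + \<Sum>X i) / n\<close> for \<open>X k\<close>. The substituted operators add up to \<open>- \<partial>\<close>, so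
  that \<open>sig n\<close> depends only on the class of a polynomial, for \<open>n > 0\<close>.\<close>

definition Uop :: "nat \<Rightarrow> nat \<Rightarrow> 'v pol \<Rightarrow> 'v pol" where
  "Uop n k Q = X k * Q - (if k < n then spol V (1 / of_nat n) (tot {..<n} Q) else 0)"

definition sig :: "nat \<Rightarrow> 'v pol \<Rightarrow> 'v pol" where
  "sig n = ops (Uop n)"

lemma Uop_additive: "additive (Uop n k)"
  by (rule additiveI) (simp add: Uop_def tot_add spol_add distrib_left)

lemma spol_X: "spol V c (X i * P) = X i * spol V c P"
  by (simp add: spol_simps)

lemma Uop_comm: "Uop n i (Uop n j P) = Uop n j (Uop n i P)"
  using IP_left_comm[OF IP_X, of "X i" j P]
  by (simp add: Uop_def tot_diff tot_spol spol_diff spol_X right_diff_distrib spol_lin tot_IP[OF IP_X] tot_0 spol_0)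

lemma sig_additive: "additive (sig n)"
  unfolding sig_def by (rule ops_additive) (rule Uop_additive)

lemmas sig_add [simp] = additive.add[OF sig_additive]
  and sig_0 [simp] = additive.zero[OF sig_additive]
  and sig_minus [simp] = additive.minus[OF sig_additive]
  and sig_diff [simp] = additive.diff[OF sig_additive]

lemma sig_cst [simp]: "sig n (cst v) = cst v"
  unfolding sig_def by (rule ops_cst) (rule Uop_additive)

lemma sig_X [simp]: "sig n (X k * P) = Uop n k (sig n P)"
  unfolding sig_def by (rule ops_X[OF Uop_additive Uop_comm])

lemma Uop_spol: "Uop n k (spol V c P) = spol V c (Uop n k P)"
  by (simp add: Uop_def tot_spol spol_diff spol_0 spol_X spol_lin mult.commute)

lemma sig_spol: "sig n (spol V c P) = spol V c (sig n P)"
proof (induction P rule: pol_induct)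
  case (cst v)
  then show ?case by (simp add: spol_simps)
qed (simp_all add: spol_X Uop_spol spol_add)

lemma sig_dpol: "sig n (dpol V P) = dpol V (sig n P)"
proof (induction P rule: pol_induct)
  case (X k P)
  have "dpol V (tot {..<n} Q) = tot {..<n} (dpol V Q)" for Q by (simp add: tot_def dpol_simps)
  then show ?case using X by (simp add: Uop_def dpol_spol dpol_simps)
qed (simp_all add: dpol_simps)

lemma sig_tot: "0 < n \<Longrightarrow> sig n (tot {..<n} P) = 0"
proof -
  assume n: "0 < n"
  have "sig n ((\<Sum>i<n. X i) * P) = (\<Sum>i<n. X i * sig n P - spol V (1 / of_nat n) (tot {..<n} (sig n P)))"
    by (simp add: sum_distrib_right additive.sum[OF sig_additive] Uop_def)
  also have "\<dots> = (\<Sum>i<n. X i) * sig n P - of_nat n * spol V (1 / of_nat n) (tot {..<n} (sig n P))"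
    by (simp add: sum_subtractf sum_distrib_right)
  also have "of_nat n * spol V (1 / of_nat n) (tot {..<n} (sig n P)) = tot {..<n} (sig n P)"
    using n by (simp add: of_nat_spol spol_lin)
  finally show ?thesis by (simp add: tot_def sig_dpol)
qed

text \<open>Each substituted operator differs from multiplication by its variable by a multiple of
  \<open>tot\<close>, so \<open>sig n P\<close> represents the class of \<open>P\<close>. By
  \<open>sig_cl\<close> it depends on nothing else, which makes it a canonical representative for
  \<open>n > 0\<close>.\<close>

lemma sig_I: "P \<in> pon {..<n} \<Longrightarrow> sig n P \<in> pon {..<n} \<and> sig n P - P \<in> I n"
proof (induction rule: pol_induct_on)
  case (X k P)
  have "Uop n k (sig n P) - X k * P = X k * (sig n P - P) - spol V (1 / of_nat n) (tot {..<n} (sig n P))"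
    using X by (simp add: Uop_def right_diff_distrib)
  moreover have "Uop n k (sig n P) \<in> pon {..<n}"
    using X by (auto simp: Uop_def intro!: pon_diff pon_mult spol_pon tot_pon)
  ultimately show ?case using X by (auto intro!: I_closed I_X tot_in_I)
next
  case (add P Q)
  have "sig n P + sig n Q - (P + Q) = (sig n P - P) + (sig n Q - Q)" by simp
  then show ?case using add by (simp only: sig_add) (auto intro: I_closed)
qed simp

lemma sig_cl: "0 < n \<Longrightarrow> Cl n P = Cl n Q \<Longrightarrow> sig n P = sig n Q"
proof -
  assume "0 < n" "Cl n P = Cl n Q"
  then have "sig n (P - Q) = 0" by (auto simp: Cl_eq I_tot sig_tot simp del: sig_diff)
  then show ?thesis by simp
qed

lemma Uop_rpar: "P \<in> rpar V r \<Longrightarrow> Uop n k P \<in> rpar V r"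
  by (simp add: Uop_def tot_rpar spol_rpar)

lemma sig_rpar: "P \<in> rpar V r \<Longrightarrow> sig n P \<in> rpar V r"
  by (induction rule: rpar_induct) (simp_all add: Uop_rpar)

lemma sig_ren: "P \<in> pon {..<n} \<Longrightarrow> inj_on \<rho> {..<n} \<Longrightarrow> \<rho> ` {..<n} = {..<n} \<Longrightarrow> sig n (ren \<rho> P) = ren \<rho> (sig n P)"
proof (induction rule: pol_induct_on)
  case (X k P)
  have "\<rho> k < n" using X by auto
  then show ?case using X tot_ren[OF X(4), of "sig n P"] by (simp add: Uop_def ren_spol)
qed simp_all

end

context boson
begin

text \<open>Slot by slot, agreement spreads from generators to their derivatives by sesquilinearity,
  to products by the Leibniz rule, and to 1, which cochains kill.\<close>

lemma hc_unique_hom: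
  assumes Y: "Y \<in> hcochains V n q" "Y' \<in> hcochains V n q"
    and e: "\<And>u ps. homs H ps u \<Longrightarrow> length u = n \<Longrightarrow> Y (map \<iota> u) = Y' (map \<iota> u)"
    and as: "length as = n" "set as \<subseteq> par V 0 \<union> par V 1"
  shows "Y as = Y' as"
proof (rule slot_induct[where P = "\<lambda>as. Y as = Y' as" and S = "\<iota> ` (par H 0 \<union> par H 1)" and T = "par V 0 \<union> par V 1"])
  show "\<iota> ` (par H 0 \<union> par H 1) \<subseteq> par V 0 \<union> par V 1" using \<iota>_par by auto
  show "length as = n" "set as \<subseteq> par V 0 \<union> par V 1" by (rule as)+
next
  fix as assume as: "length as = n" "set as \<subseteq> \<iota> ` (par H 0 \<union> par H 1)"
  then have "\<forall>a\<in>set as. \<exists>u\<in>par H 0 \<union> par H 1. a = \<iota> u" by auto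
  then have "\<exists>u. as = map \<iota> u \<and> set u \<subseteq> par H 0 \<union> par H 1"
  proof (induction as)
    case (Cons a as)
    then obtain x u where "a = \<iota> x" "x \<in> par H 0 \<union> par H 1" "as = map \<iota> u" "set u \<subseteq> par H 0 \<union> par H 1" by auto
    then show ?case by (intro exI[of _ "x # u"]) auto
  qed simp
  then obtain u where u: "as = map \<iota> u" "set u \<subseteq> par H 0 \<union> par H 1" by blast
  obtain ps where "homs H ps u" using homs_exist[OF HS u(2)] by blast
  then show "Y as = Y' as" using e u as by simp
next
  fix as i a
  assume as: "length as = n" "i < n" "set as \<subseteq> par V 0 \<union> par V 1" and a: "a \<in> par V 0 \<union> par V 1"
    and S: "\<And>b. b \<in> \<iota> ` (par H 0 \<union> par H 1) \<Longrightarrow> Y (as[i := b]) = Y' (as[i := b])"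
  obtain ps where ps: "homs V ps as" using homs_exist[OF VS as(3)] by blast
  obtain p where "a \<in> par V p" using a by auto
  then show "Y (as[i := a]) = Y' (as[i := a])"
  proof (induction rule: V_induct_hom)
    case (zero p)
    have "Z (as[i := 0]) = Cl n 0" if Z: "Z \<in> hcochains V n q" for Z
    proof -
      obtain P where "Z (as[i := 0]) = Cl n P" using hc_car[OF Z, of "as[i := 0]"] as by auto
      then show ?thesis using hc_scl[OF Z as(1,2), of 0 0] by (simp add: Vscl spol_lin)
    qed
    from this[OF Y(1)] this[OF Y(2)] show ?case by simp
  next
    case one
    show ?case using hc_one[OF Y(1) as(1) ps as(2)] hc_one[OF Y(2) as(1) ps as(2)] by simp
  next
    case (scl p c v)
    then show ?case using hc_scl[OF Y(1) as(1,2)] hc_scl[OF Y(2) as(1,2)] by simp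
  next
    case (add p v w)
    then show ?case using hc_add[OF Y(1) as(1,2)] hc_add[OF Y(2) as(1,2)] by simp
  next
    case (gen r p b k v)
    have "b \<in> par H 0 \<union> par H 1" using gen(1) by (cases r) auto
    then have "Y (as[i := (der V ^^ k) (\<iota> b)]) = Y' (as[i := (der V ^^ k) (\<iota> b)])"
      by (induction k) (use S hc_der[OF Y(1) as(1,2)] hc_der[OF Y(2) as(1,2)] in auto)
    moreover have "(der V ^^ k) (\<iota> b) \<in> par V r" using ders_par[OF \<iota>_par[OF gen(1)]] .
    ultimately show ?case
      using hc_leib[OF Y(1) as(1) ps as(2) _ gen(2)] hc_leib[OF Y(2) as(1) ps as(2) _ gen(2)] gen(3) by metis
  qed
qed

lemma hc_unique:
  assumes Y: "Y \<in> hcochains V n q" "Y' \<in> hcochains V n q"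
    and e: "\<And>u ps. homs H ps u \<Longrightarrow> length u = n \<Longrightarrow> Y (map \<iota> u) = Y' (map \<iota> u)"
  shows "Y = Y'"
proof (rule extensionalityI[OF hc_extensional hc_extensional, OF Y])
  fix as :: "'v list" assume "as \<in> lists_of_length n"
  then have n: "length as = n" by (simp add: lists_of_length_def)
  show "Y as = Y' as"
  proof (rule super_space.slot_induct_par[OF VS, where P = "\<lambda>as. Y as = Y' as", OF _ _ n])
    show "Y as = Y' as" if "length as = n" "set as \<subseteq> par V 0 \<union> par V 1" for as
      using hc_unique_hom[OF Y] e that by blast
  qed (use hc_add[OF Y(1)] hc_add[OF Y(2)] in auto)
qed

lemma homs_map: "homs H ps u \<Longrightarrow> homs V ps (map \<iota> u)"
  by (auto simp: homs_def list_all2_map2 \<iota>_par elim: list_all2_mono)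

lemma gdh_homs: "gdh l \<Longrightarrow> homs V (map pt l) (map (\<lambda>x. \<iota> (ag x)) l)"
  by (auto simp: homs_def list_all2_map1 list_all2_map2 gd_def intro!: list.rel_refl_strong \<iota>_par)

theorem hc_lift:
  assumes Y: "Y \<in> hcochains V n q"
  shows "\<exists>y. lch n q y \<and> (\<forall>ps u. homs H ps u \<and> length u = n \<longrightarrow> Y (map \<iota> u) = Cl n (y (zit ps u)))"
proof -
  define good where "good l P \<longleftrightarrow> P \<in> pon {..<n} \<and> P \<in> rpar V (1 + q + pbs l) \<and> Y (map (\<lambda>x. \<iota> (ag x)) l) = Cl n P" for l :: "'h item list" and P
  define R where "R l = (SOME P. good l P)" for l
  define y where "y l = ren ((!) (map fst l)) (sig n (R l))" for l :: "'h item list"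
  have R: "R l \<in> pon {..<n}" "R l \<in> rpar V (1 + q + pbs l)" "Y (map (\<lambda>x. \<iota> (ag x)) l) = Cl n (R l)"
    if l: "gdh l" "length l = n" for l
  proof -
    have "Y (map (\<lambda>x. \<iota> (ag x)) l) \<in> tgt_par V n (1 + (q + pbs l))"
      using hc_par[OF Y _ gdh_homs[OF l(1)]] l(2) by (simp add: pbs_def comp_def)
    then have "\<exists>P. good l P" unfolding tgt_par_Cl good_def by (auto simp: add.assoc)
    then have "good l (R l)" unfolding R_def by (rule someI_ex)
    then show "R l \<in> pon {..<n}" "R l \<in> rpar V (1 + q + pbs l)" "Y (map (\<lambda>x. \<iota> (ag x)) l) = Cl n (R l)"
      by (simp_all add: good_def)
  qed
  have im: "(!) (map fst l) ` {..<n} = lb l" if "length l = n" for l :: "'h item list"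
    using nth_image[of n "map fst l"] that by (simp add: atLeast0LessThan)
  have "lch n q y" unfolding lco_def
  proof (intro conjI allI impI)
    fix l assume "gdh l \<and> length l = n"
    then have l: "gdh l" "length l = n" by auto
    note s = sig_I[OF R(1)[OF l]]
    show "y l \<in> pon (lb l)" using ren_pon[of "sig n (R l)" "{..<n}" "(!) (map fst l)"] s im[OF l(2)] by (simp add: y_def)
    show "y l \<in> rpar V (1 + q + pbs l)" unfolding y_def by (intro ren_rpar sig_rpar R l)
    fix \<rho> :: "nat \<Rightarrow> nat"
    have "map (\<lambda>x. \<iota> (ag x)) (rl \<rho> l) = map (\<lambda>x. \<iota> (ag x)) l" by (simp add: rl_def comp_def)
    \<comment> \<open>The choice of representative looks at parities and values only, never at
      labels.\<close>
    then have "R (rl \<rho> l) = R l" by (simp add: R_def good_def)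
    then show "y (rl \<rho> l) = ren \<rho> (y l)" using s l by (simp only: y_def ren_ren) (rule ren_cong, auto simp: rl_def)
  next
    fix l1 x z l2 assume "gdh (l1 @ x # z # l2) \<and> length (l1 @ x # z # l2) = n"
    then have g: "gdh (l1 @ x # z # l2)" and n: "length (l1 @ x # z # l2) = n" by auto
    have g': "gdh (l1 @ z # x # l2)" and n': "length (l1 @ z # x # l2) = n" using g n by auto
    let ?l = "l1 @ x # z # l2" and ?l' = "l1 @ z # x # l2" and ?i = "length l1"
    let ?s = "sgx x z :: 'v pol"
    have i: "Suc ?i < n" using n by simp
    have sw: "lswap ?i (map (\<lambda>x. \<iota> (ag x)) ?l) = map (\<lambda>x. \<iota> (ag x)) ?l'"
      by (simp add: lswap_def nth_append list_update_append)
    have nth: "map pt ?l ! ?i = pt x" "map pt ?l ! Suc ?i = pt z" by (simp_all add: nth_append)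
    have "Cl n (ren (tau ?i) (R ?l')) = Cl n (?s * R ?l)"
      using hc_sym[OF Y _ gdh_homs[OF g] i] n qmap_tau[OF i R(1)[OF g' n']]
      unfolding sw R(3)[OF g n] R(3)[OF g' n'] nth by (simp add: spol_sg_eq)
    then have "sig n (ren (tau ?i) (R ?l')) = sig n (?s * R ?l)" by (rule sig_cl[rotated]) (use i in simp)
    moreover have "sig n (ren (tau ?i) (R ?l')) = ren (tau ?i) (sig n (R ?l'))"
      by (rule sig_ren[OF R(1)[OF g' n']]) (simp_all add: tau_image[OF i] inj_on_subset[OF tau_inj])
    moreover have "sig n (?s * R ?l) = ?s * sig n (R ?l)" by (metis spol_sg_eq sig_spol)
    ultimately have "ren (tau ?i) (sig n (R ?l')) = ?s * sig n (R ?l)" by simp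
    then have "ren ((!) (map fst ?l)) (ren (tau ?i) (sig n (R ?l'))) = ?s * y ?l" by (simp add: y_def)
    moreover have "ren ((!) (map fst ?l)) (ren (tau ?i) (sig n (R ?l'))) = y ?l'" unfolding ren_ren y_def
    proof (rule ren_cong)
      show "sig n (R ?l') \<in> pon {..<n}" using sig_I[OF R(1)[OF g' n']] by simp
      fix k assume "k \<in> {..<n}"
      consider "k < ?i" | "k = ?i" | "k = Suc ?i" | m where "k = Suc (Suc (?i + m))"
        using le_Suc_ex[of "Suc (Suc ?i)" k] by force
      then show "((!) (map fst ?l) \<circ> tau ?i) k = map fst ?l' ! k" by cases (simp_all add: nth_append)
    qed
    ultimately show "y ?l = ?s * y ?l'" by (metis sg_sg(2))
  next
    fix i p a b c l assume "gdh ((i, p, a) # l) \<and> gdh ((i, p, b) # l) \<and> Suc (length l) = n"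
    then have g: "gdh ((i, p, a) # l)" "gdh ((i, p, b) # l)" "gdh ((i, p, scl H c a + b) # l)" and n: "Suc (length l) = n"
      by (auto simp: Hpar)
    let ?m = "map (\<lambda>x. \<iota> (ag x)) l"
    have l: "length (0 # ?m) = n" "0 < n" using n by auto
    have "Y (\<iota> (scl H c a + b) # ?m) = ladd (tgt V n) (lsmul (tgt V n) c (Y (\<iota> a # ?m))) (Y (\<iota> b # ?m))"
      using hc_add[OF Y l, of "scl V c (\<iota> a)" "\<iota> b"] hc_scl[OF Y l, of c "\<iota> a"] by (simp add: \<iota>_add \<iota>_scl)
    then have "Cl n (R ((i, p, scl H c a + b) # l)) = Cl n (spol V c (R ((i, p, a) # l)) + R ((i, p, b) # l))"
      using R(3)[OF g(1)] R(3)[OF g(2)] R(3)[OF g(3)] n by simp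
    then have "sig n (R ((i, p, scl H c a + b) # l)) = spol V c (sig n (R ((i, p, a) # l))) + sig n (R ((i, p, b) # l))"
      by (drule_tac sig_cl[OF l(2)]) (simp only: sig_add sig_spol)
    then show "y ((i, p, scl H c a + b) # l) = spol V c (y ((i, p, a) # l)) + y ((i, p, b) # l)"
      by (simp add: y_def ren_spol)
  qed
  moreover have "Y (map \<iota> u) = Cl n (y (zit ps u))" if h: "homs H ps u" "length u = n" for ps u
  proof -
    have g: "gdh (zit ps u)" by (rule zit_homs[OF h(1)])
    have l: "length (zit ps u) = n" using h by simp
    note s = sig_I[OF R(1)[OF g l]]
    have "map fst (zit ps u) = [0..<n]" using h by (simp add: zit_def comp_def)
    then have "y (zit ps u) = sig n (R (zit ps u))" unfolding y_def using s by (intro ren_ident[of _ "{..<n}"]) auto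
    moreover have "map (\<lambda>x. \<iota> (ag x)) (zit ps u) = map \<iota> u" by (rule nth_equalityI) auto
    ultimately show ?thesis using R(3)[OF g l] s by (simp add: Cl_eq I_closed(5)[of "sig n (R (zit ps u)) - R (zit ps u)", simplified])
  qed
  ultimately show ?thesis by blast
qed

end

section \<open>Cochains as pairs of cochains on generators\<close>

context boson
begin

abbreviation "Ep n q y \<equiv> flat V n (Ext y q [])"

text \<open>Every cochain is of this form, with the components of parity 0 and 1 on generators.
  Cocycles, coboundaries and equality are expressed through such pairs from here on.\<close>

definition Phi :: "nat \<Rightarrow> ('h item list \<Rightarrow> 'v pol) \<Rightarrow> ('h item list \<Rightarrow> 'v pol) \<Rightarrow> 'v list \<Rightarrow> 'v pol set" where
  "Phi n y0 y1 = (\<lambda>as\<in>lists_of_length n. Cl n (Ep n 0 y0 as + Ep n 1 y1 as))"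

abbreviation "lch2 n y0 y1 \<equiv> lch n 0 y0 \<and> lch n 1 y1"

lemma Ext_lin: "Ext (\<lambda>l. spol V c (w l) + w' l) q pre l = spol V c (Ext w q pre l) + Ext w' q pre l"
proof (induction l arbitrary: pre)
  case (Cons x l)
  then show ?case by (simp add: Mop_add Mop_spol spol_sum sum.distrib[symmetric] distrib_left)
qed simp

lemma Ep_lin: "Ep n q (\<lambda>l. spol V c (w l) + w' l) as = spol V c (Ep n q w as) + Ep n q w' as"
  by (simp add: flat_sum Ext_lin spol_sum sum.distrib)

lemma Ep_zit:
  assumes y: "lch n q y" and u: "homs H ps u" "length u = n"
  shows "Ep n q y (map \<iota> u) = y (zit ps u)"
proof -
  have "zit ps (map \<iota> u) = im (zit ps u)" by (rule nth_equalityI) (auto simp: im_def)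
  moreover have "Ext y q [] (im (zit ps u)) = y (zit ps u)"
    using Ext_gens[OF y, of "[]" "zit ps u"] zit_homs[OF u(1)] u(2) by simp
  moreover have "Ep n q y (map \<iota> u) = Ext y q [] (zit ps (map \<iota> u))"
    by (rule super_space.flat_homs[OF VS _ homs_map[OF u(1)]]) (use bco_zero_entry[OF Ext_bco[OF y]] u in auto)
  ultimately show ?thesis by simp
qed

lemma Phi_vals:
  assumes "lch2 n y0 y1" "homs H ps u" "length u = n"
  shows "Phi n y0 y1 (map \<iota> u) = Cl n (y0 (zit ps u) + y1 (zit ps u))"
  using assms Ep_zit[of n 0 y0 ps u] Ep_zit[of n 1 y1 ps u] by (simp add: Phi_def lists_of_length_def)

lemma C_PV_simps:
  "ladd (C_PV V n) Y Z = (\<lambda>as\<in>lists_of_length n. ladd (tgt V n) (Y as) (Z as))"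
  "lsmul (C_PV V n) c Y = (\<lambda>as\<in>lists_of_length n. lsmul (tgt V n) c (Y as))"
  "lzero (C_PV V n) = (\<lambda>as\<in>lists_of_length n. Cl n 0)"
  "lcarr (C_PV V n) = {\<lambda>as\<in>lists_of_length n. ladd (tgt V n) (Y0 as) (Y1 as) | Y0 Y1. Y0 \<in> hcochains V n 0 \<and> Y1 \<in> hcochains V n 1}"
  by (simp_all add: C_PV_def fun_space_def Let_def)

lemma Phi_fl: "Phi n y0 y1 = (\<lambda>as\<in>lists_of_length n. ladd (tgt V n) (fl n (Ext y0 0 []) as) (fl n (Ext y1 1 []) as))"
  unfolding Phi_def by (rule restrict_ext) (simp add: fl_def)

lemma fl_Ext: "lch n q y \<Longrightarrow> fl n (Ext y q []) \<in> hcochains V n q"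
  by (rule fl_hcochain) (rule Ext_bco)

lemma fl_Ext_val: "lch n q y \<Longrightarrow> homs H ps u \<Longrightarrow> length u = n \<Longrightarrow> fl n (Ext y q []) (map \<iota> u) = Cl n (y (zit ps u))"
  by (simp add: fl_def lists_of_length_def Ep_zit)

lemma fl_Ext_eq:
  assumes yz: "lch n q y" "lch n q z" and d: "\<And>ps u. homs H ps u \<Longrightarrow> length u = n \<Longrightarrow> y (zit ps u) - z (zit ps u) \<in> I n"
  shows "fl n (Ext y q []) = fl n (Ext z q [])"
proof (rule hc_unique[OF fl_Ext[OF yz(1)] fl_Ext[OF yz(2)]])
  fix u ps assume u: "homs H ps u" "length u = n"
  then show "fl n (Ext y q []) (map \<iota> u) = fl n (Ext z q []) (map \<iota> u)"
    unfolding fl_Ext_val[OF yz(1) u] fl_Ext_val[OF yz(2) u] Cl_eq by (rule d)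
qed

lemma hc_fl:
  assumes Y: "Y \<in> hcochains V n q"
  shows "\<exists>y. lch n q y \<and> Y = fl n (Ext y q [])"
proof -
  obtain y where y: "lch n q y" "\<And>ps u. homs H ps u \<Longrightarrow> length u = n \<Longrightarrow> Y (map \<iota> u) = Cl n (y (zit ps u))"
    using hc_lift[OF Y] by blast
  have "Y = fl n (Ext y q [])"
  proof (rule hc_unique[OF Y fl_Ext[OF y(1)]])
    fix u ps assume "homs H ps u" "length u = n"
    then show "Y (map \<iota> u) = fl n (Ext y q []) (map \<iota> u)" using y(2) fl_Ext_val[OF y(1)] by simp
  qed
  then show ?thesis using y(1) by blast
qed

lemma Phi_C: "lch2 n y0 y1 \<Longrightarrow> Phi n y0 y1 \<in> lcarr (C_PV V n)"
  unfolding C_PV_simps Phi_fl using fl_Ext by blast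

lemma C_Phi: "Y \<in> lcarr (C_PV V n) \<Longrightarrow> \<exists>y0 y1. lch2 n y0 y1 \<and> Y = Phi n y0 y1"
  unfolding C_PV_simps Phi_fl using hc_fl by blast

lemma lch_pr:
  assumes y: "lch n q y" and h: "gdh l" "length l = n"
  shows "pr (1 + q + pbs l) (y l) = y l" "pr (q + pbs l) (y l) = 0"
proof -
  have r: "y l \<in> rpar V (1 + q + pbs l)" by (rule lco_rpar[OF y h])
  show "pr (1 + q + pbs l) (y l) = y l" using pr_hom[OF r] by simp
  have "q + pbs l \<noteq> 1 + q + pbs l" by (cases q; cases "pbs l"; simp)
  then show "pr (q + pbs l) (y l) = 0" using pr_hom[OF r, of "q + pbs l"] by simp
qed

text \<open>On a given list the two components have opposite parities, and the subspace divided out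
  is stable under the parity projections.\<close>

lemma lch2_I:
  assumes y: "lch2 n y0 y1" and h: "gdh l" "length l = n" and i: "y0 l + y1 l \<in> I m"
  shows "y0 l \<in> I m" "y1 l \<in> I m"
proof -
  have b: "1 + 0 + pbs l = 1 + pbs l" "1 + 1 + pbs l = 0 + pbs l" by (cases "pbs l"; simp)+
  note a = lch_pr[OF conjunct1[OF y] h] lch_pr[OF conjunct2[OF y] h]
  have "pr (1 + pbs l) (y0 l + y1 l) = y0 l" "pr (0 + pbs l) (y0 l + y1 l) = y1 l"
    using a unfolding b pr_simps(1) by simp_all
  then show "y0 l \<in> I m" "y1 l \<in> I m" using I_pr[OF i, of "1 + pbs l"] I_pr[OF i, of "0 + pbs l"] by simp_all
qed

lemma lch2_diff: "lch2 n y0 y1 \<Longrightarrow> lch2 n z0 z1 \<Longrightarrow> lch2 n (\<lambda>l. y0 l - z0 l) (\<lambda>l. y1 l - z1 l)"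
  using lco_diff by blast

lemma Phi_eq:
  assumes y: "lch2 n y0 y1" and z: "lch2 n z0 z1"
  shows "Phi n y0 y1 = Phi n z0 z1 \<longleftrightarrow> (\<forall>ps u. homs H ps u \<and> length u = n \<longrightarrow>
    y0 (zit ps u) - z0 (zit ps u) \<in> I n \<and> y1 (zit ps u) - z1 (zit ps u) \<in> I n)" (is "?l \<longleftrightarrow> ?r")
proof
  assume l: ?l
  show ?r
  proof (intro allI impI)
    fix ps u assume u: "homs H ps u \<and> length u = n"
    then have "Cl n (y0 (zit ps u) + y1 (zit ps u)) = Cl n (z0 (zit ps u) + z1 (zit ps u))"
      using Phi_vals[OF y, of ps u] Phi_vals[OF z, of ps u] l by simp
    then have "(y0 (zit ps u) - z0 (zit ps u)) + (y1 (zit ps u) - z1 (zit ps u)) \<in> I n" by (simp add: Cl_eq algebra_simps)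
    then show "y0 (zit ps u) - z0 (zit ps u) \<in> I n \<and> y1 (zit ps u) - z1 (zit ps u) \<in> I n"
      using lch2_I[OF lch2_diff[OF y z] zit_homs] u by simp
  qed
next
  assume r: ?r
  then have "fl n (Ext y0 0 []) = fl n (Ext z0 0 [])" "fl n (Ext y1 1 []) = fl n (Ext z1 1 [])"
    using fl_Ext_eq[of n 0 y0 z0] fl_Ext_eq[of n 1 y1 z1] y z by blast+
  then show ?l unfolding Phi_fl by simp
qed

lemma C_unique:
  assumes "Y \<in> lcarr (C_PV V n)" "Z \<in> lcarr (C_PV V n)"
    and e: "\<And>ps u. homs H ps u \<Longrightarrow> length u = n \<Longrightarrow> Y (map \<iota> u) = Z (map \<iota> u)"
  shows "Y = Z"
proof -
  obtain y0 y1 z0 z1 where y: "lch2 n y0 y1" "Y = Phi n y0 y1" and z: "lch2 n z0 z1" "Z = Phi n z0 z1"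
    using C_Phi assms(1,2) by blast
  have "y0 (zit ps u) - z0 (zit ps u) \<in> I n \<and> y1 (zit ps u) - z1 (zit ps u) \<in> I n" if u: "homs H ps u" "length u = n" for ps u
  proof -
    have "(y0 (zit ps u) - z0 (zit ps u)) + (y1 (zit ps u) - z1 (zit ps u)) \<in> I n"
      using e[OF u] Phi_vals[OF y(1) u] Phi_vals[OF z(1) u] y(2) z(2) by (simp add: Cl_eq algebra_simps)
    then show ?thesis using lch2_I[OF lch2_diff[OF y(1) z(1)] zit_homs[OF u(1)]] u by simp
  qed
  then show ?thesis using Phi_eq[OF y(1) z(1)] y(2) z(2) by blast
qed

lemma lch2_add: "lch2 n y0 y1 \<Longrightarrow> lch2 n z0 z1 \<Longrightarrow> lch2 n (\<lambda>l. y0 l + z0 l) (\<lambda>l. y1 l + z1 l)"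
  using lco_add by blast

lemma lch_spol: "lch n q y \<Longrightarrow> lch n q (\<lambda>l. spol V c (y l))"
  by (drule lco_comb[OF _ lco_null]) simp

lemma Phi_lin:
  "ladd (C_PV V n) (Phi n y0 y1) (Phi n z0 z1) = Phi n (\<lambda>l. y0 l + z0 l) (\<lambda>l. y1 l + z1 l)"
  "lsmul (C_PV V n) c (Phi n y0 y1) = Phi n (\<lambda>l. spol V c (y0 l)) (\<lambda>l. spol V c (y1 l))"
  "lzero (C_PV V n) = Phi n (\<lambda>_. 0) (\<lambda>_. 0)"
proof -
  have z: "Ep n q (\<lambda>_. 0) as = 0" for q as using Ep_lin[of n 1 "\<lambda>_. 0" "\<lambda>_. 0" q as] by (simp add: spol_lin)
  have a: "Ep n q (\<lambda>l. y l + y' l) as = Ep n q y as + Ep n q y' as" for q y y' as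
    using Ep_lin[of n 1 y y' q as] by (simp add: spol_lin)
  have s: "Ep n q (\<lambda>l. spol V c (y l)) as = spol V c (Ep n q y as)" for q y as
    using Ep_lin[of n c y "\<lambda>_. 0" q as] by (simp add: z)
  show "ladd (C_PV V n) (Phi n y0 y1) (Phi n z0 z1) = Phi n (\<lambda>l. y0 l + z0 l) (\<lambda>l. y1 l + z1 l)"
    unfolding C_PV_simps Phi_def a by (rule restrict_ext) (simp add: add_ac)
  show "lsmul (C_PV V n) c (Phi n y0 y1) = Phi n (\<lambda>l. spol V c (y0 l)) (\<lambda>l. spol V c (y1 l))"
    unfolding C_PV_simps Phi_def s by (rule restrict_ext) (simp add: spol_add)
  show "lzero (C_PV V n) = Phi n (\<lambda>_. 0) (\<lambda>_. 0)" unfolding C_PV_simps Phi_def z by simp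
qed

text \<open>By \<open>Phi_eq\<close>, equal sums of two components force equal components; hence the
  definite descriptions are met.\<close>

lemma cochain_comp_Phi:
  assumes y: "lch2 n y0 y1"
  shows "cochain_comp V n 0 (Phi n y0 y1) = fl n (Ext y0 0 [])" "cochain_comp V n 1 (Phi n y0 y1) = fl n (Ext y1 1 [])"
proof -
  have u: "z0 = y0' \<and> z1 = y1'" if z: "z0 \<in> hcochains V n 0" "z1 \<in> hcochains V n 1" "y0' \<in> hcochains V n 0" "y1' \<in> hcochains V n 1"
    and e: "ladd (C_PV V n) z0 z1 = ladd (C_PV V n) y0' y1'" for z0 z1 y0' y1'
  proof -
    obtain a0 a1 b0 b1 where ab: "lch2 n a0 a1" "z0 = fl n (Ext a0 0 [])" "z1 = fl n (Ext a1 1 [])"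
      "lch2 n b0 b1" "y0' = fl n (Ext b0 0 [])" "y1' = fl n (Ext b1 1 [])" using hc_fl z by metis
    have "Phi n a0 a1 = Phi n b0 b1" using e ab by (simp add: Phi_fl C_PV_simps)
    then have d: "\<forall>ps u. homs H ps u \<and> length u = n \<longrightarrow> a0 (zit ps u) - b0 (zit ps u) \<in> I n \<and> a1 (zit ps u) - b1 (zit ps u) \<in> I n"
      using Phi_eq[OF ab(1,4)] by simp
    then have "fl n (Ext a0 0 []) = fl n (Ext b0 0 [])" "fl n (Ext a1 1 []) = fl n (Ext b1 1 [])"
      using fl_Ext_eq[of n 0 a0 b0] fl_Ext_eq[of n 1 a1 b1] ab by blast+
    then show ?thesis using ab by simp
  qed
  have comm: "ladd (C_PV V n) Z Z' = ladd (C_PV V n) Z' Z" if ZZ: "Z \<in> hcochains V n q" "Z' \<in> hcochains V n q'" for Z Z' q q'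
    unfolding C_PV_simps
  proof (rule restrict_ext)
    fix as :: "'v list" assume "as \<in> lists_of_length n"
    then have "length as = n" by (simp add: lists_of_length_def)
    then obtain P P' where "Z as = Cl n P" "Z' as = Cl n P'" using hc_car[OF ZZ(1)] hc_car[OF ZZ(2)] by blast
    then show "ladd (tgt V n) (Z as) (Z' as) = ladd (tgt V n) (Z' as) (Z as)" by (simp add: add.commute)
  qed
  have P: "Phi n y0 y1 = ladd (C_PV V n) (fl n (Ext y0 0 [])) (fl n (Ext y1 1 []))" by (simp add: Phi_fl C_PV_simps)
  have y': "fl n (Ext y0 0 []) \<in> hcochains V n 0" "fl n (Ext y1 1 []) \<in> hcochains V n 1" using y fl_Ext by auto
  have b: "1 + 0 = (1 :: bit)" "1 + 1 = (0 :: bit)" by simp_all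
  show "cochain_comp V n 0 (Phi n y0 y1) = fl n (Ext y0 0 [])"
    unfolding cochain_comp_def b P by (rule the_equality) (use y' u in blast)+
  show "cochain_comp V n 1 (Phi n y0 y1) = fl n (Ext y1 1 [])"
    unfolding cochain_comp_def b P by (rule the_equality) (use y' u comm in metis)+
qed

lemma d_Ext:
  assumes y: "lch n q y"
  shows "d_ext V n q (fl n (Ext y q [])) = fl (Suc n) (Ext (dc y q) (q + 1) [])"
proof -
  note b = Ext_bco[OF y] and dl = dc_lco[OF y]
  have D: "bco V (Suc n) (q + 1) (dd (Ext y q []) q [])" by (rule dd_bco[OF b])
  have "fl (Suc n) (dd (Ext y q []) q []) = fl (Suc n) (Ext (dc y q) (q + 1) [])"
  proof (rule hc_unique[OF fl_hcochain[OF D] fl_Ext[OF dl]])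
    fix u ps assume u: "homs H ps u" "length u = Suc n"
    have z: "zit ps (map \<iota> u) = im (zit ps u)" by (rule nth_equalityI) (auto simp: im_def)
    have g: "gdh (zit ps u)" by (rule zit_homs[OF u(1)])
    have "dd (Ext y q []) q [] (im (zit ps u)) = dc (\<lambda>l. Ext y q [] (im l)) q (zit ps u)"
      using dd_gens[OF b, of "[]" "zit ps u"] g u by simp
    also have "\<dots> = dc y q (zit ps u)" by (rule dc_cong[OF g]) (use Ext_gens[OF y, of "[]"] u in auto)
    finally show "fl (Suc n) (dd (Ext y q []) q []) (map \<iota> u) = fl (Suc n) (Ext (dc y q) (q + 1) []) (map \<iota> u)"
      using fl_homs[OF D homs_map[OF u(1)]] u Ep_zit[OF dl u] by (simp add: z) (simp add: fl_def lists_of_length_def)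
  qed
  then show ?thesis by (simp add: d_ext_fl[OF b])
qed

text \<open>The differential changes the parity, so the two components trade places.\<close>

theorem Phi_d:
  assumes y: "lch2 n y0 y1"
  shows "d_PV V n (Phi n y0 y1) = Phi (Suc n) (dc y1 1) (dc y0 0)"
    and "lch2 (Suc n) (dc y1 1) (dc y0 0)"
proof -
  have b: "0 + 1 = (1 :: bit)" "1 + 1 = (0 :: bit)" by simp_all
  show "lch2 (Suc n) (dc y1 1) (dc y0 0)" using dc_lco[of n 0 y0] dc_lco[of n 1 y1] y unfolding b by blast
  show "d_PV V n (Phi n y0 y1) = Phi (Suc n) (dc y1 1) (dc y0 0)"
    unfolding d_PV_def cochain_comp_Phi[OF y] d_Ext[OF conjunct1[OF y]] d_Ext[OF conjunct2[OF y]] b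
    unfolding Phi_def C_PV_simps by (rule restrict_ext) (simp add: fl_def add.commute)
qed

lemma Z_iff: "Y \<in> lcarr (Z_PV V n) \<longleftrightarrow> (\<exists>y0 y1. lch2 n y0 y1 \<and> Y = Phi n y0 y1 \<and>
    (\<forall>ps u. homs H ps u \<and> length u = Suc n \<longrightarrow> dc y1 1 (zit ps u) \<in> I (Suc n) \<and> dc y0 0 (zit ps u) \<in> I (Suc n)))"
proof -
  have n: "lch2 (Suc n) (\<lambda>_. 0) (\<lambda>_. 0)" using lco_null by simp
  have "d_PV V n (Phi n y0 y1) = lzero (C_PV V (Suc n)) \<longleftrightarrow>
    (\<forall>ps u. homs H ps u \<and> length u = Suc n \<longrightarrow> dc y1 1 (zit ps u) \<in> I (Suc n) \<and> dc y0 0 (zit ps u) \<in> I (Suc n))"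
    if "lch2 n y0 y1" for y0 y1 unfolding Phi_d(1)[OF that] Phi_lin(3) Phi_eq[OF Phi_d(2)[OF that] n] by simp
  then show ?thesis
    unfolding Z_PV_def fun_space_def lin_space.simps mem_Collect_eq using C_Phi[of Y n] Phi_C[of n] by metis
qed

text \<open>The guard makes one formula serve all degrees: in degree 0 \<open>dc\<close> is zero on
  the empty list, and the right-hand side describes the zero cochain.\<close>

lemma B_iff: "Y \<in> B_PV V n \<longleftrightarrow> (\<exists>x0 x1. (\<forall>m. n = Suc m \<longrightarrow> lch2 m x0 x1) \<and> Y = Phi n (dc x1 1) (dc x0 0))"
proof (cases n)
  case 0
  have "Phi 0 (dc x1 1) (dc x0 0) = lzero (C_PV V 0)" for x0 x1
    unfolding Phi_def C_PV_simps by (rule restrict_ext) (simp add: lists_of_length_def flat_def zit_def)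
  then show ?thesis by (simp add: 0 B_PV_def)
next
  case (Suc m)
  show ?thesis
  proof
    assume "Y \<in> B_PV V n"
    then obtain Z where "Z \<in> lcarr (C_PV V m)" "Y = d_PV V m Z" by (auto simp: Suc B_PV_def)
    moreover then obtain x0 x1 where "lch2 m x0 x1" "Z = Phi m x0 x1" using C_Phi by blast
    ultimately show "\<exists>x0 x1. (\<forall>m. n = Suc m \<longrightarrow> lch2 m x0 x1) \<and> Y = Phi n (dc x1 1) (dc x0 0)"
      using Phi_d(1) Suc by (intro exI[of _ x0] exI[of _ x1]) simp
  next
    assume "\<exists>x0 x1. (\<forall>m. n = Suc m \<longrightarrow> lch2 m x0 x1) \<and> Y = Phi n (dc x1 1) (dc x0 0)"
    then obtain x0 x1 where x: "lch2 m x0 x1" "Y = Phi n (dc x1 1) (dc x0 0)" using Suc by blast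
    then show "Y \<in> B_PV V n" using Phi_d(1)[OF x(1)] Phi_C[OF x(1)] by (auto simp: Suc B_PV_def intro!: image_eqI[of _ _ "Phi m x0 x1"])
  qed
qed

end

section \<open>The isomorphism\<close>

text \<open>Just the laws needed to compute with cosets; the records do not come with the axioms of
  a vector space.\<close>

locale lin_quot =
  fixes W :: "('f::field, 'a) lin_space" and U :: "'a set"
  assumes cl: "x \<in> lcarr W \<Longrightarrow> y \<in> lcarr W \<Longrightarrow> ladd W x y \<in> lcarr W"
    and comm: "x \<in> lcarr W \<Longrightarrow> y \<in> lcarr W \<Longrightarrow> ladd W x y = ladd W y x"
    and assoc: "x \<in> lcarr W \<Longrightarrow> y \<in> lcarr W \<Longrightarrow> z \<in> lcarr W \<Longrightarrow> ladd W (ladd W x y) z = ladd W x (ladd W y z)"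
    and zero: "lzero W \<in> U" "x \<in> lcarr W \<Longrightarrow> ladd W x (lzero W) = x"
    and scl: "x \<in> lcarr W \<Longrightarrow> lsmul W c x \<in> lcarr W"
      "x \<in> lcarr W \<Longrightarrow> y \<in> lcarr W \<Longrightarrow> lsmul W c (ladd W x y) = ladd W (lsmul W c x) (lsmul W c y)"
    and neg: "x \<in> lcarr W \<Longrightarrow> ladd W x (lsmul W (- 1) x) = lzero W"
    and U: "U \<subseteq> lcarr W" "x \<in> U \<Longrightarrow> y \<in> U \<Longrightarrow> ladd W x y \<in> U" "x \<in> U \<Longrightarrow> lsmul W c x \<in> U"
begin

lemma coset_absorb:
  assumes x: "x \<in> lcarr W" and u: "u \<in> U"
  shows "lcoset W U (ladd W x u) = lcoset W U x"
proof -
  have uL: "u \<in> lcarr W" using u U by auto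
  have "ladd W (ladd W x u) v \<in> lcoset W U x" if "v \<in> U" for v
    using assoc[OF x uL, of v] U(2)[OF u that] that U(1) by (auto simp: lcoset_def)
  moreover have "ladd W x v \<in> lcoset W U (ladd W x u)" if v: "v \<in> U" for v
  proof -
    let ?w = "ladd W (lsmul W (- 1) u) v"
    have n: "lsmul W (- 1) u \<in> lcarr W" "v \<in> lcarr W" "lzero W \<in> lcarr W" using uL scl v U(1) zero by auto
    have "ladd W (ladd W x u) ?w = ladd W x (ladd W u ?w)" by (rule assoc[OF x uL cl[OF n(1,2)]])
    also have "ladd W u ?w = ladd W (lzero W) v" using assoc[OF uL n(1,2)] neg[OF uL] by simp
    also have "\<dots> = v" using comm[OF n(3,2)] zero(2)[OF n(2)] by simp
    finally have "ladd W x v = ladd W (ladd W x u) ?w" by simp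
    moreover have "?w \<in> U" using U(2,3) u v by blast
    ultimately show ?thesis unfolding lcoset_def by blast
  qed
  ultimately show ?thesis unfolding lcoset_def by blast
qed

lemma coset_eqD:
  assumes "x \<in> lcarr W" "y \<in> lcarr W" "lcoset W U x = lcoset W U y"
  shows "\<exists>u\<in>U. y = ladd W x u"
proof -
  have "ladd W y (lzero W) \<in> lcoset W U y" unfolding lcoset_def using zero(1) by blast
  then have "y \<in> lcoset W U x" using assms zero(2) by simp
  then show ?thesis by (auto simp: lcoset_def)
qed

lemma coset_add:
  assumes x: "x \<in> lcarr W" and y: "y \<in> lcarr W"
  shows "ladd (lquot W U) (lcoset W U x) (lcoset W U y) = lcoset W U (ladd W x y)"
proof -
  have e: "ladd W (ladd W x u) (ladd W y v) = ladd W (ladd W x y) (ladd W u v)" if uv: "u \<in> U" "v \<in> U" for u v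
  proof -
    have L: "u \<in> lcarr W" "v \<in> lcarr W" using uv U by auto
    have "ladd W (ladd W x u) (ladd W y v) = ladd W x (ladd W (ladd W u y) v)"
      using assoc[OF x L(1) cl[OF y L(2)]] assoc[OF L(1) y L(2)] by simp
    also have "\<dots> = ladd W x (ladd W y (ladd W u v))" using comm[OF L(1) y] assoc[OF y L] by simp
    also have "\<dots> = ladd W (ladd W x y) (ladd W u v)" using assoc[OF x y cl[OF L]] by simp
    finally show ?thesis .
  qed
  show ?thesis
  proof (rule set_eqI)
    fix t
    have "t \<in> ladd (lquot W U) (lcoset W U x) (lcoset W U y) \<longleftrightarrow> (\<exists>u\<in>U. \<exists>v\<in>U. t = ladd W (ladd W x u) (ladd W y v))"
      by (auto simp: lquot_def lcoset_def)
    also have "\<dots> \<longleftrightarrow> (\<exists>u\<in>U. \<exists>v\<in>U. t = ladd W (ladd W x y) (ladd W u v))" using e by auto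
    also have "\<dots> \<longleftrightarrow> (\<exists>u\<in>U. t = ladd W (ladd W x y) u)" using U(2) zero(1) zero(2) U(1) by (metis subsetD)
    finally show "t \<in> ladd (lquot W U) (lcoset W U x) (lcoset W U y) \<longleftrightarrow> t \<in> lcoset W U (ladd W x y)"
      by (auto simp: lcoset_def)
  qed
qed

lemma coset_smul:
  assumes x: "x \<in> lcarr W"
  shows "lsmul (lquot W U) c (lcoset W U x) = lcoset W U (lsmul W c x)"
proof -
  have e: "ladd W (lsmul W c (ladd W x u)) v = ladd W (lsmul W c x) (ladd W (lsmul W c u) v)" if uv: "u \<in> U" "v \<in> U" for u v
  proof -
    have L: "u \<in> lcarr W" "v \<in> lcarr W" using uv U by auto
    show ?thesis unfolding scl(2)[OF x L(1)] by (rule assoc[OF scl(1)[OF x] scl(1)[OF L(1)] L(2)])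
  qed
  show ?thesis
  proof (rule set_eqI)
    fix t
    have "t \<in> lsmul (lquot W U) c (lcoset W U x) \<longleftrightarrow> (\<exists>u\<in>U. \<exists>v\<in>U. t = ladd W (lsmul W c (ladd W x u)) v)"
      by (auto simp: lquot_def lcoset_def)
    also have "\<dots> \<longleftrightarrow> (\<exists>u\<in>U. \<exists>v\<in>U. t = ladd W (lsmul W c x) (ladd W (lsmul W c u) v))" using e by auto
    also have "\<dots> \<longleftrightarrow> (\<exists>u\<in>U. t = ladd W (lsmul W c x) u)"
    proof
      assume "\<exists>u\<in>U. t = ladd W (lsmul W c x) u"
      moreover have "t = ladd W (lsmul W c x) (ladd W (lsmul W c (lzero W)) u) \<longleftrightarrow> t = ladd W (lsmul W c x) u" if "u \<in> U" for u
        using e[OF zero(1) that] zero(2)[OF x] by simp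
      ultimately show "\<exists>u\<in>U. \<exists>v\<in>U. t = ladd W (lsmul W c x) (ladd W (lsmul W c u) v)" using zero(1) by blast
    qed (use U(2,3) in blast)
    finally show "t \<in> lsmul (lquot W U) c (lcoset W U x) \<longleftrightarrow> t \<in> lcoset W U (lsmul W c x)" by (auto simp: lcoset_def)
  qed
qed

end

lemma Sdual_simps:
  "ladd (Sdual H n) \<alpha> \<beta> = (\<lambda>u\<in>lists_of_length n. \<alpha> u + \<beta> u)"
  "lsmul (Sdual H n) c \<alpha> = (\<lambda>u\<in>lists_of_length n. c * \<alpha> u)"
  "\<alpha> \<in> lcarr (Sdual H n) \<longleftrightarrow> \<alpha> \<in> extensional (lists_of_length n) \<and>
    (\<forall>as i a b. length as = n \<and> i < n \<longrightarrow> \<alpha> (as[i := a + b]) = \<alpha> (as[i := a]) + \<alpha> (as[i := b])) \<and>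
    (\<forall>as i a c. length as = n \<and> i < n \<longrightarrow> \<alpha> (as[i := scl H c a]) = c * \<alpha> (as[i := a])) \<and>
    (\<forall>as ps i. length as = n \<and> homs H ps as \<and> Suc i < n \<longrightarrow> \<alpha> (lswap i as) = sg ((1 + ps ! i) * (1 + ps ! Suc i)) * \<alpha> as)"
  by (auto simp: Sdual_def fun_space_def base_field_def multilinear_def lists_of_length_def PiE_def)

lemma Sdual_unique:
  assumes S: "super_space H" and a: "\<alpha> \<in> lcarr (Sdual H n)" "\<alpha>' \<in> lcarr (Sdual H n)"
    and e: "\<And>ps u. homs H ps u \<Longrightarrow> length u = n \<Longrightarrow> \<alpha> u = \<alpha>' u"
  shows "\<alpha> = \<alpha>'"
proof (rule extensionalityI[of _ "lists_of_length n"])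
  fix u :: "'b list" assume "u \<in> lists_of_length n"
  then have n: "length u = n" by (simp add: lists_of_length_def)
  show "\<alpha> u = \<alpha>' u"
  proof (rule super_space.slot_induct_par[OF S, where P = "\<lambda>u. \<alpha> u = \<alpha>' u", OF _ _ n])
    show "\<alpha> u = \<alpha>' u" if "length u = n" "set u \<subseteq> par H 0 \<union> par H 1" for u using homs_exist[OF S] e that by metis
    show "\<alpha> (u[i := x + y]) = \<alpha>' (u[i := x + y])"
      if "length u = n" "i < n" "\<alpha> (u[i := x]) = \<alpha>' (u[i := x])" "\<alpha> (u[i := y]) = \<alpha>' (u[i := y])" for u i x y
      using a that unfolding Sdual_simps by metis
  qed
qed (use a in \<open>auto simp: Sdual_simps\<close>)

section \<open>The explicit cocycles and the isomorphism\<close>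

context boson
begin

abbreviation "S n \<equiv> lcarr (Sdual H n)"

lemma S_D:
  assumes "\<alpha> \<in> S n"
  shows "length as = n \<Longrightarrow> i < n \<Longrightarrow> \<alpha> (as[i := a + b]) = \<alpha> (as[i := a]) + \<alpha> (as[i := b])"
    "length as = n \<Longrightarrow> i < n \<Longrightarrow> \<alpha> (as[i := scl H c a]) = c * \<alpha> (as[i := a])"
    "length as = n \<Longrightarrow> homs H ps as \<Longrightarrow> Suc i < n \<Longrightarrow> \<alpha> (lswap i as) = sg ((1 + ps ! i) * (1 + ps ! Suc i)) * \<alpha> as"
  using assms unfolding Sdual_simps by blast+

text \<open>Constants are even, so the scalar cochain of parity \<open>q\<close> is the restriction of \<open>\<alpha>\<close> to one total parity of
  the arguments.\<close>

definition sa :: "('h list \<Rightarrow> 'f) \<Rightarrow> bit \<Rightarrow> 'h item list \<Rightarrow> 'f" where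
  "sa \<alpha> q l = (if 1 + q + pbs l = 0 then \<alpha> (map ag l) else 0)"

lemma sa_sum: "sa \<alpha> 0 l + sa \<alpha> 1 l = \<alpha> (map ag l)"
  by (cases "pbs l") (simp_all add: sa_def)

lemma gdh_homsH: "gdh l \<Longrightarrow> homs H (map pt l) (map ag l)"
  by (auto simp: homs_def list_all2_map1 list_all2_map2 gd_def intro!: list.rel_refl_strong)

lemma sa_lch:
  assumes \<alpha>: "\<alpha> \<in> S n"
  shows "lch n q (sc (sa \<alpha> q))"
  unfolding lco_def
proof (intro conjI allI impI)
  fix l assume l: "gdh l \<and> length l = n"
  show "sc (sa \<alpha> q) l \<in> pon (lb l)" by simp
  show "sc (sa \<alpha> q) l \<in> rpar V (1 + q + pbs l)" using scl1_even[of "\<alpha> (map ag l)"] by (auto simp: sa_def Vscl)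
  fix \<rho> :: "nat \<Rightarrow> nat"
  have "map ag (rl \<rho> l) = map ag l" by (simp add: rl_def comp_def)
  then have "sa \<alpha> q (rl \<rho> l) = sa \<alpha> q l" by (simp only: sa_def rl_simps)
  then show "sc (sa \<alpha> q) (rl \<rho> l) = ren \<rho> (sc (sa \<alpha> q) l)" by simp
next
  fix l1 x z l2 assume g: "gdh (l1 @ x # z # l2) \<and> length (l1 @ x # z # l2) = n"
  let ?L = "l1 @ z # x # l2"
  have h: "homs H (map pt ?L) (map ag ?L)" by (rule gdh_homsH) (use g in auto)
  have "map ag (l1 @ x # z # l2) = lswap (length l1) (map ag ?L)"
    by (simp add: lswap_def nth_append list_update_append)
  then have "\<alpha> (map ag (l1 @ x # z # l2)) = sgx z x * \<alpha> (map ag ?L)"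
    using S_D(3)[OF \<alpha> _ h, of "length l1"] g by (simp add: nth_append)
  moreover have "pbs (l1 @ x # z # l2) = pbs ?L" by (simp add: add_ac)
  ultimately have "sa \<alpha> q (l1 @ x # z # l2) = sgx x z * sa \<alpha> q ?L"
    unfolding sa_def mult.commute[of "1 + pt z"] by (cases "1 + q + pbs ?L = 0") (simp_all only: refl if_True if_False mult_zero_right)
  then show "sc (sa \<alpha> q) (l1 @ x # z # l2) = sgx x z * sc (sa \<alpha> q) ?L"
    by (simp only: spol_sg_eq[symmetric] spol_scal)
next
  fix i p a b c l assume g: "gdh ((i, p, a) # l) \<and> gdh ((i, p, b) # l) \<and> Suc (length l) = n"
  have "\<alpha> ((scl H c a + b) # map ag l) = c * \<alpha> (a # map ag l) + \<alpha> (b # map ag l)"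
    using S_D(1)[OF \<alpha>, of "b # map ag l" 0 "scl H c a" b] S_D(2)[OF \<alpha>, of "b # map ag l" 0 c a] g by auto
  then have "sa \<alpha> q ((i, p, scl H c a + b) # l) = c * sa \<alpha> q ((i, p, a) # l) + sa \<alpha> q ((i, p, b) # l)"
    by (simp add: sa_def)
  then show "sc (sa \<alpha> q) ((i, p, scl H c a + b) # l) = spol V c (sc (sa \<alpha> q) ((i, p, a) # l)) + sc (sa \<alpha> q) ((i, p, b) # l)"
    by (simp only: spol_scal single_add[symmetric] Vscl(2)[symmetric])
qed

text \<open>The two scalar cochains live on lists of opposite total parity, so their sum determines
  both; extending it additively to arguments that are not homogeneous gives the linear
  function.\<close>

lemma sa_of:
  assumes c0: "lch n 0 (sc c0)" and c1: "lch n 1 (sc c1)"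
  shows "\<exists>\<alpha>\<in>S n. \<forall>l. gdh l \<and> length l = n \<longrightarrow> sa \<alpha> 0 l = c0 l \<and> sa \<alpha> 1 l = c1 l"
proof -
  define c where "c l = c0 l + c1 l" for l
  define \<alpha> where "\<alpha> = (\<lambda>u\<in>lists_of_length n. flat H n c u)"
  have lin: "c (l1 @ (i, p, scl H r a + b) # l2) = r * c (l1 @ (i, p, a) # l2) + c (l1 @ (i, p, b) # l2)"
    if "gdh (l1 @ (i, p, a) # l2)" "gdh (l1 @ (i, p, b) # l2)" "length (l1 @ (i, p, a) # l2) = n" for l1 i p a b l2 r
    using b_lin[OF c0 that, of r] b_lin[OF c1 that, of r] by (simp add: c_def algebra_simps)
  have zero: "c (l1 @ (i, p, 0) # l2) = 0" if "gdh (l1 @ (i, p, 0) # l2)" "length (l1 @ (i, p, 0) # l2) = n" for l1 i p l2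
    using lin[OF that(1,1,2), of 1] by (simp add: Hscl)
  have val: "\<alpha> u = c (zit ps u)" if u: "homs H ps u" "length u = n" for ps u
  proof -
    have "flat H n c u = c (zit ps u)" by (rule super_space.flat_homs[OF HS _ u]) (rule zero)
    then show ?thesis using u(2) by (simp add: \<alpha>_def lists_of_length_def)
  qed
  have flin: "flat H n c (as[i := scl H r a + b]) = r * flat H n c (as[i := a]) + flat H n c (as[i := b])" if "length as = n" "i < n" for as i a b r
    by (rule super_space.flat_lin[OF HS lin _ that]) (auto intro: additiveI simp: distrib_left)
  have "\<alpha> \<in> S n" unfolding Sdual_simps
  proof (intro conjI allI impI)
    show "\<alpha> \<in> extensional (lists_of_length n)" by (simp add: \<alpha>_def)
    fix as :: "'h list" and i a b r assume as: "length as = n \<and> i < n"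
    show "\<alpha> (as[i := a + b]) = \<alpha> (as[i := a]) + \<alpha> (as[i := b])"
      using flin[of as i 1 a b] as by (simp add: \<alpha>_def lists_of_length_def Hscl)
    have "flat H n c (as[i := 0]) = 0" using flin[of as i 1 0 0] as by (simp add: Hscl)
    then show "\<alpha> (as[i := scl H r a]) = r * \<alpha> (as[i := a])"
      using flin[of as i r a 0] as by (simp add: \<alpha>_def lists_of_length_def)
  next
    fix as :: "'h list" and ps i assume "length as = n \<and> homs H ps as \<and> Suc i < n"
    then have as: "length as = n" "homs H ps as" "Suc i < n" by auto
    note h' = lco_zit_swap(1)[OF c0 as]
    have "c' (zit (lswap i ps) (lswap i as)) = sg ((1 + ps ! i) * (1 + ps ! Suc i)) * c' (zit ps as)" if "lch n r (sc c')" for r c'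
      using lco_zit_swap(2)[OF that as] by (simp only: ren_simps spol_sg_eq[symmetric] spol_scal sc_eq)
    from this[OF c0] this[OF c1] show "\<alpha> (lswap i as) = sg ((1 + ps ! i) * (1 + ps ! Suc i)) * \<alpha> as"
      using val[OF h'] val[OF as(2,1)] as(1) by (simp add: c_def distrib_left)
  qed
  moreover have "sa \<alpha> 0 l = c0 l \<and> sa \<alpha> 1 l = c1 l" if l: "gdh l" "length l = n" for l
  proof -
    let ?z = "zit (map pt l) (map ag l)" and ?\<rho> = "(!) (map fst l)"
    note h = gdh_homsH[OF l(1)]
    have e: "rl ?\<rho> ?z = l" by (rule nth_equalityI) (auto simp: rl_def)
    have "distinct (map fst l)" using l(1) by (simp add: gd_def)
    then have inj: "inj_on ?\<rho> (lb ?z)" using inj_on_nth[of "map fst l" "{..<length l}"] by auto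
    have "c' l = c' ?z" if "lch n r (sc c')" for r c' using b_rl[OF that zit_homs[OF h] _ inj] l(2) e by simp
    then have "\<alpha> (map ag l) = c0 l + c1 l" using val[OF h] l(2) c0 c1 by (metis c_def length_map)
    moreover have "c1 l = 0" if "1 + 0 + pbs l = 0" using b_par[OF c1 l] that by (cases "pbs l") simp_all
    moreover have "c0 l = 0" if "1 + 0 + pbs l \<noteq> 0" using b_par[OF c0 l] that by simp
    moreover have "c0 l = 0" if "1 + 1 + pbs l = 0" using b_par[OF c0 l] that by (cases "pbs l") simp_all
    moreover have "c1 l = 0" if "1 + 1 + pbs l \<noteq> 0" using b_par[OF c1 l] that by simp
    ultimately show ?thesis unfolding sa_def by (metis add.right_neutral add.left_neutral)
  qed
  ultimately show ?thesis by blast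
qed

definition val :: "('h list \<Rightarrow> 'f) \<Rightarrow> ('h list \<Rightarrow> 'f) \<Rightarrow> 'h list \<Rightarrow> 'v" where
  "val \<alpha> \<beta> u = scl V (\<alpha> u) 1 + (\<Sum>j<N. scl V (\<beta> (u @ [us' ! j])) (\<iota> (us ! j)))"

text \<open>\<open>yb\<close> changes the parity, so the component of parity \<open>q\<close> takes
  the opposite component of \<beta>.\<close>

definition Wab :: "('h list \<Rightarrow> 'f) \<Rightarrow> ('h list \<Rightarrow> 'f) \<Rightarrow> bit \<Rightarrow> 'h item list \<Rightarrow> 'v pol" where
  "Wab \<alpha> \<beta> q l = sc (sa \<alpha> q) l + yb (sa \<beta> (q + 1)) l"

definition Yab :: "nat \<Rightarrow> ('h list \<Rightarrow> 'f) \<Rightarrow> ('h list \<Rightarrow> 'f) \<Rightarrow> 'v list \<Rightarrow> 'v pol set" where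
  "Yab n \<alpha> \<beta> = Phi n (Wab \<alpha> \<beta> 0) (Wab \<alpha> \<beta> 1)"

lemma Wab_lch: "\<alpha> \<in> S n \<Longrightarrow> \<beta> \<in> S (Suc n) \<Longrightarrow> lch n q (Wab \<alpha> \<beta> q)"
  using lco_add[OF sa_lch[of \<alpha> n q], of "yb (sa \<beta> (q + 1))"] yb_lco[OF sa_lch[of \<beta> "Suc n" "q + 1"]]
  unfolding Wab_def[abs_def] by (simp add: add.assoc)

lemma Wab_val: "Wab \<alpha> \<beta> 0 (zit ps u) + Wab \<alpha> \<beta> 1 (zit ps u) = cst (val \<alpha> \<beta> u)"
proof -
  have z: "map ag (zit ps u) = u" by (rule nth_equalityI) auto
  have "yb (sa \<beta> 1) (zit ps u) + yb (sa \<beta> 0) (zit ps u) = cst (\<Sum>j<N. scl V (\<beta> (u @ [us' ! j])) (\<iota> (us ! j)))"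
  proof -
    have "yb (sa \<beta> 1) (zit ps u) + yb (sa \<beta> 0) (zit ps u)
      = (\<Sum>j<N. cst (scl V (sa \<beta> 0 (zit ps u @ [(fresh (zit ps u), pu j, us' ! j)]) + sa \<beta> 1 (zit ps u @ [(fresh (zit ps u), pu j, us' ! j)])) (\<iota> (us ! j))))"
      by (simp only: yb_def sum.distrib[symmetric] single_add[symmetric] Vscl(2)[symmetric] add.commute)
    also have "\<dots> = (\<Sum>j<N. cst (scl V (\<beta> (u @ [us' ! j])) (\<iota> (us ! j))))" unfolding sa_sum by (simp add: z)
    also have "\<dots> = cst (\<Sum>j<N. scl V (\<beta> (u @ [us' ! j])) (\<iota> (us ! j)))"
      by (rule additive.sum[symmetric, OF cst_additive[of "\<lambda>v. v"]]) (simp add: additive_def)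
    finally show ?thesis .
  qed
  moreover have "sc (sa \<alpha> 0) (zit ps u) + sc (sa \<alpha> 1) (zit ps u) = cst (scl V (\<alpha> u) 1)"
    by (simp only: single_add[symmetric] Vscl(2)[symmetric] sa_sum z)
  ultimately show ?thesis by (simp add: Wab_def val_def single_add add_ac)
qed

lemma C_add:
  assumes Y: "Y \<in> lcarr (C_PV V n)" and as: "length as = n" "i < n"
  shows "Y (as[i := a + b]) = ladd (tgt V n) (Y (as[i := a])) (Y (as[i := b]))"
proof -
  obtain Y0 Y1 where Y01: "Y0 \<in> hcochains V n 0" "Y1 \<in> hcochains V n 1"
    and e: "Y = (\<lambda>as\<in>lists_of_length n. ladd (tgt V n) (Y0 as) (Y1 as))"
    using Y unfolding C_PV_simps by blast
  have l: "length (as[i := c]) = n" for c using as by simp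
  obtain P Q P' Q' where "Y0 (as[i := a]) = Cl n P" "Y0 (as[i := b]) = Cl n Q" "Y1 (as[i := a]) = Cl n P'" "Y1 (as[i := b]) = Cl n Q'"
    using hc_car[OF Y01(1) l] hc_car[OF Y01(2) l] by metis
  then show ?thesis
    using hc_add[OF Y01(1) as, of a b] hc_add[OF Y01(2) as, of a b] as by (simp add: e lists_of_length_def add_ac)
qed

text \<open>First for homogeneous arguments through the standard list, then for all by additivity in
  each slot.\<close>

lemma Yab_vals:
  assumes \<alpha>: "\<alpha> \<in> S n" and \<beta>: "\<beta> \<in> S (Suc n)" and u: "length u = n"
  shows "Yab n \<alpha> \<beta> (map \<iota> u) = Cl n (cst (val \<alpha> \<beta> u))"
proof -
  have l: "lch2 n (Wab \<alpha> \<beta> 0) (Wab \<alpha> \<beta> 1)" using Wab_lch[OF \<alpha> \<beta>] by blast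
  have C: "Yab n \<alpha> \<beta> \<in> lcarr (C_PV V n)" unfolding Yab_def by (rule Phi_C[OF l])
  show ?thesis
  proof (rule super_space.slot_induct_par[OF HS, where P = "\<lambda>u. Yab n \<alpha> \<beta> (map \<iota> u) = Cl n (cst (val \<alpha> \<beta> u))", OF _ _ u])
    fix u assume u: "length u = n" "set u \<subseteq> par H 0 \<union> par H 1"
    then obtain ps where "homs H ps u" using homs_exist[OF HS] by blast
    then show "Yab n \<alpha> \<beta> (map \<iota> u) = Cl n (cst (val \<alpha> \<beta> u))"
      unfolding Yab_def using Phi_vals[OF l] u(1) by (simp add: Wab_val)
  next
    fix u i a b
    assume u: "length u = n" "i < n" and h: "Yab n \<alpha> \<beta> (map \<iota> (u[i := a])) = Cl n (cst (val \<alpha> \<beta> (u[i := a])))"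
      "Yab n \<alpha> \<beta> (map \<iota> (u[i := b])) = Cl n (cst (val \<alpha> \<beta> (u[i := b])))"
    have "\<beta> (u[i := a + b] @ [v]) = \<beta> (u[i := a] @ [v]) + \<beta> (u[i := b] @ [v])" for v
      using S_D(1)[OF \<beta>, of "u @ [v]" i a b] u by (simp add: list_update_append)
    then have "val \<alpha> \<beta> (u[i := a + b]) = val \<alpha> \<beta> (u[i := a]) + val \<alpha> \<beta> (u[i := b])"
      using S_D(1)[OF \<alpha> u] by (simp add: val_def Vscl sum.distrib)
    then show "Yab n \<alpha> \<beta> (map \<iota> (u[i := a + b])) = Cl n (cst (val \<alpha> \<beta> (u[i := a + b])))"
      using C_add[OF C, of "map \<iota> u" i "\<iota> a" "\<iota> b"] u h by (simp add: map_update \<iota>_add single_add)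
  qed
qed

text \<open>The scalar part is closed, and the differential of the Casimir part lies in the image of
  \<open>tot\<close>; so the class in the quotient is a cocycle although the lift is not closed in
  general.\<close>

lemma dc_Wab:
  assumes \<beta>: "\<beta> \<in> S (Suc n)" and l: "gdh l" "length l = Suc n"
  shows "dc (Wab \<alpha> \<beta> q) q l = - tot (lb l) (sc (sa \<beta> (q + 1)) l)"
proof -
  have "dc (Wab \<alpha> \<beta> q) q l = dc (sc (sa \<alpha> q)) q l + dc (yb (sa \<beta> (q + 1))) q l"
    unfolding Wab_def[abs_def] by (rule dc_add)
  then show ?thesis using dc_yb[OF sa_lch[OF \<beta>] l, of "q + 1"] by (simp add: dc_sc add.assoc)
qed

lemma Yab_C: "\<alpha> \<in> S n \<Longrightarrow> \<beta> \<in> S (Suc n) \<Longrightarrow> Yab n \<alpha> \<beta> \<in> lcarr (C_PV V n)"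
  unfolding Yab_def using Phi_C Wab_lch by blast

lemma Yab_Z:
  assumes \<alpha>: "\<alpha> \<in> S n" and \<beta>: "\<beta> \<in> S (Suc n)"
  shows "Yab n \<alpha> \<beta> \<in> lcarr (Z_PV V n)"
proof -
  have "dc (Wab \<alpha> \<beta> q) q (zit ps u) \<in> I (Suc n)" if "homs H ps u" "length u = Suc n" for q ps u
    using dc_Wab[OF \<beta> zit_homs[OF that(1)], of \<alpha> q] that tot_in_I[of "sc (sa \<beta> (q + 1)) (zit ps u)" "Suc n"] I_closed(5)
    by (simp del: lessThan_Suc)
  then show ?thesis unfolding Z_iff Yab_def using Wab_lch[OF \<alpha> \<beta>] by blast
qed

lemma Yab_unique:
  assumes "\<alpha> \<in> S n" "\<beta> \<in> S (Suc n)" "Y \<in> lcarr (C_PV V n)" "\<And>u. length u = n \<Longrightarrow> Y (map \<iota> u) = Cl n (cst (val \<alpha> \<beta> u))"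
  shows "Y = Yab n \<alpha> \<beta>"
  by (rule C_unique[OF assms(3) Yab_C[OF assms(1,2)]]) (simp add: assms(4) Yab_vals[OF assms(1,2)])

lemma dcx_lch:
  assumes "\<forall>m. n = Suc m \<longrightarrow> lch2 m x0 x1"
  shows "lch2 n (dc x1 1) (dc x0 0)"
proof (cases n)
  case 0
  have "lch 0 q (dc x Q)" for q x Q by (rule lco_cong[OF lco_null]) (auto simp: Hpar)
  then show ?thesis using 0 by simp
qed (use assms Phi_d(2) in auto)

lemma B_C: "B_PV V n \<subseteq> lcarr (C_PV V n)"
proof
  fix Y assume "Y \<in> B_PV V n"
  then obtain x0 x1 where "\<forall>m. n = Suc m \<longrightarrow> lch2 m x0 x1" "Y = Phi n (dc x1 1) (dc x0 0)" unfolding B_iff by blast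
  then show "Y \<in> lcarr (C_PV V n)" using Phi_C dcx_lch by blast
qed

lemma B_closed:
  shows "lzero (C_PV V n) \<in> B_PV V n"
    and "Y \<in> B_PV V n \<Longrightarrow> Z \<in> B_PV V n \<Longrightarrow> ladd (C_PV V n) Y Z \<in> B_PV V n"
    and "Y \<in> B_PV V n \<Longrightarrow> lsmul (C_PV V n) c Y \<in> B_PV V n"
proof -
  have z: "dc (\<lambda>_. 0) Q l = 0" for Q l using dc_add[of "\<lambda>_. 0" "\<lambda>_. 0" Q l] by simp
  show "lzero (C_PV V n) \<in> B_PV V n"
    unfolding B_iff Phi_lin(3) by (intro exI[of _ "\<lambda>_. 0"]) (simp add: lco_null z[abs_def])
  show "ladd (C_PV V n) Y Z \<in> B_PV V n" if YZ: "Y \<in> B_PV V n" "Z \<in> B_PV V n"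
  proof -
    obtain x0 x1 z0 z1 where "\<forall>m. n = Suc m \<longrightarrow> lch2 m x0 x1" "Y = Phi n (dc x1 1) (dc x0 0)"
      "\<forall>m. n = Suc m \<longrightarrow> lch2 m z0 z1" "Z = Phi n (dc z1 1) (dc z0 0)" using YZ unfolding B_iff by metis
    then show ?thesis unfolding B_iff
      by (rule_tac exI[of _ "\<lambda>l. x0 l + z0 l"], rule_tac exI[of _ "\<lambda>l. x1 l + z1 l"]) (simp add: Phi_lin dc_add[abs_def] lco_add)
  qed
  show "lsmul (C_PV V n) c Y \<in> B_PV V n" if Y: "Y \<in> B_PV V n"
  proof -
    obtain x0 x1 where "\<forall>m. n = Suc m \<longrightarrow> lch2 m x0 x1" "Y = Phi n (dc x1 1) (dc x0 0)" using Y unfolding B_iff by metis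
    then show ?thesis unfolding B_iff
      by (rule_tac exI[of _ "\<lambda>l. spol V c (x0 l)"], rule_tac exI[of _ "\<lambda>l. spol V c (x1 l)"]) (simp add: Phi_lin dc_spol[abs_def] lch_spol)
  qed
qed

lemma lin_quot_C: "lin_quot (C_PV V n) (B_PV V n)"
proof
  fix x y z and c :: 'f
  assume "x \<in> lcarr (C_PV V n)"
  then obtain x0 x1 where x: "lch2 n x0 x1" "x = Phi n x0 x1" using C_Phi by blast
  show "ladd (C_PV V n) x (lzero (C_PV V n)) = x" by (simp add: x(2) Phi_lin)
  show "lsmul (C_PV V n) c x \<in> lcarr (C_PV V n)" unfolding x(2) Phi_lin by (rule Phi_C) (use x(1) lch_spol in blast)
  show "ladd (C_PV V n) x (lsmul (C_PV V n) (- 1) x) = lzero (C_PV V n)" by (simp add: x(2) Phi_lin spol_neg1)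
  assume "y \<in> lcarr (C_PV V n)"
  then obtain y0 y1 where y: "lch2 n y0 y1" "y = Phi n y0 y1" using C_Phi by blast
  show "ladd (C_PV V n) x y \<in> lcarr (C_PV V n)" unfolding x(2) y(2) Phi_lin by (rule Phi_C) (rule lch2_add[OF x(1) y(1)])
  show "ladd (C_PV V n) x y = ladd (C_PV V n) y x" by (simp add: x(2) y(2) Phi_lin add.commute)
  show "lsmul (C_PV V n) c (ladd (C_PV V n) x y) = ladd (C_PV V n) (lsmul (C_PV V n) c x) (lsmul (C_PV V n) c y)"
    by (simp add: x(2) y(2) Phi_lin spol_add)
  assume "z \<in> lcarr (C_PV V n)"
  then obtain z0 z1 where "z = Phi n z0 z1" using C_Phi by blast
  then show "ladd (C_PV V n) (ladd (C_PV V n) x y) z = ladd (C_PV V n) x (ladd (C_PV V n) y z)"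
    by (simp add: x(2) y(2) Phi_lin add.assoc)
qed (use B_C B_closed in blast)+

text \<open>Cocycles carry the operations of all cochains, so the cosets can be formed in
  \<open>C_PV\<close>.\<close>

lemma H_PV_simps:
  "lcarr (H_PV V n) = H_class V n ` lcarr (Z_PV V n)"
  "H_class V n = lcoset (C_PV V n) (B_PV V n)"
  "ladd (H_PV V n) = ladd (lquot (C_PV V n) (B_PV V n))" "lsmul (H_PV V n) = lsmul (lquot (C_PV V n) (B_PV V n))"
  by (auto simp: H_PV_def H_class_def[abs_def] lquot_def lcoset_def[abs_def] Z_PV_def C_PV_def fun_space_def Let_def)

text \<open>A good list is a renamed standard list, and renaming carries \<open>tot\<close> to
  \<open>tot\<close> with the new labels.\<close>

lemma std_ext:
  assumes w: "lch n q w" and i: "\<And>ps u. homs H ps u \<Longrightarrow> length u = n \<Longrightarrow> w (zit ps u) \<in> I n"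
    and l: "gdh l" "length l = n"
  shows "\<exists>P\<in>pon (lb l). w l = tot (lb l) P"
proof -
  let ?z = "zit (map pt l) (map ag l)" and ?\<rho> = "(!) (map fst l)"
  note h = gdh_homsH[OF l(1)]
  have e: "rl ?\<rho> ?z = l" by (rule nth_equalityI) (auto simp: rl_def)
  have "distinct (map fst l)" using l(1) by (simp add: gd_def)
  then have inj: "inj_on ?\<rho> {..<n}" using inj_on_nth[of "map fst l" "{..<n}"] l(2) by auto
  have im: "?\<rho> ` {..<n} = lb l" using nth_image[of n "map fst l"] l(2) by (simp add: atLeast0LessThan)
  obtain P where P: "P \<in> pon {..<n}" "w ?z = tot {..<n} P" using i[OF h] l(2) by (auto simp: I_tot)
  have "w l = ren ?\<rho> (w ?z)" using lco_rl[OF w zit_homs[OF h], of ?\<rho>] l(2) inj e by simp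
  also have "\<dots> = tot (lb l) (ren ?\<rho> P)" unfolding P(2) tot_ren[OF inj] im ..
  finally show ?thesis using ren_pon[OF P(1), of ?\<rho>] im by auto
qed

lemma Wab_diff: "Wab \<alpha>' \<beta>' q l - Wab \<alpha> \<beta> q l
  = sc (\<lambda>l. sa \<alpha>' q l - sa \<alpha> q l) l + yb (\<lambda>l. sa \<beta>' (q + 1) l - sa \<beta> (q + 1) l) l"
proof -
  have d: "scl V (c - d) v = scl V c v - scl V d v" for c d v using Vscl(2)[of "c - d" d v] by simp
  show ?thesis by (simp add: Wab_def yb_def d single_diff sum_subtractf)
qed

text \<open>The hypothesis splits into its two parities, and \<open>les_inj\<close> applies to the
  difference of the data in each of them.\<close>

lemma Yab_inj:
  assumes ab: "\<alpha> \<in> S n" "\<beta> \<in> S (Suc n)" "\<alpha>' \<in> S n" "\<beta>' \<in> S (Suc n)"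
    and b: "B \<in> B_PV V n" and e: "Yab n \<alpha>' \<beta>' = ladd (C_PV V n) (Yab n \<alpha> \<beta>) B"
  shows "\<alpha> = \<alpha>' \<and> \<beta> = \<beta>'"
proof -
  obtain x0 x1 where x: "\<forall>m. n = Suc m \<longrightarrow> lch2 m x0 x1" "B = Phi n (dc x1 1) (dc x0 0)" using b unfolding B_iff by blast
  have lW: "lch2 n (Wab \<alpha> \<beta> 0) (Wab \<alpha> \<beta> 1)" "lch2 n (Wab \<alpha>' \<beta>' 0) (Wab \<alpha>' \<beta>' 1)" using Wab_lch ab by blast+
  note lr = lch2_add[OF lW(1) dcx_lch[OF x(1)]]
  have i: "Wab \<alpha>' \<beta>' 0 (zit ps u) - (Wab \<alpha> \<beta> 0 (zit ps u) + dc x1 1 (zit ps u)) \<in> I n \<and>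
    Wab \<alpha>' \<beta>' 1 (zit ps u) - (Wab \<alpha> \<beta> 1 (zit ps u) + dc x0 0 (zit ps u)) \<in> I n" if "homs H ps u" "length u = n" for ps u
    using e that Phi_eq[OF lW(2) lr] unfolding Yab_def x(2) Phi_lin by blast
  have step: "(\<forall>l. gdh l \<and> length l = Suc n \<longrightarrow> sa \<beta>' (q + 1) l = sa \<beta> (q + 1) l) \<and> (\<forall>l. gdh l \<and> length l = n \<longrightarrow> sa \<alpha>' q l = sa \<alpha> q l)"
    if lx: "lch n q (\<lambda>l. Wab \<alpha>' \<beta>' q l - (Wab \<alpha> \<beta> q l + dc x (q + 1) l))"
      and i: "\<And>ps u. homs H ps u \<Longrightarrow> length u = n \<Longrightarrow> Wab \<alpha>' \<beta>' q (zit ps u) - (Wab \<alpha> \<beta> q (zit ps u) + dc x (q + 1) (zit ps u)) \<in> I n" for q x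
  proof -
    obtain z where z: "\<And>l. gdh l \<Longrightarrow> length l = n \<Longrightarrow> Wab \<alpha>' \<beta>' q l - (Wab \<alpha> \<beta> q l + dc x (q + 1) l) = tot (lb l) (z l)"
      using std_ext[OF lx i] by metis
    have "lch (Suc n) (q + 1) (\<lambda>l. sc (sa \<beta>' (q + 1)) l - sc (sa \<beta> (q + 1)) l)"
      by (rule lco_diff[OF sa_lch[OF ab(4)] sa_lch[OF ab(2)]])
    moreover have "scl V (c - d) 1 = scl V c 1 - scl V d 1" for c d using Vscl(2)[of "c - d" d 1] by simp
    ultimately have bl: "lch (Suc n) (q + 1) (sc (\<lambda>l. sa \<beta>' (q + 1) l - sa \<beta> (q + 1) l))" by (simp add: single_diff)
    have eq: "sc (\<lambda>l. sa \<alpha>' q l - sa \<alpha> q l) l + yb (\<lambda>l. sa \<beta>' (q + 1) l - sa \<beta> (q + 1) l) l = tot (lb l) (z l) + dc x (q + 1) l"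
      if "gdh l" "length l = n" for l unfolding Wab_diff[symmetric] using z[OF that] by (simp add: algebra_simps)
    show ?thesis using les_inj[OF bl eq] by auto
  qed
  have b01: "0 + 1 = (1 :: bit)" "1 + 1 = (0 :: bit)" by simp_all
  have s0: "(\<forall>l. gdh l \<and> length l = Suc n \<longrightarrow> sa \<beta>' 1 l = sa \<beta> 1 l) \<and> (\<forall>l. gdh l \<and> length l = n \<longrightarrow> sa \<alpha>' 0 l = sa \<alpha> 0 l)"
    using step[of 0 x1] lch2_diff[OF lW(2) lr] i unfolding b01 by blast
  have s1: "(\<forall>l. gdh l \<and> length l = Suc n \<longrightarrow> sa \<beta>' 0 l = sa \<beta> 0 l) \<and> (\<forall>l. gdh l \<and> length l = n \<longrightarrow> sa \<alpha>' 1 l = sa \<alpha> 1 l)"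
    using step[of 1 x0] lch2_diff[OF lW(2) lr] i unfolding b01 by blast
  have z: "map ag (zit ps u) = u" for ps and u :: "'h list" by (rule nth_equalityI) auto
  have "\<alpha> u = \<alpha>' u" if "homs H ps u" "length u = n" for ps u
    using s0 s1 zit_homs[OF that(1)] that sa_sum[of \<alpha> "zit ps u"] sa_sum[of \<alpha>' "zit ps u"] by (simp add: z)
  moreover have "\<beta> u = \<beta>' u" if "homs H ps u" "length u = Suc n" for ps u
    using s0 s1 zit_homs[OF that(1)] that sa_sum[of \<beta> "zit ps u"] sa_sum[of \<beta>' "zit ps u"] by (simp add: z)
  ultimately show ?thesis using Sdual_unique[OF HS ab(1,3)] Sdual_unique[OF HS ab(2,4)] by blast
qed

text \<open>\<open>les_surj\<close> is applied to both parities of a lift of the cocycle, and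
  \<open>sa_of\<close> glues the resulting scalar cochains to linear functions.\<close>

lemma Yab_surj:
  assumes Y: "Y \<in> lcarr (Z_PV V n)"
  shows "\<exists>\<alpha>\<in>S n. \<exists>\<beta>\<in>S (Suc n). \<exists>B\<in>B_PV V n. Y = ladd (C_PV V n) (Yab n \<alpha> \<beta>) B"
proof -
  obtain w0 w1 where w: "lch2 n w0 w1" "Y = Phi n w0 w1"
    and d: "\<And>ps u. homs H ps u \<Longrightarrow> length u = Suc n \<Longrightarrow> dc w1 1 (zit ps u) \<in> I (Suc n) \<and> dc w0 0 (zit ps u) \<in> I (Suc n)"
    using Y unfolding Z_iff by blast
  have b01: "0 + 1 = (1 :: bit)" "1 + 1 = (0 :: bit)" by simp_all
  have D: "\<exists>P\<in>pon (lb l). dc w q l = tot (lb l) P"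
    if "lch n q w" "\<And>ps u. homs H ps u \<Longrightarrow> length u = Suc n \<Longrightarrow> dc w q (zit ps u) \<in> I (Suc n)" "gdh l" "length l = Suc n" for w q l
    by (rule std_ext[OF dc_lco[OF that(1)] that(2-4)])
  obtain c0 e0 z0 x0 where 0: "lch n 0 (sc c0)" "lch (Suc n) 1 (sc e0)" "lch n 0 z0" "\<And>m. n = Suc m \<Longrightarrow> lch m 1 x0"
    "\<And>l. gdh l \<Longrightarrow> length l = n \<Longrightarrow> w0 l = sc c0 l - yb e0 l + tot (lb l) (z0 l) + dc x0 1 l"
    using les_surj[OF conjunct1[OF w(1)] D[OF conjunct1[OF w(1)] conjunct2[OF d]]] unfolding b01 by blast
  obtain c1 e1 z1 x1 where 1: "lch n 1 (sc c1)" "lch (Suc n) 0 (sc e1)" "lch n 1 z1" "\<And>m. n = Suc m \<Longrightarrow> lch m 0 x1"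
    "\<And>l. gdh l \<Longrightarrow> length l = n \<Longrightarrow> w1 l = sc c1 l - yb e1 l + tot (lb l) (z1 l) + dc x1 0 l"
    using les_surj[OF conjunct2[OF w(1)] D[OF conjunct2[OF w(1)] conjunct1[OF d]]] unfolding b01 by blast
  obtain \<alpha> where \<alpha>: "\<alpha> \<in> S n" "\<And>l. gdh l \<Longrightarrow> length l = n \<Longrightarrow> sa \<alpha> 0 l = c0 l \<and> sa \<alpha> 1 l = c1 l"
    using sa_of[OF 0(1) 1(1)] by blast
  \<comment> \<open>\<open>les_surj\<close> yields the Casimir cochain with a minus sign, so \<beta>
    is the negative of what it provides.\<close>
  have neg: "lch (Suc n) q (sc (\<lambda>l. - e l))" if "lch (Suc n) q (sc e)" for q e
    using lco_diff[OF lco_null that] by (simp add: Vscl single_uminus)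
  obtain \<beta> where \<beta>: "\<beta> \<in> S (Suc n)" "\<And>l. gdh l \<Longrightarrow> length l = Suc n \<Longrightarrow> sa \<beta> 0 l = - e1 l \<and> sa \<beta> 1 l = - e0 l"
    using sa_of[OF neg[OF 1(2)] neg[OF 0(2)]] by blast
  have yb: "yb (sa \<beta> q) l = - yb e l" if "\<And>l. gdh l \<Longrightarrow> length l = Suc n \<Longrightarrow> sa \<beta> q l = - e l" "gdh l" "length l = n" for q e l
  proof -
    have "sa \<beta> q (l @ [(fresh l, pu j, us' ! j)]) = - e (l @ [(fresh l, pu j, us' ! j)])" if "j < N" for j
      by (rule \<open>\<And>l. gdh l \<Longrightarrow> length l = Suc n \<Longrightarrow> sa \<beta> q l = - e l\<close>) (use \<open>gdh l\<close> \<open>length l = n\<close> us'_par[OF that] fresh_notin[of l] in auto)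
    then show ?thesis by (simp add: yb_def Vscl single_uminus sum_negf)
  qed
  have W0: "w0 l = Wab \<alpha> \<beta> 0 l + dc x0 1 l + tot (lb l) (z0 l)" if "gdh l" "length l = n" for l
    using 0(5)[OF that] \<alpha>(2)[OF that] yb[of 1 e0 l] \<beta>(2) that by (simp add: Wab_def)
  have W1: "w1 l = Wab \<alpha> \<beta> 1 l + dc x1 0 l + tot (lb l) (z1 l)" if "gdh l" "length l = n" for l
    using 1(5)[OF that] \<alpha>(2)[OF that] yb[of 0 e1 l] \<beta>(2) that by (simp add: Wab_def)
  have x: "\<forall>m. n = Suc m \<longrightarrow> lch2 m x1 x0" using 0(4) 1(4) by blast
  have lW: "lch2 n (Wab \<alpha> \<beta> 0) (Wab \<alpha> \<beta> 1)" using Wab_lch \<alpha> \<beta> by blast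
  have "Y = ladd (C_PV V n) (Yab n \<alpha> \<beta>) (Phi n (dc x0 1) (dc x1 0))" unfolding w(2) Yab_def Phi_lin
  proof (subst Phi_eq[OF w(1) lch2_add[OF lW dcx_lch[OF x]]], intro allI impI)
    fix ps u assume u: "homs H ps u \<and> length u = n"
    have g: "gdh (zit ps u)" "length (zit ps u) = n" using zit_homs u by auto
    show "w0 (zit ps u) - (Wab \<alpha> \<beta> 0 (zit ps u) + dc x0 1 (zit ps u)) \<in> I n \<and>
      w1 (zit ps u) - (Wab \<alpha> \<beta> 1 (zit ps u) + dc x1 0 (zit ps u)) \<in> I n"
      using W0[OF g] W1[OF g] lco_pon[OF 0(3) g] lco_pon[OF 1(3) g] u by (auto intro: tot_in_I)
  qed
  moreover have "Phi n (dc x0 1) (dc x1 0) \<in> B_PV V n" unfolding B_iff using x by blast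
  ultimately show ?thesis using \<alpha>(1) \<beta>(1) by blast
qed

theorem Yab_iso: "lin_iso (ldsum (Sdual H n) (Sdual H (Suc n))) (H_PV V n) (\<lambda>(\<alpha>, \<beta>). H_class V n (Yab n \<alpha> \<beta>))"
proof -
  interpret Q: lin_quot "C_PV V n" "B_PV V n" by (rule lin_quot_C)
  have S0: "(\<lambda>u\<in>lists_of_length k. c * \<alpha> u + \<alpha>' u) \<in> S k" (is "?f \<in> _") if S: "\<alpha> \<in> S k" "\<alpha>' \<in> S k" for k \<alpha> \<alpha>' c
    unfolding Sdual_simps
  proof (intro conjI allI impI)
    fix as :: "'h list" and i a b d assume "length as = k \<and> i < k"
    then show "?f (as[i := a + b]) = ?f (as[i := a]) + ?f (as[i := b])" "?f (as[i := scl H d a]) = d * ?f (as[i := a])"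
      using S_D(1,2)[OF S(1), of as i] S_D(1,2)[OF S(2), of as i] by (simp_all add: lists_of_length_def distrib_left)
  next
    fix as :: "'h list" and ps i assume "length as = k \<and> homs H ps as \<and> Suc i < k"
    then show "?f (lswap i as) = sg ((1 + ps ! i) * (1 + ps ! Suc i)) * ?f as"
      using S_D(3)[OF S(1), of as ps i] S_D(3)[OF S(2), of as ps i]
      by (simp add: lists_of_length_def distrib_left[of "sg _ :: 'f"] mult.left_commute[of c])
  qed simp
  have Sadd: "ladd (Sdual H k) \<alpha> \<alpha>' \<in> S k" if "\<alpha> \<in> S k" "\<alpha>' \<in> S k" for k \<alpha> \<alpha>'
    using S0[OF that, of 1] by (simp add: Sdual_simps(1))
  have Ssmul: "lsmul (Sdual H k) c \<alpha> \<in> S k" if "\<alpha> \<in> S k" for k \<alpha> c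
    \<comment> \<open>A scalar multiple written as (c - 1) \<alpha> + \<alpha>.\<close>
    using S0[OF that that, of "c - 1"] by (simp add: Sdual_simps(2) left_diff_distrib)
  have add: "Yab n (ladd (Sdual H n) \<alpha> \<alpha>') (ladd (Sdual H (Suc n)) \<beta> \<beta>') = ladd (C_PV V n) (Yab n \<alpha> \<beta>) (Yab n \<alpha>' \<beta>')"
    if ab: "\<alpha> \<in> S n" "\<beta> \<in> S (Suc n)" "\<alpha>' \<in> S n" "\<beta>' \<in> S (Suc n)" for \<alpha> \<beta> \<alpha>' \<beta>'
  proof (rule Yab_unique[symmetric])
    fix u :: "'h list" assume u: "length u = n"
    then show "ladd (C_PV V n) (Yab n \<alpha> \<beta>) (Yab n \<alpha>' \<beta>') (map \<iota> u) = Cl n (cst (val (ladd (Sdual H n) \<alpha> \<alpha>') (ladd (Sdual H (Suc n)) \<beta> \<beta>') u))"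
      using Yab_vals[OF ab(1,2) u] Yab_vals[OF ab(3,4) u]
      by (simp add: C_PV_simps(1) Sdual_simps lists_of_length_def val_def Vscl sum.distrib single_add[symmetric] add_ac)
  qed (use ab Sadd Q.cl Yab_C in auto)
  have smul: "Yab n (lsmul (Sdual H n) c \<alpha>) (lsmul (Sdual H (Suc n)) c \<beta>) = lsmul (C_PV V n) c (Yab n \<alpha> \<beta>)"
    if ab: "\<alpha> \<in> S n" "\<beta> \<in> S (Suc n)" for \<alpha> \<beta> c
  proof (rule Yab_unique[symmetric])
    fix u :: "'h list" assume u: "length u = n"
    have "scl V c (\<Sum>j<N. f j) = (\<Sum>j<N. scl V c (f j))" for f by (rule additive.sum[OF super_space.scl_additive[OF VS]])
    then show "lsmul (C_PV V n) c (Yab n \<alpha> \<beta>) (map \<iota> u) = Cl n (cst (val (lsmul (Sdual H n) c \<alpha>) (lsmul (Sdual H (Suc n)) c \<beta>) u))"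
      using Yab_vals[OF ab u] u by (simp add: C_PV_simps(2) Sdual_simps lists_of_length_def val_def Vscl spol_simps)
  qed (use ab Ssmul Q.scl Yab_C in auto)
  have inj: "\<alpha> = \<alpha>' \<and> \<beta> = \<beta>'" if ab: "\<alpha> \<in> S n" "\<beta> \<in> S (Suc n)" "\<alpha>' \<in> S n" "\<beta>' \<in> S (Suc n)"
    and e: "H_class V n (Yab n \<alpha> \<beta>) = H_class V n (Yab n \<alpha>' \<beta>')" for \<alpha> \<beta> \<alpha>' \<beta>'
    using Q.coset_eqD[OF Yab_C[OF ab(1,2)] Yab_C[OF ab(3,4)]] e Yab_inj[OF ab] unfolding H_PV_simps by blast
  have surj: "\<exists>\<alpha>\<in>S n. \<exists>\<beta>\<in>S (Suc n). A = H_class V n (Yab n \<alpha> \<beta>)" if A: "A \<in> lcarr (H_PV V n)" for A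
  proof -
    obtain Y where Y: "Y \<in> lcarr (Z_PV V n)" "A = H_class V n Y" using A unfolding H_PV_simps(1) by blast
    then obtain \<alpha> \<beta> B where "\<alpha> \<in> S n" "\<beta> \<in> S (Suc n)" "B \<in> B_PV V n" "Y = ladd (C_PV V n) (Yab n \<alpha> \<beta>) B"
      using Yab_surj by metis
    then show ?thesis using Y(2) Q.coset_absorb Yab_C unfolding H_PV_simps by metis
  qed
  have car: "H_class V n (Yab n \<alpha> \<beta>) \<in> lcarr (H_PV V n)" if "\<alpha> \<in> S n" "\<beta> \<in> S (Suc n)" for \<alpha> \<beta>
    using Yab_Z[OF that] by (simp add: H_PV_simps(1))
  have L: "lcarr (ldsum (Sdual H n) (Sdual H (Suc n))) = S n \<times> S (Suc n)"
    "ladd (ldsum (Sdual H n) (Sdual H (Suc n))) (\<alpha>, \<beta>) (\<alpha>', \<beta>') = (ladd (Sdual H n) \<alpha> \<alpha>', ladd (Sdual H (Suc n)) \<beta> \<beta>')"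
    "lsmul (ldsum (Sdual H n) (Sdual H (Suc n))) c (\<alpha>, \<beta>) = (lsmul (Sdual H n) c \<alpha>, lsmul (Sdual H (Suc n)) c \<beta>)" for \<alpha> \<beta> \<alpha>' \<beta>' c
    by (simp_all add: ldsum_def)
  show ?thesis unfolding lin_iso_def L
  proof (intro conjI ballI allI)
    show "bij_betw (\<lambda>(\<alpha>, \<beta>). H_class V n (Yab n \<alpha> \<beta>)) (S n \<times> S (Suc n)) (lcarr (H_PV V n))"
      unfolding bij_betw_def inj_on_def using inj surj car by (auto simp: image_iff)
  next
    fix x y assume "x \<in> S n \<times> S (Suc n)" "y \<in> S n \<times> S (Suc n)"
    then obtain \<alpha> \<beta> \<alpha>' \<beta>' where xy: "x = (\<alpha>, \<beta>)" "y = (\<alpha>', \<beta>')" "\<alpha> \<in> S n" "\<beta> \<in> S (Suc n)" "\<alpha>' \<in> S n" "\<beta>' \<in> S (Suc n)" by auto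
    show "(case ladd (ldsum (Sdual H n) (Sdual H (Suc n))) x y of (\<alpha>, \<beta>) \<Rightarrow> H_class V n (Yab n \<alpha> \<beta>))
      = ladd (H_PV V n) (case x of (\<alpha>, \<beta>) \<Rightarrow> H_class V n (Yab n \<alpha> \<beta>)) (case y of (\<alpha>, \<beta>) \<Rightarrow> H_class V n (Yab n \<alpha> \<beta>))"
      unfolding xy L prod.case add[OF xy(3-6)] H_PV_simps by (rule Q.coset_add[symmetric]) (use xy Yab_C in auto)
  next
    fix c x assume "x \<in> S n \<times> S (Suc n)"
    then obtain \<alpha> \<beta> where x: "x = (\<alpha>, \<beta>)" "\<alpha> \<in> S n" "\<beta> \<in> S (Suc n)" by auto
    show "(case lsmul (ldsum (Sdual H n) (Sdual H (Suc n))) c x of (\<alpha>, \<beta>) \<Rightarrow> H_class V n (Yab n \<alpha> \<beta>))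
      = lsmul (H_PV V n) c (case x of (\<alpha>, \<beta>) \<Rightarrow> H_class V n (Yab n \<alpha> \<beta>))"
      unfolding x L prod.case smul[OF x(2,3)] H_PV_simps by (rule Q.coset_smul[symmetric]) (use x Yab_C in auto)
  qed
qed

end

section \<open>Existence of bases\<close>

context supersymmetric_form
begin

text \<open>A maximal independent set of homogeneous elements spans because the homogeneous elements
  do, and it is finite because the space is finitely spanned.\<close>

lemma ex_homogeneous_basis: "\<exists>us. homogeneous_basis H us"
proof -
  interpret vector_space "scl H" by (rule vs)
  obtain B where B: "B \<subseteq> par H 0 \<union> par H 1" "independent B" "par H 0 \<union> par H 1 \<subseteq> span B"
    using maximal_independent_subset[of "par H 0 \<union> par H 1"] by blast
  have "x \<in> span B" for x
  proof -
    obtain y z where "y \<in> par H 0" "z \<in> par H 1" "x = y + z" using par_decomp by blast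
    then show ?thesis using B(3) by (auto intro!: span_add)
  qed
  then have sp: "span B = UNIV" by blast
  obtain F where F: "finite F" "span F = UNIV" using fin_dim by blast
  have "finite B" using independent_span_bound[OF F(1) B(2)] F(2) by simp
  then obtain us where "set us = B" "distinct us" using finite_distinct_list by blast
  then show ?thesis using B sp unfolding homogeneous_basis_def by (intro exI[of _ us]) auto
qed

text \<open>The form, written in coordinates, is an injective endomorphism by nondegeneracy, hence
  surjective in finite dimension; the dual basis consists of preimages of the basis vectors.\<close>

lemma ex_dual_basis:
  assumes us: "homogeneous_basis H us"
  shows "\<exists>us'. dual_basis form us us'"
proof -
  let ?B = "set us"
  have d: "distinct us" using us by (simp add: homogeneous_basis_def)
  interpret finite_dimensional_vector_space "scl H" ?B by (rule finite_dimensional_vector_space.intro[OF vs])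
      (use us in \<open>auto simp: homogeneous_basis_def finite_dimensional_vector_space_axioms_def\<close>)
  \<comment> \<open>Pairing with \<open>a\<close> as the first argument of the form, in the order
    that \<open>dual_basis\<close> requires.\<close>
  define T where "T a = (\<Sum>b\<in>?B. scl H (form a b) b)" for a
  have lin: "Vector_Spaces.linear (scl H) (scl H) T"
    by unfold_locales (simp_all add: T_def form_add_left form_scale_left scale_left_distrib sum.distrib scale_sum_right)
  have coeffs: "\<forall>b\<in>?B. f b = 0" if "(\<Sum>b\<in>?B. scl H (f b) b) = 0" for f
    using independentD[OF independent_Basis finite_Basis subset_refl that] by blast
  have "inj T"
  proof (rule injI)
    fix x y assume e: "T x = T y"
    define a where "a = x - y"
    have "T a + T y = T x"
      using form_add_left[of a y] by (simp add: T_def sum.distrib[symmetric] scale_left_distrib[symmetric] a_def)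
    then have "T a = 0" using e by simp
    then have z: "\<forall>b\<in>?B. form a b = 0" unfolding T_def by (rule coeffs)
    have "form a b = 0" for b
    proof -
      have "b \<in> span ?B" using span_Basis by simp
      then show ?thesis
      proof (induction rule: span_induct_alt)
        case base
        show ?case using form_scale_right[of a 0 0] by simp
      next
        case (step c x y)
        then show ?case using z by (simp add: form_add_right form_scale_right)
      qed
    qed
    then have "a = 0" by (rule form_nondeg)
    then show "x = y" by (simp add: a_def)
  qed
  then have "surj T" by (rule linear_inj_imp_surj[OF lin])
  then obtain v where v: "\<And>b. T (v b) = b" by (metis surj_def)
  have "form (v b) c = (if b = c then 1 else 0)" if "b \<in> ?B" "c \<in> ?B" for b c
  proof -
    have "(\<Sum>c\<in>?B. scl H (form (v b) c - (if b = c then 1 else 0)) c) = T (v b) - (\<Sum>c\<in>?B. scl H (if b = c then 1 else 0) c)"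
      by (simp add: T_def scale_left_diff_distrib sum_subtractf)
    also have "(\<Sum>c\<in>?B. scl H (if b = c then 1 else 0) c) = (\<Sum>c\<in>?B. if b = c then c else 0)"
      by (intro sum.cong refl) simp
    also have "\<dots> = b" using that(1) by simp
    finally have "(\<Sum>c\<in>?B. scl H (form (v b) c - (if b = c then 1 else 0)) c) = 0" by (simp add: v)
    from coeffs[OF this] that(2) show ?thesis by auto
  qed
  then show ?thesis unfolding dual_basis_def using d by (intro exI[of _ "map v us"]) (auto simp: nth_eq_iff_index_eq)
qed

end

theorem theorem4p2:
  fixes H :: "('f::field_char_0, 'h::ab_group_add) superspace"
    and form :: "'h \<Rightarrow> 'h \<Rightarrow> 'f"
    and V :: "('f, 'v::ring_1) pva"
    and \<iota> :: "'h \<Rightarrow> 'v"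
    and n :: nat
  assumes "free_superboson H form V \<iota>"
  shows "(\<exists>\<Psi>. lin_iso (ldsum (Sdual H n) (Sdual H (Suc n))) (H_PV V n) \<Psi>) \<and>
    (\<forall>us us'. homogeneous_basis H us \<and> dual_basis form us us' \<longrightarrow>
      (let has_values = (\<lambda>\<alpha> \<beta> Y. \<forall>u. length u = n \<longrightarrow>
             Y (map \<iota> u) = cls V n (cst (scl V (\<alpha> u) 1
               + (\<Sum>j<length us. scl V (\<beta> (u @ [us' ! j])) (\<iota> (us ! j))))))
       in (\<forall>\<alpha>\<in>lcarr (Sdual H n). \<forall>\<beta>\<in>lcarr (Sdual H (Suc n)).
            \<exists>!Y. Y \<in> lcarr (C_PV V n) \<and> has_values \<alpha> \<beta> Y) \<and>
          (\<forall>\<alpha>\<in>lcarr (Sdual H n). \<forall>\<beta>\<in>lcarr (Sdual H (Suc n)). \<forall>Y\<in>lcarr (C_PV V n).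
            has_values \<alpha> \<beta> Y \<longrightarrow> Y \<in> lcarr (Z_PV V n)) \<and>
          (\<exists>\<Psi>. lin_iso (ldsum (Sdual H n) (Sdual H (Suc n))) (H_PV V n) \<Psi> \<and>
            (\<forall>\<alpha>\<in>lcarr (Sdual H n). \<forall>\<beta>\<in>lcarr (Sdual H (Suc n)). \<forall>Y\<in>lcarr (C_PV V n).
              has_values \<alpha> \<beta> Y \<longrightarrow> \<Psi> (\<alpha>, \<beta>) = H_class V n Y))))"
proof (intro conjI allI impI, goal_cases)
  case 1
  interpret free_superboson H form V \<iota> by (rule assms)
  have sf: "supersymmetric_form H form" by (rule supersymmetric_form_axioms)
  \<comment> \<open>The first claim mentions no basis, so one is chosen to enter the locale.\<close>
  obtain us us' where b: "homogeneous_basis H us" "dual_basis form us us'"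
    using supersymmetric_form.ex_homogeneous_basis[OF sf] supersymmetric_form.ex_dual_basis[OF sf] by metis
  have "boson H form V \<iota> us us'" using assms b by (simp add: boson_def boson_axioms_def)
  then show ?case using boson.Yab_iso by blast
next
  case (2 us us')
  then interpret boson H form V \<iota> us us' using assms by (simp add: boson_def boson_axioms_def)
  let ?hv = "\<lambda>\<alpha> \<beta> Y. \<forall>u. length u = n \<longrightarrow>
             Y (map \<iota> u) = cls V n (cst (scl V (\<alpha> u) 1
               + (\<Sum>j<length us. scl V (\<beta> (u @ [us' ! j])) (\<iota> (us ! j)))))"
  have hv: "?hv \<alpha> \<beta> (Yab n \<alpha> \<beta>)" if "\<alpha> \<in> S n" "\<beta> \<in> S (Suc n)" for \<alpha> \<beta> using Yab_vals[OF that] by (simp add: val_def)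
  have uniq: "Y = Yab n \<alpha> \<beta>" if "\<alpha> \<in> S n" "\<beta> \<in> S (Suc n)" "Y \<in> lcarr (C_PV V n)" "?hv \<alpha> \<beta> Y" for \<alpha> \<beta> Y
    by (rule Yab_unique[OF that(1-3)]) (use that(4) in \<open>simp add: val_def\<close>)
  show ?case unfolding Let_def
  proof (intro conjI ballI)
    fix \<alpha> \<beta> assume ab: "\<alpha> \<in> S n" "\<beta> \<in> S (Suc n)"
    show "\<exists>!Y. Y \<in> lcarr (C_PV V n) \<and> ?hv \<alpha> \<beta> Y"
      by (rule ex1I[of _ "Yab n \<alpha> \<beta>"]) (use hv[OF ab] Yab_C[OF ab] uniq[OF ab] in blast)+
  next
    show "?hv \<alpha> \<beta> Y \<longrightarrow> Y \<in> lcarr (Z_PV V n)" if "\<alpha> \<in> S n" "\<beta> \<in> S (Suc n)" "Y \<in> lcarr (C_PV V n)" for \<alpha> \<beta> Y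
      using uniq[OF that] Yab_Z[OF that(1,2)] by blast
  next
    have "\<forall>\<alpha>\<in>S n. \<forall>\<beta>\<in>S (Suc n). \<forall>Y\<in>lcarr (C_PV V n). ?hv \<alpha> \<beta> Y \<longrightarrow> (case (\<alpha>, \<beta>) of (\<alpha>, \<beta>) \<Rightarrow> H_class V n (Yab n \<alpha> \<beta>)) = H_class V n Y"
      using uniq by simp
    with Yab_iso[of n] show "\<exists>\<Psi>. lin_iso (ldsum (Sdual H n) (Sdual H (Suc n))) (H_PV V n) \<Psi> \<and>
            (\<forall>\<alpha>\<in>S n. \<forall>\<beta>\<in>S (Suc n). \<forall>Y\<in>lcarr (C_PV V n). ?hv \<alpha> \<beta> Y \<longrightarrow> \<Psi> (\<alpha>, \<beta>) = H_class V n Y)" by blast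
  qed
qed

end
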